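(* Let $p:X\to Y$ be a holomorphic submersion from a projective manifold $X$ to a connected complex manifold $Y$. Let $(L,h_L)$ be a Hermitian holomorphic line bundle over $X$ such that $H^0(X_y,K_{X_y}\otimes L|_{X_y})\neq\{0\}$ for some $y\in Y$, where $X_y:=p^{-1}(y)$. Assume that for any semi-positive Hermitian holomorphic line bundle $(E,h_E)$ on $X$, the direct image sheaf $p_*(K_{X/Y}\otimes L\otimes E)$, equipped with the $L^2$ metric induced by $h_L$ and $h_E$, is Griffiths semi-positive. Then the curvature of $(L,h_L)$ is semi-positive.
   Context: Hermitian metrics on line bundles are smooth. A Hermitian holomorphic line bundle $(L,h_L)$ is called semi-positive (has semi-positive curvature) if for every local holomorphic frame $f_L$, writing $|f_L|_{h_L}^2=e^{-\varphi_L}$, the local weight $\varphi_L$ is plurisubharmonic; equivalently, $i\partial\bar\partial\varphi_L\geq 0$. $K_{X/Y}:=K_X\otimes (p^*K_Y)^{-1}$ is the relative canonical line bundle of $p$; there is a natural isomorphism $K_{X/Y}|_{X_y}\cong K_{X_y}$. Direct image: given a Hermitian holomorphic line bundle $(M,h_M)$ on $X$ (here $M=L\otimes E$ with $h_M=h_L\otimes h_E$), the direct image $p_*(K_{X/Y}\otimes M)$ is regarded as the family of finite-dimensional vector spaces $\mathcal{E}=\coprod_{y\in Y}\mathcal{E}_y$, $\mathcal{E}_y:=H^0(X_y,K_{X_y}\otimes M|_{X_y})$ (not assumed locally trivial), with $L^2$ metric $\|u_y\|^2:=\int_{X_y}|u_y|_{h_M}^2$ for $u_y\in\mathcal{E}_y$.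 Here $|u_y|^2_{h_M}$ is the volume form on $X_y$ given in local coordinates $z=(z_1,\dots,z_n)$ of $X_y$ and a local frame $\mathbf{e}$ of $M$ by $|v(z)|^2|\mathbf{e}|_{h_M}^2\,d\lambda_z$ if $u_y=v\,dz_1\wedge\cdots\wedge dz_n\otimes\mathbf{e}$, where $d\lambda_z$ is Lebesgue measure. A local section $y\mapsto u_y\in\mathcal{E}_y$ on an open set $U\subset Y$ is holomorphic if it is holomorphic as a section of $K_{X/Y}\otimes M$ over $p^{-1}(U)$. A local section $y\mapsto\xi_y\in(\mathcal{E}_y)^*$ of $\mathcal{E}^*:=\coprod_{y}(\mathcal{E}_y)^*$ is holomorphic if $y\mapsto\xi_y(u_y)$ is holomorphic for every local holomorphic section $u$ of $\mathcal{E}$. The direct image $p_*(K_{X/Y}\otimes M)$ is called Griffiths semi-positive if for every local holomorphic section $\xi$ of $\mathcal{E}^*$ the function $y\mapsto\log\|\xi_y\|$ is plurisubharmonic (the function identically $-\infty$ being allowed), where $\|\cdot\|$ on $(\mathcal{E}_y)^*$ is the norm dual to the $L^2$ norm on $\mathcal{E}_y$.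
   Formalization: The base Y is assumed to have dimension at least 1; if Y is a point the claim fails, e.g. for X = P^1 and L = O(4) with a metric that is not semi-positive, since plurisubharmonicity on a point is vacuous. *)

theory Defs
  imports "HOL-Analysis.Analysis"
begin

section \<open>Functions on open subsets of complex coordinate space\<close>

definition holo_on :: "(complex^'k::finite) set \<Rightarrow> (complex^'k \<Rightarrow> complex) \<Rightarrow> bool" where
  "holo_on \<Omega> f \<longleftrightarrow>
     (\<forall>z\<in>\<Omega>. \<exists>D. (f has_derivative D) (at z) \<and> (\<forall>c v. D (c *s v) = c * D v))"

definition holo_map_on ::
  "(complex^'k::finite) set \<Rightarrow> (complex^'k \<Rightarrow> complex^'m::finite) \<Rightarrow> bool" where
  "holo_map_on \<Omega> f \<longleftrightarrow> (\<forall>j. holo_on \<Omega> (\<lambda>z. f z $ j))"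

text \<open>The domains \<open>\<Omega>\<close> are open throughout.\<close>

primrec Ck_on :: "nat \<Rightarrow> ('v::real_normed_vector) set \<Rightarrow> ('v \<Rightarrow> real) \<Rightarrow> bool" where
  "Ck_on 0 \<Omega> f \<longleftrightarrow> continuous_on \<Omega> f"
| "Ck_on (Suc n) \<Omega> f \<longleftrightarrow>
     (\<forall>z\<in>\<Omega>. f differentiable (at z)) \<and>
     (\<forall>v. Ck_on n \<Omega> (\<lambda>z. frechet_derivative f (at z) v))"

definition smooth_on :: "('v::real_normed_vector) set \<Rightarrow> ('v \<Rightarrow> real) \<Rightarrow> bool" where
  "smooth_on \<Omega> f \<longleftrightarrow> (\<forall>n. Ck_on n \<Omega> f)"

text \<open>The mean over \<open>[0, 2 \<pi>]\<close> of a function with values in \<open>[-\<infinity>, \<infinity>)\<close>, as the integral of the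
  positive part minus that of the negative part. It is only used for functions that are bounded
  above, so the first integral is finite and the value \<open>-\<infinity>\<close> is attained exactly when the
  negative part is not integrable.\<close>

definition circle_mean :: "(real \<Rightarrow> ereal) \<Rightarrow> ereal" where
  "circle_mean g =
     enn2ereal (\<integral>\<^sup>+\<theta>. e2ennreal (g \<theta>) \<partial>uniform_measure lborel {0..2*pi}) -
     enn2ereal (\<integral>\<^sup>+\<theta>. e2ennreal (- g \<theta>) \<partial>uniform_measure lborel {0..2*pi})"

text \<open>Plurisubharmonic: upper semicontinuous with values in \<open>[-\<infinity>, \<infinity>)\<close>, and satisfying the
  sub-mean value inequality on every closed disc in a complex line. The function identically
  \<open>-\<infinity>\<close> is allowed.\<close>

definition psh_on :: "(complex^'k::finite) set \<Rightarrow> (complex^'k \<Rightarrow> ereal) \<Rightarrow> bool" where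
  "psh_on \<Omega> f \<longleftrightarrow>
     (\<forall>z\<in>\<Omega>. f z < \<infinity>) \<and>
     (\<forall>c. open {z\<in>\<Omega>. f z < c}) \<and>
     (\<forall>a b. (\<forall>\<zeta>. cmod \<zeta> \<le> 1 \<longrightarrow> a + \<zeta> *s b \<in> \<Omega>) \<longrightarrow>
        f a \<le> circle_mean (\<lambda>\<theta>. f (a + cis \<theta> *s b)))"


section \<open>Complex manifolds\<close>

text \<open>The complex dimension of a manifold is the cardinality of a finite type, hence at least 1.
  The underlying topological space of a manifold is a whole type; the manifold structure is
  a maximal holomorphic atlas. Only the values of a coordinate map on its chart domain matter.\<close>

type_synonym ('a, 'k) chart = "'a set \<times> ('a \<Rightarrow> complex^'k)"

definition is_chart :: "('a::topological_space, 'k::finite) chart \<Rightarrow> bool" where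
  "is_chart c \<longleftrightarrow> (case c of (U, \<phi>) \<Rightarrow>
     open U \<and> open (\<phi> ` U) \<and> homeomorphism U (\<phi> ` U) \<phi> (inv_into U \<phi>))"

definition transition :: "('a, 'k::finite) chart \<Rightarrow> ('a, 'k) chart \<Rightarrow> complex^'k \<Rightarrow> complex^'k" where
  "transition c d = snd d \<circ> inv_into (fst c) (snd c)"

definition holo_compatible :: "('a, 'k::finite) chart \<Rightarrow> ('a, 'k) chart \<Rightarrow> bool" where
  "holo_compatible c d \<longleftrightarrow>
     holo_map_on (snd c ` (fst c \<inter> fst d)) (transition c d) \<and>
     holo_map_on (snd d ` (fst c \<inter> fst d)) (transition d c)"

definition complex_manifold ::
  "('a::{t2_space,second_countable_topology}, 'k::finite) chart set \<Rightarrow> bool" where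
  "complex_manifold A \<longleftrightarrow>
     (\<forall>c\<in>A. is_chart c) \<and> (\<Union>c\<in>A. fst c) = UNIV \<and>
     (\<forall>c\<in>A. \<forall>d\<in>A. holo_compatible c d) \<and>
     (\<forall>c. is_chart c \<and> (\<forall>d\<in>A. holo_compatible c d) \<longrightarrow> c \<in> A)"

definition holo_fun ::
  "('a::topological_space, 'k::finite) chart set \<Rightarrow> 'a set \<Rightarrow> ('a \<Rightarrow> complex) \<Rightarrow> bool" where
  "holo_fun A W f \<longleftrightarrow> (\<forall>(U, \<phi>)\<in>A. holo_on (\<phi> ` (U \<inter> W)) (f \<circ> inv_into U \<phi>))"

text \<open>A function on a complex submanifold \<open>S\<close> is holomorphic iff it is locally the restriction
  of a holomorphic function of the ambient manifold. For open \<open>S\<close> this is \<open>holo_fun A S f\<close>;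
  the other case of interest is a fibre of a submersion.\<close>

definition holo_fun_sub ::
  "('a::topological_space, 'k::finite) chart set \<Rightarrow> 'a set \<Rightarrow> ('a \<Rightarrow> complex) \<Rightarrow> bool" where
  "holo_fun_sub A S f \<longleftrightarrow>
     (\<forall>x\<in>S. \<exists>W F. open W \<and> x \<in> W \<and> holo_fun A W F \<and> (\<forall>x'\<in>W \<inter> S. f x' = F x'))"

definition smooth_fun ::
  "('a::topological_space, 'k::finite) chart set \<Rightarrow> 'a set \<Rightarrow> ('a \<Rightarrow> real) \<Rightarrow> bool" where
  "smooth_fun A W f \<longleftrightarrow> (\<forall>(U, \<phi>)\<in>A. smooth_on (\<phi> ` (U \<inter> W)) (f \<circ> inv_into U \<phi>))"

definition psh_fun ::
  "('a::topological_space, 'k::finite) chart set \<Rightarrow> 'a set \<Rightarrow> ('a \<Rightarrow> ereal) \<Rightarrow> bool" where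
  "psh_fun A W f \<longleftrightarrow> (\<forall>(U, \<phi>)\<in>A. psh_on (\<phi> ` (U \<inter> W)) (f \<circ> inv_into U \<phi>))"

definition holomorphic_submersion ::
  "('a::topological_space, 'k::finite) chart set \<Rightarrow> ('b::topological_space, 'm::finite) chart set
     \<Rightarrow> ('a \<Rightarrow> 'b) \<Rightarrow> bool" where
  "holomorphic_submersion A B p \<longleftrightarrow>
     continuous_on UNIV p \<and>
     (\<forall>(U, \<phi>)\<in>A. \<forall>(V, \<psi>)\<in>B.
        holo_map_on (\<phi> ` (U \<inter> p -` V)) (\<psi> \<circ> p \<circ> inv_into U \<phi>) \<and>
        (\<forall>x\<in>U \<inter> p -` V. surj (frechet_derivative (\<psi> \<circ> p \<circ> inv_into U \<phi>) (at (\<phi> x)))))"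

text \<open>Complex projective \<open>N\<close>-space: a point is a line in \<open>\<complex>\<^sup>N\<^sup>+\<^sup>1\<close>, the homogeneous coordinates
  being indexed by \<open>0, \<dots>, N\<close>. In the definition of a projective manifold, \<open>F\<close> is the embedding;
  near each point it is written in one of the standard affine charts (the functions \<open>f x j\<close>,
  normalised by \<open>f x i = 1\<close>, are the affine coordinates of \<open>F x\<close>) and required to be holomorphic
  with injective differential. Since the manifold is compact, an injective immersion is an
  embedding onto a closed submanifold.\<close>

definition proj_point :: "(nat \<Rightarrow> complex) \<Rightarrow> (nat \<Rightarrow> complex) set" where
  "proj_point w = {(\<lambda>j. c * w j) | c. True}"

definition proj_space :: "nat \<Rightarrow> (nat \<Rightarrow> complex) set set" where
  "proj_space N = {proj_point w | w. (\<exists>j. w j \<noteq> 0) \<and> (\<forall>j>N. w j = 0)}"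

definition projective_manifold ::
  "('a::{t2_space,second_countable_topology}, 'k::finite) chart set \<Rightarrow> bool" where
  "projective_manifold A \<longleftrightarrow>
     complex_manifold A \<and> compact (UNIV :: 'a set) \<and>
     (\<exists>N F. inj F \<and> range F \<subseteq> proj_space N \<and>
        (\<forall>x. \<exists>W i f. open W \<and> x \<in> W \<and> i \<le> N \<and>
           (\<forall>x'\<in>W. F x' = proj_point (f x') \<and> f x' i = 1 \<and> (\<forall>j>N. f x' j = 0)) \<and>
           (\<forall>j. holo_fun A W (\<lambda>x'. f x' j)) \<and>
           (\<forall>(U, \<phi>)\<in>A. x \<in> U \<longrightarrow>
              (\<forall>v. (\<forall>j. frechet_derivative (\<lambda>z. f (inv_into U \<phi> z) j) (at (\<phi> x)) v = 0)
                   \<longrightarrow> v = 0))))"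


section \<open>Holomorphic line bundles and Hermitian metrics\<close>

text \<open>A line bundle is given by local frames \<open>e\<^sub>i\<close> on \<open>lb_dom i\<close>, for \<open>i\<close> in \<open>lb_index\<close>, and
  transition functions \<open>g\<^sub>i\<^sub>j = lb_trans i j\<close>, where \<open>e\<^sub>j = g\<^sub>i\<^sub>j e\<^sub>i\<close>; an element \<open>v\<^sub>i e\<^sub>i = v\<^sub>j e\<^sub>j\<close>
  of a fibre thus satisfies \<open>v\<^sub>i = g\<^sub>i\<^sub>j v\<^sub>j\<close>. Since manifolds are second countable, every line
  bundle is trivialised by a countable cover, so bundles with index type \<open>nat\<close> represent all line
  bundles up to isomorphism.\<close>

record ('i, 'a) line_bundle =
  lb_index :: "'i set"
  lb_dom :: "'i \<Rightarrow> 'a set"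
  lb_trans :: "'i \<Rightarrow> 'i \<Rightarrow> 'a \<Rightarrow> complex"

definition holomorphic_line_bundle ::
  "('a::topological_space, 'k::finite) chart set \<Rightarrow> ('i, 'a) line_bundle \<Rightarrow> bool" where
  "holomorphic_line_bundle A B \<longleftrightarrow>
     (\<forall>i\<in>lb_index B. open (lb_dom B i)) \<and> (\<Union>i\<in>lb_index B. lb_dom B i) = UNIV \<and>
     (\<forall>i\<in>lb_index B. \<forall>j\<in>lb_index B.
        holo_fun A (lb_dom B i \<inter> lb_dom B j) (lb_trans B i j) \<and>
        (\<forall>x\<in>lb_dom B i \<inter> lb_dom B j. lb_trans B i j x \<noteq> 0)) \<and>
     (\<forall>i\<in>lb_index B. \<forall>j\<in>lb_index B. \<forall>k\<in>lb_index B.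
        \<forall>x\<in>lb_dom B i \<inter> lb_dom B j \<inter> lb_dom B k.
          lb_trans B i j x * lb_trans B j k x = lb_trans B i k x)"

text \<open>The fibre over \<open>x\<close>; the coefficient is set to zero for frames not defined at \<open>x\<close>, so that
  the fibre is a one-dimensional complex vector space.\<close>

definition lb_fibre :: "('i, 'a) line_bundle \<Rightarrow> 'a \<Rightarrow> ('i \<Rightarrow> complex) set" where
  "lb_fibre B x = {v.
     (\<forall>i. \<not> (i \<in> lb_index B \<and> x \<in> lb_dom B i) \<longrightarrow> v i = 0) \<and>
     (\<forall>i\<in>lb_index B. \<forall>j\<in>lb_index B. x \<in> lb_dom B i \<inter> lb_dom B j \<longrightarrow>
        v i = lb_trans B i j x * v j)}"

text \<open>Holomorphic sections over an open set, or over a complex submanifold, extended by zero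
  outside of it.\<close>

definition lb_sections ::
  "('a::topological_space, 'k::finite) chart set \<Rightarrow> ('i, 'a) line_bundle \<Rightarrow> 'a set
     \<Rightarrow> ('a \<Rightarrow> 'i \<Rightarrow> complex) set" where
  "lb_sections A B S = {s.
     (\<forall>x\<in>S. s x \<in> lb_fibre B x) \<and> (\<forall>x. x \<notin> S \<longrightarrow> s x = (\<lambda>_. 0)) \<and>
     (\<forall>i\<in>lb_index B. holo_fun_sub A (S \<inter> lb_dom B i) (\<lambda>x. s x i))}"

definition lb_frame ::
  "('a::topological_space, 'k::finite) chart set \<Rightarrow> ('i, 'a) line_bundle \<Rightarrow> 'a set
     \<Rightarrow> ('a \<Rightarrow> 'i \<Rightarrow> complex) \<Rightarrow> bool" where
  "lb_frame A B W f \<longleftrightarrow>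
     open W \<and> f \<in> lb_sections A B W \<and> (\<forall>x\<in>W. f x \<noteq> (\<lambda>_. 0))"

definition lb_tensor ::
  "('i, 'a) line_bundle \<Rightarrow> ('j, 'a) line_bundle \<Rightarrow> ('i \<times> 'j, 'a) line_bundle" where
  "lb_tensor B C = \<lparr>
     lb_index = lb_index B \<times> lb_index C,
     lb_dom = (\<lambda>(i, j). lb_dom B i \<inter> lb_dom C j),
     lb_trans = (\<lambda>(i, j) (i', j') x. lb_trans B i i' x * lb_trans C j j' x)\<rparr>"

definition lb_dual :: "('i, 'a) line_bundle \<Rightarrow> ('i, 'a) line_bundle" where
  "lb_dual B = \<lparr>
     lb_index = lb_index B,
     lb_dom = lb_dom B,
     lb_trans = (\<lambda>i j x. inverse (lb_trans B i j x))\<rparr>"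

definition lb_pullback :: "('a \<Rightarrow> 'b) \<Rightarrow> ('i, 'b) line_bundle \<Rightarrow> ('i, 'a) line_bundle" where
  "lb_pullback p B = \<lparr>
     lb_index = lb_index B,
     lb_dom = (\<lambda>i. p -` lb_dom B i),
     lb_trans = (\<lambda>i j x. lb_trans B i j (p x))\<rparr>"

text \<open>A Hermitian metric is given by the functions \<open>h i = |e\<^sub>i|\<^sup>2\<close>.\<close>

definition hermitian_metric ::
  "('a::topological_space, 'k::finite) chart set \<Rightarrow> ('i, 'a) line_bundle
     \<Rightarrow> ('i \<Rightarrow> 'a \<Rightarrow> real) \<Rightarrow> bool" where
  "hermitian_metric A B h \<longleftrightarrow>
     (\<forall>i\<in>lb_index B. smooth_fun A (lb_dom B i) (h i) \<and> (\<forall>x\<in>lb_dom B i. h i x > 0)) \<and>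
     (\<forall>i\<in>lb_index B. \<forall>j\<in>lb_index B. \<forall>x\<in>lb_dom B i \<inter> lb_dom B j.
        h j x = (cmod (lb_trans B i j x))\<^sup>2 * h i x)"

definition tensor_metric ::
  "('i \<Rightarrow> 'a \<Rightarrow> real) \<Rightarrow> ('j \<Rightarrow> 'a \<Rightarrow> real) \<Rightarrow> 'i \<times> 'j \<Rightarrow> 'a \<Rightarrow> real" where
  "tensor_metric h h' = (\<lambda>(i, j) x. h i x * h' j x)"

text \<open>\<open>|v|\<^sup>2\<^sub>h\<close> for \<open>v\<close> in the fibre over \<open>x\<close>; the choice of the frame does not matter.\<close>

definition lb_norm2 ::
  "('i, 'a) line_bundle \<Rightarrow> ('i \<Rightarrow> 'a \<Rightarrow> real) \<Rightarrow> 'a \<Rightarrow> ('i \<Rightarrow> complex) \<Rightarrow> real" where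
  "lb_norm2 B h x v =
     (let i = (SOME i. i \<in> lb_index B \<and> x \<in> lb_dom B i) in (cmod (v i))\<^sup>2 * h i x)"

definition semipositive ::
  "('a::topological_space, 'k::finite) chart set \<Rightarrow> ('i, 'a) line_bundle
     \<Rightarrow> ('i \<Rightarrow> 'a \<Rightarrow> real) \<Rightarrow> bool" where
  "semipositive A B h \<longleftrightarrow>
     (\<forall>W f. lb_frame A B W f \<longrightarrow> psh_fun A W (\<lambda>x. ereal (- ln (lb_norm2 B h x (f x)))))"


section \<open>The relative canonical bundle and direct images\<close>

text \<open>The canonical bundle, with one frame \<open>dz\<^sub>1 \<and> \<dots> \<and> dz\<^sub>k\<close> for each chart; the transition
  functions are the complex Jacobian determinants.\<close>

definition canonical_bundle ::
  "('a, 'k::finite) chart set \<Rightarrow> (('a, 'k) chart, 'a) line_bundle" where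
  "canonical_bundle A = \<lparr>
     lb_index = A,
     lb_dom = fst,
     lb_trans = (\<lambda>c d x. det (matrix (frechet_derivative (transition c d) (at (snd c x)))))\<rparr>"

definition relative_canonical_bundle ::
  "('a, 'k::finite) chart set \<Rightarrow> ('b, 'm::finite) chart set \<Rightarrow> ('a \<Rightarrow> 'b)
     \<Rightarrow> (('a, 'k) chart \<times> ('b, 'm) chart, 'a) line_bundle" where
  "relative_canonical_bundle A B p =
     lb_tensor (canonical_bundle A) (lb_dual (lb_pullback p (canonical_bundle B)))"

text \<open>Charts \<open>(U, \<phi>)\<close> of \<open>X\<close> and \<open>(V, \<psi>)\<close> of \<open>Y\<close> in which \<open>p\<close> is a coordinate projection: the
  coordinates of \<open>\<phi>\<close> with index in the range of \<open>\<iota>\<close> are those of \<open>\<psi> \<circ> p\<close>, and the remaining ones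
  (possibly none) are coordinates \<open>z\<close> on the fibres of \<open>p\<close>. Under the natural isomorphism
  of \<open>K\<^sub>X\<^sub>/\<^sub>Y\<close> restricted to a fibre with the canonical bundle of the fibre, the frame of \<open>K\<^sub>X\<^sub>/\<^sub>Y\<close>
  belonging to \<open>(U, \<phi>)\<close> and \<open>(V, \<psi>)\<close> corresponds, up to sign, to \<open>dz\<^sub>1 \<and> \<dots> \<and> dz\<^sub>n\<close>.\<close>

definition adapted_charts ::
  "('a, 'k::finite) chart set \<Rightarrow> ('b, 'm::finite) chart set \<Rightarrow> ('a \<Rightarrow> 'b)
     \<Rightarrow> (('a, 'k) chart \<times> ('b, 'm) chart \<times> ('m \<Rightarrow> 'k)) set" where
  "adapted_charts A B p = {((U, \<phi>), (V, \<psi>), \<iota>).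
     (U, \<phi>) \<in> A \<and> (V, \<psi>) \<in> B \<and> inj \<iota> \<and> p ` U \<subseteq> V \<and>
     (\<forall>x\<in>U. \<forall>j. \<phi> x $ \<iota> j = \<psi> (p x) $ j)}"

definition slice_point ::
  "('m::finite \<Rightarrow> 'k::finite) \<Rightarrow> complex^'m \<Rightarrow> ('k \<Rightarrow> complex) \<Rightarrow> complex^'k" where
  "slice_point \<iota> t z = (\<chi> k. if k \<in> range \<iota> then t $ inv \<iota> k else z k)"

text \<open>The vector space \<open>H\<^sup>0(X\<^sub>y, K\<^sub>X\<^sub>y \<otimes> M)\<close>, with the canonical bundle of \<open>X\<^sub>y\<close> identified with the
  restriction of \<open>K\<^sub>X\<^sub>/\<^sub>Y\<close>.\<close>

definition direct_image_fibre ::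
  "('a::topological_space, 'k::finite) chart set \<Rightarrow> ('b, 'm::finite) chart set \<Rightarrow> ('a \<Rightarrow> 'b)
     \<Rightarrow> ('i, 'a) line_bundle \<Rightarrow> 'b
     \<Rightarrow> ('a \<Rightarrow> (('a, 'k) chart \<times> ('b, 'm) chart) \<times> 'i \<Rightarrow> complex) set" where
  "direct_image_fibre A B p M y =
     lb_sections A (lb_tensor (relative_canonical_bundle A B p) M) (p -` {y})"

text \<open>The volume form \<open>|u|\<^sup>2\<^sub>h\<close> on \<open>X\<^sub>y\<close>, as a Borel measure on \<open>X\<close> carried by \<open>X\<^sub>y\<close>: the unique one
  that in fibre coordinates \<open>z\<close>, with \<open>u = v dz\<^sub>1 \<and> \<dots> \<and> dz\<^sub>n \<otimes> e\<close>, is \<open>|v|\<^sup>2 |e|\<^sup>2\<^sub>h\<close> times Lebesgue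
  measure.\<close>

definition fibre_volume ::
  "('a::topological_space, 'k::finite) chart set \<Rightarrow> ('b, 'm::finite) chart set \<Rightarrow> ('a \<Rightarrow> 'b)
     \<Rightarrow> ('i, 'a) line_bundle \<Rightarrow> ('i \<Rightarrow> 'a \<Rightarrow> real) \<Rightarrow> 'b
     \<Rightarrow> ('a \<Rightarrow> (('a, 'k) chart \<times> ('b, 'm) chart) \<times> 'i \<Rightarrow> complex) \<Rightarrow> 'a measure" where
  "fibre_volume A B p M h y u = (THE \<mu>.
     sets \<mu> = sets borel \<and> emeasure \<mu> (- (p -` {y})) = 0 \<and>
     (\<forall>((U, \<phi>), (V, \<psi>), \<iota>)\<in>adapted_charts A B p. \<forall>S\<in>sets borel. S \<subseteq> U \<longrightarrow>
        emeasure \<mu> S =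
          (\<integral>\<^sup>+z. (let w = slice_point \<iota> (\<psi> y) z; x = inv_into U \<phi> w in
             indicator (\<phi> ` (S \<inter> p -` {y})) w *
             ennreal (lb_norm2 M h x (\<lambda>i. u x (((U, \<phi>), (V, \<psi>)), i))))
           \<partial>Pi\<^sub>M (- range \<iota>) (\<lambda>_. lborel :: complex measure))))"

definition fibre_L2_norm ::
  "('a::topological_space, 'k::finite) chart set \<Rightarrow> ('b, 'm::finite) chart set \<Rightarrow> ('a \<Rightarrow> 'b)
     \<Rightarrow> ('i, 'a) line_bundle \<Rightarrow> ('i \<Rightarrow> 'a \<Rightarrow> real) \<Rightarrow> 'b
     \<Rightarrow> ('a \<Rightarrow> (('a, 'k) chart \<times> ('b, 'm) chart) \<times> 'i \<Rightarrow> complex) \<Rightarrow> real" where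
  "fibre_L2_norm A B p M h y u = sqrt (measure (fibre_volume A B p M h y u) (p -` {y}))"

definition linear_functional_on ::
  "('a \<Rightarrow> 'j \<Rightarrow> complex) set \<Rightarrow> (('a \<Rightarrow> 'j \<Rightarrow> complex) \<Rightarrow> complex) \<Rightarrow> bool" where
  "linear_functional_on E \<xi> \<longleftrightarrow>
     (\<forall>u\<in>E. \<forall>v\<in>E. \<xi> (\<lambda>x j. u x j + v x j) = \<xi> u + \<xi> v) \<and>
     (\<forall>u\<in>E. \<forall>c. \<xi> (\<lambda>x j. c * u x j) = c * \<xi> u)"

definition restrict_section :: "('a \<Rightarrow> 'b) \<Rightarrow> ('a \<Rightarrow> 'j \<Rightarrow> complex) \<Rightarrow> 'b \<Rightarrow> 'a \<Rightarrow> 'j \<Rightarrow> complex" where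
  "restrict_section p u y = (\<lambda>x. if p x = y then u x else (\<lambda>_. 0))"

definition holo_dual_section ::
  "('a::topological_space, 'k::finite) chart set \<Rightarrow> ('b::topological_space, 'm::finite) chart set
     \<Rightarrow> ('a \<Rightarrow> 'b) \<Rightarrow> ('i, 'a) line_bundle \<Rightarrow> 'b set
     \<Rightarrow> ('b \<Rightarrow> ('a \<Rightarrow> (('a, 'k) chart \<times> ('b, 'm) chart) \<times> 'i \<Rightarrow> complex) \<Rightarrow> complex) \<Rightarrow> bool" where
  "holo_dual_section A B p M U \<xi> \<longleftrightarrow>
     (\<forall>y\<in>U. linear_functional_on (direct_image_fibre A B p M y) (\<xi> y)) \<and>
     (\<forall>V u. open V \<and> V \<subseteq> U \<and>
        u \<in> lb_sections A (lb_tensor (relative_canonical_bundle A B p) M) (p -` V) \<longrightarrow>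
        holo_fun B V (\<lambda>y. \<xi> y (restrict_section p u y)))"

definition dual_norm ::
  "('a::topological_space, 'k::finite) chart set \<Rightarrow> ('b, 'm::finite) chart set \<Rightarrow> ('a \<Rightarrow> 'b)
     \<Rightarrow> ('i, 'a) line_bundle \<Rightarrow> ('i \<Rightarrow> 'a \<Rightarrow> real) \<Rightarrow> 'b
     \<Rightarrow> (('a \<Rightarrow> (('a, 'k) chart \<times> ('b, 'm) chart) \<times> 'i \<Rightarrow> complex) \<Rightarrow> complex) \<Rightarrow> real" where
  "dual_norm A B p M h y \<xi> =
     (SUP u \<in> {u \<in> direct_image_fibre A B p M y. fibre_L2_norm A B p M h y u \<le> 1}. cmod (\<xi> u))"

definition ereal_log :: "real \<Rightarrow> ereal" where
  "ereal_log r = (if r = 0 then - \<infinity> else ereal (ln r))"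

definition griffiths_semipositive ::
  "('a::topological_space, 'k::finite) chart set \<Rightarrow> ('b::topological_space, 'm::finite) chart set
     \<Rightarrow> ('a \<Rightarrow> 'b) \<Rightarrow> ('i, 'a) line_bundle \<Rightarrow> ('i \<Rightarrow> 'a \<Rightarrow> real) \<Rightarrow> bool" where
  "griffiths_semipositive A B p M h \<longleftrightarrow>
     (\<forall>U \<xi>. open U \<and> holo_dual_section A B p M U \<xi> \<longrightarrow>
        psh_fun B U (\<lambda>y. ereal_log (dual_norm A B p M h y (\<xi> y))))"

end

theory Submission
 imports Defs "HOL-Complex_Analysis.Cauchy_Integral_Formula"
begin

text \<open>Suppose that the curvature of \<open>L\<close> is negative at a point \<open>x0\<close> in a direction \<open>v0\<close>, which may be chosen
 transverse to the fibres. Let \<open>A\<close> be the hyperplane bundle of the projective embedding and let \<open>E\<close> be the \<open>k\<close>-th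
 power of \<open>A\<close> tensored with the dual of \<open>K\<^sub>X\<^sub>/\<^sub>Y \<otimes> L\<close>. Then \<open>K\<^sub>X\<^sub>/\<^sub>Y \<otimes> L \<otimes> E\<close> is the \<open>k\<close>-th power of \<open>A\<close>, and the \<open>k\<close>-th
 power of a hyperplane section whose Fubini-Study norm is maximal exactly at \<open>x0\<close> is a section of it. The
 Fubini-Study metric is modified near \<open>x0\<close> such that the weight of this section becomes a constant plus a positive
 multiple of the squared distance to the complex line through \<open>x0\<close> in the direction \<open>v0\<close>. Its curvature degenerates
 only in the direction \<open>v0\<close>, where the dual of \<open>L\<close> is positive, and there is room for an additional weight
 \<open>c |t|\<^sup>2\<close> in the base coordinate \<open>t\<close> along \<open>v0\<close>. Hence \<open>E\<close> is semi-positive for large \<open>k\<close>.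

 Now consider the evaluation functionals at the points of this line. On a circle of radius \<open>r\<close> the mean value
 property of the coefficient of a section against the Gaussian weight shows that their squared norm is smaller by the
 factor \<open>exp (- c r\<^sup>2)\<close> than the bound obtained at the centre from the above section, up to a relative error that
 is exponentially small in \<open>k\<close>. This contradicts the sub-mean value property of the logarithm of the norm.\<close>

section \<open>Holomorphic functions of several variables\<close>

text \<open>Cancelling the relative canonical bundle and L inside E makes sections of the twisted
  bundle sections of a power of A, so the competitor at the centre can be written down and no
  extension theorem is called upon. The comparison of norms has to survive as k grows: the gain on a
  circle is a fixed factor, whereas the L2 norms themselves decay with k. Both bounds must therefore
  contain exactly the same Gaussian integral. This dictates the modified weight: it depends only on
  the displacement from the line, so near the line it is the same Gaussian, about the point of
  intersection, on every fibre that the line meets. At the centre one section suffices, because the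
  dual norm is a supremum; on the circle every section has to be estimated, and there the mean value
  inequality replaces any knowledge of the sections. Transversality makes the line project to a disc
  in the base; negativity is an open condition, so a perturbation of the direction achieves it. The
  weight on the base spends half of the negativity guaranteed near the point, and the other half
  remains for the semi-positivity of E.\<close>

abbreviation fd :: "('v::real_normed_vector => 'w::real_normed_vector) => 'v => 'v => 'w" where
 "fd f z \<equiv> frechet_derivative f (at z)"

lemma fd_eq: "(f has_derivative D) (at z) ==> fd f z = D"
 by (rule frechet_derivative_at[symmetric])

lemma fd_cong_open:
 assumes "open S" "z \<in> S" "!!w. w \<in> S ==> f w = g w"
 shows "fd f z = fd g z"
proof -
 have "(f has_derivative D) (at z) \<longleftrightarrow> (g has_derivative D) (at z)" for D
  using assms has_derivative_transform_within_open[of _ D z UNIV S] by metis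
 then show ?thesis unfolding frechet_derivative_def by simp
qed

lemma has_derivative_vecI:
 fixes f :: "'v::real_normed_vector => 'w::euclidean_space^'n::finite"
 assumes "!!j. ((\<lambda>z. f z $ j) has_derivative (\<lambda>v. D v $ j)) (at z within S)"
 shows "(f has_derivative D) (at z within S)"
 unfolding has_derivative_componentwise_within[of f]
proof
 fix i :: "'w^'n" assume "i \<in> Basis"
 then obtain j u where i: "i = axis j u" by (auto simp: Basis_vec_def)
 show "((\<lambda>z. f z \<bullet> i) has_derivative (\<lambda>z. D z \<bullet> i)) (at z within S)"
  unfolding i inner_axis by (rule has_derivative_inner_left[OF assms])
qed

lemma has_derivative_nth:
 "(f has_derivative D) F ==> ((\<lambda>z. f z $ j) has_derivative (\<lambda>v. D v $ j)) F"
 by (rule bounded_linear.has_derivative[OF bounded_linear_vec_nth])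

lemma has_derivative_line:
 "((\<lambda>ze::complex. a + ze *s b) has_derivative (\<lambda>h. h *s b)) (at ze within S)"
 by (rule has_derivative_vecI) (auto intro!: derivative_eq_intros)

lemma holo_onI:
 assumes "!!z. z \<in> Om ==> (f has_derivative D z) (at z)"
  and "!!z c v. z \<in> Om ==> D z (c *s v) = c * D z v"
 shows "holo_on Om f"
 using assms unfolding holo_on_def by blast

lemma holo_onD:
 assumes "holo_on Om f" "z \<in> Om"
 shows "(f has_derivative fd f z) (at z)" "fd f z (c *s v) = c * fd f z v"
 using assms fd_eq unfolding holo_on_def by metis+

lemma holo_on_subset: "holo_on Om f ==> Om' \<subseteq> Om ==> holo_on Om' f"
 unfolding holo_on_def by blast

lemma holo_on_local:
 assumes "!!z. z \<in> Om ==> \<exists>W. z \<in> W \<and> holo_on W f"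
 shows "holo_on Om f"
 using assms unfolding holo_on_def by blast

lemma holo_on_cong:
 assumes "holo_on Om f" "open Om" "!!z. z \<in> Om ==> f z = g z"
 shows "holo_on Om g"
 using assms has_derivative_transform_within_open[of f _ _ UNIV Om g]
 unfolding holo_on_def by metis

lemma holo_on_continuous: "holo_on Om f ==> continuous_on Om f"
 using has_derivative_continuous holo_onD(1)
 by (intro continuous_at_imp_continuous_on) blast

lemma fd_bounded_linear: "holo_on Om f ==> z \<in> Om ==> bounded_linear (fd f z)"
 using holo_onD(1) has_derivative_bounded_linear by blast

lemma holo_on_const [simp, intro]: "holo_on Om (\<lambda>z. c)"
 by (rule holo_onI[where D = "\<lambda>z v. 0"]) auto

lemma holo_on_nth [simp, intro]: "holo_on Om (\<lambda>z. z $ j)"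
 by (rule holo_onI[where D = "\<lambda>z v. v $ j"])
  (auto intro!: bounded_linear.has_derivative[OF bounded_linear_vec_nth] has_derivative_ident)

lemma holo_on_add: "holo_on Om f ==> holo_on Om g ==> holo_on Om (\<lambda>z. f z + g z)"
 by (rule holo_onI[where D = "\<lambda>z v. fd f z v + fd g z v"])
  (auto intro!: derivative_eq_intros dest: holo_onD simp: holo_onD(2) algebra_simps)

lemma holo_on_minus: "holo_on Om f ==> holo_on Om (\<lambda>z. - f z)"
 by (rule holo_onI[where D = "\<lambda>z v. - fd f z v"])
  (auto intro!: derivative_eq_intros dest: holo_onD simp: holo_onD(2) algebra_simps)

lemma holo_on_diff: "holo_on Om f ==> holo_on Om g ==> holo_on Om (\<lambda>z. f z - g z)"
 using holo_on_add[OF _ holo_on_minus] by simp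

lemma holo_on_mult: "holo_on Om f ==> holo_on Om g ==> holo_on Om (\<lambda>z. f z * g z)"
 by (rule holo_onI[where D = "\<lambda>z v. f z * fd g z v + fd f z v * g z"])
  (auto intro!: derivative_eq_intros dest: holo_onD simp: holo_onD(2) algebra_simps)

lemma holo_on_inverse:
 "holo_on Om f ==> (!!z. z \<in> Om ==> f z \<noteq> 0) ==> holo_on Om (\<lambda>z. inverse (f z))"
 by (rule holo_onI[where D = "\<lambda>z v. - (inverse (f z) * fd f z v * inverse (f z))"])
  (auto intro!: derivative_eq_intros dest: holo_onD simp: holo_onD(2) algebra_simps)

lemma holo_on_divide:
 "holo_on Om f ==> holo_on Om g ==> (!!z. z \<in> Om ==> g z \<noteq> 0) ==> holo_on Om (\<lambda>z. f z / g z)"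
 unfolding divide_inverse by (intro holo_on_mult holo_on_inverse)

lemma holo_on_power: "holo_on Om f ==> holo_on Om (\<lambda>z. f z ^ n)"
 by (induction n) (auto intro: holo_on_mult)

lemma holo_on_sum: "(!!i. i \<in> I ==> holo_on Om (f i)) ==> holo_on Om (\<lambda>z. \<Sum>i\<in>I. f i z)"
 by (induction I rule: infinite_finite_induct) (auto intro: holo_on_add)

lemma holo_on_prod: "(!!i. i \<in> I ==> holo_on Om (f i)) ==> holo_on Om (\<lambda>z. \<Prod>i\<in>I. f i z)"
 by (induction I rule: infinite_finite_induct) (auto intro: holo_on_mult)

lemma holo_on_det:
 "(!!i j. holo_on Om (\<lambda>z. M z $ i $ j)) ==> holo_on Om (\<lambda>z. det (M z))"
 unfolding det_def by (intro holo_on_sum holo_on_mult holo_on_prod) auto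

lemma holo_map_onD:
 assumes "holo_map_on Om G" "z \<in> Om"
 shows "(G has_derivative fd G z) (at z)" "fd G z (c *s v) = c *s fd G z v"
  "fd G z v $ j = fd (\<lambda>w. G w $ j) z v"
proof -
 have j: "holo_on Om (\<lambda>z. G z $ j)" for j using assms unfolding holo_map_on_def by blast
 let ?D = "\<lambda>v. \<chi> j. fd (\<lambda>w. G w $ j) z v"
 have D: "(G has_derivative ?D) (at z)"
  by (rule has_derivative_vecI) (use holo_onD(1)[OF j assms(2)] in simp)
 then have eq: "fd G z = ?D" by (rule fd_eq)
 show "(G has_derivative fd G z) (at z)" using D eq by simp
 show "fd G z (c *s v) = c *s fd G z v"
  unfolding eq by (simp add: vec_eq_iff holo_onD(2)[OF j assms(2)])
 show "fd G z v $ j = fd (\<lambda>w. G w $ j) z v" unfolding eq by simp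
qed

lemma holo_map_onI:
 assumes "!!z. z \<in> Om ==> (G has_derivative D z) (at z)"
  and "!!z c v. z \<in> Om ==> D z (c *s v) = c *s D z v"
 shows "holo_map_on Om G"
 unfolding holo_map_on_def
 by (intro allI holo_onI[where D = "\<lambda>z v. D z v $ _"])
  (use assms in \<open>auto intro!: bounded_linear.has_derivative[OF bounded_linear_vec_nth]\<close>)

lemma holo_map_on_subset: "holo_map_on Om f ==> Om' \<subseteq> Om ==> holo_map_on Om' f"
 unfolding holo_map_on_def using holo_on_subset by blast

lemma holo_map_on_continuous: "holo_map_on Om f ==> continuous_on Om f"
 using has_derivative_continuous holo_map_onD(1)
 by (intro continuous_at_imp_continuous_on) blast

lemma holo_map_on_cong:
 assumes "holo_map_on Om f" "open Om" "!!z. z \<in> Om ==> f z = g z"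
 shows "holo_map_on Om g"
 using assms unfolding holo_map_on_def by (metis (no_types, lifting) holo_on_cong)

lemma fd_compose:
 assumes "holo_map_on Om G" "z \<in> Om" "(f has_derivative D) (at (G z))"
 shows "((\<lambda>z. f (G z)) has_derivative (\<lambda>v. D (fd G z v))) (at z)"
 using has_derivative_compose[OF holo_map_onD(1)[OF assms(1,2)] assms(3)] .

lemma holo_on_compose:
 assumes "holo_map_on Om G" "holo_on Om' f" "!!z. z \<in> Om ==> G z \<in> Om'"
 shows "holo_on Om (\<lambda>z. f (G z))"
 by (rule holo_onI[where D = "\<lambda>z v. fd f (G z) (fd G z v)"])
  (use assms in \<open>auto intro!: fd_compose[where Om = Om] holo_onD simp: holo_onD(2) holo_map_onD(2)\<close>)

lemma holo_map_on_compose: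
 assumes "holo_map_on Om G" "holo_map_on Om' f" "!!z. z \<in> Om ==> G z \<in> Om'"
 shows "holo_map_on Om (\<lambda>z. f (G z))"
 using assms unfolding holo_map_on_def[of _ f] holo_map_on_def[of _ "\<lambda>z. f (G z)"]
 by (auto intro: holo_on_compose)

lemma holo_on_line:
 assumes "holo_on Om f" "z + ze *s v \<in> Om"
 shows "((\<lambda>ze. f (z + ze *s v)) has_field_derivative fd f (z + ze *s v) v) (at ze)"
proof -
 have "((\<lambda>ze. f (z + ze *s v)) has_derivative (\<lambda>h. fd f (z + ze *s v) (h *s v))) (at ze)"
  by (rule has_derivative_compose[OF has_derivative_line]) (rule holo_onD(1)[OF assms])
 then show ?thesis
  unfolding has_field_derivative_def
  by (rule has_derivative_eq_rhs) (simp add: fun_eq_iff holo_onD(2)[OF assms])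
qed

text \<open>Cauchy's formula for the derivative of \<open>ze \<mapsto> f (z + ze *s v)\<close> at 0.
  Over the fixed interval \<open>{0..1}\<close> the point \<open>z\<close> is only a parameter of
  the integrand, which is the form that regularity in \<open>z\<close> requires.\<close>

lemma fd_eq_circle_integral:
 assumes "holo_on Om f" and r: "0 < r" and sub: "!!ze. cmod ze \<le> r ==> z + ze *s v \<in> Om"
 shows "fd f z v = integral {0..1}
  (\<lambda>t. f (z + (of_real r * exp (2 * of_real pi * \<i> * of_real t)) *s v)
     * exp (- (2 * of_real pi * \<i> * of_real t))) / of_real r"
proof -
 let ?F = "\<lambda>ze. f (z + ze *s v)"
 let ?e = "\<lambda>t. exp (2 * complex_of_real pi * \<i> * of_real t)"
 have der: "(?F has_field_derivative fd f (z + ze *s v) v) (at ze)" if "cmod ze \<le> r" for ze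
  by (rule holo_on_line[OF assms(1) sub[OF that]])
 have cont: "continuous_on (cball 0 r) ?F"
  using der by (intro continuous_at_imp_continuous_on ballI) (auto intro: DERIV_isCont)
 have hol: "?F holomorphic_on ball 0 r"
  unfolding holomorphic_on_def field_differentiable_def
  using der has_field_derivative_at_within by (metis less_eq_real_def mem_ball_0)
 have "(?F has_field_derivative (1 / (2 * of_real pi * \<i>) *
   contour_integral (circlepath 0 r) (\<lambda>u. ?F u / (u - 0)\<^sup>2))) (at 0)"
  by (rule Cauchy_derivative_integral_circlepath(2)[OF cont hol]) (use r in auto)
 with der[of 0] r have "fd f z v = 1 / (2 * of_real pi * \<i>) *
   contour_integral (circlepath 0 r) (\<lambda>u. ?F u / (u - 0)\<^sup>2)"
  using DERIV_unique by fastforce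
 also have "contour_integral (circlepath 0 r) (\<lambda>u. ?F u / (u - 0)\<^sup>2) =
   integral {0..1} (\<lambda>t. (2 * of_real pi * \<i> / of_real r) * (?F (of_real r * ?e t) * exp (- (2 * of_real pi * \<i> * of_real t))))"
  unfolding contour_integral_integral vector_derivative_circlepath
 proof (rule integral_cong)
  fix t :: real
  have "?e t \<noteq> 0" by simp
  then show "?F (circlepath 0 r t) / (circlepath 0 r t - 0)\<^sup>2 * (2 * pi * \<i> * r * exp (2 * complex_of_real pi * \<i> * t)) =
    2 * of_real pi * \<i> / of_real r * (?F (of_real r * ?e t) * exp (- (2 * of_real pi * \<i> * of_real t)))"
   unfolding circlepath using r by (simp only: exp_minus) (simp add: power2_eq_square divide_simps del: exp_not_eq_zero)
 qed
 also have "... = (2 * of_real pi * \<i> / of_real r) * integral {0..1} (\<lambda>t. ?F (of_real r * ?e t) * exp (- (2 * of_real pi * \<i> * of_real t)))"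
  by (rule integral_mult_right)
 finally show ?thesis by simp
qed

text \<open>\<open>holo_on\<close> asks only for a complex linear derivative at each point. The
  integral formula first gives continuity of the derivative in \<open>z\<close>; with that, the same
  formula may be differentiated under the integral sign.\<close>

lemma holo_on_fd:
 fixes f :: "complex^'k::finite => complex"
 assumes f: "holo_on Om f" and "open Om"
 shows "holo_on Om (\<lambda>z. fd f z v)"
proof -
 let ?e = "\<lambda>t. exp (2 * complex_of_real pi * \<i> * of_real t)"
 have loc: "\<exists>r>0. \<exists>d>0. \<forall>z \<in> ball z0 d. \<forall>ze. cmod ze \<le> r --> z + ze *s v \<in> Om" if z0: "z0 \<in> Om" for z0 v
 proof -
  from \<open>open Om\<close> z0 obtain e where e: "e > 0" "ball z0 e \<subseteq> Om" by (auto simp: open_contains_ball)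
  \<comment> \<open>Without the summand 1, \<open>v = 0\<close> would give the radius 0.\<close>
  define r where "r = e / (2 * (norm v + 1))"
  have nv: "norm v + 1 > 0" by (smt (verit) norm_ge_zero)
  then have r: "r > 0" using e by (simp add: r_def)
  have "z + ze *s v \<in> Om" if "z \<in> ball z0 (e/2)" "cmod ze \<le> r" for z ze
  proof -
   have "norm (ze *s v) = cmod ze * norm v"
    by (simp add: norm_vec_def L2_set_def norm_mult power_mult_distrib real_sqrt_mult flip: sum_distrib_left)
   also have "... \<le> r * (norm v + 1)" using that r by (intro mult_mono) auto
   also have "... = e / 2" using nv unfolding r_def by (simp add: divide_simps del: distrib_left_numeral)
   finally have "dist z0 (z + ze *s v) < e"
    using that(1) norm_triangle_ineq4[of "z0 - z" "ze *s v"] by (simp add: dist_norm diff_diff_eq)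
   then show ?thesis using e by auto
  qed
  then show ?thesis using e r by (metis half_gt_zero)
 qed
 have cont: "continuous_on Om (\<lambda>z. fd f z v)" for v
 proof (rule continuous_at_imp_continuous_on, rule ballI)
  fix z0 assume "z0 \<in> Om"
  from loc[OF this, of v] obtain r d where rd: "r > 0" "d > 0"
   and sub: "!!z ze. z \<in> ball z0 d ==> cmod ze \<le> r ==> z + ze *s v \<in> Om" by blast
  have "continuous_on (ball z0 d) (\<lambda>z. integral (cbox 0 1)
    (\<lambda>t. f (z + (of_real r * ?e t) *s v) * exp (- (2 * of_real pi * \<i> * of_real t))) / of_real r)"
   unfolding split_def
   apply (intro continuous_intros integral_continuous_on_param)
   unfolding split_def
   apply (intro continuous_intros continuous_on_compose2[OF holo_on_continuous[OF f]])
   using sub rd by (auto simp: norm_mult vector_scalar_mult_def intro!: continuous_intros)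
  then have "continuous_on (ball z0 d) (\<lambda>z. fd f z v)"
   by (rule continuous_on_eq)
    (subst fd_eq_circle_integral[OF f rd(1)], use sub in auto)
  then show "isCont (\<lambda>z. fd f z v) z0"
   using rd by (simp add: continuous_on_eq_continuous_at)
 qed
 \<comment> \<open>The Leibniz rule wants the derivative as a continuous family of bounded
   operators; in finite dimension this follows from continuity in each direction.\<close>
 define B where "B z = Blinfun (fd f z)" for z
 have B: "blinfun_apply (B z) = fd f z" if "z \<in> Om" for z
  unfolding B_def by (rule bounded_linear_Blinfun_apply[OF fd_bounded_linear[OF f that]])
 have contB: "continuous_on Om B"
  by (rule continuous_on_blinfun_componentwise) (use cont B in \<open>simp cong: continuous_on_cong\<close>)
 show ?thesis
 proof (rule holo_on_local)
  fix z0 assume "z0 \<in> Om"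
  from loc[OF this, of v] obtain r d where rd: "r > 0" "d > 0"
   and sub: "!!z ze. z \<in> ball z0 d ==> cmod ze \<le> r ==> z + ze *s v \<in> Om" by blast
  define h where "h t = exp (- (2 * complex_of_real pi * \<i> * of_real t))" for t
  define p where "p z t = z + (of_real r * ?e t) *s v" for z t
  have p: "p z t \<in> Om" if "z \<in> ball z0 d" for z t
   unfolding p_def using sub[OF that] rd by (simp add: norm_mult)
  have pc: "continuous_on S (\<lambda>x. p (fst x) (snd x))" for S
   unfolding p_def by (auto simp: vector_scalar_mult_def intro!: continuous_intros)
  have hc: "continuous_on S (\<lambda>x. h (g x))" if "continuous_on S g" for S and g :: "'x::topological_space => real"
   unfolding h_def by (intro continuous_intros that)
  define fx where "fx z t = blinfun_mult_left (h t) o\<^sub>L B (p z t)" for z t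
  have fxa: "blinfun_apply (fx z t) w = fd f (p z t) w * h t" if "z \<in> ball z0 d" for z t w
   unfolding fx_def using B[OF p[OF that]] by simp
  have fxc: "continuous_on (ball z0 d \<times> cbox 0 1) (\<lambda>(z, t). fx z t)"
   unfolding split_def fx_def
   by (intro continuous_intros hc continuous_on_compose2[OF contB pc]) (use p in auto)
  have lr: "((\<lambda>z. integral (cbox 0 1) (\<lambda>t. f (p z t) * h t)) has_derivative
     blinfun_apply (integral (cbox 0 1) (fx z))) (at z)" if z: "z \<in> ball z0 d" for z
  proof -
   have "((\<lambda>z. integral (cbox 0 1) (\<lambda>t. f (p z t) * h t)) has_derivative
     blinfun_apply (integral (cbox 0 1) (fx z))) (at z within ball z0 d)"
   proof (rule leibniz_rule[OF _ _ fxc z])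
    fix x t assume x: "x \<in> ball z0 d"
    have "((\<lambda>x. p x t) has_derivative (\<lambda>h. h)) (at x within ball z0 d)"
     unfolding p_def by (auto intro!: derivative_eq_intros)
    from has_derivative_compose[OF this holo_onD(1)[OF f p[OF x]]]
    have "((\<lambda>x. f (p x t)) has_derivative fd f (p x t)) (at x within ball z0 d)" .
    then have "((\<lambda>x. f (p x t) * h t) has_derivative (\<lambda>v. fd f (p x t) v * h t)) (at x within ball z0 d)"
     by (rule has_derivative_mult_left)
    then show "((\<lambda>x. f (p x t) * h t) has_derivative blinfun_apply (fx x t)) (at x within ball z0 d)"
     by (rule has_derivative_eq_rhs) (use fxa[OF x] in auto)
    show "(\<lambda>t. f (p x t) * h t) integrable_on cbox 0 1"
     by (intro integrable_continuous continuous_intros hc continuous_on_compose2[OF holo_on_continuous[OF f]])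
      (use p[OF x] in \<open>auto simp: p_def vector_scalar_mult_def intro!: continuous_intros\<close>)
   qed auto
   then show ?thesis unfolding at_within_open[OF z open_ball] .
  qed
  have "holo_on (ball z0 d) (\<lambda>z. integral (cbox 0 1) (\<lambda>t. f (p z t) * h t))"
  proof (rule holo_onI[OF lr])
   fix z c w assume z: "z \<in> ball z0 d"
   have I: "fx z integrable_on cbox 0 1"
   proof (rule integrable_continuous)
    have "continuous_on (cbox 0 1) (\<lambda>t. (\<lambda>(z, t). fx z t) (z, t))"
     by (rule continuous_on_compose2[OF fxc]) (use z in \<open>auto intro: continuous_on_Pair\<close>)
    then show "continuous_on (cbox 0 1) (fx z)" by simp
   qed
   show "blinfun_apply (integral (cbox 0 1) (fx z)) (c *s w) = c * blinfun_apply (integral (cbox 0 1) (fx z)) w"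
    unfolding blinfun_apply_integral[OF I] fxa[OF z] holo_onD(2)[OF f p[OF z]]
    by (simp add: mult.assoc)
  qed
  then have "holo_on (ball z0 d) (\<lambda>z. integral (cbox 0 1) (\<lambda>t. f (p z t) * h t) / of_real r)"
   by (rule holo_on_divide) (use rd in auto)
  then have "holo_on (ball z0 d) (\<lambda>z. fd f z v)"
   by (rule holo_on_cong)
    (auto simp: p_def h_def sub intro!: fd_eq_circle_integral[OF f rd(1), symmetric])
  then show "\<exists>W. z0 \<in> W \<and> holo_on W (\<lambda>z. fd f z v)" using rd
   by (intro exI[of _ "ball z0 d"]) auto
 qed
qed

section \<open>Smooth functions and the Levi form\<close>

lemma Ck_on_cong:
 assumes "open Om" "Ck_on n Om f" "!!z. z \<in> Om ==> f z = g z"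
 shows "Ck_on n Om g"
 using assms(2,3)
proof (induction n arbitrary: f g)
 case 0
 then show ?case using continuous_on_cong[of Om Om f g] by simp
next
 case (Suc n)
 have "g differentiable (at z)" if "z \<in> Om" for z
  using Suc.prems that has_derivative_transform_within_open[of f _ z UNIV Om g] assms(1)
  unfolding differentiable_def by (metis Ck_on.simps(2) differentiable_def)
 moreover have "Ck_on n Om (\<lambda>z. fd g z v)" for v
  by (rule Suc.IH[of "\<lambda>z. fd f z v"])
   (use Suc.prems fd_cong_open[OF assms(1), of _ f g] in auto)
 ultimately show ?case by simp
qed

lemma Ck_on_SucI:
 assumes "open Om" "!!z. z \<in> Om ==> (f has_derivative D z) (at z)"
  and "!!v. Ck_on n Om (\<lambda>z. D z v)"
 shows "Ck_on (Suc n) Om f"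
proof -
 have "Ck_on n Om (\<lambda>z. fd f z v)" for v
  by (rule Ck_on_cong[OF assms(1) assms(3)[of v]]) (use assms(2) fd_eq in fastforce)
 then show ?thesis using assms(2) by (auto simp: differentiable_def)
qed

lemma Ck_on_SucD: "Ck_on (Suc n) Om f ==> z \<in> Om ==> (f has_derivative fd f z) (at z)"
 "Ck_on (Suc n) Om f ==> Ck_on n Om (\<lambda>z. fd f z v)"
 by (auto simp: frechet_derivative_works)

lemma Ck_on_lower: "Ck_on (Suc n) Om f ==> Ck_on n Om f"
proof (induction n arbitrary: f)
 case 0
 then show ?case
  by (auto intro!: continuous_at_imp_continuous_on differentiable_imp_continuous_within)
next
 case (Suc n)
 then show ?case by simp
qed

lemma Ck_on_subset: "Ck_on n Om f ==> Om' \<subseteq> Om ==> Ck_on n Om' f"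
 by (induction n arbitrary: f) (auto intro: continuous_on_subset)

lemma Ck_on_const: "Ck_on n Om (\<lambda>z. c)"
proof (induction n arbitrary: c)
 case (Suc n)
 then show ?case using fd_eq[OF has_derivative_const[of c]] by simp
qed simp

lemma Ck_on_add:
 assumes "open Om" shows "Ck_on n Om f ==> Ck_on n Om g ==> Ck_on n Om (\<lambda>z. f z + g z)"
proof (induction n arbitrary: f g)
 case (Suc n)
 show ?case
  by (rule Ck_on_SucI[where D = "\<lambda>z v. fd f z v + fd g z v"])
   (auto intro!: assms Suc.IH Ck_on_SucD[OF Suc.prems(1)] Ck_on_SucD[OF Suc.prems(2)] has_derivative_add)
qed (auto intro: continuous_intros)

lemma Ck_on_mult:
 assumes "open Om" shows "Ck_on n Om f ==> Ck_on n Om g ==> Ck_on n Om (\<lambda>z. f z * g z)"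
proof (induction n arbitrary: f g)
 case (Suc n)
 show ?case
  by (rule Ck_on_SucI[where D = "\<lambda>z v. f z * fd g z v + fd f z v * g z"])
   (auto intro!: assms Suc.IH Ck_on_add Ck_on_SucD[OF Suc.prems(1)] Ck_on_SucD[OF Suc.prems(2)]
    Ck_on_lower[OF Suc.prems(1)] Ck_on_lower[OF Suc.prems(2)] has_derivative_mult)
qed (auto intro: continuous_intros)

lemma Ck_on_compose_real:
 fixes G :: "nat => real => real"
 assumes "open Om" "!!z. z \<in> Om ==> f z \<in> S"
  and G: "!!j x. x \<in> S ==> (G j has_real_derivative G (Suc j) x) (at x)"
 shows "Ck_on n Om f ==> Ck_on n Om (\<lambda>z. G j (f z))"
proof (induction n arbitrary: j)
 case 0
 have "continuous_on S (G j)" using G by (metis DERIV_isCont continuous_at_imp_continuous_on)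
 with 0 assms(2) show ?case by (auto intro: continuous_on_compose2)
next
 case (Suc n)
 show ?case
 proof (rule Ck_on_SucI[where D = "\<lambda>z v. G (Suc j) (f z) * fd f z v"])
  fix z assume z: "z \<in> Om"
  show "((\<lambda>z. G j (f z)) has_derivative (\<lambda>v. G (Suc j) (f z) * fd f z v)) (at z)"
   using has_derivative_compose[OF Ck_on_SucD(1)[OF Suc.prems z] G[OF assms(2)[OF z], unfolded has_field_derivative_def]]
   by (simp add: mult.commute)
 qed (auto intro!: assms(1) Ck_on_mult Suc.IH Ck_on_SucD(2)[OF Suc.prems] Ck_on_lower[OF Suc.prems])
qed

lemma smooth_onD:
 assumes "smooth_on Om f"
 shows "z \<in> Om ==> (f has_derivative fd f z) (at z)"
  and "smooth_on Om (\<lambda>z. fd f z v)" and "continuous_on Om f"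
proof -
 have s: "Ck_on n Om f" for n using assms unfolding smooth_on_def by blast
 from Ck_on_SucD(1)[OF s] show "z \<in> Om ==> (f has_derivative fd f z) (at z)" by blast
 from Ck_on_SucD(2)[OF s] show "smooth_on Om (\<lambda>z. fd f z v)" unfolding smooth_on_def by blast
 from s[of 0] show "continuous_on Om f" by simp
qed

lemma smooth_on_cong:
 "open Om ==> smooth_on Om f ==> (!!z. z \<in> Om ==> f z = g z) ==> smooth_on Om g"
 unfolding smooth_on_def using Ck_on_cong by blast

lemma smooth_on_subset: "smooth_on Om f ==> Om' \<subseteq> Om ==> smooth_on Om' f"
 unfolding smooth_on_def using Ck_on_subset by blast

lemma smooth_on_const [simp]: "smooth_on Om (\<lambda>z. c)"
 unfolding smooth_on_def by (simp add: Ck_on_const)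

lemma smooth_on_add:
 "open Om ==> smooth_on Om f ==> smooth_on Om g ==> smooth_on Om (\<lambda>z. f z + g z)"
 unfolding smooth_on_def by (simp add: Ck_on_add)

lemma smooth_on_mult:
 "open Om ==> smooth_on Om f ==> smooth_on Om g ==> smooth_on Om (\<lambda>z. f z * g z)"
 unfolding smooth_on_def by (simp add: Ck_on_mult)

lemma smooth_on_minus: "open Om ==> smooth_on Om f ==> smooth_on Om (\<lambda>z. - f z)"
 using smooth_on_mult[of Om "\<lambda>_. -1" f] by simp

lemma smooth_on_diff:
 "open Om ==> smooth_on Om f ==> smooth_on Om g ==> smooth_on Om (\<lambda>z. f z - g z)"
 using smooth_on_add[OF _ _ smooth_on_minus] by auto

lemma smooth_on_sum:
 "open Om ==> (!!i. i \<in> I ==> smooth_on Om (f i)) ==> smooth_on Om (\<lambda>z. \<Sum>i\<in>I. f i z)"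
 by (induction I rule: infinite_finite_induct) (auto intro: smooth_on_add)

lemma smooth_on_power: "open Om ==> smooth_on Om f ==> smooth_on Om (\<lambda>z. f z ^ n)"
 by (induction n) (auto intro: smooth_on_mult)

lemma smooth_on_local:
 assumes "!!z. z \<in> Om ==> \<exists>W. z \<in> W \<and> open W \<and> smooth_on W f"
 shows "smooth_on Om f"
proof -
 have "\<forall>z\<in>Om. \<exists>W. z \<in> W \<and> open W \<and> Ck_on n W f ==> Ck_on n Om f" for n
 proof (induction n arbitrary: f)
  case 0
  then show ?case
   by (auto intro!: continuous_at_imp_continuous_on simp: continuous_on_eq_continuous_at)
 next
  case (Suc n)
  have "Ck_on n Om (\<lambda>z. fd f z v)" for v
   by (rule Suc.IH) (use Suc.prems in fastforce)
  then show ?case using Suc.prems by fastforce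
 qed
 then show ?thesis using assms unfolding smooth_on_def by meson
qed

text \<open>The whole sequence of derivatives is the witness: the induction in
  \<open>Ck_on_compose_real\<close> passes from \<open>G j\<close> to
  \<open>G (Suc j)\<close>.\<close>

definition smooth_real :: "real set => (real => real) => bool" where
 "smooth_real S g \<longleftrightarrow> (\<exists>G. G (0::nat) = g \<and>
   (\<forall>j. \<forall>x\<in>S. (G j has_real_derivative G (Suc j) x) (at x)))"

lemma smooth_on_compose_real:
 assumes "open Om" "smooth_real S g" "!!z. z \<in> Om ==> f z \<in> S" "smooth_on Om f"
 shows "smooth_on Om (\<lambda>z. g (f z))"
proof -
 obtain G where G: "G (0::nat) = g" "!!j x. x \<in> S ==> (G j has_real_derivative G (Suc j) x) (at x)"
  using assms(2) unfolding smooth_real_def by blast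
 show ?thesis
  using Ck_on_compose_real[of Om f S G _ 0] assms(1,3,4) G unfolding smooth_on_def by blast
qed

lemma smooth_real_primitive:
 assumes "smooth_real S g'" "!!x. x \<in> S ==> (g has_real_derivative g' x) (at x)"
 shows "smooth_real S g"
proof -
 obtain G where G: "G (0::nat) = g'" "!!j x. x \<in> S ==> (G j has_real_derivative G (Suc j) x) (at x)"
  using assms(1) unfolding smooth_real_def by blast
 show ?thesis unfolding smooth_real_def
  by (rule exI[of _ "\<lambda>j. case j of 0 => g | Suc i => G i"])
   (use G assms(2) in \<open>auto split: nat.split\<close>)
qed

lemma smooth_real_exp: "smooth_real S exp"
 unfolding smooth_real_def by (rule exI[of _ "\<lambda>_. exp"]) auto

lemma smooth_real_inverse: "smooth_real {0<..} inverse"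
 unfolding smooth_real_def
proof (rule exI[of _ "\<lambda>j x. (-1)^j * fact j * inverse x ^ Suc j"], intro conjI allI ballI)
 fix j and x :: real assume "x \<in> {0<..}"
 then show "((\<lambda>x. (-1)^j * fact j * inverse x ^ Suc j) has_real_derivative
   (-1)^Suc j * fact (Suc j) * inverse x ^ Suc (Suc j)) (at x)"
  using DERIV_cmult[OF DERIV_power[OF DERIV_inverse, of x "Suc j" UNIV], of "(-1)^j * fact j"]
  by (simp add: algebra_simps power2_eq_square)
qed auto

lemma smooth_real_ln: "smooth_real {0<..} ln"
 by (rule smooth_real_primitive[OF smooth_real_inverse])
  (auto intro!: derivative_eq_intros simp: divide_simps)

lemma smooth_on_ln:
 "open Om ==> smooth_on Om f ==> (!!z. z \<in> Om ==> f z > 0) ==> smooth_on Om (\<lambda>z. ln (f z))"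
 by (rule smooth_on_compose_real[OF _ smooth_real_ln]) auto

lemma smooth_on_divide:
 "open Om ==> smooth_on Om f ==> smooth_on Om g ==> (!!z. z \<in> Om ==> g z > 0) ==>
  smooth_on Om (\<lambda>z. f z / g z)"
 unfolding divide_inverse
 by (intro smooth_on_mult smooth_on_compose_real[OF _ smooth_real_inverse]) auto

text \<open>Every directional derivative of \<open>Re f\<close> is again the real part of a
  holomorphic function, by \<open>holo_on_fd\<close>, so the induction reproduces its own
  hypothesis.\<close>

lemma smooth_on_Re:
 fixes f :: "complex^'k::finite => complex"
 assumes "open Om" "holo_on Om f"
 shows "smooth_on Om (\<lambda>z. Re (f z))"
proof -
 have "Ck_on n Om (\<lambda>z. Re (f z))" for n using assms(2)
 proof (induction n arbitrary: f)
  case 0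
  then show ?case using holo_on_continuous by (auto intro!: continuous_intros)
 next
  case (Suc n)
  show ?case
   by (rule Ck_on_SucI[where D = "\<lambda>z v. Re (fd f z v)"])
    (auto intro!: Suc.IH assms(1) holo_on_fd has_derivative_Re holo_onD(1)[OF Suc.prems] Suc.prems)
 qed
 then show ?thesis unfolding smooth_on_def by blast
qed

lemma smooth_on_cmod2:
 fixes f :: "complex^'k::finite => complex"
 assumes "open Om" "holo_on Om f"
 shows "smooth_on Om (\<lambda>z. (cmod (f z))\<^sup>2)"
proof -
 have "smooth_on Om (\<lambda>z. (Re (f z))\<^sup>2 + (Re (- \<i> * f z))\<^sup>2)"
  by (intro smooth_on_add smooth_on_power smooth_on_Re holo_on_mult assms) auto
 then show ?thesis by (simp add: cmod_power2)
qed

section \<open>The Levi form and its behaviour under composition\<close>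

abbreviation d2 :: "('v::real_normed_vector => real) => 'v => 'v => 'v => real" where
 "d2 f z u v \<equiv> fd (\<lambda>w. fd f w u) z v"

text \<open>The Laplacian at 0 of \<open>ze \<mapsto> f (z + ze *s v)\<close>, that is four times
  the complex Hessian form; the constants 4 and 1/8 further on come from this normalisation.\<close>

definition levi :: "(complex^'k::finite => real) => complex^'k => complex^'k => real" where
 "levi f z v = d2 f z v v + d2 f z (\<i> *s v) (\<i> *s v)"

lemma levi_cong:
 assumes "open Om" "z \<in> Om" "!!w. w \<in> Om ==> f w = g w"
 shows "levi f z v = levi g z v"
proof -
 have "d2 f z u v = d2 g z u v" for u v
  by (subst fd_cong_open[OF assms(1,2), of _ "\<lambda>w. fd g w u"])
   (use fd_cong_open[OF assms(1) _ assms(3)] in auto)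
 then show ?thesis unfolding levi_def by simp
qed

lemma d2_eq:
 assumes "open Om" "z \<in> Om" "!!w. w \<in> Om ==> (f has_derivative D w) (at w)"
  and "((\<lambda>w. D w u) has_derivative E) (at z)"
 shows "d2 f z u v = E v"
proof -
 have "d2 f z u v = fd (\<lambda>w. D w u) z v"
  by (subst fd_cong_open[OF assms(1,2), of _ "\<lambda>w. D w u"]) (use fd_eq[OF assms(3)] in auto)
 then show ?thesis using fd_eq[OF assms(4)] by simp
qed

lemma smooth_on_d2:
 assumes "smooth_on Om f" "z \<in> Om"
 shows "((\<lambda>w. fd f w u) has_derivative d2 f z u) (at z)"
 using smooth_onD(1)[OF smooth_onD(2)[OF assms(1)] assms(2)] .

lemma levi_add:
 assumes "open Om" "z \<in> Om" "smooth_on Om f" "smooth_on Om g"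
 shows "levi (\<lambda>w. f w + g w) z v = levi f z v + levi g z v"
proof -
 have "d2 (\<lambda>w. f w + g w) z u v = d2 f z u v + d2 g z u v" for u v
  by (rule d2_eq[OF assms(1,2)])
   (auto intro!: has_derivative_add smooth_onD(1)[OF assms(3)] smooth_onD(1)[OF assms(4)]
    smooth_on_d2[OF assms(3,2)] smooth_on_d2[OF assms(4,2)])
 then show ?thesis unfolding levi_def by simp
qed

lemma levi_const [simp]: "levi (\<lambda>w. c) z v = 0"
proof -
 have "d2 (\<lambda>w. c) z u v = 0" for u v
  by (rule d2_eq[where Om = UNIV and D = "\<lambda>_ _. 0"]) auto
 then show ?thesis unfolding levi_def by simp
qed

lemma levi_sum:
 assumes "open Om" "z \<in> Om" "!!i. i \<in> I ==> smooth_on Om (f i)"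
 shows "levi (\<lambda>w. \<Sum>i\<in>I. f i w) z v = (\<Sum>i\<in>I. levi (f i) z v)"
 using assms(3)
proof (induction I rule: infinite_finite_induct)
 case (insert i I)
 then show ?case
  using levi_add[OF assms(1,2) _ smooth_on_sum[OF assms(1), of I f], of "f i"] by simp
qed auto

lemma fd_compose_real:
 assumes "(f has_derivative fd f w) (at w)" "(g has_real_derivative g') (at (f w))"
 shows "((\<lambda>z. g (f z)) has_derivative (\<lambda>v. g' * fd f w v)) (at w)"
 using has_derivative_compose[OF assms(1) assms(2)[unfolded has_field_derivative_def]]
 by simp

lemma levi_compose_real:
 assumes "open Om" "z \<in> Om" "smooth_on Om f"
  and g: "!!w. w \<in> Om ==> (g has_real_derivative g' (f w)) (at (f w))"
  and g': "(g' has_real_derivative g'') (at (f z))"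
 shows "levi (\<lambda>w. g (f w)) z v = g' (f z) * levi f z v + g'' * ((fd f z v)\<^sup>2 + (fd f z (\<i> *s v))\<^sup>2)"
proof -
 have "d2 (\<lambda>w. g (f w)) z u v = g' (f z) * d2 f z u v + (g'' * fd f z v) * fd f z u" for u v
  by (rule d2_eq[OF assms(1,2) fd_compose_real[OF smooth_onD(1)[OF assms(3)] g]])
   (auto intro!: has_derivative_mult fd_compose_real[OF smooth_onD(1)[OF assms(3,2)] g']
    smooth_on_d2[OF assms(3,2)])
 then show ?thesis unfolding levi_def by (simp add: power2_eq_square algebra_simps)
qed

lemma levi_cmult:
 assumes "open Om" "z \<in> Om" "smooth_on Om f"
 shows "levi (\<lambda>w. c * f w) z v = c * levi f z v"
 using levi_compose_real[OF assms, of "(*) c" "\<lambda>_. c" 0 v] by (auto intro!: derivative_eq_intros)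

lemma levi_minus:
 assumes "open Om" "z \<in> Om" "smooth_on Om f"
 shows "levi (\<lambda>w. - f w) z v = - levi f z v"
 using levi_cmult[OF assms, of "-1"] by simp

lemma levi_diff:
 assumes "open Om" "z \<in> Om" "smooth_on Om f" "smooth_on Om g"
 shows "levi (\<lambda>w. f w - g w) z v = levi f z v - levi g z v"
 using levi_add[OF assms(1-3) smooth_on_minus[OF assms(1,4)]] levi_minus[OF assms(1,2,4)] by simp

lemma cmod2_derivative:
 fixes f :: "complex^'k::finite => complex"
 assumes "holo_on Om f" "w \<in> Om"
 shows "((\<lambda>z. (cmod (f z))\<^sup>2) has_derivative (\<lambda>v. 2 * Re (cnj (f w) * fd f w v))) (at w)"
proof -
 have "((\<lambda>z. (Re (f z))\<^sup>2 + (Im (f z))\<^sup>2) has_derivative (\<lambda>v. 2 * Re (cnj (f w) * fd f w v))) (at w)"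
  using holo_onD(1)[OF assms]
  by (auto intro!: derivative_eq_intros simp: algebra_simps)
 then show ?thesis by (simp add: cmod_power2)
qed

text \<open>The second derivative of a holomorphic \<open>f\<close> is complex bilinear, so its
  values at \<open>(v, v)\<close> and \<open>(\<i> *s v, \<i> *s v)\<close> cancel and only products
  of first derivatives remain.\<close>

lemma levi_cmod2:
 fixes f :: "complex^'k::finite => complex"
 assumes "open Om" "z \<in> Om" "holo_on Om f"
 shows "levi (\<lambda>w. (cmod (f w))\<^sup>2) z v = 4 * (cmod (fd f z v))\<^sup>2"
proof -
 let ?H = "\<lambda>u. fd (\<lambda>w. fd f w u) z"
 have H: "holo_on Om (\<lambda>w. fd f w u)" for u by (rule holo_on_fd[OF assms(3,1)])
 have d2: "d2 (\<lambda>w. (cmod (f w))\<^sup>2) z u v = 2 * Re (cnj (f z) * ?H u v + cnj (fd f z v) * fd f z u)" for u v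
  by (rule d2_eq[OF assms(1,2) cmod2_derivative[OF assms(3)]])
   (use holo_onD(1)[OF assms(3,2)] holo_onD(1)[OF H assms(2)] in \<open>auto intro!: derivative_eq_intros\<close>)
 have "?H (\<i> *s v) v' = \<i> * ?H v v'" for v'
 proof -
  have "?H (\<i> *s v) = fd (\<lambda>w. \<i> * fd f w v) z"
   by (rule fd_cong_open[OF assms(1,2)]) (simp add: holo_onD(2)[OF assms(3)])
  also have "... = (\<lambda>v'. \<i> * ?H v v')"
   by (rule fd_eq) (use holo_onD(1)[OF H assms(2)] in \<open>auto intro!: derivative_eq_intros\<close>)
  finally show ?thesis by simp
 qed
 then have "?H (\<i> *s v) (\<i> *s v) = - ?H v v"
  using holo_onD(2)[OF H assms(2)] by simp
 then have "levi (\<lambda>w. (cmod (f w))\<^sup>2) z v = 4 * Re (cnj (fd f z v) * fd f z v)"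
  unfolding levi_def d2 using holo_onD(2)[OF assms(3,2)] by (simp add: algebra_simps)
 then show ?thesis unfolding cmod_power2 by (simp add: power2_eq_square)
qed

lemma linear_Basis_expansion:
 fixes v :: "'v::euclidean_space"
 assumes "bounded_linear (L :: 'v => real)"
 shows "L v = (\<Sum>e\<in>Basis. (v \<bullet> e) * L e)"
proof -
 interpret bounded_linear L by fact
 have "L v = L (\<Sum>e\<in>Basis. (v \<bullet> e) *\<^sub>R e)" by (simp add: euclidean_representation)
 also have "... = (\<Sum>e\<in>Basis. (v \<bullet> e) * L e)" by (simp add: sum scaleR)
 finally show ?thesis .
qed

lemma fd_linear: "smooth_on Om f ==> z \<in> Om ==> bounded_linear (fd f z)"
 using has_derivative_bounded_linear smooth_onD(1) by blast

lemma fd_expand: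
 fixes f :: "'v::euclidean_space => real"
 assumes "smooth_on Om f" "z \<in> Om"
 shows "fd f z v = (\<Sum>e\<in>Basis. (v \<bullet> e) * fd f z e)"
 by (rule linear_Basis_expansion[OF fd_linear[OF assms]])

lemma d2_expand_left:
 fixes f :: "'v::euclidean_space => real"
 assumes "open Om" "smooth_on Om f" "z \<in> Om"
 shows "d2 f z u v = (\<Sum>e\<in>Basis. (u \<bullet> e) * d2 f z e v)"
proof -
 have "fd (\<lambda>w. fd f w u) z = fd (\<lambda>w. \<Sum>e\<in>Basis. (u \<bullet> e) * fd f w e) z"
  by (rule fd_cong_open[OF assms(1,3)]) (rule fd_expand[OF assms(2)])
 also have "... = (\<lambda>v. \<Sum>e\<in>Basis. (u \<bullet> e) * d2 f z e v)"
  by (rule fd_eq) (auto intro!: has_derivative_sum has_derivative_mult_right smooth_on_d2 assms)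
 finally show ?thesis by simp
qed

lemma d2_expand_right:
 fixes f :: "'v::euclidean_space => real"
 assumes "smooth_on Om f" "z \<in> Om"
 shows "d2 f z u v = (\<Sum>e\<in>Basis. (v \<bullet> e) * d2 f z u e)"
 by (rule fd_expand[OF smooth_onD(2)[OF assms(1)] assms(2)])

lemma d2_continuous:
 fixes f :: "'v::euclidean_space => real"
 assumes "open Om" "smooth_on Om f" "continuous_on S p" "continuous_on S q" "continuous_on S r"
  "!!x. x \<in> S ==> p x \<in> Om"
 shows "continuous_on S (\<lambda>x. d2 f (p x) (q x) (r x))"
proof -
 have "continuous_on S (\<lambda>x. \<Sum>e\<in>Basis. (q x \<bullet> e) * (\<Sum>e'\<in>Basis. (r x \<bullet> e') * d2 f (p x) e e'))"
  by (intro continuous_intros assms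
    continuous_on_compose2[OF smooth_onD(3)[OF smooth_onD(2)[OF smooth_onD(2)[OF assms(2)]]] assms(3)])
   (use assms(6) in auto)
 then show ?thesis
  by (rule continuous_on_eq)
   (simp add: d2_expand_left[OF assms(1,2,6), of _ "q _" "r _"] d2_expand_right[OF assms(2,6), of _ _ "r _"])
qed

lemma fd_continuous:
 fixes f :: "'v::euclidean_space => real"
 assumes "smooth_on Om f" "continuous_on S p" "continuous_on S q" "!!x. x \<in> S ==> p x \<in> Om"
 shows "continuous_on S (\<lambda>x. fd f (p x) (q x))"
proof -
 have "continuous_on S (\<lambda>x. \<Sum>e\<in>Basis. (q x \<bullet> e) * fd f (p x) e)"
  by (intro continuous_intros assms
    continuous_on_compose2[OF smooth_onD(3)[OF smooth_onD(2)[OF assms(1)]] assms(2)])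
   (use assms(4) in auto)
 then show ?thesis
  by (rule continuous_on_eq) (simp add: fd_expand[OF assms(1,4), of _ "q _"])
qed

text \<open>Point and direction both move. Expansion in a basis turns the moving direction into
  scalar factors in front of derivatives in fixed directions.\<close>

lemma fd_moving_derivative:
 fixes f :: "'v::euclidean_space => real"
 assumes "open Om" "smooth_on Om f" "!!y. y \<in> S ==> p y \<in> Om" "open S" "x \<in> S"
  and p: "(p has_derivative p') (at x)" and q: "(q has_derivative q') (at x)"
 shows "((\<lambda>y. fd f (p y) (q y)) has_derivative (\<lambda>v. d2 f (p x) (q x) (p' v) + fd f (p x) (q' v))) (at x)"
proof -
 have px: "p x \<in> Om" using assms by blast
 have "((\<lambda>y. \<Sum>e\<in>Basis. (q y \<bullet> e) * fd f (p y) e) has_derivative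
   (\<lambda>v. \<Sum>e\<in>Basis. (q x \<bullet> e) * d2 f (p x) e (p' v) + (q' v \<bullet> e) * fd f (p x) e)) (at x)"
  by (intro has_derivative_sum has_derivative_mult has_derivative_inner_left q
    has_derivative_compose[OF p] smooth_on_d2[OF assms(2) px])
 then have "((\<lambda>y. \<Sum>e\<in>Basis. (q y \<bullet> e) * fd f (p y) e) has_derivative
   (\<lambda>v. d2 f (p x) (q x) (p' v) + fd f (p x) (q' v))) (at x)"
  by (rule has_derivative_eq_rhs)
   (simp add: fun_eq_iff sum.distrib d2_expand_left[OF assms(1,2) px, of "q x"] fd_expand[OF assms(2) px, of "q' _"])
 then show ?thesis
  by (rule has_derivative_transform_within_open[OF _ assms(4,5)])
   (simp add: fd_expand[OF assms(2,3), of _ "q _"])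
qed

lemma levi_continuous:
 assumes "open Om" "smooth_on Om f" "continuous_on S p" "continuous_on S q"
  "!!x. x \<in> S ==> p x \<in> Om"
 shows "continuous_on S (\<lambda>x. levi f (p x) (q x))"
 unfolding levi_def vector_scalar_mult_def
 by (intro continuous_intros d2_continuous[OF assms(1,2,3)] assms)

lemma levi_scaleR:
 assumes "open Om" "smooth_on Om f" "z \<in> Om"
 shows "levi f z (r *\<^sub>R v) = r\<^sup>2 * levi f z v"
proof -
 have "d2 f z (r *\<^sub>R u) w = r * d2 f z u w" for u w
  by (simp add: d2_expand_left[OF assms, of "r *\<^sub>R u" w] d2_expand_left[OF assms, of u w]
    sum_distrib_left mult.assoc)
 moreover have "d2 f z u (r *\<^sub>R w) = r * d2 f z u w" for u w
  using bounded_linear.linear[OF fd_linear[OF smooth_onD(2)[OF assms(2)] assms(3)]] linear_cmul by fastforce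
 ultimately have "d2 f z (r *\<^sub>R u) (r *\<^sub>R u) = r\<^sup>2 * d2 f z u u" for u
  by (simp add: power2_eq_square)
 moreover have "\<i> *s (r *\<^sub>R v) = r *\<^sub>R (\<i> *s v)"
  by (simp add: vec_eq_iff)
 ultimately show ?thesis unfolding levi_def by (simp add: algebra_simps)
qed

lemma holo_on_fd_rot:
 fixes f :: "complex^'k::finite => complex"
 assumes "open Om" "z \<in> Om" "holo_on Om f"
 shows "fd (\<lambda>w. fd f w (\<i> *s v)) z (\<i> *s v) = - fd (\<lambda>w. fd f w v) z v"
proof -
 have H: "holo_on Om (\<lambda>w. fd f w u)" for u by (rule holo_on_fd[OF assms(3,1)])
 have "fd (\<lambda>w. fd f w (\<i> *s v)) z = fd (\<lambda>w. \<i> * fd f w v) z"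
  by (rule fd_cong_open[OF assms(1,2)]) (simp add: holo_onD(2)[OF assms(3)])
 also have "... = (\<lambda>v'. \<i> * fd (\<lambda>w. fd f w v) z v')"
  by (rule fd_eq) (use holo_onD(1)[OF H assms(2)] in \<open>auto intro!: derivative_eq_intros\<close>)
 finally show ?thesis using holo_onD(2)[OF H assms(2)] by simp
qed

text \<open>The chain rule produces a term with the second derivative of \<open>G\<close>; being
  complex bilinear, it changes sign from \<open>v\<close> to \<open>\<i> *s v\<close> and drops out
  of the sum. Thus the Levi form is a form on tangent vectors, independent of the chart.\<close>

lemma levi_compose_holo:
 fixes G :: "complex^'k::finite => complex^'k2::finite"
 assumes "open Om" "open Om'" "smooth_on Om' f" "holo_map_on Om G" "z \<in> Om"
  and G: "!!w. w \<in> Om ==> G w \<in> Om'"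
 shows "levi (\<lambda>w. f (G w)) z v = levi f (G z) (fd G z v)"
proof -
 have hol: "holo_map_on Om (\<lambda>w. fd G w u)" for u
  unfolding holo_map_on_def
 proof
  fix j
  have "holo_on Om (\<lambda>w. fd (\<lambda>w. G w $ j) w u)"
   by (rule holo_on_fd) (use assms in \<open>auto simp: holo_map_on_def\<close>)
  then show "holo_on Om (\<lambda>w. fd G w u $ j)"
   by (rule holo_on_cong[OF _ assms(1)]) (simp add: holo_map_onD(3)[OF assms(4)])
 qed
 have d2: "d2 (\<lambda>w. f (G w)) z u v = d2 f (G z) (fd G z u) (fd G z v) + fd f (G z) (fd (\<lambda>w. fd G w u) z v)" for u v
  by (rule d2_eq[OF assms(1,5) fd_compose[OF assms(4) _ smooth_onD(1)[OF assms(3) G]]])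
   (auto intro!: fd_moving_derivative[OF assms(2,3) G assms(1,5)] holo_map_onD(1) assms hol)
 have "fd (\<lambda>w. fd G w (\<i> *s v)) z (\<i> *s v) = - fd (\<lambda>w. fd G w v) z v"
  unfolding vec_eq_iff
 proof
  fix j
  have hj: "holo_on Om (\<lambda>w. G w $ j)" using assms(4) unfolding holo_map_on_def by blast
  have "fd (\<lambda>w. fd G w u) z v $ j = fd (\<lambda>w. fd (\<lambda>w. G w $ j) w u) z v" for u v
   unfolding holo_map_onD(3)[OF hol assms(5)]
   by (subst fd_cong_open[OF assms(1,5)]) (auto simp: holo_map_onD(3)[OF assms(4)])
  then show "fd (\<lambda>w. fd G w (\<i> *s v)) z (\<i> *s v) $ j = (- fd (\<lambda>w. fd G w v) z v) $ j"
   using holo_on_fd_rot[OF assms(1,5) hj] by simp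
 qed
 moreover have "fd f (G z) (- h) = - fd f (G z) h" for h
  using fd_linear[OF assms(3) G[OF assms(5)]] by (simp add: bounded_linear.linear linear_neg)
 ultimately show ?thesis
  unfolding levi_def d2 holo_map_onD(2)[OF assms(4,5)] by simp
qed

text \<open>By complex linearity of the derivative the two squared first derivatives add up to
  \<open>4 * (cmod (f z))\<^sup>2 * (cmod (fd f z v))\<^sup>2\<close>, which cancels the second
  order term. Weights in different frames differ by such a function, so their Levi forms
  agree.\<close>

lemma levi_ln_cmod2:
 fixes f :: "complex^'k::finite => complex"
 assumes "open Om" "z \<in> Om" "holo_on Om f" "!!w. w \<in> Om ==> f w \<noteq> 0"
 shows "levi (\<lambda>w. ln ((cmod (f w))\<^sup>2)) z v = 0"
proof -
 let ?F = "\<lambda>w. (cmod (f w))\<^sup>2"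
 have s: "smooth_on Om ?F" by (rule smooth_on_cmod2[OF assms(1,3)])
 have fz: "f z \<noteq> 0" using assms by blast
 have fdF: "fd ?F z u = 2 * Re (cnj (f z) * fd f z u)" for u
  by (subst fd_eq[OF cmod2_derivative[OF assms(3,2)]]) simp
 have "levi (\<lambda>w. ln (?F w)) z v = inverse (?F z) * levi ?F z v +
   - (inverse (?F z) * inverse (?F z)) * ((fd ?F z v)\<^sup>2 + (fd ?F z (\<i> *s v))\<^sup>2)"
  by (rule levi_compose_real[OF assms(1,2) s])
   (use assms(4) fz in \<open>auto intro!: derivative_eq_intros simp: inverse_eq_divide\<close>)
 moreover have "(fd ?F z v)\<^sup>2 + (fd ?F z (\<i> *s v))\<^sup>2 = 4 * (cmod (cnj (f z) * fd f z v))\<^sup>2"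
  unfolding fdF holo_onD(2)[OF assms(3,2)] unfolding cmod_power2
  by (simp add: power2_eq_square algebra_simps)
 ultimately show ?thesis
  using fz by (simp add: levi_cmod2[OF assms(1-3)] norm_mult power_mult_distrib field_simps)
qed

text \<open>\<open>c * a\<close> is the orthogonal projection of \<open>b\<close> to the line of
  \<open>a\<close>, and the defect in the Cauchy-Schwarz inequality is governed by the squared
  distance. The explicit defect yields the equality case, both for the Fubini-Study form and for
  \<open>ray\<close>.\<close>

lemma complex_Cauchy_Schwarz_sum:
 fixes a b :: "'i => complex"
 assumes "finite I" "(\<Sum>i\<in>I. (cmod (a i))\<^sup>2) > 0"
 defines "c \<equiv> (\<Sum>i\<in>I. cnj (a i) * b i) / of_real (\<Sum>i\<in>I. (cmod (a i))\<^sup>2)"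
 shows "(\<Sum>i\<in>I. (cmod (a i))\<^sup>2) * (\<Sum>i\<in>I. (cmod (b i))\<^sup>2) - (cmod (\<Sum>i\<in>I. cnj (a i) * b i))\<^sup>2
  = (\<Sum>i\<in>I. (cmod (a i))\<^sup>2) * (\<Sum>i\<in>I. (cmod (b i - c * a i))\<^sup>2)"
proof -
 let ?A = "\<Sum>i\<in>I. (cmod (a i))\<^sup>2" and ?p = "\<Sum>i\<in>I. cnj (a i) * b i"
 have p: "?p = c * of_real ?A" using assms(2) unfolding c_def by (simp del: of_real_sum)
 have "(cmod (b i - c * a i))\<^sup>2 = (cmod (b i))\<^sup>2 - 2 * Re (cnj c * (cnj (a i) * b i)) + (cmod c)\<^sup>2 * (cmod (a i))\<^sup>2" for i
  unfolding cmod_power2 by (simp add: power2_eq_square algebra_simps)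
 then have "(\<Sum>i\<in>I. (cmod (b i - c * a i))\<^sup>2)
   = (\<Sum>i\<in>I. (cmod (b i))\<^sup>2) - 2 * Re (cnj c * ?p) + (cmod c)\<^sup>2 * ?A"
  by (simp add: sum.distrib sum_subtractf sum_distrib_left)
 also have "Re (cnj c * ?p) = (cmod c)\<^sup>2 * ?A"
  unfolding p cmod_power2 by (simp add: power2_eq_square algebra_simps del: of_real_sum)
 finally have "(\<Sum>i\<in>I. (cmod (b i - c * a i))\<^sup>2) = (\<Sum>i\<in>I. (cmod (b i))\<^sup>2) - (cmod c)\<^sup>2 * ?A" by simp
 moreover have "(cmod ?p)\<^sup>2 = (cmod c)\<^sup>2 * ?A\<^sup>2"
  unfolding p norm_mult power_mult_distrib norm_of_real by simp
 ultimately show ?thesis by algebra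
qed

text \<open>The quotient rule followed by the explicit Cauchy-Schwarz defect. The sum of squares
  exhibits the null directions: there the derivatives are proportional to the values, with one
  common factor \<open>c\<close>.\<close>

lemma levi_ln_sum_cmod2:
 fixes f :: "'i => complex^'k::finite => complex"
 assumes "open Om" "z \<in> Om" "finite I" "!!i. i \<in> I ==> holo_on Om (f i)"
  and pos: "!!w. w \<in> Om ==> (\<Sum>i\<in>I. (cmod (f i w))\<^sup>2) > 0"
 defines "F \<equiv> \<lambda>w. \<Sum>i\<in>I. (cmod (f i w))\<^sup>2"
 shows "\<exists>c. levi (\<lambda>w. ln (F w)) z v = 4 * (\<Sum>i\<in>I. (cmod (fd (f i) z v - c * f i z))\<^sup>2) / F z"
proof -
 have s: "smooth_on Om F" unfolding F_def
  by (intro smooth_on_sum smooth_on_cmod2 assms)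
 have Fz: "F z > 0" unfolding F_def using pos assms(2) by blast
 have "(F has_derivative (\<lambda>u. \<Sum>i\<in>I. 2 * Re (cnj (f i z) * fd (f i) z u))) (at z)"
  unfolding F_def by (intro has_derivative_sum cmod2_derivative[OF assms(4,2)])
 from fd_eq[OF this] have fdF: "fd F z u = 2 * Re (\<Sum>i\<in>I. cnj (f i z) * fd (f i) z u)" for u
  by (simp add: sum_distrib_left)
 have l: "levi F z v = 4 * (\<Sum>i\<in>I. (cmod (fd (f i) z v))\<^sup>2)"
  unfolding F_def by (subst levi_sum[OF assms(1,2)])
   (auto intro!: smooth_on_cmod2 assms simp: levi_cmod2[OF assms(1,2,4)] sum_distrib_left)
 have "levi (\<lambda>w. ln (F w)) z v = inverse (F z) * levi F z v +
   - (inverse (F z) * inverse (F z)) * ((fd F z v)\<^sup>2 + (fd F z (\<i> *s v))\<^sup>2)"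
  by (rule levi_compose_real[OF assms(1,2) s])
   (use pos Fz in \<open>auto intro!: derivative_eq_intros simp: inverse_eq_divide F_def\<close>)
 moreover have "(fd F z v)\<^sup>2 + (fd F z (\<i> *s v))\<^sup>2 = 4 * (cmod (\<Sum>i\<in>I. cnj (f i z) * fd (f i) z v))\<^sup>2"
 proof -
  have "(\<Sum>i\<in>I. cnj (f i z) * fd (f i) z (\<i> *s v)) = \<i> * (\<Sum>i\<in>I. cnj (f i z) * fd (f i) z v)"
   by (simp add: holo_onD(2)[OF assms(4,2)] sum_distrib_left algebra_simps)
  then show ?thesis unfolding fdF cmod_power2 by (simp add: power2_eq_square)
 qed
 ultimately have "levi (\<lambda>w. ln (F w)) z v = 4 * (F z * (\<Sum>i\<in>I. (cmod (fd (f i) z v))\<^sup>2)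
   - (cmod (\<Sum>i\<in>I. cnj (f i z) * fd (f i) z v))\<^sup>2) / (F z * F z)"
  unfolding l using Fz by (simp add: field_simps)
 also have "F z * (\<Sum>i\<in>I. (cmod (fd (f i) z v))\<^sup>2) - (cmod (\<Sum>i\<in>I. cnj (f i z) * fd (f i) z v))\<^sup>2
  = F z * (\<Sum>i\<in>I. (cmod (fd (f i) z v - (\<Sum>i\<in>I. cnj (f i z) * fd (f i) z v) / of_real (F z) * f i z))\<^sup>2)"
  using complex_Cauchy_Schwarz_sum[OF assms(3) Fz[unfolded F_def], of "\<lambda>i. fd (f i) z v"]
  unfolding F_def by simp
 finally show ?thesis using Fz
  by (intro exI[of _ "(\<Sum>i\<in>I. cnj (f i z) * fd (f i) z v) / of_real (F z)"]) simp
qed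

text \<open>By compactness of the unit sphere: a failure for all \<open>k\<close> would produce a unit vector on which
 the Levi form of \<open>f\<close> at \<open>z0\<close> vanishes while that of \<open>g\<close> is at most zero.\<close>

lemma levi_absorb:
 fixes f g :: "complex^'k::finite => real"
 assumes "open Om" "z0 \<in> Om" "smooth_on Om f" "smooth_on Om g"
  and f: "!!z v. z \<in> Om ==> levi f z v \<ge> 0"
  and g: "!!v. v \<noteq> 0 ==> levi f z0 v = 0 ==> levi g z0 v > 0"
 shows "\<exists>k0::nat. \<exists>W. open W \<and> z0 \<in> W \<and> W \<subseteq> Om \<and>
  (\<forall>k\<ge>k0. \<forall>z\<in>W. \<forall>v. real k * levi f z v + levi g z v \<ge> 0)"
proof (rule ccontr)
 assume neg: "\<not> ?thesis"
 obtain e where e: "e > 0" "ball z0 e \<subseteq> Om" using assms(1,2) by (auto simp: open_contains_ball)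
 have en: "e / Suc n \<le> e" for n using e by (simp add: divide_le_eq)
 have "\<exists>k z v. k \<ge> n \<and> z \<in> ball z0 (e / Suc n) \<and> norm v = 1 \<and> real k * levi f z v + levi g z v < 0" for n
 proof -
  have "ball z0 (e / Suc n) \<subseteq> Om" by (rule subset_trans[OF subset_ball[OF en] e(2)])
  moreover have "z0 \<in> ball z0 (e / Suc n)" using e by simp
  ultimately
  obtain k z v where kz: "k \<ge> n" "z \<in> ball z0 (e / Suc n)" "real k * levi f z v + levi g z v < 0" "z \<in> Om"
   using neg by (metis not_le open_ball subsetD)
  have v: "v \<noteq> 0"
  proof
   assume "v = 0"
   then have "v = 0 *\<^sub>R v" by simp
   then have "levi f z v = 0" "levi g z v = 0"
    using levi_scaleR[OF assms(1,3) kz(4), of 0 v] levi_scaleR[OF assms(1,4) kz(4), of 0 v] by auto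
   then show False using kz by simp
  qed
  let ?v = "inverse (norm v) *\<^sub>R v"
  have "real k * levi f z ?v + levi g z ?v = (inverse (norm v))\<^sup>2 * (real k * levi f z v + levi g z v)"
   unfolding levi_scaleR[OF assms(1,3) kz(4)] levi_scaleR[OF assms(1,4) kz(4)] by (simp add: algebra_simps)
  also have "... < 0" using kz(3) v by (simp add: mult_less_0_iff)
  finally show ?thesis using kz v by (intro exI[of _ k] exI[of _ z] exI[of _ ?v]) auto
 qed
 then obtain k z v where kzv: "!!n. k n \<ge> n" "!!n. z n \<in> ball z0 (e / Suc n)" "!!n. norm (v n) = 1"
  "!!n. real (k n) * levi f (z n) (v n) + levi g (z n) (v n) < 0" by metis
 have "compact (sphere (0::complex^'k) 1)" by simp
 then obtain l r where lr: "l \<in> sphere 0 1" "strict_mono (r :: nat => nat)" "(v \<circ> r) \<longlonglongrightarrow> l"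
  using kzv(3) unfolding compact_eq_seq_compact_metric seq_compact_def by (metis dist_0_norm mem_sphere)
 have "z \<longlonglongrightarrow> z0"
 proof (rule metric_tendsto_imp_tendsto)
  show "(\<lambda>n. e / Suc n) \<longlonglongrightarrow> 0" by (rule LIMSEQ_Suc[OF lim_const_over_n])
  show "\<forall>\<^sub>F n in sequentially. dist (z n) z0 \<le> dist (e / Suc n) 0"
   using kzv(2) e by (intro always_eventually) (auto simp: dist_commute less_imp_le)
 qed
 then have zr: "(z \<circ> r) \<longlonglongrightarrow> z0" by (rule LIMSEQ_subseq_LIMSEQ[OF _ lr(2)])
 have lim: "(\<lambda>n. levi h (z (r n)) (v (r n))) \<longlonglongrightarrow> levi h z0 l" if "smooth_on Om h" for h
 proof -
  have c: "continuous_on (Om \<times> UNIV) (\<lambda>x. levi h (fst x) (snd x))"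
   by (rule levi_continuous[OF assms(1) that]) (auto intro: continuous_intros)
  have zv: "(\<lambda>n. (z (r n), v (r n))) \<longlonglongrightarrow> (z0, l)"
   using tendsto_Pair[OF zr lr(3)] by (simp add: o_def)
  have "open (Om \<times> (UNIV :: (complex^'k) set))" "(z0, l) \<in> Om \<times> UNIV"
   using assms(1,2) by (auto intro: open_Times)
  with c have "isCont (\<lambda>x. levi h (fst x) (snd x)) (z0, l)"
   by (simp only: continuous_on_eq_continuous_at)
  from isCont_tendsto_compose[OF this zv] show ?thesis by simp
 qed
 have zO: "z n \<in> Om" for n
  using kzv(2)[of n] subset_trans[OF subset_ball[OF en] e(2)] by blast
 \<comment> \<open>The multiple of the form of \<open>f\<close> is nonnegative, so the sum can only
   be negative through \<open>g\<close>. In the limit \<open>levi g z0 l\<close> is at most 0, and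
   the hypothesis then forces \<open>levi f z0 l\<close> to be positive.\<close>
 have "levi g (z n) (v n) < 0" for n
  using kzv(4)[of n] f[OF zO[of n], of "v n"] by (smt (verit) mult_nonneg_nonneg of_nat_0_le_iff)
 then have "levi g z0 l \<le> 0"
  by (intro LIMSEQ_le_const2[OF lim[OF assms(4)]]) (auto intro: less_imp_le)
 with g[of l] lr(1) f[OF assms(2), of l] have fl: "levi f z0 l > 0" by force
 have "\<forall>\<^sub>F n in sequentially. levi f (z (r n)) (v (r n)) > levi f z0 l / 2"
  by (rule order_tendstoD(1)[OF lim[OF assms(3)]]) (use fl in simp)
 moreover have "\<forall>\<^sub>F n in sequentially. levi g (z (r n)) (v (r n)) > levi g z0 l - 1"
  by (rule order_tendstoD(1)[OF lim[OF assms(4)]]) simp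
 moreover have "\<forall>\<^sub>F n in sequentially. real n * (levi f z0 l / 2) > 1 - levi g z0 l"
 proof -
  have "filterlim (\<lambda>n. levi f z0 l / 2 * real n) at_top sequentially"
   by (rule filterlim_tendsto_pos_mult_at_top[OF tendsto_const _ filterlim_real_sequentially]) (use fl in simp)
  then show ?thesis unfolding filterlim_at_top_dense by (simp only: mult.commute)
 qed
 ultimately have "\<forall>\<^sub>F n in sequentially. False"
 proof eventually_elim
  case (elim n)
  have "n \<le> k (r n)" using kzv(1)[of "r n"] seq_suble[OF lr(2), of n] by linarith
  then have "real n * (levi f z0 l / 2) \<le> real (k (r n)) * levi f (z (r n)) (v (r n))"
   using elim fl by (intro mult_mono) auto
  with elim kzv(4)[of "r n"] show False by linarith
 qed
 then show False by simp
qed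

text \<open>For the integral \<open>M r\<close> over the circle of radius \<open>r\<close>, the
  Laplacian in polar coordinates gives \<open>r\<^sup>2 * M'' + r * M' \<ge> 0\<close>, because the
  second angular derivative integrates to 0. Hence \<open>r * M'\<close> increases from 0, and
  \<open>M\<close> increases.\<close>

lemma levi_nonneg_imp_submean:
 fixes f :: "complex^'k::finite => real"
 assumes "open Om" "smooth_on Om f" and lev: "!!z v. z \<in> Om ==> levi f z v \<ge> 0"
  and disc: "!!ze. cmod ze \<le> 1 ==> a + ze *s b \<in> Om"
 shows "2 * pi * f a \<le> integral {0..2*pi} (\<lambda>t. f (a + cis t *s b))"
proof -
 define p where "p r t = a + (of_real r * cis t) *s b" for r t
 have pOm: "p r t \<in> Om" if "r \<in> {0..1}" for r t
  unfolding p_def using that by (intro disc) (simp add: norm_mult)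
 define g1 where "g1 r t = fd f (p r t) (cis t *s b)" for r t
 define g2 where "g2 r t = d2 f (p r t) (cis t *s b) (cis t *s b)" for r t
 define M where "M r = integral {0..2*pi} (\<lambda>t. f (p r t))" for r
 define M1 where "M1 r = integral {0..2*pi} (\<lambda>t. g1 r t)" for r
 define M2 where "M2 r = integral {0..2*pi} (\<lambda>t. g2 r t)" for r
 have contp: "continuous_on S (\<lambda>x. p (u x) (w x))"
  if "continuous_on S u" "continuous_on S w" for S and u w :: "'x::topological_space => real"
  unfolding p_def vector_scalar_mult_def using that by (intro continuous_intros) auto
 have contc1: "continuous_on S (\<lambda>x. cis (w x) *s b)"
  if "continuous_on S w" for S and w :: "'x::topological_space => real"
  unfolding vector_scalar_mult_def using that by (intro continuous_intros) auto
 have cg: "continuous_on S (\<lambda>x. f (p (u x) (w x)))" "continuous_on S (\<lambda>x. g1 (u x) (w x))"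
  "continuous_on S (\<lambda>x. g2 (u x) (w x))"
  if "continuous_on S u" "continuous_on S w" "!!x. x \<in> S ==> u x \<in> {0..1}" for S and u w :: "'x::topological_space => real"
  unfolding g1_def g2_def using that
  by (auto intro!: continuous_on_compose2[OF smooth_onD(3)[OF assms(2)] contp]
    fd_continuous[OF assms(2) contp] d2_continuous[OF assms(1,2) contp] contc1 pOm)
 have dr: "((\<lambda>r. p r t) has_derivative (\<lambda>h. h *\<^sub>R (cis t *s b))) (at r)" for r t
  unfolding p_def by (rule has_derivative_vecI) (auto intro!: derivative_eq_intros simp: scaleR_conv_of_real[where 'a = complex])
 have dt: "((\<lambda>t. p r t) has_derivative (\<lambda>h. h *\<^sub>R ((of_real r * \<i> * cis t) *s b))) (at t)" for r t
  unfolding p_def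
  by (rule has_derivative_vecI) (auto intro!: derivative_eq_intros simp: fun_eq_iff scaleR_conv_of_real[where 'a = complex])
 have scale: "fd f z (h *\<^sub>R v) = fd f z v * h" "d2 f z u (h *\<^sub>R v) = d2 f z u v * h" if "z \<in> Om" for z h u v
  by (simp_all add: linear_cmul[OF bounded_linear.linear[OF fd_linear[OF assms(2) that]]]
   linear_cmul[OF bounded_linear.linear[OF fd_linear[OF smooth_onD(2)[OF assms(2)] that]]])
 have der1: "((\<lambda>r. f (p r t)) has_field_derivative g1 r t) (at r)" if "r \<in> {0<..<1}" for r t
 proof -
  have r: "r \<in> {0..1}" using that by auto
  from has_derivative_compose[OF dr smooth_onD(1)[OF assms(2) pOm[OF r]]]
  show ?thesis unfolding has_field_derivative_def g1_def
   by (rule has_derivative_eq_rhs) (simp add: fun_eq_iff scale pOm[OF r])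
 qed
 have der2: "((\<lambda>r. g1 r t) has_field_derivative g2 r t) (at r)" if "r \<in> {0<..<1}" for r t
 proof -
  have "((\<lambda>r. fd f (p r t) (cis t *s b)) has_derivative
    (\<lambda>h. d2 f (p r t) (cis t *s b) (h *\<^sub>R (cis t *s b)) + fd f (p r t) 0)) (at r)"
   by (rule fd_moving_derivative[OF assms(1,2) _ open_greaterThanLessThan that dr]) (use pOm in auto)
  moreover have r: "r \<in> {0..1}" using that by auto
  moreover have "fd f (p r t) 0 = 0"
   by (rule linear_0[OF bounded_linear.linear[OF fd_linear[OF assms(2) pOm[OF r]]]])
  ultimately show ?thesis
   unfolding has_field_derivative_def g1_def g2_def
   by (simp add: scale pOm[OF r] mult.commute[of _ "d2 f (p r t) (cis t *s b) (cis t *s b)"])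
 qed
 have leib: "((\<lambda>r. integral {0..2*pi} (\<lambda>t. F r t)) has_field_derivative integral {0..2*pi} (F' r)) (at r)"
  if r: "r \<in> {0<..<1}" and der: "!!r t. r \<in> {0<..<1} ==> ((\<lambda>r. F r t) has_field_derivative F' r t) (at r)"
   and c: "!!r. r \<in> {0<..<1} ==> continuous_on {0..2*pi} (\<lambda>t. F r t)"
   and c': "continuous_on ({0<..<1} \<times> {0..2*pi}) (\<lambda>x. F' (fst x) (snd x))" for F F' :: "real => real => real" and r
 proof -
  have "((\<lambda>r. integral (cbox 0 (2*pi)) (F r)) has_field_derivative integral (cbox 0 (2*pi)) (F' r)) (at r within {0<..<1})"
  proof (rule leibniz_rule_field_derivative)
   show "!!x t. x \<in> {0<..<1} ==> ((\<lambda>x. F x t) has_field_derivative F' x t) (at x within {0<..<1})"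
    by (rule has_field_derivative_at_within[OF der])
   show "!!x. x \<in> {0<..<1} ==> F x integrable_on cbox 0 (2 * pi)"
    unfolding cbox_interval by (rule integrable_continuous_real[OF c])
   show "continuous_on ({0<..<1} \<times> cbox 0 (2 * pi)) (\<lambda>(x, t). F' x t)"
    unfolding cbox_interval split_def by (rule c')
  qed (use r in auto)
  then show ?thesis unfolding cbox_interval at_within_open[OF r open_greaterThanLessThan] .
 qed
 have lr: "(M has_field_derivative M1 r) (at r)" "(M1 has_field_derivative M2 r) (at r)"
  if r: "r \<in> {0<..<1}" for r
 proof -
  show "(M has_field_derivative M1 r) (at r)" unfolding M_def[abs_def] M1_def
   by (rule leib[OF r der1]; (rule cg)?) (auto intro: continuous_on_const continuous_on_id continuous_on_fst continuous_on_snd)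
  show "(M1 has_field_derivative M2 r) (at r)" unfolding M1_def[abs_def] M2_def
   by (rule leib[OF r der2]; (rule cg)?) (auto intro: continuous_on_const continuous_on_id continuous_on_fst continuous_on_snd)
 qed
 have contM: "continuous_on {0..1} M" "continuous_on {0..1} M1"
  unfolding M_def[abs_def] M1_def[abs_def] cbox_interval[symmetric]
  by (rule integral_continuous_on_param, unfold split_def, rule cg; auto intro: continuous_intros)+
 have M12: "M1 r + r * M2 r \<ge> 0" if r: "r \<in> {0<..<1}" for r
 proof -
  \<comment> \<open>\<open>h2\<close> is the second derivative of
    \<open>t \<mapsto> f (p r t)\<close>, hence the derivative of a periodic function.\<close>
  define h2 where "h2 t = r\<^sup>2 * d2 f (p r t) ((\<i> * cis t) *s b) ((\<i> * cis t) *s b) - r * g1 r t" for t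
  have pr: "p r t \<in> Om" for t using r pOm by auto
  have dh: "((\<lambda>t. fd f (p r t) ((of_real r * \<i> * cis t) *s b)) has_vector_derivative h2 t) (at t)" for t
  proof -
   have rot: "of_real r * \<i> * (of_real x * (\<i> * cis t)) * y = - (of_real x * of_real r * (cis t * y))" for x y
    using i_squared by algebra
   have q: "((\<lambda>t. (of_real r * \<i> * cis t) *s b) has_derivative (\<lambda>h. h *\<^sub>R (- (r *\<^sub>R (cis t *s b))))) (at t)"
    by (rule has_derivative_vecI) (auto intro!: derivative_eq_intros simp: fun_eq_iff scaleR_conv_of_real[where 'a = complex] rot)
   have e: "(of_real r * \<i> * cis t) *s b = r *\<^sub>R ((\<i> * cis t) *s b)"
    by (simp add: vec_eq_iff scaleR_conv_of_real[where 'a = complex])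
   have neg: "fd f (p r t) (- v) = - fd f (p r t) v" for v
    by (rule linear_neg[OF bounded_linear.linear[OF fd_linear[OF assms(2) pr]]])
   have left: "d2 f (p r t) (r *\<^sub>R u) v = r * d2 f (p r t) u v" for u v
    by (simp add: d2_expand_left[OF assms(1,2) pr[of t], of "r *\<^sub>R u" v] d2_expand_left[OF assms(1,2) pr[of t], of u v]
      sum_distrib_left mult.assoc)
   from fd_moving_derivative[OF assms(1,2) pr open_UNIV UNIV_I dt q]
   show ?thesis
    unfolding has_vector_derivative_def e h2_def g1_def
    by (rule has_derivative_eq_rhs)
     (simp only: fun_eq_iff scale[OF pr] neg left, simp add: power2_eq_square algebra_simps)
  qed
  have "(h2 has_integral fd f (p r (2*pi)) ((of_real r * \<i> * cis (2*pi)) *s b) - fd f (p r 0) ((of_real r * \<i> * cis 0) *s b)) {0..2*pi}"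
   by (rule fundamental_theorem_of_calculus[OF _ has_vector_derivative_at_within[OF dh]]) simp
  then have h2: "(h2 has_integral 0) {0..2*pi}"
   by (simp add: p_def cis_2pi)
  have i1: "(g1 r has_integral M1 r) {0..2*pi}" and i2: "(g2 r has_integral M2 r) {0..2*pi}"
   unfolding M1_def M2_def
   by (intro integrable_integral integrable_continuous_real cg; use r in \<open>auto intro: continuous_intros\<close>)+
  have "((\<lambda>t. r\<^sup>2 * g2 r t + h2 t + r * g1 r t) has_integral (r\<^sup>2 * M2 r + 0 + r * M1 r)) {0..2*pi}"
   by (intro has_integral_add has_integral_mult_right i1 i2 h2)
  moreover have "r\<^sup>2 * g2 r t + h2 t + r * g1 r t \<ge> 0" for t
   using mult_nonneg_nonneg[OF zero_le_power2[of r] lev[OF pr[of t], of "cis t *s b"]]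
   unfolding levi_def h2_def g2_def by (simp add: algebra_simps)
  ultimately have "r\<^sup>2 * M2 r + 0 + r * M1 r \<ge> 0"
   by (rule has_integral_nonneg)
  then have "r * (M1 r + r * M2 r) \<ge> 0" by (simp add: algebra_simps power2_eq_square)
  then show ?thesis using r by (simp add: zero_le_mult_iff)
 qed
 have M1: "M1 r \<ge> 0" if r: "r \<in> {0<..<1}" for r
 proof -
  have "0 * M1 0 \<le> r * M1 r"
  proof (rule DERIV_nonneg_imp_increasing_open[where f = "\<lambda>r. r * M1 r"])
   fix x assume "0 < x" "x < r"
   then have x: "x \<in> {0<..<1}" using r by auto
   show "\<exists>y. ((\<lambda>r. r * M1 r) has_real_derivative y) (at x) \<and> 0 \<le> y"
    using DERIV_mult[OF DERIV_ident lr(2)[OF x]] M12[OF x]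
    by (intro exI[of _ "M1 x + x * M2 x"]) (auto simp: algebra_simps)
  next
   show "continuous_on {0..r} (\<lambda>r. r * M1 r)"
    using r by (intro continuous_intros continuous_on_subset[OF contM(2)]) auto
  qed (use r in auto)
  then show ?thesis using r by (simp add: zero_le_mult_iff)
 qed
 have "M 0 \<le> M 1"
  by (rule DERIV_nonneg_imp_increasing_open) (use lr(1) M1 contM in auto)
 then show ?thesis unfolding M_def p_def by (simp add: vec_eq_iff mult.commute)
qed

section \<open>Circle means and plurisubharmonic functions\<close>

lemma circle_mean_continuous:
 assumes "continuous_on UNIV g"
 shows "circle_mean (\<lambda>th. ereal (g th)) = ereal (integral {0..2*pi} g / (2 * pi))"
proof -
 let ?M = "uniform_measure lborel {0..2*pi}"
 have em: "emeasure lborel {0..2*pi} = ennreal (2 * pi)" by (simp add: pi_ge_zero)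
 have [measurable]: "g \<in> borel_measurable borel" using assms by (rule borel_measurable_continuous_onI)
 have int: "set_integrable lborel {0..2*pi} g"
  by (rule borel_integrable_atLeastAtMost') (rule continuous_on_subset[OF assms], simp)
 have Meq: "?M = density lborel (\<lambda>x. ennreal (indicator {0..2*pi} x / (2 * pi)))"
  unfolding uniform_measure_def em
  by (rule density_cong) (auto simp: indicator_def divide_ennreal simp flip: ennreal_1)
 have eq: "(indicator {0..2*pi} x / (2 * pi)) *\<^sub>R g x = (indicator {0..2*pi} x *\<^sub>R g x) / (2 * pi)" for x
  by simp
 have intM: "integrable ?M g"
  unfolding Meq
 proof (subst integrable_density)
  show "integrable lborel (\<lambda>x. (indicator {0..2*pi} x / (2 * pi)) *\<^sub>R g x)"
   unfolding eq using int unfolding set_integrable_def by (rule integrable_divide_zero)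
 qed auto
 have "integral\<^sup>L ?M g = integral\<^sup>L lborel (\<lambda>x. (indicator {0..2*pi} x / (2 * pi)) *\<^sub>R g x)"
  unfolding Meq by (rule integral_density) auto
 also have "... = (LINT x:{0..2*pi}|lborel. g x) / (2 * pi)"
  unfolding eq set_lebesgue_integral_def by (rule integral_divide_zero)
 also have "(LINT x:{0..2*pi}|lborel. g x) = integral {0..2*pi} g"
  by (rule set_borel_integral_eq_integral(2)[OF int])
 finally have eq: "integral\<^sup>L ?M g = integral {0..2*pi} g / (2 * pi)" .
 have fin: "(\<integral>\<^sup>+x. ennreal (g x) \<partial>?M) \<noteq> \<infinity>" "(\<integral>\<^sup>+x. ennreal (- g x) \<partial>?M) \<noteq> \<infinity>"
  using intM unfolding real_integrable_def by auto
 show ?thesis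
  unfolding circle_mean_def eq[symmetric] real_lebesgue_integral_def[OF intM]
  using fin by (cases "\<integral>\<^sup>+x. ennreal (g x) \<partial>?M"; cases "\<integral>\<^sup>+x. ennreal (- g x) \<partial>?M")
   (auto simp: e2ennreal_ereal)
qed

text \<open>\<open>nn_integral\<close> is monotone on all functions, so a pointwise bound is enough;
  the dual norm is bounded pointwise on a circle and enters in this way.\<close>

lemma circle_mean_le:
 assumes "!!th. g th \<le> ereal C"
 shows "circle_mean g \<le> ereal C"
proof -
 let ?M = "uniform_measure lborel {0..2*pi}"
 have one: "emeasure ?M (space ?M) = 1"
  using emeasure_uniform_measure_1[of lborel "{0..2*pi}"] by simp
 have 1: "(\<integral>\<^sup>+th. e2ennreal (g th) \<partial>?M) \<le> ennreal C"
 proof -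
  have "(\<integral>\<^sup>+th. e2ennreal (g th) \<partial>?M) \<le> (\<integral>\<^sup>+th. ennreal C \<partial>?M)"
   using e2ennreal_mono[OF assms] by (intro nn_integral_mono) (simp add: e2ennreal_ereal)
  then show ?thesis using one by simp
 qed
 have 2: "ennreal (- C) \<le> (\<integral>\<^sup>+th. e2ennreal (- g th) \<partial>?M)"
 proof -
  have "(\<integral>\<^sup>+th. ennreal (- C) \<partial>?M) \<le> (\<integral>\<^sup>+th. e2ennreal (- g th) \<partial>?M)"
  proof (rule nn_integral_mono)
   fix th
   have "ereal (- C) \<le> - g th" using assms[of th] ereal_minus_le_minus by fastforce
   from e2ennreal_mono[OF this] show "ennreal (- C) \<le> e2ennreal (- g th)" by (simp add: e2ennreal_ereal)
  qed
  then show ?thesis using one by simp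
 qed
 \<comment> \<open>At least one of \<open>ennreal C\<close> and \<open>ennreal (- C)\<close> is 0,
   so the same two estimates cover both signs of \<open>C\<close>.\<close>
 have "circle_mean g \<le> enn2ereal (ennreal C) - enn2ereal (ennreal (- C))"
  unfolding circle_mean_def using 1 2 by (intro ereal_minus_mono) (auto simp: less_eq_ennreal.rep_eq)
 also have "... = ereal C" by (cases "C \<ge> 0") (auto simp: ennreal_neg zero_ennreal.rep_eq)
 finally show ?thesis .
qed

lemma levi_nonneg_imp_psh:
 fixes f :: "complex^'k::finite => real"
 assumes "open Om" "smooth_on Om f" and lev: "!!z v. z \<in> Om ==> levi f z v \<ge> 0"
 shows "psh_on Om (\<lambda>z. ereal (f z))"
 unfolding psh_on_def
proof (intro conjI allI impI ballI)
 fix c :: ereal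
 have *: "open {z \<in> Om. f z < r}" for r
 proof -
  have "open (f -` {..<r} \<inter> Om)"
   using smooth_onD(3)[OF assms(2)] continuous_on_open_vimage[OF assms(1), of f] open_lessThan by metis
  moreover have "f -` {..<r} \<inter> Om = {z \<in> Om. f z < r}" by auto
  ultimately show ?thesis by simp
 qed
 show "open {z \<in> Om. ereal (f z) < c}"
 proof (cases c)
  case (real r)
  then show ?thesis using *[of r] by simp
 qed (use assms(1) in auto)
next
 fix a b assume disc: "\<forall>ze. cmod ze \<le> 1 --> a + ze *s b \<in> Om"
 have line: "continuous_on UNIV (\<lambda>th. a + cis th *s b)"
  unfolding vector_scalar_mult_def by (intro continuous_intros)
 have "continuous_on UNIV (\<lambda>th. f (a + cis th *s b))"
  by (rule continuous_on_compose2[OF smooth_onD(3)[OF assms(2)] line]) (use disc in auto)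
 from circle_mean_continuous[OF this]
 have cm: "circle_mean (\<lambda>th. ereal (f (a + cis th *s b))) = ereal (integral {0..2*pi} (\<lambda>th. f (a + cis th *s b)) / (2 * pi))" .
 have "2 * pi * f a \<le> integral {0..2*pi} (\<lambda>t. f (a + cis t *s b))"
  by (rule levi_nonneg_imp_submean[OF assms]) (use disc in auto)
 then have "f a \<le> integral {0..2*pi} (\<lambda>t. f (a + cis t *s b)) / (2 * pi)"
  using pi_gt_zero by (simp add: le_divide_eq mult.commute)
 then show "ereal (f a) \<le> circle_mean (\<lambda>th. ereal (f (a + cis th *s b)))"
  unfolding cm by simp
qed auto

section \<open>Change of variables for holomorphic maps\<close>

text \<open>\<open>has_measure_differentiable_image\<close> measures images of sets. Read as an
  equality between Lebesgue measure on the image and a push-forward of the Jacobian density, it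
  integrates arbitrary nonnegative Borel functions.\<close>

lemma nn_integral_change_of_variables_cart:
 fixes g h :: "real^'n::{finite,wellorder} => real^'n::_"
 assumes S: "open S" "open (g ` S)"
  and der: "!!x. x \<in> S ==> (g has_derivative g' x) (at x)"
  and cont: "!!v. continuous_on S (\<lambda>x. g' x v)"
  and inv: "!!x. x \<in> S ==> h (g x) = x" "continuous_on (g ` S) h"
  and f [measurable]: "f \<in> borel_measurable borel"
 shows "(\<integral>\<^sup>+y. f y * indicator (g ` S) y \<partial>lborel) =
  (\<integral>\<^sup>+x. f (g x) * (ennreal \<bar>det (matrix (g' x))\<bar> * indicator S x) \<partial>lborel)"
proof -
 let ?J = "\<lambda>x. \<bar>det (matrix (g' x))\<bar>"
 have inj: "inj_on g S" using inv(1) by (metis inj_onI)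
 have contJ: "continuous_on S ?J"
  unfolding matrix_def det_def by (auto intro!: continuous_intros cont)
 have [measurable]: "S \<in> sets borel" "g ` S \<in> sets borel" using S by auto
 have Jm: "(\<lambda>x. ennreal (?J x) * indicator S x) \<in> borel_measurable borel"
 proof -
  have "(\<lambda>x. indicator S x *\<^sub>R ?J x) \<in> borel_measurable borel"
   using borel_measurable_continuous_on_indicator[OF _ contJ] by simp
  then have "(\<lambda>x. ennreal (indicator S x *\<^sub>R ?J x)) \<in> borel_measurable borel" by measurable
  moreover have "(\<lambda>x. ennreal (indicator S x *\<^sub>R ?J x)) = (\<lambda>x. ennreal (?J x) * indicator S x)"
   by (auto simp: fun_eq_iff indicator_def)
  ultimately show ?thesis by metis
 qed
 \<comment> \<open>The value 0 outside \<open>S\<close> makes the map Borel on the whole space, as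
   the push-forward requires.\<close>
 define g0 where "g0 x = (if x \<in> S then g x else 0)" for x
 have contg: "continuous_on S g"
  using der has_derivative_continuous by (intro continuous_at_imp_continuous_on) blast
 have g0m [measurable]: "g0 \<in> borel_measurable borel"
 proof -
  have "(\<lambda>x. indicator S x *\<^sub>R g x) \<in> borel_measurable borel"
   using borel_measurable_continuous_on_indicator[OF _ contg] by simp
  moreover have "(\<lambda>x. indicator S x *\<^sub>R g x) = g0" by (auto simp: fun_eq_iff g0_def indicator_def)
  ultimately show ?thesis by simp
 qed
 have meas: "emeasure lborel (g ` A) = (\<integral>\<^sup>+x. ennreal (?J x) * indicator A x \<partial>lborel)"
  if A: "A \<in> sets borel" "A \<subseteq> S" for A
 proof -
  \<comment> \<open>Images of Borel sets are Borel here because they are preimages under the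
    continuous inverse \<open>h\<close>.\<close>
  have gA: "g ` A \<in> sets borel"
  proof -
   have "(\<lambda>x. indicator (g ` S) x *\<^sub>R h x) \<in> borel_measurable borel"
    using borel_measurable_continuous_on_indicator[OF _ inv(2)] by simp
   then have "(\<lambda>x. indicator (g ` S) x *\<^sub>R h x) -` A \<inter> space borel \<in> sets borel"
    by (rule measurable_sets[OF _ A(1)])
   then have "g ` S \<inter> (\<lambda>x. indicator (g ` S) x *\<^sub>R h x) -` A \<in> sets borel" by auto
   moreover have "g ` S \<inter> (\<lambda>x. indicator (g ` S) x *\<^sub>R h x) -` A = g ` A"
    using A inv(1) by (auto simp: subset_iff)
   ultimately show ?thesis by simp
  qed
  have AL: "A \<in> sets lebesgue" using A by auto
  have JA: "(\<lambda>x. indicator A x * ?J x) \<in> borel_measurable borel"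
   using borel_measurable_continuous_on_indicator[OF A(1) continuous_on_subset[OF contJ A(2)]] by simp
  have ni: "(\<integral>\<^sup>+x. ennreal (?J x) * indicator A x \<partial>lborel) = (\<integral>\<^sup>+x. ennreal (indicator A x * ?J x) \<partial>lborel)"
   by (intro nn_integral_cong) (auto simp: indicator_def)
  have hm: "g ` A \<in> lmeasurable \<and> measure lebesgue (g ` A) = m \<longleftrightarrow> (?J has_integral m) A" for m
   by (rule has_measure_differentiable_image[OF AL])
    (use A inj der in \<open>auto intro: has_derivative_at_withinI inj_on_subset\<close>)
  show ?thesis
  \<comment> \<open>\<open>has_integral\<close> speaks only of finite values; an infinite integral
    has to be matched with an infinite measure separately.\<close>
  proof (cases "(\<integral>\<^sup>+x. ennreal (indicator A x * ?J x) \<partial>lborel) < \<infinity>")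
   case True
   then have i: "integrable lborel (\<lambda>x. indicator A x * ?J x)"
    using JA by (intro integrableI_nonneg) auto
   have "((\<lambda>x. indicator A x * ?J x) has_integral (LINT x|lborel. indicator A x * ?J x)) UNIV"
    by (rule has_integral_integral_lborel[OF i])
   then have "((\<lambda>x. if x \<in> A then ?J x else 0) has_integral (LINT x|lborel. indicator A x * ?J x)) UNIV"
    by (rule has_integral_eq[rotated]) (auto simp: indicator_def)
   then have "(?J has_integral (LINT x|lborel. indicator A x * ?J x)) A"
    by (simp only: has_integral_restrict_UNIV)
   with hm have lm: "g ` A \<in> lmeasurable" "measure lebesgue (g ` A) = (LINT x|lborel. indicator A x * ?J x)" by auto
   have "emeasure lebesgue (g ` A) = ennreal (LINT x|lborel. indicator A x * ?J x)"
    unfolding lm(2)[symmetric] by (rule emeasure_eq_measure2[OF lm(1)])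
   also have "... = (\<integral>\<^sup>+x. ennreal (indicator A x * ?J x) \<partial>lborel)"
    by (rule nn_integral_eq_integral[symmetric, OF i]) auto
   finally show ?thesis unfolding ni using gA by simp
  next
   case False
   have "emeasure lborel (g ` A) = \<infinity>"
   proof (rule ccontr)
    assume "\<not> ?thesis"
    then have "g ` A \<in> lmeasurable" using gA by (auto simp: fmeasurable_def top.not_eq_extremum)
    with hm have hi: "(?J has_integral measure lebesgue (g ` A)) A" by blast
    then have "((\<lambda>x. if x \<in> A then ?J x else 0) has_integral measure lebesgue (g ` A)) UNIV"
     by (simp only: has_integral_restrict_UNIV)
    then have "((\<lambda>x. indicator A x * ?J x) has_integral measure lebesgue (g ` A)) UNIV"
     by (rule has_integral_eq[rotated]) (auto simp: indicator_def)
    from nn_integral_has_integral_lborel[OF JA _ this] False show False by simp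
   qed
   moreover have "(\<integral>\<^sup>+x. ennreal (indicator A x * ?J x) \<partial>lborel) = \<infinity>"
    using False by (metis infinity_ennreal_def top.not_eq_extremum)
   ultimately show ?thesis unfolding ni by simp
  qed
 qed
 have "density lborel (indicator (g ` S)) = distr (density lborel (\<lambda>x. ennreal (?J x) * indicator S x)) borel g0"
  (is "?M1 = ?M2")
 proof (rule measure_eqI)
  fix B assume "B \<in> sets ?M1"
  then have B [measurable]: "B \<in> sets borel" by simp
  let ?A = "g0 -` B \<inter> S"
  have A: "?A \<in> sets borel" using measurable_sets[OF g0m B] by auto
  have "emeasure ?M1 B = (\<integral>\<^sup>+x. indicator (g ` S) x * indicator B x \<partial>lborel)"
   by (rule emeasure_density) auto
  also have "... = (\<integral>\<^sup>+x. indicator (g ` S \<inter> B) x \<partial>lborel)" by (simp only: indicator_inter_arith)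
  also have "... = emeasure lborel (g ` S \<inter> B)" by (rule nn_integral_indicator) (use S in auto)
  also have "g ` S \<inter> B = g ` ?A" by (auto simp: g0_def)
  also have "emeasure lborel (g ` ?A) = (\<integral>\<^sup>+x. ennreal (?J x) * indicator ?A x \<partial>lborel)"
   by (rule meas[OF A]) auto
  also have "... = (\<integral>\<^sup>+x. ennreal (?J x) * indicator S x * indicator (g0 -` B) x \<partial>lborel)"
   by (intro nn_integral_cong) (auto simp: indicator_def)
  also have "... = emeasure ?M2 B"
   using Jm measurable_sets[OF g0m B] by (simp add: emeasure_distr emeasure_density)
  finally show "emeasure ?M1 B = emeasure ?M2 B" .
 qed simp
 then have "(\<integral>\<^sup>+y. f y \<partial>?M1) = (\<integral>\<^sup>+y. f y \<partial>?M2)" by simp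
 also have "(\<integral>\<^sup>+y. f y \<partial>?M1) = (\<integral>\<^sup>+y. f y * indicator (g ` S) y \<partial>lborel)"
  by (simp add: nn_integral_density mult.commute)
 also have "(\<integral>\<^sup>+y. f y \<partial>?M2) = (\<integral>\<^sup>+x. (ennreal (?J x) * indicator S x) * f (g0 x) \<partial>lborel)"
  using Jm by (simp add: nn_integral_distr nn_integral_density)
 also have "... = (\<integral>\<^sup>+x. f (g x) * (ennreal (?J x) * indicator S x) \<partial>lborel)"
  by (intro nn_integral_cong) (auto simp: indicator_def g0_def mult.commute)
 finally show ?thesis .
qed

text \<open>The library states the change of variables formula for \<open>real^'n\<close> with a well-ordered index
 type. This copy of an initial segment of the naturals provides one for every Euclidean space.\<close>

typedef (overloaded) 'e coord_index = "{..<DIM('e::euclidean_space)}"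
 by (rule exI[of _ 0]) simp

instantiation coord_index :: (euclidean_space) linorder
begin
definition "x \<le> y \<longleftrightarrow> Rep_coord_index x \<le> Rep_coord_index y"
definition "x < y \<longleftrightarrow> Rep_coord_index x < Rep_coord_index y"
instance
 by intro_classes (auto simp: less_eq_coord_index_def less_coord_index_def Rep_coord_index_inject)
end

instance coord_index :: (euclidean_space) finite
proof
 show "finite (UNIV :: 'a coord_index set)"
  unfolding type_definition.univ[OF type_definition_coord_index] by simp
qed

instance coord_index :: (euclidean_space) wellorder
proof
 fix P :: "'a coord_index => bool" and a
 assume step: "!!x. (!!y. y < x ==> P y) ==> P x"
 show "P a"
 proof (induction "Rep_coord_index a" arbitrary: a rule: less_induct)
  case less
  show ?case by (rule step, rule less) (simp add: less_coord_index_def)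
 qed
qed

definition coord_basis :: "'e::euclidean_space coord_index => 'e" where
 "coord_basis = (SOME b. bij_betw b UNIV Basis)"

lemma bij_coord_basis: "bij_betw coord_basis UNIV (Basis :: 'e::euclidean_space set)"
proof -
 have "card (UNIV :: 'e coord_index set) = DIM('e)"
  using type_definition.card[OF type_definition_coord_index] by simp
 then have "\<exists>b. bij_betw b (UNIV :: 'e coord_index set) (Basis :: 'e set)"
  by (intro finite_same_card_bij) auto
 then show ?thesis unfolding coord_basis_def by (rule someI_ex)
qed

definition from_coords :: "real^('e::euclidean_space coord_index) => 'e" where
 "from_coords x = (\<Sum>i\<in>UNIV. x $ i *\<^sub>R coord_basis i)"

definition to_coords :: "'e::euclidean_space => real^('e coord_index)" where
 "to_coords y = (\<chi> i. y \<bullet> coord_basis i)"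

lemma coord_basis_in [simp]: "coord_basis i \<in> Basis"
 using bij_coord_basis by (auto simp: bij_betw_def)

lemma coord_basis_inner: "coord_basis i \<bullet> coord_basis j = (if i = j then 1 else 0)"
proof -
 have "coord_basis i = coord_basis j \<longleftrightarrow> i = j"
  using bij_betw_imp_inj_on[OF bij_coord_basis] by (auto dest: injD)
 then show ?thesis by (simp add: inner_Basis)
qed

lemma to_from_coords [simp]: "to_coords (from_coords x) = x"
 unfolding to_coords_def from_coords_def
 by (simp add: vec_eq_iff inner_sum_left coord_basis_inner if_distrib cong: if_cong)

lemma from_to_coords [simp]: "from_coords (to_coords y) = y"
proof -
 have "from_coords (to_coords y) = (\<Sum>b\<in>Basis. (y \<bullet> b) *\<^sub>R b)"
  unfolding from_coords_def to_coords_def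
  using sum.reindex_bij_betw[OF bij_coord_basis, of "\<lambda>b. (y \<bullet> b) *\<^sub>R b"] by simp
 then show ?thesis by (simp add: euclidean_representation)
qed

lemma linear_from_coords: "linear from_coords"
 unfolding from_coords_def by (rule linearI) (auto simp: scaleR_left_distrib sum.distrib scaleR_sum_right)

lemma linear_to_coords: "linear to_coords"
 unfolding to_coords_def by (rule linearI) (auto simp: vec_eq_iff inner_left_distrib)

lemma continuous_from_coords [continuous_intros]: "continuous_on S f ==> continuous_on S (\<lambda>x. from_coords (f x))"
 using continuous_on_compose2[OF linear_continuous_on[OF linear_from_coords[unfolded linear_conv_bounded_linear]], of S f UNIV]
 by simp

lemma continuous_to_coords [continuous_intros]: "continuous_on S f ==> continuous_on S (\<lambda>x. to_coords (f x))"
 using continuous_on_compose2[OF linear_continuous_on[OF linear_to_coords[unfolded linear_conv_bounded_linear]], of S f UNIV]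
 by simp

lemma distr_from_coords: "distr lborel borel from_coords = (lborel :: 'e::euclidean_space measure)"
proof (rule lborel_eqI[symmetric])
 fix l u :: 'e assume lu: "!!b. b \<in> Basis ==> l \<bullet> b \<le> u \<bullet> b"
 have [measurable]: "from_coords \<in> borel_measurable borel"
  by (intro borel_measurable_continuous_onI continuous_intros)
 have inner: "from_coords x \<bullet> coord_basis i = x $ i" for x and i :: "'e coord_index"
  using arg_cong[OF to_from_coords[of x], of "\<lambda>v. v $ i"] by (simp add: to_coords_def)
 have "from_coords -` box l u = box (to_coords l) (to_coords u)"
 proof -
  have *: "(\<forall>b\<in>Basis. P b) \<longleftrightarrow> (\<forall>i. P (coord_basis i))" for P :: "'e => bool"
   unfolding bij_betw_imp_surj_on[OF bij_coord_basis, symmetric] by auto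
  have "x \<in> from_coords -` box l u \<longleftrightarrow> (\<forall>i. l \<bullet> coord_basis i < x $ i \<and> x $ i < u \<bullet> coord_basis i)" for x
   unfolding vimage_eq mem_box(1) * inner ..
  moreover have "x \<in> box (to_coords l) (to_coords u) \<longleftrightarrow> (\<forall>i. l \<bullet> coord_basis i < x $ i \<and> x $ i < u \<bullet> coord_basis i)" for x
   unfolding mem_box_cart by (simp add: to_coords_def)
  ultimately show ?thesis by blast
 qed
 then have "emeasure (distr lborel borel from_coords) (box l u) = emeasure lborel (box (to_coords l) (to_coords u))"
  by (simp add: emeasure_distr)
 also have "... = ennreal (\<Prod>b\<in>Basis. (to_coords u - to_coords l) \<bullet> b)"
  by (rule emeasure_lborel_box) (auto simp: Basis_vec_def inner_axis to_coords_def lu)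
 also have "(\<Prod>b\<in>Basis. (to_coords u - to_coords l) \<bullet> b) = (\<Prod>i\<in>UNIV. (u - l) \<bullet> coord_basis i)"
 proof -
  have "(\<Prod>b\<in>Basis. (to_coords u - to_coords l) \<bullet> b) = (\<Prod>i\<in>UNIV. (to_coords u - to_coords l) \<bullet> axis i 1)"
   by (rule prod.reindex_cong[where l = "\<lambda>i. axis i 1"])
    (auto simp: Basis_vec_def inj_on_def axis_eq_axis)
  then show ?thesis by (simp add: inner_axis to_coords_def inner_diff_left)
 qed
 also have "... = (\<Prod>b\<in>Basis. (u - l) \<bullet> b)"
  using prod.reindex_bij_betw[OF bij_coord_basis, of "\<lambda>b. (u - l) \<bullet> b"] by simp
 finally show "emeasure (distr lborel borel from_coords) (box l u) = ennreal (\<Prod>b\<in>Basis. (u - l) \<bullet> b)" .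
qed simp

text \<open>The absolute Jacobian determinant on any Euclidean space. On complex linear maps it will
  be computed through its multiplicativity rather than by expanding a real determinant of twice the
  size.\<close>

definition jac :: "('e::euclidean_space => 'e) => real" where
 "jac T = \<bar>det (matrix (to_coords \<circ> T \<circ> from_coords))\<bar>"

lemma nn_integral_change_of_variables:
 fixes g h :: "'e::euclidean_space => 'e"
 assumes S: "open S" "open (g ` S)"
  and der: "!!x. x \<in> S ==> (g has_derivative g' x) (at x)"
  and cont: "!!v. continuous_on S (\<lambda>x. g' x v)"
  and inv: "!!x. x \<in> S ==> h (g x) = x" "continuous_on (g ` S) h"
  and f [measurable]: "f \<in> borel_measurable borel"
 shows "(\<integral>\<^sup>+y. f y * indicator (g ` S) y \<partial>lborel) =
  (\<integral>\<^sup>+x. f (g x) * (ennreal (jac (g' x)) * indicator S x) \<partial>lborel)"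
proof -
 have [measurable]: "from_coords \<in> borel_measurable borel" "to_coords \<in> borel_measurable borel"
  by (intro borel_measurable_continuous_onI continuous_intros)+
 have tr: "(\<integral>\<^sup>+y. F y \<partial>lborel) = (\<integral>\<^sup>+x. F (from_coords x) \<partial>lborel)" if "F \<in> borel_measurable borel" for F :: "'e => ennreal"
  using nn_integral_distr[of from_coords lborel borel F] that by (simp add: distr_from_coords)
 let ?S = "to_coords ` S" and ?g = "to_coords \<circ> g \<circ> from_coords"
 have img: "to_coords ` A = from_coords -` A" for A :: "'e set"
  by (auto simp: image_iff) (metis from_to_coords to_from_coords)
 have gS: "?g ` ?S = to_coords ` g ` S" by (auto simp: image_iff)
 have op: "open (to_coords ` A)" if "open A" for A :: "'e set"
  unfolding img using that by (intro open_vimage continuous_intros)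
 have cg: "continuous_on S g"
  using der has_derivative_continuous by (intro continuous_at_imp_continuous_on) blast
 have [measurable]: "S \<in> sets borel" "g ` S \<in> sets borel" using S by auto
 have "(\<integral>\<^sup>+y. f (from_coords y) * indicator (?g ` ?S) y \<partial>lborel) =
  (\<integral>\<^sup>+x. f (from_coords (?g x)) * (ennreal \<bar>det (matrix (to_coords \<circ> g' (from_coords x) \<circ> from_coords))\<bar> * indicator ?S x) \<partial>lborel)"
 proof (rule nn_integral_change_of_variables_cart[where h = "to_coords \<circ> h \<circ> from_coords"])
  show "open ?S" "open (?g ` ?S)" unfolding gS using S op by auto
  fix x assume "x \<in> ?S"
  then have x: "from_coords x \<in> S" by (auto simp: img)
  show "(?g has_derivative to_coords \<circ> g' (from_coords x) \<circ> from_coords) (at x)"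
   unfolding o_def
   by (intro has_derivative_compose[OF _ linear_imp_has_derivative[OF linear_to_coords]]
     has_derivative_compose[OF linear_imp_has_derivative[OF linear_from_coords] der[OF x]])
  show "(to_coords \<circ> h \<circ> from_coords) (?g x) = x" using inv(1)[OF x] by simp
 next
  show "continuous_on ?S (\<lambda>x. (to_coords \<circ> g' (from_coords x) \<circ> from_coords) v)" for v
   unfolding o_def by (intro continuous_intros continuous_on_compose2[OF cont]) auto
  show "continuous_on (?g ` ?S) (to_coords \<circ> h \<circ> from_coords)"
   unfolding o_def gS by (intro continuous_intros continuous_on_compose2[OF inv(2)]) auto
 qed simp
 moreover have "indicator (?g ` ?S) y = (indicator (g ` S) (from_coords y) :: ennreal)" for y
  unfolding gS by (auto simp: indicator_def img)
 moreover have "indicator ?S y = (indicator S (from_coords y) :: ennreal)" for y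
  by (auto simp: indicator_def img)
 moreover have "(\<integral>\<^sup>+y. f y * indicator (g ` S) y \<partial>lborel) = (\<integral>\<^sup>+y. f (from_coords y) * indicator (g ` S) (from_coords y) \<partial>lborel)"
  by (rule tr) measurable
 moreover have "(\<integral>\<^sup>+x. f (g x) * (ennreal (jac (g' x)) * indicator S x) \<partial>lborel)
  = (\<integral>\<^sup>+x. f (g (from_coords x)) * (ennreal (jac (g' (from_coords x))) * indicator S (from_coords x)) \<partial>lborel)"
 proof (rule tr)
  have "(\<lambda>x. if x \<in> S then g x else 0) \<in> borel_measurable borel"
  proof -
   have "(\<lambda>x. indicator S x *\<^sub>R g x) \<in> borel_measurable borel"
    using borel_measurable_continuous_on_indicator[OF _ cg] by simp
   moreover have "(\<lambda>x. indicator S x *\<^sub>R g x) = (\<lambda>x. if x \<in> S then g x else 0)" by (auto simp: fun_eq_iff indicator_def)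
   ultimately show ?thesis by simp
  qed
  then have "(\<lambda>x. f (if x \<in> S then g x else 0)) \<in> borel_measurable borel" by measurable
  moreover have "continuous_on S (\<lambda>x. jac (g' x))"
   unfolding jac_def matrix_def det_def o_def by (auto intro!: continuous_intros cont)
  from borel_measurable_continuous_on_indicator[OF _ this]
  have "(\<lambda>x. indicator S x *\<^sub>R jac (g' x)) \<in> borel_measurable borel" by simp
  then have "(\<lambda>x. ennreal (indicator S x *\<^sub>R jac (g' x))) \<in> borel_measurable borel" by measurable
  ultimately have "(\<lambda>x. f (if x \<in> S then g x else 0) * ennreal (indicator S x *\<^sub>R jac (g' x))) \<in> borel_measurable borel"
   by measurable
  moreover have "(\<lambda>x. f (if x \<in> S then g x else 0) * ennreal (indicator S x *\<^sub>R jac (g' x)))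
   = (\<lambda>x. f (g x) * (ennreal (jac (g' x)) * indicator S x))"
   by (auto simp: fun_eq_iff indicator_def)
  ultimately show "(\<lambda>x. f (g x) * (ennreal (jac (g' x)) * indicator S x)) \<in> borel_measurable borel" by simp
 qed
 ultimately show ?thesis by (simp add: jac_def o_def)
qed

lemma jac_compose:
 fixes S T :: "'e::euclidean_space => 'e"
 assumes "linear S" "linear T"
 shows "jac (S \<circ> T) = jac S * jac T"
proof -
 have l: "linear (to_coords \<circ> U \<circ> from_coords)" if "linear U" for U :: "'e => 'e"
  by (intro linear_compose linear_from_coords linear_to_coords that)
 have "to_coords \<circ> (S \<circ> T) \<circ> from_coords = (to_coords \<circ> S \<circ> from_coords) \<circ> (to_coords \<circ> T \<circ> from_coords)"
  by (simp add: fun_eq_iff)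
 then show ?thesis
  unfolding jac_def using l[OF assms(1)] l[OF assms(2)]
  by (simp add: matrix_compose det_mul abs_mult)
qed

lemma jac_id: "jac id = 1"
proof -
 have "to_coords \<circ> id \<circ> from_coords = (id :: real^('a coord_index) => _)" by (simp add: fun_eq_iff)
 then show ?thesis unfolding jac_def by (simp add: matrix_id_mat_1)
qed

section \<open>The real Jacobian of a complex linear map\<close>

lemma linear_complex_matrix: "linear ((*v) (A :: complex^'n^'m))"
 by (rule linearI) (simp_all add: vec_eq_iff matrix_vector_mult_def sum.distrib scaleR_sum_right algebra_simps)

definition coord_scale :: "'n::finite => complex => complex^'n^'n" where
 "coord_scale j c = (\<chi> r s. if r = s then if r = j then c else 1 else 0)"

definition shear :: "'n::finite => ('n => complex) => complex^'n^'n" where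
 "shear j n = (\<chi> r s. if r = s then 1 else if s = j then n r else 0)"

lemma coord_scale_vec: "(coord_scale j c *v x) = (\<chi> r. if r = j then c * x $ r else x $ r)"
 unfolding coord_scale_def matrix_vector_mult_def
 by (simp add: vec_eq_iff if_distribR if_distrib[of "\<lambda>y. y * _"] cong: if_cong)

lemma det_coord_scale: "det (coord_scale j c) = c"
proof -
 have "det (coord_scale j c) = (\<Prod>i\<in>UNIV. coord_scale j c $ i $ i)"
  by (rule det_diagonal) (simp add: coord_scale_def)
 also have "... = c" by (simp add: coord_scale_def)
 finally show ?thesis .
qed

lemma shear_mult:
 "(shear j m ** A) $ r $ s = A $ r $ s + (if r = j then 0 else m r * A $ j $ s)"
proof -
 have "(shear j m ** A) $ r $ s = (\<Sum>t\<in>UNIV. (if t = r then A $ r $ s else 0) + (if t = j then if r = j then 0 else m r * A $ j $ s else 0))"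
  unfolding matrix_matrix_mult_def vec_lambda_beta shear_def by (intro sum.cong refl) auto
 then show ?thesis by (simp add: sum.distrib)
qed

text \<open>Both the real Jacobian and the squared modulus of the complex determinant have these
  properties, and comparing them on generators of the linear group is enough.\<close>

locale multiplicative_matrix_fun =
 fixes f :: "complex^'n::finite^'n => real"
 assumes mult: "f (A ** B) = f A * f B"
  and nonneg: "f A \<ge> 0"
  and one: "f (mat 1) = 1"
begin

lemma involution_eq_1: "A ** A = mat 1 ==> f A = 1"
proof -
 assume "A ** A = mat 1"
 then have "(f A)\<^sup>2 = 1" using mult[of A A] one by (simp add: power2_eq_square)
 then show ?thesis using nonneg[of A] by (auto simp: power2_eq_1_iff)
qed

text \<open>A shear is conjugate to its own square.\<close>

lemma shear_eq_1: "f (shear j n) = 1"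
proof -
 let ?E = "shear j n"
 let ?D = "\<lambda>c. (\<chi> r s. if r = s then if r = j then 1 else c else 0) :: complex^'n^'n"
 have DM: "(?D c ** A) $ r $ s = (if r = j then 1 else c) * A $ r $ s" for c r s and A :: "complex^'n^'n"
  unfolding matrix_matrix_mult_def by (simp add: if_distrib[of "\<lambda>y. y * _"] cong: if_cong)
 have MD: "(A ** ?D c) $ r $ s = A $ r $ s * (if s = j then 1 else c)" for c r s and A :: "complex^'n^'n"
  unfolding matrix_matrix_mult_def by (simp add: if_distrib[of "\<lambda>y. _ * y"] cong: if_cong)
 have "?D 2 ** ?D (1/2) = mat 1"
  unfolding vec_eq_iff DM by (auto simp: mat_def)
 then have D: "f (?D 2) * f (?D (1/2)) = 1" using mult[of "?D 2" "?D (1/2)"] one by simp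
 have "?E ** shear j (\<lambda>r. - n r) = mat 1"
  unfolding vec_eq_iff shear_mult by (auto simp: mat_def shear_def)
 then have E: "f ?E * f (shear j (\<lambda>r. - n r)) = 1" using mult[of ?E] one by metis
 have "?E ** ?E = (?D 2 ** ?E) ** ?D (1/2)"
  unfolding vec_eq_iff shear_mult MD DM by (auto simp: shear_def)
 from arg_cong[OF this, of f] have "f ?E * f ?E = f (?D 2) * f ?E * f (?D (1/2))"
  unfolding mult .
 also have "... = f (?D 2) * f (?D (1/2)) * f ?E" by (simp only: mult_ac)
 also have "... = f ?E" unfolding D by simp
 finally have "f ?E * f ?E = f ?E" .
 moreover have "f ?E \<noteq> 0" using E by (metis mult_zero_left zero_neq_one)
 ultimately show ?thesis by simp
qed

text \<open>Gauss-Jordan elimination. The induction is over the set \<open>K\<close> of columns that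
  may still differ from unit vectors. Permutations used are involutions and shears have value 1, so
  only the pivots contribute.\<close>

lemma eq_cmod_det:
 assumes scale: "!!j c. c \<noteq> 0 ==> f (coord_scale j c) = (cmod c)\<^sup>2"
  and "invertible A"
 shows "f A = (cmod (det A))\<^sup>2"
proof -
 interpret g: multiplicative_matrix_fun "\<lambda>A :: complex^'n^'n. (cmod (det A))\<^sup>2"
  by standard (simp_all add: det_mul norm_mult power_mult_distrib)
 define P where "P A \<longleftrightarrow> f A = (cmod (det A))\<^sup>2" for A
 have Pmult: "P A ==> P B ==> P (A ** B)" for A B
  unfolding P_def mult g.mult by simp
 have Pshear: "P (shear j n)" for j n unfolding P_def shear_eq_1 g.shear_eq_1 ..
 have Pscale: "c \<noteq> 0 ==> P (coord_scale j c)" for j c unfolding P_def by (simp add: scale det_coord_scale)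
 have Pinv: "A ** A = mat 1 ==> P A" for A
  unfolding P_def by (simp add: involution_eq_1 g.involution_eq_1)
 have "\<forall>A. invertible A --> (\<forall>l r. l \<notin> K --> A $ r $ l = (if r = l then 1 else 0)) --> P A" for K :: "'n set"
  using finite[of K]
 proof (induction K rule: finite_induct)
  case empty
  have "A = mat 1" if "\<forall>l r. A $ r $ l = (if r = l then 1 else 0)" for A :: "complex^'n^'n"
   using that by (simp add: vec_eq_iff mat_def)
  then show ?case using Pinv[of "mat 1"] by auto
 next
  case (insert j K)
  have main: "P A" if inv: "invertible A" and col: "!!l r. l \<notin> insert j K ==> A $ r $ l = (if r = l then 1 else 0)"
   and nz: "A $ j $ j \<noteq> 0" for A
  proof -
   define a where "a = A $ j $ j"
   define A' where "A' = (\<chi> r s. if r = j then A $ j $ s / a else A $ r $ s - A $ r $ j * A $ j $ s / a)"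
   have A: "A = shear j (\<lambda>r. A $ r $ j / a) ** (coord_scale j a ** A')"
   proof -
    have CM: "(coord_scale j a ** A') $ r $ s = (if r = j then a else 1) * A' $ r $ s" for r s
     unfolding matrix_matrix_mult_def coord_scale_def by (simp add: if_distrib[of "\<lambda>y. y * _"] cong: if_cong)
    show ?thesis unfolding vec_eq_iff shear_mult CM using nz by (auto simp: A'_def a_def)
   qed
   have "invertible A'"
   proof -
    have "det A \<noteq> 0" using inv by (simp add: invertible_det_nz)
    then have "det A' \<noteq> 0" by (subst (asm) A) (simp add: det_mul)
    then show ?thesis by (simp add: invertible_det_nz)
   qed
   moreover have "A' $ r $ l = (if r = l then 1 else 0)" if "l \<notin> K" for l r
    using col[of l] nz that by (cases "l = j") (auto simp: A'_def a_def)
   ultimately have "P A'" using insert.IH by blast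
   then show ?thesis
    by (subst A) (intro Pmult Pshear Pscale, use nz in \<open>auto simp: a_def\<close>)
  qed
  show ?case
  proof (intro allI impI)
   fix A :: "complex^'n^'n"
   assume inv: "invertible A" and "\<forall>l r. l \<notin> insert j K --> A $ r $ l = (if r = l then 1 else 0)"
   then have col: "!!l r. l \<notin> insert j K ==> A $ r $ l = (if r = l then 1 else 0)" by blast
   have "\<exists>i\<in>insert j K. A $ i $ j \<noteq> 0"
   proof (rule ccontr)
    assume "\<not> ?thesis"
    then have z: "!!i. i \<in> insert j K ==> A $ i $ j = 0" by blast
    \<comment> \<open>If all candidate pivots vanished, column \<open>j\<close> would be a
      combination of the unit columns outside \<open>insert j K\<close>; \<open>x\<close> records
      this relation and lies in the kernel.\<close>
    define x :: "complex^'n" where "x = (\<chi> l. if l = j then 1 else if l \<in> K then 0 else - A $ l $ j)"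
    have "A *v x = 0"
    proof -
     have "(A *v x) $ r = 0" for r
     proof -
      have "(A *v x) $ r = (\<Sum>l\<in>UNIV. (if l = j then A $ r $ j else 0) + (if l = r then if r \<in> insert j K then 0 else - A $ r $ j else 0))"
       unfolding matrix_vector_mult_def x_def vec_lambda_beta
       by (intro sum.cong refl) (use col in auto)
      also have "... = 0" using z[of r] by (auto simp: sum.distrib)
      finally show ?thesis .
     qed
     then show ?thesis by (simp add: vec_eq_iff)
    qed
    moreover have "x \<noteq> 0" by (auto simp: x_def vec_eq_iff)
    ultimately show False using inv
     by (metis invertible_def matrix_left_invertible_ker)
   qed
   then obtain i where i: "i \<in> insert j K" "A $ i $ j \<noteq> 0" by blast
   define S :: "complex^'n^'n" where "S = (\<chi> r s. if s = Transposition.transpose i j r then 1 else 0)"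
   have SM: "(S ** B) $ r $ s = B $ (Transposition.transpose i j r) $ s" for r s B
    unfolding matrix_matrix_mult_def S_def by (simp add: if_distrib[of "\<lambda>y. y * _"] cong: if_cong)
   have SS: "S ** S = mat 1"
    unfolding vec_eq_iff SM by (simp add: S_def mat_def)
   have "P (S ** A)"
   proof (rule main)
    show "invertible (S ** A)" using SS inv invertible_mult invertible_def by metis
    show "(S ** A) $ j $ j \<noteq> 0" using i by (simp add: SM)
    show "(S ** A) $ r $ l = (if r = l then 1 else 0)" if "l \<notin> insert j K" for l r
     using col[OF that] that i(1) by (auto simp: SM Transposition.transpose_def)
   qed
   then have "P (S ** (S ** A))" by (rule Pmult[OF Pinv[OF SS]])
   then show "P A" by (simp add: matrix_mul_assoc SS)
  qed
 qed
 from this[of UNIV] assms(2) show ?thesis unfolding P_def by blast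
qed

end

text \<open>Split \<open>c\<close> into modulus and phase. A real scaling is diagonal in the
  standard basis and affects the two basis vectors of coordinate \<open>j\<close>. For a phase,
  complex conjugation of that coordinate exchanges it with its inverse, so the value squares to
  1.\<close>

lemma jac_coord_scale:
 fixes j :: "'n::finite"
 assumes "c \<noteq> 0"
 shows "jac ((*v) (coord_scale j c)) = (cmod c)\<^sup>2"
proof -
 define T where "T c x = ((\<chi> r. if r = j then c * x $ r else x $ r) :: complex^'n)" for c and x :: "complex^'n"
 have T: "(*v) (coord_scale j c) = T c" for c by (simp add: fun_eq_iff coord_scale_vec T_def)
 have linT: "linear (T c)" for c unfolding T[symmetric] by (rule linear_complex_matrix)
 define C where "C x = ((\<chi> r. if r = j then cnj (x $ r) else x $ r) :: complex^'n)" for x :: "complex^'n"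
 have linC: "linear C" by (rule linearI) (auto simp: C_def vec_eq_iff)
 have comp: "T a \<circ> T b = T (a * b)" for a b by (auto simp: T_def fun_eq_iff vec_eq_iff)
 have T1: "T 1 = id" by (auto simp: T_def fun_eq_iff vec_eq_iff)
 have unit: "jac (T u) = 1" if "cmod u = 1" for u
 proof -
  have "C \<circ> C = id" by (auto simp: C_def fun_eq_iff vec_eq_iff)
  then have CC: "jac C * jac C = 1" using jac_compose[OF linC linC] jac_id by metis
  have "C \<circ> (T u \<circ> C) = T (cnj u)" by (auto simp: C_def T_def fun_eq_iff vec_eq_iff)
  then have "jac (T (cnj u)) = jac C * (jac (T u) * jac C)"
   using jac_compose[OF linC linear_compose[OF linC linT]] jac_compose[OF linT linC] by metis
  then have "jac (T (cnj u)) = jac (T u)" using CC by (metis mult.commute mult.right_neutral mult.assoc)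
  moreover have "jac (T u) * jac (T (cnj u)) = 1"
  proof -
   have "u * cnj u = 1" using complex_norm_square[of u] that by simp
   then show ?thesis using jac_compose[OF linT linT, of u "cnj u"] by (simp add: comp T1 jac_id)
  qed
  moreover have "jac (T u) \<ge> 0" by (simp add: jac_def)
  ultimately have "(jac (T u))\<^sup>2 = 1" "jac (T u) \<ge> 0" by (simp_all add: power2_eq_square)
  then show ?thesis by (auto simp: power2_eq_1_iff)
 qed
 have real: "jac (T (of_real r)) = r\<^sup>2" if "r > 0" for r
 proof -
  let ?B = "{axis j 1, axis j \<i>} :: (complex^'n) set"
  have M: "matrix (to_coords \<circ> T (of_real r) \<circ> from_coords) $ i $ i' =
   (if i = i' then if coord_basis i \<in> ?B then r else 1 else 0)" for i i'
  proof -
   have fb: "from_coords (axis i' 1) = (coord_basis i' :: complex^'n)"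
    unfolding from_coords_def by (simp add: axis_def if_distrib if_distribR cong: if_cong)
   have "T (of_real r) b = (if b \<in> ?B then r else 1) *\<^sub>R b" if bB: "b \<in> Basis" for b
   proof -
    obtain k x where b: "b = axis k x" "x \<in> Basis" using bB unfolding Basis_vec_def by blast
    have "b \<in> ?B \<longleftrightarrow> k = j" using b by (auto simp: axis_eq_axis Basis_complex_def)
    moreover have "T (of_real r) (axis k x) = (if k = j then r else 1) *\<^sub>R axis k x"
     by (auto simp: T_def vec_eq_iff axis_def scaleR_conv_of_real[where 'a = complex])
    ultimately show ?thesis using b(1) by simp
   qed
   then have "T (of_real r) (coord_basis i') = (if coord_basis i' \<in> ?B then r else 1) *\<^sub>R coord_basis i'" by simp
   then show ?thesis
    unfolding matrix_def o_def by (simp add: fb to_coords_def coord_basis_inner)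
  qed
  have "det (matrix (to_coords \<circ> T (of_real r) \<circ> from_coords)) =
    (\<Prod>i\<in>UNIV. matrix (to_coords \<circ> T (of_real r) \<circ> from_coords) $ i $ i)"
   by (rule det_diagonal) (simp add: M)
  also have "... = (\<Prod>i\<in>UNIV. if coord_basis i \<in> ?B then r else 1)" by (simp add: M)
  also have "... = (\<Prod>b\<in>Basis. if b \<in> ?B then r else 1)"
   by (rule prod.reindex_bij_betw[OF bij_coord_basis])
  also have "... = (\<Prod>b\<in>Basis \<inter> ?B. r)"
   by (simp only: prod.inter_restrict[OF finite_Basis])
  also have "Basis \<inter> ?B = ?B" by (auto simp: Basis_vec_def Basis_complex_def)
  also have "(\<Prod>b\<in>?B. r) = r\<^sup>2" by (simp add: axis_eq_axis power2_eq_square)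
  finally show ?thesis unfolding jac_def by (simp only: abs_power2)
 qed
 have "c = of_real (cmod c) * (c / of_real (cmod c))" using assms by simp
 then have "T c = T (of_real (cmod c)) \<circ> T (c / of_real (cmod c))" unfolding comp by simp
 then have "jac (T c) = jac (T (of_real (cmod c))) * jac (T (c / of_real (cmod c)))"
  using jac_compose[OF linT linT] by metis
 also have "... = (cmod c)\<^sup>2" using assms by (simp add: real unit norm_divide)
 finally show ?thesis unfolding T .
qed

lemma jac_complex_matrix:
 fixes A :: "complex^'n::finite^'n"
 assumes "invertible A"
 shows "jac ((*v) A) = (cmod (det A))\<^sup>2"
proof -
 interpret multiplicative_matrix_fun "\<lambda>A :: complex^'n^'n. jac ((*v) A)"
 proof
  fix A B :: "complex^'n^'n"
  have "(*v) (A ** B) = (*v) A \<circ> (*v) B" by (simp add: fun_eq_iff matrix_vector_mul_assoc)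
  then show "jac ((*v) (A ** B)) = jac ((*v) A) * jac ((*v) B)"
   using jac_compose[OF linear_complex_matrix linear_complex_matrix] by metis
  have "(*v) (mat 1 :: complex^'n^'n) = id" by (simp add: fun_eq_iff)
  then show "jac ((*v) (mat 1 :: complex^'n^'n)) = 1" by (simp add: jac_id)
 qed (simp add: jac_def)
 show ?thesis by (rule eq_cmod_det[OF jac_coord_scale assms])
qed

lemma complex_linear_matrix:
 fixes T :: "complex^'n::finite => complex^'m::finite"
 assumes "linear T" "!!c v. T (c *s v) = c *s T v"
 shows "matrix T *v v = T v"
proof -
 have "Vector_Spaces.linear (*s) (*s) T"
  by (intro Vector_Spaces.linear_iff[THEN iffD2] conjI vec.vector_space_axioms)
   (use assms in \<open>auto simp: linear_add\<close>)
 then show ?thesis by (rule matrix_works)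
qed

lemma jac_complex_linear:
 fixes T :: "complex^'n::finite => complex^'n"
 assumes "linear T" "!!c v. T (c *s v) = c *s T v" "det (matrix T) \<noteq> 0"
 shows "jac T = (cmod (det (matrix T)))\<^sup>2"
proof -
 have "T = (*v) (matrix T)" by (simp add: fun_eq_iff complex_linear_matrix[OF assms(1,2)])
 then show ?thesis using jac_complex_matrix[of "matrix T"] assms(3) by (simp add: invertible_det_nz)
qed

section \<open>Lebesgue measure on coordinate slices\<close>

lemma PiM_lborel_product: "product_sigma_finite (\<lambda>_. lborel :: 'e::euclidean_space measure)"
 by standard

lemma borel_measurable_vec_lambda:
 fixes f :: "'n::finite => 'x => complex"
 assumes "!!k. f k \<in> borel_measurable M"
 shows "(\<lambda>x. \<chi> k. f k x) \<in> borel_measurable M"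
 by (subst borel_measurable_euclidean_space)
  (auto simp: Basis_vec_def inner_axis intro!: borel_measurable_inner assms)

lemma lborel_eq_distr_PiM:
 fixes io :: "'m::finite => 'k::finite"
 assumes "inj io"
 shows "distr (Pi\<^sub>M (range io) (\<lambda>_. lborel)) borel (\<lambda>t. \<chi> j. t (io j)) = (lborel :: (complex^'m) measure)"
proof (rule lborel_eqI[symmetric])
 interpret product_sigma_finite "\<lambda>_. lborel :: complex measure" by (rule PiM_lborel_product)
 let ?M = "Pi\<^sub>M (range io) (\<lambda>_. lborel :: complex measure)" and ?f = "\<lambda>t. (\<chi> j. t (io j)) :: complex^'m"
 have m: "?f \<in> borel_measurable ?M"
  by (rule borel_measurable_vec_lambda) (use measurable_component_singleton[of _ "range io" "\<lambda>_. lborel :: complex measure"] in auto)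
 fix l u :: "complex^'m" assume lu: "!!b. b \<in> Basis ==> l \<bullet> b \<le> u \<bullet> b"
 have lu': "b \<in> Basis ==> l $ j \<bullet> b \<le> u $ j \<bullet> b" for j b
  using lu[of "axis j b"] by (simp add: inner_axis)
 have BB: "(\<forall>b\<in>Basis. Q b) \<longleftrightarrow> (\<forall>j. \<forall>b\<in>Basis. Q (axis j b))" for Q :: "complex^'m => bool"
  unfolding Basis_vec_def by blast
 have box: "x \<in> box l u \<longleftrightarrow> (\<forall>j. x $ j \<in> box (l $ j) (u $ j))" for x
  unfolding mem_box(1) BB inner_axis ..
 have "?f -` box l u \<inter> space ?M = (\<Pi>\<^sub>E k\<in>range io. box (l $ inv io k) (u $ inv io k))"
  by (auto simp: box space_PiM PiE_iff inv_f_f[OF assms])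
 then have "emeasure (distr ?M borel ?f) (box l u) = emeasure ?M (\<Pi>\<^sub>E k\<in>range io. box (l $ inv io k) (u $ inv io k))"
  using m by (simp add: emeasure_distr)
 also have "... = (\<Prod>k\<in>range io. emeasure lborel (box (l $ inv io k) (u $ inv io k)))"
  by (rule emeasure_PiM) auto
 also have "... = (\<Prod>j\<in>UNIV. emeasure lborel (box (l $ j) (u $ j)))"
  by (subst prod.reindex[OF assms]) (simp add: inv_f_f[OF assms])
 also have "... = (\<Prod>j\<in>UNIV. ennreal (\<Prod>b\<in>Basis. (u $ j - l $ j) \<bullet> b))"
  by (intro prod.cong refl emeasure_lborel_box lu')
 also have "... = ennreal (\<Prod>j\<in>UNIV. \<Prod>b\<in>Basis. (u $ j - l $ j) \<bullet> b)"
  by (rule prod_ennreal) (auto intro!: prod_nonneg simp: inner_diff_left lu')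
 also have "(\<Prod>j\<in>UNIV. \<Prod>b\<in>Basis. (u $ j - l $ j) \<bullet> b) = (\<Prod>b\<in>Basis. (u - l) \<bullet> b)"
 proof -
  have "(\<Prod>b\<in>Basis. (u - l) \<bullet> b) = (\<Prod>(j, b)\<in>UNIV \<times> Basis. (u - l) \<bullet> axis j b)"
   by (rule prod.reindex_cong[where l = "\<lambda>(j, b). axis j b"])
    (auto simp: Basis_vec_def inj_on_def axis_eq_axis)
  also have "... = (\<Prod>j\<in>UNIV. \<Prod>b\<in>Basis. (u - l) \<bullet> axis j b)"
   by (rule prod.cartesian_product[symmetric])
  finally show ?thesis by (simp add: inner_axis)
 qed
 finally show "emeasure (distr ?M borel ?f) (box l u) = ennreal (\<Prod>b\<in>Basis. (u - l) \<bullet> b)" .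
qed simp

abbreviation slice_lborel :: "('m => 'k) => ('k => complex) measure" where
 "slice_lborel io \<equiv> Pi\<^sub>M (- range io) (\<lambda>_. lborel)"

lemma slice_point_measurable [measurable]:
 "slice_point io t \<in> borel_measurable (slice_lborel io)"
 unfolding slice_point_def[abs_def]
proof (rule borel_measurable_vec_lambda)
 fix k
 show "(\<lambda>z. if k \<in> range io then t $ inv io k else z k) \<in> borel_measurable (slice_lborel io)"
  using measurable_component_singleton[of k "- range io" "\<lambda>_. lborel :: complex measure"]
  by (cases "k \<in> range io") auto
qed

text \<open>Tonelli for the splitting into base and fibre coordinates; the latter stay functions on
  the complement of \<open>range io\<close>, as in the definition of
  \<open>fibre_volume\<close>.\<close>

lemma nn_integral_slices:
 fixes io :: "'m::finite => 'k::finite" and f :: "complex^'k => ennreal"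
 assumes "inj io" and f [measurable]: "f \<in> borel_measurable borel"
 shows "(\<integral>\<^sup>+w. f w \<partial>lborel) =
  (\<integral>\<^sup>+t. (\<integral>\<^sup>+z. f (slice_point io t z) \<partial>slice_lborel io) \<partial>lborel)"
proof -
 interpret P: product_sigma_finite "\<lambda>_. lborel :: complex measure" by (rule PiM_lborel_product)
 let ?M = "\<lambda>I. Pi\<^sub>M I (\<lambda>_. lborel :: complex measure)"
 have vec: "(\<lambda>t. (\<chi> j. t (ka j)) :: complex^'n) \<in> borel_measurable (?M I)" if "range ka \<subseteq> I" for ka :: "'n::finite => 'k" and I
 proof (rule borel_measurable_vec_lambda)
  fix j
  have "ka j \<in> I" using that by auto
  from measurable_component_singleton[OF this, of "\<lambda>_. lborel :: complex measure"]
  show "(\<lambda>t. t (ka j)) \<in> borel_measurable (?M I)" by simp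
 qed
 have g [measurable]: "(\<lambda>x. f (\<chi> k. x k)) \<in> borel_measurable (?M UNIV)"
  using vec[of "\<lambda>k. k" UNIV] by measurable
 have "(\<integral>\<^sup>+w. f w \<partial>lborel) = (\<integral>\<^sup>+x. f (\<chi> k. x k) \<partial>?M UNIV)"
 proof -
  have d: "distr (?M UNIV) borel (\<lambda>x. \<chi> k. x k) = (lborel :: (complex^'k) measure)"
   using lborel_eq_distr_PiM[of "\<lambda>k::'k. k"] by simp
  show ?thesis unfolding d[symmetric]
   by (rule nn_integral_distr) (use vec[of "\<lambda>k. k" UNIV] in auto)
 qed
 also have "... = (\<integral>\<^sup>+x. f (\<chi> k. x k) \<partial>?M (range io \<union> - range io))" by simp
 also have "... = (\<integral>\<^sup>+t. (\<integral>\<^sup>+z. f (\<chi> k. merge (range io) (- range io) (t, z) k) \<partial>?M (- range io)) \<partial>?M (range io))"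
  by (rule P.product_nn_integral_fold) (use g in auto)
 also have "... = (\<integral>\<^sup>+t. (\<integral>\<^sup>+z. f (slice_point io (\<chi> j. t (io j)) z) \<partial>?M (- range io)) \<partial>?M (range io))"
  by (intro nn_integral_cong arg_cong[where f = f])
   (auto simp: slice_point_def merge_def vec_eq_iff inv_f_f[OF assms(1)])
 also have "... = (\<integral>\<^sup>+t. (\<integral>\<^sup>+z. f (slice_point io t z) \<partial>?M (- range io)) \<partial>distr (?M (range io)) borel (\<lambda>t. \<chi> j. t (io j)))"
 proof (rule nn_integral_distr[symmetric])
  interpret F: finite_product_sigma_finite "\<lambda>_. lborel :: complex measure" "- range io" by standard simp
  have "(\<lambda>x. slice_point io (fst x) (snd x)) \<in> borel_measurable ((borel :: (complex^'m) measure) \<Otimes>\<^sub>M ?M (- range io))"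
   unfolding slice_point_def
  proof (rule borel_measurable_vec_lambda)
   fix k
   show "(\<lambda>x. if k \<in> range io then fst x $ inv io k else snd x k) \<in> borel_measurable ((borel :: (complex^'m) measure) \<Otimes>\<^sub>M ?M (- range io))"
   proof (cases "k \<in> range io")
    case True
    have "(\<lambda>x. x $ inv io k) \<in> borel_measurable (borel :: (complex^'m) measure)"
     by (intro borel_measurable_continuous_onI continuous_intros)
    then show ?thesis using True by (simp, measurable)
   next
    case False
    have "(\<lambda>x. x k) \<in> borel_measurable (?M (- range io))"
     using measurable_component_singleton[of k "- range io" "\<lambda>_. lborel :: complex measure"] False by simp
    then show ?thesis using False by (simp, measurable)
   qed
  qed
  then have "(\<lambda>(t, z). f (slice_point io t z)) \<in> borel_measurable ((borel :: (complex^'m) measure) \<Otimes>\<^sub>M ?M (- range io))"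
   unfolding split_def by measurable
  then have "(\<lambda>t. \<integral>\<^sup>+z. f (slice_point io t z) \<partial>?M (- range io)) \<in> borel_measurable borel"
   by (rule F.borel_measurable_nn_integral)
  then show "(\<lambda>t. \<integral>\<^sup>+z. f (slice_point io t z) \<partial>?M (- range io))
    \<in> borel_measurable (distr (?M (range io)) borel (\<lambda>t. \<chi> j. t (io j)))" by simp
 qed (use vec[of io] in auto)
 also have "distr (?M (range io)) borel (\<lambda>t. \<chi> j. t (io j)) = (lborel :: (complex^'m) measure)"
  by (rule lborel_eq_distr_PiM[OF assms(1)])
 finally show ?thesis .
qed

text \<open>Multiply the rows outside \<open>R'\<close> by \<open>s\<close> and the columns outside
  \<open>R\<close> by \<open>1 / s\<close>. There are equally many of them, so the determinant
  stays; the only block that changes is scaled by \<open>s\<close>, and continuity allows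
  \<open>s = 0\<close>.\<close>

lemma det_block_scale:
 fixes M :: "complex^'k::finite^'k"
 assumes "card R = card R'" and zero: "!!k k'. k' \<in> R' ==> k \<notin> R ==> M $ k' $ k = 0"
 shows "det (\<chi> k' k. if k' \<notin> R' \<and> k \<in> R then 0 else M $ k' $ k) = det M"
proof -
 define N where "N s = (\<chi> k' k. if k' \<notin> R' \<and> k \<in> R then s * M $ k' $ k else M $ k' $ k)" for s :: complex
 have "det (N s) = det M" if "s \<noteq> 0" for s
 proof -
  define B where "B = (\<chi> k k'. M $ k' $ k)"
  have Nt: "N s = (\<chi> k'. (if k' \<in> R' then 1 else s) *s (\<chi> k. (if k \<in> R then 1 else 1/s) * M $ k' $ k))"
   unfolding N_def vec_eq_iff using that zero by auto
  have "det (N s) = (\<Prod>k'\<in>UNIV. if k' \<in> R' then 1 else s) * det (\<chi> k' k. (if k \<in> R then 1 else 1/s) * M $ k' $ k)"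
   unfolding Nt by (rule det_rows_mul)
  also have "det (\<chi> k' k. (if k \<in> R then 1 else 1/s) * M $ k' $ k) = det (transpose (\<chi> k' k. (if k \<in> R then 1 else 1/s) * M $ k' $ k))"
   by (rule det_transpose[symmetric])
  also have "transpose (\<chi> k' k. (if k \<in> R then 1 else 1/s) * M $ k' $ k) = (\<chi> k. (if k \<in> R then 1 else 1/s) *s (\<chi> k'. M $ k' $ k))"
   by (simp add: transpose_def vec_eq_iff)
  also have "det ... = (\<Prod>k\<in>UNIV. if k \<in> R then 1 else 1/s) * det (\<chi> k k'. M $ k' $ k)"
   by (rule det_rows_mul)
  also have "(\<chi> k k'. M $ k' $ k) = transpose M" by (simp add: transpose_def)
  also have "(\<Prod>k\<in>UNIV. if k \<in> R then 1 else 1/s) = (1/s) ^ card (- R)"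
   by (subst prod.If_cases) (auto simp: Collect_neg_eq[symmetric])
  also have "(\<Prod>k'\<in>UNIV. if k' \<in> R' then 1 else s) = s ^ card (- R')"
   by (subst prod.If_cases) (auto simp: Collect_neg_eq[symmetric])
  also have "card (- R') = card (- R)" using assms(1) by (simp add: Compl_eq_Diff_UNIV card_Diff_subset)
  finally show ?thesis using that by (simp add: power_one_over)
 qed
 then have "(\<lambda>s. det (N s)) \<midarrow>0\<rightarrow> det M"
  by (intro tendsto_eventually) (auto simp: eventually_at_filter)
 moreover have "isCont (\<lambda>s. det (N s)) 0"
 proof -
  have "isCont (\<lambda>s. N s $ k' $ k) 0" for k' k
   unfolding N_def by (cases "k' \<notin> R' \<and> k \<in> R") auto
  then show ?thesis unfolding det_def
   by (intro continuous_sum continuous_mult continuous_prod continuous_const)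
 qed
 ultimately have "det (N 0) = det M" unfolding isCont_def using LIM_unique by blast
 moreover have "N 0 = (\<chi> k' k. if k' \<notin> R' \<and> k \<in> R then 0 else M $ k' $ k)"
  by (auto simp: N_def vec_eq_iff)
 ultimately show ?thesis by simp
qed

lemma slice_point_slice_point [simp]: "slice_point io t0 (($) (slice_point io t z)) = slice_point io t0 z"
 by (simp add: slice_point_def vec_eq_iff)

lemma slice_point_base: "inj io ==> slice_point io t z $ io j = t $ j"
 by (simp add: slice_point_def inv_f_f)

lemma slice_point_self: "inj io ==> (!!j. w $ io j = t $ j) ==> slice_point io t (($) w) = w"
 by (auto simp: slice_point_def vec_eq_iff inv_f_f)

lemma slice_point_continuous: "continuous_on S (\<lambda>w. slice_point io t (($) w))"
 unfolding slice_point_def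
proof (rule continuous_on_vec_lambda)
 fix k
 show "continuous_on S (\<lambda>w. if k \<in> range io then t $ inv io k else w $ k)"
  by (cases "k \<in> range io") (auto intro!: continuous_intros)
qed

text \<open>The fibre transition map is extended by the linear map \<open>A\<close> in the base coordinates, so that the
 change of variables formula on the whole coordinate space applies.\<close>

lemma fibre_change_of_variables:
 fixes io io' :: "'m::finite => 'k::finite" and Ph Ps :: "complex^'k => complex^'k" and A :: "complex^'m => complex^'m"
 assumes io: "inj io" "inj io'" and Om: "open Om" "holo_map_on Om Ph" "open (Ph ` Om)"
  and Ps: "!!w. w \<in> Om ==> Ps (Ph w) = w" "continuous_on (Ph ` Om) Ps"
  and det: "!!w. w \<in> Om ==> det (matrix (fd Ph w)) \<noteq> 0"
  and A: "linear A" "!!c v. A (c *s v) = c *s A v" "det (matrix A) \<noteq> 0"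
  and base: "!!w h j. w \<in> Om ==> (!!j. w $ io j = t0 $ j) ==> fd Ph w h $ io' j = A (\<chi> j. h $ io j) $ j"
  and t0: "!!w j. w \<in> Om ==> (!!j. w $ io j = t0 $ j) ==> Ph w $ io' j = t0' $ j"
  and t0': "!!w j. w \<in> Om ==> (!!j. Ph w $ io' j = t0' $ j) ==> w $ io j = t0 $ j"
  and f [measurable]: "f \<in> borel_measurable borel"
 shows "(\<integral>\<^sup>+z. f (slice_point io' t0' z) * indicator (Ph ` Om) (slice_point io' t0' z) \<partial>slice_lborel io')
  = (\<integral>\<^sup>+z. f (Ph (slice_point io t0 z)) *
    ennreal ((cmod (det (matrix (fd Ph (slice_point io t0 z)))))\<^sup>2 / (cmod (det (matrix A)))\<^sup>2) *
    indicator Om (slice_point io t0 z) \<partial>slice_lborel io)" (is "?X = ?Y")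
proof -
 define P where "P w = slice_point io t0 (($) w)" for w :: "complex^'k"
 define Q where "Q w = slice_point io' t0' (($) w)" for w :: "complex^'k"
 define P0 where "P0 h = (\<chi> k. if k \<in> range io then 0 else h $ k)" for h :: "complex^'k"
 define b where "b w = (\<chi> j. w $ io j)" for w :: "complex^'k"
 define b' where "b' w = (\<chi> j. w $ io' j)" for w :: "complex^'k"
 have AM: "A v = matrix A *v v" for v by (simp add: complex_linear_matrix[OF A(1,2)])
 have inv: "invertible (matrix A)" using A(3) by (simp add: invertible_det_nz)
 obtain Mi where Mi: "Mi ** matrix A = mat 1" "matrix A ** Mi = mat 1"
  using inv unfolding invertible_def by blast
 define A' where "A' v = Mi *v v" for v
 have A'A: "A' (A v) = v" and AA': "A (A' v) = v" for v
  unfolding A'_def AM matrix_vector_mul_assoc Mi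
  by (rule matrix_vector_mul_lid)+
 have contP: "continuous_on S P" and contQ: "continuous_on S Q" for S
  unfolding P_def Q_def by (rule slice_point_continuous)+
 have derP: "(P has_derivative P0) (at w)" for w
  unfolding P_def P0_def slice_point_def
 proof (rule has_derivative_vecI, unfold vec_lambda_beta)
  fix j
  show "((\<lambda>z. if j \<in> range io then t0 $ inv io j else z $ j) has_derivative
    (\<lambda>v. if j \<in> range io then 0 else v $ j)) (at w)"
   by (cases "j \<in> range io") (auto intro!: has_derivative_nth)
 qed
 have Pbase: "P w $ io j = t0 $ j" for w j unfolding P_def by (rule slice_point_base[OF io(1)])
 define Om3 where "Om3 = P -` Om"
 have op3: "open Om3" unfolding Om3_def by (rule open_vimage[OF Om(1) contP])
 \<comment> \<open>The base coordinates are frozen by \<open>P\<close> before \<open>Ph\<close> is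
   applied, so \<open>G\<close> is a product map and its inverse \<open>H\<close> can be given
   explicitly.\<close>
 define G where "G w = (\<chi> k'. if k' \<in> range io' then A (b w) $ inv io' k' else Ph (P w) $ k')" for w
 define DG where "DG w h = (\<chi> k'. if k' \<in> range io' then A (b h) $ inv io' k' else fd Ph (P w) (P0 h) $ k')" for w h
 define H where "H w = (\<chi> k. if k \<in> range io then A' (b' w) $ inv io k else Ps (Q w) $ k)" for w
 have linb: "linear b" "linear b'" unfolding b_def b'_def by (rule linearI; simp add: vec_eq_iff)+
 have linA': "linear A'" unfolding A'_def by (rule linear_complex_matrix)
 have QG: "Q (G w) = Ph (P w)" if "w \<in> Om3" for w
  unfolding vec_eq_iff
 proof
  fix k'
  show "Q (G w) $ k' = Ph (P w) $ k'"
  proof (cases "k' \<in> range io'")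
   case True
   then obtain j where "k' = io' j" by blast
   then show ?thesis using t0[of "P w" j] Pbase that
    unfolding Q_def by (simp add: slice_point_base[OF io(2)] Om3_def)
  qed (simp add: Q_def slice_point_def G_def)
 qed
 have b'G: "b' (G w) = A (b w)" for w by (simp add: b'_def G_def vec_eq_iff inv_f_f[OF io(2)])
 have HG: "H (G w) = w" if "w \<in> Om3" for w
 proof -
  have Pw: "P w \<in> Om" using that by (simp add: Om3_def)
  show ?thesis
   unfolding H_def QG[OF that] b'G A'A Ps(1)[OF Pw]
   by (auto simp: vec_eq_iff b_def P_def slice_point_def inv_f_f[OF io(1)])
 qed
 have img: "G ` Om3 = Q -` (Ph ` Om)"
 proof (intro equalityI subsetI)
  fix w' assume "w' \<in> G ` Om3"
  then show "w' \<in> Q -` (Ph ` Om)" using QG by (auto simp: Om3_def)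
 next
  fix w' assume "w' \<in> Q -` (Ph ` Om)"
  then obtain v where v: "v \<in> Om" "Q w' = Ph v" by auto
  have "Ph v $ io' j = t0' $ j" for j
   unfolding v(2)[symmetric] Q_def by (rule slice_point_base[OF io(2)])
  then have vb: "v $ io j = t0 $ j" for j using t0'[OF v(1)] by blast
  define w where "w = slice_point io (A' (b' w')) (($) v)"
  have Pw: "P w = v" unfolding P_def w_def using slice_point_self[OF io(1) vb] by simp
  have bw: "b w = A' (b' w')" by (simp add: b_def w_def slice_point_base[OF io(1)])
  have "G w = w'"
   unfolding G_def Pw bw AA' v(2)[symmetric]
   by (auto simp: vec_eq_iff b'_def Q_def slice_point_def inv_f_f[OF io(2)])
  moreover have "w \<in> Om3" using v Pw by (simp add: Om3_def)
  ultimately show "w' \<in> G ` Om3" by blast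
 qed
 have opG: "open (G ` Om3)" unfolding img by (rule open_vimage[OF Om(3) contQ])
 have derG: "(G has_derivative DG w) (at w)" if "w \<in> Om3" for w
 proof (rule has_derivative_vecI)
  fix k'
  have l: "linear (\<lambda>w. A (b w) $ c)" for c
   using linear_compose[OF linear_compose[OF linb(1) A(1)], of "\<lambda>v. v $ c"]
   by (simp add: o_def bounded_linear.linear bounded_linear_vec_nth)
  have "((\<lambda>w. Ph (P w)) has_derivative (\<lambda>h. fd Ph (P w) (P0 h))) (at w)"
   by (rule has_derivative_compose[OF derP holo_map_onD(1)[OF Om(2)]]) (use that in \<open>simp add: Om3_def\<close>)
  then show "((\<lambda>w. G w $ k') has_derivative (\<lambda>h. DG w h $ k')) (at w)"
   unfolding G_def DG_def
   by (cases "k' \<in> range io'") (auto intro: has_derivative_nth linear_imp_has_derivative[OF l])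
 qed
 have contDG: "continuous_on Om3 (\<lambda>w. DG w v)" for v
  unfolding DG_def
 proof (rule continuous_on_vec_lambda)
  fix k'
  have "continuous_on Om3 (\<lambda>w. fd (\<lambda>w. Ph w $ k') (P w) (P0 v))"
  proof (rule continuous_on_compose2[OF holo_on_continuous contP])
   show "holo_on Om (\<lambda>z. fd (\<lambda>w. Ph w $ k') z (P0 v))"
    by (rule holo_on_fd[OF _ Om(1)]) (use Om(2) in \<open>auto simp: holo_map_on_def\<close>)
  qed (auto simp: Om3_def)
  then have "continuous_on Om3 (\<lambda>w. fd Ph (P w) (P0 v) $ k')"
   by (rule continuous_on_eq) (simp add: holo_map_onD(3)[OF Om(2)] Om3_def)
  then show "continuous_on Om3 (\<lambda>w. if k' \<in> range io' then A (b v) $ inv io' k' else fd Ph (P w) (P0 v) $ k')"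
   by (cases "k' \<in> range io'") auto
 qed
 have contH: "continuous_on (G ` Om3) H"
  unfolding H_def
 proof (rule continuous_on_vec_lambda)
  fix k
  have 1: "continuous_on (G ` Om3) (\<lambda>w. A' (b' w))"
   by (rule continuous_on_compose2[where t = UNIV, OF linear_continuous_on[OF linA'[unfolded linear_conv_bounded_linear]]
      linear_continuous_on[OF linb(2)[unfolded linear_conv_bounded_linear]]]) simp
  have 2: "continuous_on (G ` Om3) (\<lambda>w. Ps (Q w))"
   by (rule continuous_on_compose2[OF Ps(2) contQ]) (simp add: img)
  show "continuous_on (G ` Om3) (\<lambda>w. if k \<in> range io then A' (b' w) $ inv io k else Ps (Q w) $ k)"
   using 1 2 by (cases "k \<in> range io") (auto intro: continuous_intros)
 qed
 have jacDG: "jac (DG w) = (cmod (det (matrix (fd Ph (P w)))))\<^sup>2" if "w \<in> Om3" for w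
 proof -
  have Pw: "P w \<in> Om" using that by (simp add: Om3_def)
  have lin: "linear (fd Ph (P w))" using holo_map_onD(1)[OF Om(2) Pw] has_derivative_linear by blast
  have A0: "A 0 = 0" by (rule linear_0[OF A(1)])
  have Mb: "matrix (fd Ph (P w)) $ io' j $ k = A (b (axis k 1)) $ j" for j k
   unfolding matrix_def b_def using base[OF Pw Pbase] by simp
  have b0: "b (axis k 1) = 0" if "k \<notin> range io" for k
   using that by (auto simp: b_def axis_def vec_eq_iff)
  have P01: "P0 (axis k 1) = (if k \<in> range io then 0 else axis k 1)" for k
   by (auto simp: P0_def axis_def vec_eq_iff)
  have M: "matrix (DG w) = (\<chi> k' k. if k' \<notin> range io' \<and> k \<in> range io then 0 else matrix (fd Ph (P w)) $ k' $ k)"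
   unfolding vec_eq_iff
  proof (intro allI)
   fix k' k
   show "matrix (DG w) $ k' $ k = (\<chi> k' k. if k' \<notin> range io' \<and> k \<in> range io then 0 else matrix (fd Ph (P w)) $ k' $ k) $ k' $ k"
   proof (cases "k' \<in> range io'")
    case True
    then obtain j where j: "k' = io' j" by blast
    show ?thesis unfolding j by (simp add: Mb) (simp add: matrix_def DG_def inv_f_f[OF io(2)])
   next
    case False
    then show ?thesis by (simp add: matrix_def DG_def P01 linear_0[OF lin])
   qed
  qed
  \<comment> \<open>The base rows vanish on the fibre columns, so deleting the base columns from the
    fibre rows leaves the determinant of \<open>Ph\<close>.\<close>
  have dM: "det (matrix (DG w)) = det (matrix (fd Ph (P w)))"
   unfolding M
  proof (rule det_block_scale)
   show "card (range io) = card (range io')" using io by (simp add: card_image)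
   fix k k' assume "k' \<in> range io'" "k \<notin> range io"
   then show "matrix (fd Ph (P w)) $ k' $ k = 0" using Mb b0 A0 by auto
  qed
  have "linear (DG w)" using derG[OF that] has_derivative_linear by blast
  moreover have "DG w (c *s v) = c *s DG w v" for c v
  proof -
   have bs: "b (c *s v) = c *s b v" "P0 (c *s v) = c *s P0 v" by (simp_all add: b_def P0_def vec_eq_iff)
   show ?thesis unfolding DG_def bs A(2) holo_map_onD(2)[OF Om(2) Pw] by (simp add: vec_eq_iff)
  qed
  ultimately show ?thesis using jac_complex_linear[of "DG w"] dM det[OF Pw] by simp
 qed
 \<comment> \<open>A box of volume 1 in the target base coordinates: multiplying by its indicator
   turns the integral over one slice into an integral over the whole space with the same
   value.\<close>
 let ?B = "box 0 One :: (complex^'m) set"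
 have B1: "emeasure lborel ?B = 1" by (subst emeasure_lborel_box) auto
 have bm [measurable]: "b \<in> borel_measurable borel" "b' \<in> borel_measurable borel" "A \<in> borel_measurable borel"
  by (intro borel_measurable_continuous_onI linear_continuous_on linb[unfolded linear_conv_bounded_linear]
    A(1)[unfolded linear_conv_bounded_linear])+
 have PQm [measurable]: "P \<in> borel_measurable borel" "Q \<in> borel_measurable borel"
  by (intro borel_measurable_continuous_onI contP contQ)+
 have [measurable]: "Om \<in> sets borel" "Ph ` Om \<in> sets borel" using Om by auto
 define F1 where "F1 w = f w * indicator (Ph ` Om) w" for w
 have F1m [measurable]: "F1 \<in> borel_measurable borel" unfolding F1_def by measurable
 define K where "K w = f (Ph w) * ennreal ((cmod (det (matrix (fd Ph w))))\<^sup>2) * indicator Om w" for w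
 have Km [measurable]: "K \<in> borel_measurable borel"
 proof -
  have "holo_on Om (\<lambda>w. det (matrix (fd Ph w)))"
  proof (rule holo_on_det)
   fix i j
   have "holo_on Om (\<lambda>w. fd (\<lambda>w. Ph w $ i) w (axis j 1))"
    by (rule holo_on_fd[OF _ Om(1)]) (use Om(2) in \<open>auto simp: holo_map_on_def\<close>)
   then show "holo_on Om (\<lambda>w. matrix (fd Ph w) $ i $ j)"
    by (rule holo_on_cong[OF _ Om(1)]) (simp add: matrix_def holo_map_onD(3)[OF Om(2)])
  qed
  from holo_on_continuous[OF this] have "continuous_on Om (\<lambda>w. (cmod (det (matrix (fd Ph w))))\<^sup>2)"
   by (intro continuous_intros)
  from borel_measurable_continuous_on_indicator[OF _ this]
  have 1: "(\<lambda>w. indicator Om w *\<^sub>R (cmod (det (matrix (fd Ph w))))\<^sup>2) \<in> borel_measurable borel" by simp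
  from borel_measurable_continuous_on_indicator[OF _ holo_map_on_continuous[OF Om(2)]]
  have 2: "(\<lambda>w. indicator Om w *\<^sub>R Ph w) \<in> borel_measurable borel" by simp
  have "(\<lambda>w. f (indicator Om w *\<^sub>R Ph w) * ennreal (indicator Om w *\<^sub>R (cmod (det (matrix (fd Ph w))))\<^sup>2)) \<in> borel_measurable borel"
   using 1 2 by measurable
  moreover have "(\<lambda>w. f (indicator Om w *\<^sub>R Ph w) * ennreal (indicator Om w *\<^sub>R (cmod (det (matrix (fd Ph w))))\<^sup>2)) = K"
   by (auto simp: K_def fun_eq_iff indicator_def)
  ultimately show ?thesis by metis
 qed
 define F where "F w = F1 (Q w) * indicator ?B (b' w)" for w
 have cv: "(\<integral>\<^sup>+w. F w * indicator (G ` Om3) w \<partial>lborel) =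
   (\<integral>\<^sup>+w. F (G w) * (ennreal (jac (DG w)) * indicator Om3 w) \<partial>lborel)"
  by (rule nn_integral_change_of_variables[OF op3 opG derG contDG HG contH])
   (auto simp: F_def)
 have "(\<integral>\<^sup>+w. F w * indicator (G ` Om3) w \<partial>lborel) = (\<integral>\<^sup>+w. F w \<partial>lborel)"
  unfolding img by (intro nn_integral_cong) (auto simp: F_def F1_def indicator_def)
 also have "... = (\<integral>\<^sup>+t. (\<integral>\<^sup>+z. F (slice_point io' t z) \<partial>slice_lborel io') \<partial>lborel)"
  by (rule nn_integral_slices[OF io(2)]) (simp add: F_def)
 also have "... = (\<integral>\<^sup>+t. ?X * indicator ?B t \<partial>lborel)"
 proof (rule nn_integral_cong)
  fix t :: "complex^'m"
  have "b' (slice_point io' t z) = t" "Q (slice_point io' t z) = slice_point io' t0' z" for z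
   by (simp_all add: b'_def Q_def slice_point_base[OF io(2)])
  then have "(\<integral>\<^sup>+z. F (slice_point io' t z) \<partial>slice_lborel io')
   = (\<integral>\<^sup>+z. F1 (slice_point io' t0' z) * indicator ?B t \<partial>slice_lborel io')"
   by (simp add: F_def)
  also have "... = ?X * indicator ?B t"
   by (subst nn_integral_multc) (auto simp: F1_def)
  finally show "(\<integral>\<^sup>+z. F (slice_point io' t z) \<partial>slice_lborel io') = ?X * indicator ?B t" .
 qed
 also have "... = ?X" by (simp add: nn_integral_cmult B1)
 finally have X: "?X = (\<integral>\<^sup>+w. F (G w) * (ennreal (jac (DG w)) * indicator Om3 w) \<partial>lborel)" using cv by simp
 let ?K = "\<integral>\<^sup>+z. K (slice_point io t0 z) \<partial>slice_lborel io"
 have "(\<integral>\<^sup>+w. F (G w) * (ennreal (jac (DG w)) * indicator Om3 w) \<partial>lborel) =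
   (\<integral>\<^sup>+w. K (P w) * indicator ?B (A (b w)) \<partial>lborel)"
 proof (rule nn_integral_cong)
  fix w
  show "F (G w) * (ennreal (jac (DG w)) * indicator Om3 w) = K (P w) * indicator ?B (A (b w))"
  proof (cases "w \<in> Om3")
   case True
   then have "P w \<in> Om" by (simp add: Om3_def)
   then show ?thesis
    by (simp add: F_def QG[OF True] b'G jacDG[OF True] F1_def K_def True mult_ac)
  next
   case False
   then show ?thesis by (simp add: K_def Om3_def)
  qed
 qed
 also have "... = (\<integral>\<^sup>+t. (\<integral>\<^sup>+z. K (P (slice_point io t z)) * indicator ?B (A (b (slice_point io t z))) \<partial>slice_lborel io) \<partial>lborel)"
  by (rule nn_integral_slices[OF io(1)]) simp
 also have "... = (\<integral>\<^sup>+t. ?K * indicator ?B (A t) \<partial>lborel)"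
 proof (rule nn_integral_cong)
  fix t :: "complex^'m"
  have "b (slice_point io t z) = t" "P (slice_point io t z) = slice_point io t0 z" for z
   by (simp_all add: b_def P_def slice_point_base[OF io(1)])
  then have "(\<integral>\<^sup>+z. K (P (slice_point io t z)) * indicator ?B (A (b (slice_point io t z))) \<partial>slice_lborel io)
   = (\<integral>\<^sup>+z. K (slice_point io t0 z) * indicator ?B (A t) \<partial>slice_lborel io)" by simp
  also have "... = ?K * indicator ?B (A t)" by (rule nn_integral_multc) measurable
  finally show "(\<integral>\<^sup>+z. K (P (slice_point io t z)) * indicator ?B (A (b (slice_point io t z))) \<partial>slice_lborel io) = ?K * indicator ?B (A t)" .
 qed
 also have "... = ?K * (\<integral>\<^sup>+t. indicator ?B (A t) \<partial>lborel)" by (rule nn_integral_cmult) measurable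
 \<comment> \<open>The preimage of the box under \<open>A\<close> has the inverse Jacobian as its
   volume; this is the denominator in the claim.\<close>
 also have "(\<integral>\<^sup>+t. indicator ?B (A t) \<partial>lborel) = ennreal (1 / (cmod (det (matrix A)))\<^sup>2)"
 proof -
  have rA: "range A = UNIV" using AA' by (metis surjI)
  have "(\<integral>\<^sup>+y. indicator ?B y * indicator (range A) y \<partial>lborel) =
   (\<integral>\<^sup>+x. indicator ?B (A x) * (ennreal (jac A) * indicator UNIV x) \<partial>lborel)"
  proof (rule nn_integral_change_of_variables[where h = A'])
   show "continuous_on (range A) A'"
    by (rule linear_continuous_on[OF linA'[unfolded linear_conv_bounded_linear]])
  qed (auto simp: rA A'A intro: linear_imp_has_derivative[OF A(1)])
  then have "1 = (\<integral>\<^sup>+x. ennreal (jac A) * indicator ?B (A x) \<partial>lborel)"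
   by (simp add: rA B1 mult.commute)
  also have "... = ennreal (jac A) * (\<integral>\<^sup>+x. indicator ?B (A x) \<partial>lborel)" by (rule nn_integral_cmult) measurable
  finally have e: "1 = ennreal (jac A) * (\<integral>\<^sup>+x. indicator ?B (A x) \<partial>lborel)" .
  have j: "jac A = (cmod (det (matrix A)))\<^sup>2" by (rule jac_complex_linear[OF A])
  have "jac A > 0" unfolding j using A(3) by simp
  then have "ennreal (1 / jac A) * ennreal (jac A) = 1" by (simp flip: ennreal_mult)
  then have "(\<integral>\<^sup>+x. indicator ?B (A x) \<partial>lborel) = ennreal (1 / jac A) * (ennreal (jac A) * (\<integral>\<^sup>+x. indicator ?B (A x) \<partial>lborel))"
   by (simp only: mult.assoc[symmetric] mult_1)
  then show ?thesis using e j by (metis mult.right_neutral)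
 qed
 also have "?K * ennreal (1 / (cmod (det (matrix A)))\<^sup>2) = (\<integral>\<^sup>+z. K (slice_point io t0 z) * ennreal (1 / (cmod (det (matrix A)))\<^sup>2) \<partial>slice_lborel io)"
  by (rule nn_integral_multc[symmetric]) measurable
 also have "... = ?Y"
  by (intro nn_integral_cong) (auto simp: K_def indicator_def mult.assoc simp flip: ennreal_mult)
 finally show ?thesis using X by simp
qed

section \<open>Manifolds\<close>

abbreviation cinv :: "('a, 'k::finite) chart => complex^'k => 'a" where
 "cinv c \<equiv> inv_into (fst c) (snd c)"

lemma holo_funD: "holo_fun A W f ==> c \<in> A ==> holo_on (snd c ` (fst c \<inter> W)) (\<lambda>w. f (cinv c w))"
 unfolding holo_fun_def o_def by (cases c) auto

lemma smooth_funD: "smooth_fun A W f ==> c \<in> A ==> smooth_on (snd c ` (fst c \<inter> W)) (\<lambda>w. f (cinv c w))"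
 unfolding smooth_fun_def o_def by (cases c) auto

lemma holo_fun_subset: "holo_fun A W f ==> W' \<subseteq> W ==> holo_fun A W' f"
 unfolding holo_fun_def
proof clarify
 fix U ph assume "\<forall>(U, ph)\<in>A. holo_on (ph ` (U \<inter> W)) (f \<circ> inv_into U ph)" "W' \<subseteq> W" "(U, ph) \<in> A"
 then have "holo_on (ph ` (U \<inter> W)) (f \<circ> inv_into U ph)" "ph ` (U \<inter> W') \<subseteq> ph ` (U \<inter> W)" by auto
 then show "holo_on (ph ` (U \<inter> W')) (f \<circ> inv_into U ph)" by (rule holo_on_subset)
qed

lemma smooth_fun_subset: "smooth_fun A W f ==> W' \<subseteq> W ==> smooth_fun A W' f"
 unfolding smooth_fun_def
proof clarify
 fix U ph assume "\<forall>(U, ph)\<in>A. smooth_on (ph ` (U \<inter> W)) (f \<circ> inv_into U ph)" "W' \<subseteq> W" "(U, ph) \<in> A"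
 then have "smooth_on (ph ` (U \<inter> W)) (f \<circ> inv_into U ph)" "ph ` (U \<inter> W') \<subseteq> ph ` (U \<inter> W)" by auto
 then show "smooth_on (ph ` (U \<inter> W')) (f \<circ> inv_into U ph)" by (rule smooth_on_subset)
qed

locale cmanifold =
 fixes X :: "('a::{t2_space,second_countable_topology}, 'k::finite) chart set"
 assumes mfd: "complex_manifold X"
begin

lemma chart:
 assumes "c \<in> X"
 shows "open (fst c)" "open (snd c ` fst c)" "inj_on (snd c) (fst c)"
  "x \<in> fst c ==> cinv c (snd c x) = x" "w \<in> snd c ` fst c ==> snd c (cinv c w) = w"
  "w \<in> snd c ` fst c ==> cinv c w \<in> fst c"
  "continuous_on (fst c) (snd c)" "continuous_on (snd c ` fst c) (cinv c)"
  "W \<subseteq> fst c ==> open W ==> open (snd c ` W)"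
  "open (snd c ` (fst c \<inter> W)) \<longleftrightarrow> open (fst c \<inter> W)"
proof -
 have "is_chart c" using mfd assms unfolding complex_manifold_def by blast
 then have ch: "open (fst c)" "open (snd c ` fst c)" and hom: "homeomorphism (fst c) (snd c ` fst c) (snd c) (cinv c)"
  unfolding is_chart_def by (auto split: prod.splits)
 show "open (fst c)" "open (snd c ` fst c)" by fact+
 have inv: "cinv c (snd c x) = x" if "x \<in> fst c" for x
  using hom that unfolding homeomorphism_def by blast
 show inj: "inj_on (snd c) (fst c)" using inv by (metis inj_onI)
 show "x \<in> fst c ==> cinv c (snd c x) = x" by (rule inv)
 show "w \<in> snd c ` fst c ==> snd c (cinv c w) = w" by (rule f_inv_into_f)
 show "w \<in> snd c ` fst c ==> cinv c w \<in> fst c" by (rule inv_into_into)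
 show c1: "continuous_on (fst c) (snd c)" and c2: "continuous_on (snd c ` fst c) (cinv c)"
  using hom unfolding homeomorphism_def by blast+
 show op: "open (snd c ` W)" if "W \<subseteq> fst c" "open W" for W
 proof -
  have "open (cinv c -` W \<inter> snd c ` fst c)"
   using continuous_on_open_vimage[OF ch(2), of "cinv c"] c2 that(2) by blast
  moreover have "cinv c -` W \<inter> snd c ` fst c = snd c ` W"
   using that(1) inv by (auto simp: image_iff subset_iff)
  ultimately show ?thesis by simp
 qed
 show "open (snd c ` (fst c \<inter> W)) \<longleftrightarrow> open (fst c \<inter> W)"
 proof
  assume o: "open (snd c ` (fst c \<inter> W))"
  have "open (snd c -` (snd c ` (fst c \<inter> W)) \<inter> fst c)"
   using continuous_on_open_vimage[OF ch(1), of "snd c"] c1 o by blast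
  moreover have "snd c -` (snd c ` (fst c \<inter> W)) \<inter> fst c = fst c \<inter> W"
   using inj by (auto dest: inj_onD)
  ultimately show "open (fst c \<inter> W)" by simp
 qed (use op in auto)
qed

lemma chart_at: "\<exists>c\<in>X. x \<in> fst c"
 using mfd unfolding complex_manifold_def by blast

lemma chart_image_open: "c \<in> X ==> open W ==> open (snd c ` (fst c \<inter> W))"
 by (rule chart(9)) (auto intro: chart(1))

lemma chart_image_inter: "c \<in> X ==> w \<in> snd c ` (fst c \<inter> W) \<longleftrightarrow> w \<in> snd c ` fst c \<and> cinv c w \<in> W"
 using chart(4) by (auto simp: image_iff)

lemma chart_pt: "c \<in> X ==> w \<in> snd c ` (fst c \<inter> W) ==> cinv c w \<in> W"
 using chart_image_inter by blast

lemma transition_holo: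
 assumes "c \<in> X" "d \<in> X"
 shows "holo_map_on (snd c ` (fst c \<inter> fst d)) (transition c d)"
 using mfd assms unfolding complex_manifold_def holo_compatible_def by blast

lemma transition_eq: "c \<in> X ==> x \<in> fst c ==> transition c d (snd c x) = snd d x"
 by (simp add: transition_def chart(4))

lemma holo_funI:
 assumes "!!x. x \<in> W ==> \<exists>c\<in>X. \<exists>N. open N \<and> x \<in> N \<and> N \<subseteq> fst c \<and> holo_on (snd c ` N) (\<lambda>w. f (cinv c w))"
 shows "holo_fun X W f"
 unfolding holo_fun_def
proof (clarify, rule holo_on_local)
 fix U ph z assume c': "(U, ph) \<in> X" and "z \<in> ph ` (U \<inter> W)"
 then obtain x where x: "x \<in> U" "x \<in> W" "z = ph x" by auto
 obtain c N where c: "c \<in> X" and N: "open N" "x \<in> N" "N \<subseteq> fst c" and h: "holo_on (snd c ` N) (\<lambda>w. f (cinv c w))"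
  using assms[OF x(2)] by blast
 let ?c' = "(U, ph)"
 have op: "open (ph ` (U \<inter> N))" using chart_image_open[OF c' N(1)] by simp
 have "holo_on (ph ` (U \<inter> N)) (\<lambda>w. f (cinv c (transition ?c' c w)))"
 proof (rule holo_on_compose[OF _ h])
  show "holo_map_on (ph ` (U \<inter> N)) (transition ?c' c)"
   by (rule holo_map_on_subset[OF transition_holo[OF c' c]]) (use N in auto)
  show "transition ?c' c w \<in> snd c ` N" if "w \<in> ph ` (U \<inter> N)" for w
   using that transition_eq[OF c', of _ c] by auto
 qed
 then have "holo_on (ph ` (U \<inter> N)) (f \<circ> inv_into U ph)"
 proof (rule holo_on_cong[OF _ op])
  fix w assume "w \<in> ph ` (U \<inter> N)"
  then obtain x' where "x' \<in> U" "x' \<in> N" "w = ph x'" by auto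
  then show "f (cinv c (transition ?c' c w)) = (f \<circ> inv_into U ph) w"
   using transition_eq[OF c', of x' c] chart(4)[OF c', of x'] chart(4)[OF c, of x'] N(3) by auto
 qed
 then show "\<exists>V. z \<in> V \<and> holo_on V (f \<circ> inv_into U ph)"
  using x N by (intro exI[of _ "ph ` (U \<inter> N)"]) auto
qed

lemma holo_fun_chart: "c \<in> X ==> open W ==> W \<subseteq> fst c ==> holo_on (snd c ` W) (\<lambda>w. f (cinv c w)) ==> holo_fun X W f"
 by (rule holo_funI) auto

lemma holo_fun_local:
 assumes "!!x. x \<in> W ==> \<exists>N. x \<in> N \<and> open N \<and> holo_fun X N f"
 shows "holo_fun X W f"
proof (rule holo_funI)
 fix x assume "x \<in> W"
 then obtain N where N: "x \<in> N" "open N" "holo_fun X N f" using assms by blast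
 obtain c where c: "c \<in> X" "x \<in> fst c" using chart_at by blast
 show "\<exists>c\<in>X. \<exists>N. open N \<and> x \<in> N \<and> N \<subseteq> fst c \<and> holo_on (snd c ` N) (\<lambda>w. f (cinv c w))"
  using N c holo_funD[OF N(3) c(1)] chart(1)[OF c(1)]
  by (intro bexI[OF _ c(1)] exI[of _ "fst c \<inter> N"]) auto
qed

lemma holo_fun_cong:
 assumes "holo_fun X W f" "open W" "!!x. x \<in> W ==> f x = g x"
 shows "holo_fun X W g"
 unfolding holo_fun_def
proof clarify
 fix U ph assume c: "(U, ph) \<in> X"
 have "holo_on (snd (U, ph) ` (fst (U, ph) \<inter> W)) (\<lambda>w. g (cinv (U, ph) w))"
  by (rule holo_on_cong[OF holo_funD[OF assms(1) c] chart_image_open[OF c assms(2)]])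
   (rule assms(3)[OF chart_pt[OF c]])
 then show "holo_on (ph ` (U \<inter> W)) (g \<circ> inv_into U ph)" by (simp add: o_def)
qed

lemma holo_fun_const [simp]: "holo_fun X W (\<lambda>x. c)"
 unfolding holo_fun_def o_def by auto

lemma holo_fun_add: "holo_fun X W f ==> holo_fun X W g ==> holo_fun X W (\<lambda>x. f x + g x)"
 unfolding holo_fun_def o_def by (auto intro: holo_on_add)

lemma holo_fun_mult: "holo_fun X W f ==> holo_fun X W g ==> holo_fun X W (\<lambda>x. f x * g x)"
 unfolding holo_fun_def o_def by (auto intro: holo_on_mult)

lemma holo_fun_power: "holo_fun X W f ==> holo_fun X W (\<lambda>x. f x ^ n)"
 unfolding holo_fun_def o_def by (auto intro: holo_on_power)

lemma holo_fun_sum: "(!!i. i \<in> I ==> holo_fun X W (f i)) ==> holo_fun X W (\<lambda>x. \<Sum>i\<in>I. f i x)"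
 by (induction I rule: infinite_finite_induct) (auto intro: holo_fun_add)

lemma holo_fun_inverse:
 assumes "holo_fun X W f" "!!x. x \<in> W ==> f x \<noteq> 0"
 shows "holo_fun X W (\<lambda>x. inverse (f x))"
 unfolding holo_fun_def o_def
proof clarify
 fix U ph assume c: "(U, ph) \<in> X"
 show "holo_on (ph ` (U \<inter> W)) (\<lambda>w. inverse (f (inv_into U ph w)))"
  using holo_on_inverse[OF holo_funD[OF assms(1) c] assms(2)[OF chart_pt[OF c]]] by simp
qed

lemma holo_fun_coord:
 assumes "c \<in> X"
 shows "holo_fun X (fst c) (\<lambda>x. snd c x $ k)"
 using assms chart(2)[OF assms] chart(5)[OF assms]
 by (intro holo_fun_chart[OF assms] chart(1) holo_on_cong[OF holo_on_nth[of _ k]]) auto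

lemma holo_fun_continuous:
 assumes "holo_fun X W f" "open W"
 shows "continuous_on W f"
proof (rule continuous_at_imp_continuous_on, rule ballI)
 fix x assume x: "x \<in> W"
 obtain c where c: "c \<in> X" "x \<in> fst c" using chart_at by blast
 have o: "open (fst c \<inter> W)" using chart(1)[OF c(1)] assms(2) by auto
 have "continuous_on (fst c \<inter> W) (\<lambda>x. f (cinv c (snd c x)))"
  by (rule continuous_on_compose2[OF holo_on_continuous[OF holo_funD[OF assms(1) c(1)]]
     continuous_on_subset[OF chart(7)[OF c(1)]]]) auto
 then have "continuous_on (fst c \<inter> W) f"
  by (rule continuous_on_eq) (simp add: chart(4)[OF c(1)])
 then show "isCont f x" using o x c by (simp add: continuous_on_eq_continuous_at)
qed

lemma smooth_fun_continuous:
 assumes "smooth_fun X W f" "open W"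
 shows "continuous_on W f"
proof (rule continuous_at_imp_continuous_on, rule ballI)
 fix x assume x: "x \<in> W"
 obtain c where c: "c \<in> X" "x \<in> fst c" using chart_at by blast
 have o: "open (fst c \<inter> W)" using chart(1)[OF c(1)] assms(2) by auto
 have "continuous_on (fst c \<inter> W) (\<lambda>x. f (cinv c (snd c x)))"
  by (rule continuous_on_compose2[OF smooth_onD(3)[OF smooth_funD[OF assms(1) c(1)]]
     continuous_on_subset[OF chart(7)[OF c(1)]]]) auto
 then have "continuous_on (fst c \<inter> W) f"
  by (rule continuous_on_eq) (simp add: chart(4)[OF c(1)])
 then show "isCont f x" using o x c by (simp add: continuous_on_eq_continuous_at)
qed

lemma smooth_funI:
 assumes "!!c. c \<in> X ==> smooth_on (snd c ` (fst c \<inter> W)) (\<lambda>w. f (cinv c w))"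
 shows "smooth_fun X W f"
 unfolding smooth_fun_def o_def using assms by force

lemma smooth_fun_cong:
 assumes "smooth_fun X W f" "open W" "!!x. x \<in> W ==> f x = g x"
 shows "smooth_fun X W g"
proof (rule smooth_funI)
 fix c assume c: "c \<in> X"
 show "smooth_on (snd c ` (fst c \<inter> W)) (\<lambda>w. g (cinv c w))"
  by (rule smooth_on_cong[OF chart_image_open[OF c assms(2)] smooth_funD[OF assms(1) c]])
   (rule assms(3)[OF chart_pt[OF c]])
qed

lemma smooth_fun_local:
 assumes "!!x. x \<in> W ==> \<exists>N. x \<in> N \<and> open N \<and> smooth_fun X N f"
 shows "smooth_fun X W f"
proof (rule smooth_funI, rule smooth_on_local)
 fix c z assume c: "c \<in> X" and "z \<in> snd c ` (fst c \<inter> W)"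
 then obtain x where x: "x \<in> fst c" "x \<in> W" "z = snd c x" by auto
 then obtain N where "x \<in> N" "open N" "smooth_fun X N f" using assms by blast
 then show "\<exists>V. z \<in> V \<and> open V \<and> smooth_on V (\<lambda>w. f (cinv c w))"
  using smooth_funD[OF _ c, of N f] chart_image_open[OF c, of N] x
  by (intro exI[of _ "snd c ` (fst c \<inter> N)"]) auto
qed

lemma smooth_fun_const [simp]: "smooth_fun X W (\<lambda>x. c)"
 by (rule smooth_funI) simp

lemma smooth_fun_add: "open W ==> smooth_fun X W f ==> smooth_fun X W g ==> smooth_fun X W (\<lambda>x. f x + g x)"
 by (rule smooth_funI, rule smooth_on_add; (intro chart_image_open smooth_funD; assumption))

lemma smooth_fun_mult: "open W ==> smooth_fun X W f ==> smooth_fun X W g ==> smooth_fun X W (\<lambda>x. f x * g x)"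
 by (rule smooth_funI, rule smooth_on_mult; (intro chart_image_open smooth_funD; assumption))

lemma smooth_fun_diff: "open W ==> smooth_fun X W f ==> smooth_fun X W g ==> smooth_fun X W (\<lambda>x. f x - g x)"
 by (rule smooth_funI, rule smooth_on_diff; (intro chart_image_open smooth_funD; assumption))

lemma smooth_fun_sum: "open W ==> (!!i. i \<in> I ==> smooth_fun X W (f i)) ==> smooth_fun X W (\<lambda>x. \<Sum>i\<in>I. f i x)"
 by (induction I rule: infinite_finite_induct) (auto intro: smooth_fun_add)

lemma smooth_fun_power: "open W ==> smooth_fun X W f ==> smooth_fun X W (\<lambda>x. f x ^ n)"
 by (induction n) (auto intro: smooth_fun_mult)

lemma smooth_fun_compose_real:
 assumes "open W" "smooth_real S g" "smooth_fun X W f" "!!x. x \<in> W ==> f x \<in> S"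
 shows "smooth_fun X W (\<lambda>x. g (f x))"
proof (rule smooth_funI)
 fix c assume c: "c \<in> X"
 show "smooth_on (snd c ` (fst c \<inter> W)) (\<lambda>w. g (f (cinv c w)))"
  by (rule smooth_on_compose_real[OF chart_image_open[OF c assms(1)] assms(2) _ smooth_funD[OF assms(3) c]])
   (rule assms(4)[OF chart_pt[OF c]])
qed

lemma smooth_fun_ln: "open W ==> smooth_fun X W f ==> (!!x. x \<in> W ==> f x > 0) ==> smooth_fun X W (\<lambda>x. ln (f x))"
 by (rule smooth_fun_compose_real[OF _ smooth_real_ln]) auto

lemma smooth_fun_exp: "open W ==> smooth_fun X W f ==> smooth_fun X W (\<lambda>x. exp (f x))"
 by (rule smooth_fun_compose_real[OF _ smooth_real_exp[of UNIV]]) auto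

lemma smooth_fun_divide:
 "open W ==> smooth_fun X W f ==> smooth_fun X W g ==> (!!x. x \<in> W ==> g x > 0) ==> smooth_fun X W (\<lambda>x. f x / g x)"
 unfolding divide_inverse
 by (intro smooth_fun_mult smooth_fun_compose_real[OF _ smooth_real_inverse]) auto

lemma smooth_fun_cmod2: "open W ==> holo_fun X W f ==> smooth_fun X W (\<lambda>x. (cmod (f x))\<^sup>2)"
 by (rule smooth_funI, rule smooth_on_cmod2; (intro chart_image_open holo_funD; assumption))

text \<open>Maximality of the atlas puts the composed map into \<open>X\<close> once compatibility
  with every chart is checked in both directions. Coordinates adapted to \<open>p\<close> are
  obtained in this way.\<close>

lemma atlas_compose:
 assumes c: "c \<in> X" and U': "open U'" "U' \<subseteq> fst c"
  and G: "holo_map_on (snd c ` U') G" "open (G ` snd c ` U')" "holo_map_on (G ` snd c ` U') H"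
  and HG: "!!w. w \<in> snd c ` U' ==> H (G w) = w"
 shows "(U', G \<circ> snd c) \<in> X"
proof -
 let ?ph = "G \<circ> snd c"
 have img: "?ph ` U' = G ` snd c ` U'" by (simp add: image_comp)
 have inj: "inj_on ?ph U'"
 proof (rule inj_onI)
  fix x y assume "x \<in> U'" "y \<in> U'" "?ph x = ?ph y"
  then have "snd c x = snd c y" using HG by (metis comp_apply imageI)
  then show "x = y" using inj_onD[OF chart(3)[OF c]] \<open>x \<in> U'\<close> \<open>y \<in> U'\<close> U' by blast
 qed
 have inv: "inv_into U' ?ph w = cinv c (H w)" if w: "w \<in> G ` snd c ` U'" for w
 proof -
  obtain x where x: "x \<in> U'" "w = G (snd c x)" using w by auto
  then have "inv_into U' ?ph w = x" using inv_into_f_f[OF inj x(1)] by simp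
  also have "x = cinv c (H w)" using x HG[of "snd c x"] chart(4)[OF c, of x] U' by auto
  finally show ?thesis .
 qed
 have Hin: "H w \<in> snd c ` U'" if "w \<in> G ` snd c ` U'" for w using that HG by auto
 have chart': "is_chart (U', ?ph)"
  unfolding is_chart_def split homeomorphism_def img
 proof (intro conjI ballI)
  show "continuous_on U' ?ph"
   by (rule continuous_on_compose[OF continuous_on_subset[OF chart(7)[OF c] U'(2)] holo_map_on_continuous[OF G(1)]])
  have "continuous_on (G ` snd c ` U') (\<lambda>w. cinv c (H w))"
   by (rule continuous_on_compose2[OF chart(8)[OF c] holo_map_on_continuous[OF G(3)]]) (use Hin U' in blast)
  then show "continuous_on (G ` snd c ` U') (inv_into U' ?ph)"
   by (rule continuous_on_eq) (simp add: inv)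
  show "inv_into U' ?ph (?ph x) = x" if "x \<in> U'" for x by (rule inv_into_f_f[OF inj that])
  show "?ph (inv_into U' ?ph y) = y" if "y \<in> G ` snd c ` U'" for y
   by (rule f_inv_into_f) (use that img in simp)
  show "inv_into U' ?ph ` (G ` snd c ` U') = U'"
   unfolding img[symmetric] by (rule inv_into_image_cancel[OF inj]) simp
 qed (use U' G img in auto)
 moreover have "holo_compatible (U', ?ph) d" if d: "d \<in> X" for d
  unfolding holo_compatible_def fst_conv snd_conv
 proof
  have img2: "?ph ` (U' \<inter> fst d) = G ` snd c ` (U' \<inter> fst d)" by (simp add: image_comp)
  have o1: "open (snd c ` (U' \<inter> fst d))" by (rule chart(9)[OF c]) (use U' chart(1)[OF d] in auto)
  have "G ` snd c ` (U' \<inter> fst d) = H -` (snd c ` (U' \<inter> fst d)) \<inter> G ` snd c ` U'"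
  proof (intro equalityI subsetI)
   fix w assume "w \<in> H -` (snd c ` (U' \<inter> fst d)) \<inter> G ` snd c ` U'"
   then obtain x x' where x: "x \<in> U'" "w = G (snd c x)" "x' \<in> U' \<inter> fst d" "H w = snd c x'" by auto
   then have "snd c x = snd c x'" using HG[of "snd c x"] by simp
   then show "w \<in> G ` snd c ` (U' \<inter> fst d)" using x by auto
  qed (use HG in auto)
  then have o2: "open (G ` snd c ` (U' \<inter> fst d))"
   using continuous_on_open_vimage[OF G(2), of H] holo_map_on_continuous[OF G(3)] o1 by auto
  have "holo_map_on (G ` snd c ` (U' \<inter> fst d)) (\<lambda>w. transition c d (H w))"
   by (rule holo_map_on_compose[OF holo_map_on_subset[OF G(3)] transition_holo[OF c d]])
    (use HG U' in auto)
  then show "holo_map_on (?ph ` (U' \<inter> fst d)) (transition (U', ?ph) d)"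
   unfolding img2
   by (rule holo_map_on_cong[OF _ o2]) (use inv in \<open>auto simp: transition_def\<close>)
  have o3: "open (snd d ` (U' \<inter> fst d))" by (rule chart(9)[OF d]) (use U' chart(1)[OF d] in auto)
  have "holo_map_on (snd d ` (U' \<inter> fst d)) (\<lambda>w. G (transition d c w))"
  proof (rule holo_map_on_compose[OF holo_map_on_subset[OF transition_holo[OF d c]] G(1)])
   show "snd d ` (U' \<inter> fst d) \<subseteq> snd d ` (fst d \<inter> fst c)" using U' by auto
   show "transition d c w \<in> snd c ` U'" if "w \<in> snd d ` (U' \<inter> fst d)" for w
    using that transition_eq[OF d, of _ c] by auto
  qed
  then show "holo_map_on (snd d ` (U' \<inter> fst d)) (transition d (U', ?ph))"
   by (rule holo_map_on_cong[OF _ o3]) (simp add: transition_def)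
 qed
 ultimately show ?thesis using mfd unfolding complex_manifold_def by blast
qed

end

text \<open>The real inverse function theorem yields a differentiable inverse; its derivative
  inverts a complex linear map and is therefore complex linear.\<close>

lemma holo_inverse_function:
 fixes G :: "complex^'k::finite => complex^'k"
 assumes "open Om" "holo_map_on Om G" "z0 \<in> Om" "inj (fd G z0)"
 obtains U V g where "open U" "U \<subseteq> Om" "z0 \<in> U" "open V" "G ` U = V" "!!z. z \<in> U ==> g (G z) = z" "holo_map_on V g"
proof -
 define B where "B z = Blinfun (fd G z)" for z
 have B: "blinfun_apply (B z) = fd G z" if "z \<in> Om" for z
  unfolding B_def by (rule bounded_linear_Blinfun_apply)
   (use holo_map_onD(1)[OF assms(2) that] has_derivative_bounded_linear in blast)
 have contB: "continuous_on Om B"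
 proof (rule continuous_on_blinfun_componentwise)
  fix i :: "complex^'k"
  have "continuous_on Om (\<lambda>z. \<chi> j. fd (\<lambda>w. G w $ j) z i)"
   by (rule continuous_on_vec_lambda, rule holo_on_continuous, rule holo_on_fd)
    (use assms in \<open>auto simp: holo_map_on_def\<close>)
  then show "continuous_on Om (\<lambda>z. blinfun_apply (B z) i)"
   by (rule continuous_on_eq) (simp add: B holo_map_onD(3)[OF assms(2)] vec_eq_iff)
 qed
 have lin: "linear (fd G z0)" using holo_map_onD(1)[OF assms(2,3)] has_derivative_linear by blast
 obtain L where L: "linear L" "L \<circ> fd G z0 = id"
  using linear_injective_left_inverse[OF lin assms(4)] by blast
 have inv: "Blinfun L o\<^sub>L B z0 = id_blinfun"
  by (rule blinfun_eqI)
   (simp add: B[OF assms(3)] bounded_linear_Blinfun_apply[OF L(1)[unfolded linear_conv_bounded_linear]] fun_cong[OF L(2), simplified])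
 have der: "(G has_derivative blinfun_apply (B z)) (at z)" if "z \<in> Om" for z
  unfolding B[OF that] by (rule holo_map_onD(1)[OF assms(2) that])
 obtain U V g g' where UV: "open U" "U \<subseteq> Om" "z0 \<in> U" "open V" "homeomorphism U V G g"
  and g: "!!y. y \<in> V ==> (g has_derivative g' y) (at y)" "!!y. y \<in> V ==> g' y = inv (blinfun_apply (B (g y)))"
   "!!y. y \<in> V ==> bij (blinfun_apply (B (g y)))"
  by (rule inverse_function_theorem[OF assms(1) der contB assms(3) inv], assumption, rule that; assumption)
 have "holo_map_on V g"
 proof (rule holo_map_onI[OF g(1)])
  fix y c v assume y: "y \<in> V"
  then have gy: "g y \<in> Om" using UV homeomorphism_image2[OF UV(5)] by blast
  have b: "bij (fd G (g y))" "g' y = inv (fd G (g y))" using g(2,3)[OF y] B[OF gy] by auto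
  have "fd G (g y) (c *s inv (fd G (g y)) v) = c *s v"
   using holo_map_onD(2)[OF assms(2) gy] b(1) by (simp add: bij_is_surj surj_f_inv_f)
  then show "g' y (c *s v) = c *s g' y v"
   unfolding b(2) using b(1) by (metis bij_inv_eq_iff)
 qed
 then show ?thesis
  using that[of U V g] UV homeomorphism_image1[OF UV(5)] homeomorphism_apply1[OF UV(5)] by blast
qed

text \<open>Choose columns of \<open>D\<close> that form a basis of the target; \<open>io\<close>
  lists their positions. A kernel vector of the combined map vanishes in the other coordinates, and
  then independence of the chosen columns kills the rest.\<close>

lemma surjective_coordinates:
 fixes D :: "complex^'k::finite => complex^'m::finite"
 assumes "linear D" "!!c v. D (c *s v) = c *s D v" "surj D"
 shows "\<exists>io :: 'm => 'k. inj io \<and> inj (\<lambda>h. \<chi> k. if k \<in> range io then D h $ inv io k else h $ k)"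
proof -
 let ?c = "\<lambda>k. D (axis k 1)"
 have vlin: "Vector_Spaces.linear (*s) (*s) D"
  by (intro Vector_Spaces.linear_iff[THEN iffD2] conjI vec.vector_space_axioms)
   (use assms in \<open>auto simp: linear_add\<close>)
 have expand: "D h = (\<Sum>k\<in>UNIV. h $ k *s ?c k)" for h
  using linear_componentwise[OF vlin, of h] by (simp add: vec_eq_iff mult.commute sum_component)
 obtain B where B: "B \<subseteq> range ?c" "vec.independent B" "range ?c \<subseteq> vec.span B"
  using vec.maximal_independent_subset[of "range ?c"] by blast
 have "vec.span B = UNIV"
 proof -
  have "D h \<in> vec.span B" for h
   by (subst expand, intro vec.span_sum vec.span_scale) (use B(3) in auto)
  then have "range D \<subseteq> vec.span B" by blast
  then show ?thesis using assms(3) by auto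
 qed
 then have cB: "card B = CARD('m)"
  using vec.basis_card_eq_dim[of B UNIV] B(2) by (simp add: card_cart_basis vec.dim_UNIV)
 have fB: "finite B" by (rule finite_subset[OF B(1)]) simp
 obtain \<beta> where \<beta>: "bij_betw \<beta> (UNIV :: 'm set) B"
  using finite_same_card_bij[OF _ fB, of "UNIV :: 'm set"] cB by auto
 define io where "io j = (SOME k. ?c k = \<beta> j)" for j
 have io: "?c (io j) = \<beta> j" for j
 proof -
  have "\<beta> j \<in> range ?c" using \<beta> B(1) by (auto simp: bij_betw_def)
  then show ?thesis unfolding io_def by (metis (mono_tags, lifting) imageE someI_ex)
 qed
 have inj: "inj io"
 proof (rule injI)
  fix i j assume "io i = io j"
  then have "\<beta> i = \<beta> j" using io by metis
  then show "i = j" using \<beta> by (auto simp: bij_betw_def dest: injD)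
 qed
 have "inj (\<lambda>h. \<chi> k. if k \<in> range io then D h $ inv io k else h $ k)" (is "inj ?S")
 proof -
  have "h = 0" if "?S h = 0" for h
  proof -
   have S0: "(if k \<in> range io then D h $ inv io k else h $ k) = 0" for k
    using arg_cong[OF that, of "\<lambda>v. v $ k"] by simp
   have h0: "h $ k = 0" if "k \<notin> range io" for k using S0[of k] that by simp
   have "D h $ j = 0" for j using S0[of "io j"] inv_f_f[OF inj, of j] by simp
   then have "D h = 0" by (simp add: vec_eq_iff)
   moreover have "D h = (\<Sum>k\<in>range io. h $ k *s ?c k)"
    by (subst expand, rule sum.mono_neutral_right) (auto simp: h0)
   moreover have "... = (\<Sum>j\<in>UNIV. h $ io j *s \<beta> j)"
    by (subst sum.reindex[OF inj]) (simp add: io)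
   moreover have "... = (\<Sum>b\<in>B. h $ io (inv_into UNIV \<beta> b) *s b)"
    using sum.reindex_bij_betw[OF \<beta>, of "\<lambda>b. h $ io (inv_into UNIV \<beta> b) *s b"]
     inv_f_f[OF bij_betw_imp_inj_on[OF \<beta>]] by simp
   ultimately have "(\<Sum>b\<in>B. h $ io (inv_into UNIV \<beta> b) *s b) = 0" by simp
   then have "h $ io (inv_into UNIV \<beta> b) = 0" if "b \<in> B" for b
    using vec.independentD[OF B(2) fB subset_refl, of "\<lambda>b. h $ io (inv_into UNIV \<beta> b)"] that by simp
   then have hj: "h $ io j = 0" for j
    using inv_f_f[OF bij_betw_imp_inj_on[OF \<beta>], of j] bij_betw_apply[OF \<beta>, of j] by force
   have "h $ k = 0" for k by (cases "k \<in> range io") (use hj h0 in auto)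
   then show ?thesis by (simp add: vec_eq_iff)
  qed
  moreover have "linear ?S"
   using assms(1) by (intro linearI) (auto simp: vec_eq_iff linear_add linear_cmul)
  ultimately show ?thesis using linear_injective_0[of ?S] by blast
 qed
 then show ?thesis using inj by blast
qed

section \<open>Line bundles\<close>

lemma lb_trans_self:
 assumes "holomorphic_line_bundle X L" "i \<in> lb_index L" "x \<in> lb_dom L i"
 shows "lb_trans L i i x = 1"
proof -
 have "lb_trans L i i x * lb_trans L i i x = lb_trans L i i x" "lb_trans L i i x \<noteq> 0"
  using assms unfolding holomorphic_line_bundle_def by blast+
 then show ?thesis by simp
qed

lemma lb_trans_cocycle:
 assumes "holomorphic_line_bundle X L" "i \<in> lb_index L" "x \<in> lb_dom L i"
  "j \<in> lb_index L" "x \<in> lb_dom L j" "k \<in> lb_index L" "x \<in> lb_dom L k"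
 shows "lb_trans L i j x * lb_trans L j k x = lb_trans L i k x"
 using assms unfolding holomorphic_line_bundle_def by blast

lemma lb_trans_nz:
 assumes "holomorphic_line_bundle X L" "i \<in> lb_index L" "x \<in> lb_dom L i"
  "j \<in> lb_index L" "x \<in> lb_dom L j"
 shows "lb_trans L i j x \<noteq> 0"
 using assms unfolding holomorphic_line_bundle_def by blast

lemma lb_norm2_eq:
 assumes L: "holomorphic_line_bundle X L" "hermitian_metric X L h"
  and v: "!!i j. i \<in> lb_index L ==> j \<in> lb_index L ==> x \<in> lb_dom L i ==> x \<in> lb_dom L j ==>
   v i = lb_trans L i j x * v j"
  and i: "i \<in> lb_index L" "x \<in> lb_dom L i"
 shows "lb_norm2 L h x v = (cmod (v i))\<^sup>2 * h i x"
proof -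
 define j where "j = (SOME i. i \<in> lb_index L \<and> x \<in> lb_dom L i)"
 have j: "j \<in> lb_index L" "x \<in> lb_dom L j"
  unfolding j_def using someI_ex[of "\<lambda>i. i \<in> lb_index L \<and> x \<in> lb_dom L i"] i by blast+
 have h: "h j x = (cmod (lb_trans L i j x))\<^sup>2 * h i x"
  using L(2) i j unfolding hermitian_metric_def by blast
 have "v i = lb_trans L i j x * v j" by (rule v[OF i(1) j(1) i(2) j(2)])
 then have eq: "(cmod (v i))\<^sup>2 * h i x = (cmod (v j))\<^sup>2 * ((cmod (lb_trans L i j x))\<^sup>2 * h i x)"
  by (simp add: norm_mult power_mult_distrib)
 show ?thesis unfolding lb_norm2_def Let_def j_def[symmetric] h by (rule eq[symmetric])
qed

context cmanifold
begin

lemma line_bundle_tensor: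
 assumes "holomorphic_line_bundle X L" "holomorphic_line_bundle X M"
 shows "holomorphic_line_bundle X (lb_tensor L M)"
 unfolding holomorphic_line_bundle_def
proof (intro conjI ballI)
 fix a assume "a \<in> lb_index (lb_tensor L M)"
 then show "open (lb_dom (lb_tensor L M) a)"
  using assms unfolding holomorphic_line_bundle_def by (auto simp: lb_tensor_def)
next
 have "\<exists>i\<in>lb_index L. x \<in> lb_dom L i" "\<exists>i\<in>lb_index M. x \<in> lb_dom M i" for x
  using assms unfolding holomorphic_line_bundle_def by blast+
 then show "(\<Union>i\<in>lb_index (lb_tensor L M). lb_dom (lb_tensor L M) i) = UNIV"
  by (force simp: lb_tensor_def)
next
 fix a b assume a: "a \<in> lb_index (lb_tensor L M)" and b: "b \<in> lb_index (lb_tensor L M)"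
 obtain i j i' j' where ij: "a = (i, j)" "b = (i', j')" by (cases a, cases b)
 have I: "i \<in> lb_index L" "j \<in> lb_index M" "i' \<in> lb_index L" "j' \<in> lb_index M"
  using a b ij by (auto simp: lb_tensor_def)
 have h: "holo_fun X (lb_dom L i \<inter> lb_dom L i') (lb_trans L i i')"
  "holo_fun X (lb_dom M j \<inter> lb_dom M j') (lb_trans M j j')"
  using assms I unfolding holomorphic_line_bundle_def by blast+
 show "holo_fun X (lb_dom (lb_tensor L M) a \<inter> lb_dom (lb_tensor L M) b) (lb_trans (lb_tensor L M) a b)"
  unfolding ij lb_tensor_def
  by (simp, rule holo_fun_mult[OF holo_fun_subset[OF h(1)] holo_fun_subset[OF h(2)]]) auto
 fix x assume "x \<in> lb_dom (lb_tensor L M) a \<inter> lb_dom (lb_tensor L M) b"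
 then show "lb_trans (lb_tensor L M) a b x \<noteq> 0"
  using lb_trans_nz[OF assms(1) I(1) _ I(3)] lb_trans_nz[OF assms(2) I(2) _ I(4)]
  by (auto simp: ij lb_tensor_def)
next
 fix a b c x assume abc: "a \<in> lb_index (lb_tensor L M)" "b \<in> lb_index (lb_tensor L M)" "c \<in> lb_index (lb_tensor L M)"
  "x \<in> lb_dom (lb_tensor L M) a \<inter> lb_dom (lb_tensor L M) b \<inter> lb_dom (lb_tensor L M) c"
 obtain i j i' j' i'' j'' where ij: "a = (i, j)" "b = (i', j')" "c = (i'', j'')" by (cases a, cases b, cases c)
 have "lb_trans L i i' x * lb_trans L i' i'' x = lb_trans L i i'' x"
  by (rule lb_trans_cocycle[OF assms(1)]) (use abc in \<open>auto simp: ij lb_tensor_def\<close>)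
 moreover have "lb_trans M j j' x * lb_trans M j' j'' x = lb_trans M j j'' x"
  by (rule lb_trans_cocycle[OF assms(2)]) (use abc in \<open>auto simp: ij lb_tensor_def\<close>)
 moreover have "lb_trans L i i' x * lb_trans M j j' x * (lb_trans L i' i'' x * lb_trans M j' j'' x) =
  (lb_trans L i i' x * lb_trans L i' i'' x) * (lb_trans M j j' x * lb_trans M j' j'' x)" by (simp only: mult_ac)
 ultimately show "lb_trans (lb_tensor L M) a b x * lb_trans (lb_tensor L M) b c x = lb_trans (lb_tensor L M) a c x"
  by (simp add: ij lb_tensor_def)
qed

lemma line_bundle_dual:
 assumes "holomorphic_line_bundle X L"
 shows "holomorphic_line_bundle X (lb_dual L)"
 using assms lb_trans_nz[OF assms]
 unfolding holomorphic_line_bundle_def lb_dual_def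
 by (auto intro!: holo_fun_inverse simp flip: inverse_mult_distrib)

lemma transition_compose:
 assumes "c \<in> X" "d \<in> X" "e \<in> X" "x \<in> fst c" "x \<in> fst d" "x \<in> fst e"
 shows "fd (transition c e) (snd c x) = fd (transition d e) (snd d x) \<circ> fd (transition c d) (snd c x)"
proof -
 have op: "open (snd c ` (fst c \<inter> (fst d \<inter> fst e)))"
  by (rule chart_image_open[OF assms(1)], intro open_Int chart(1) assms)
 have "fd (transition c e) (snd c x) = fd (\<lambda>w. transition d e (transition c d w)) (snd c x)"
 proof (rule fd_cong_open[OF op])
  fix w assume "w \<in> snd c ` (fst c \<inter> (fst d \<inter> fst e))"
  then obtain x' where "x' \<in> fst c" "x' \<in> fst d" "w = snd c x'" by auto
  then show "transition c e w = transition d e (transition c d w)"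
   using assms transition_eq by simp
 qed (use assms in auto)
 also have "... = (\<lambda>v. fd (transition d e) (snd d x) (fd (transition c d) (snd c x) v))"
 proof (rule fd_eq, rule fd_compose[OF transition_holo[OF assms(1,2)]])
  show "(transition d e has_derivative fd (transition d e) (snd d x)) (at (transition c d (snd c x)))"
   unfolding transition_eq[OF assms(1,4)]
   by (rule holo_map_onD(1)[OF transition_holo[OF assms(2,3)]]) (use assms in auto)
 qed (use assms in auto)
 finally show ?thesis by (simp add: o_def)
qed

lemma transition_self: "c \<in> X ==> x \<in> fst c ==> fd (transition c c) (snd c x) = id"
proof -
 assume c: "c \<in> X" "x \<in> fst c"
 have "fd (transition c c) (snd c x) = fd (\<lambda>w. w) (snd c x)"
  by (rule fd_cong_open[OF chart(2)[OF c(1)]])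
   (use c chart(5)[OF c(1)] in \<open>auto simp: transition_def chart(4)[OF c(1)]\<close>)
 also have "... = id" using fd_eq[OF has_derivative_ident] by (simp add: id_def)
 finally show ?thesis .
qed

lemma transition_linear:
 assumes "c \<in> X" "d \<in> X" "x \<in> fst c" "x \<in> fst d"
 shows "linear (fd (transition c d) (snd c x))" "fd (transition c d) (snd c x) (s *s v) = s *s fd (transition c d) (snd c x) v"
  "Vector_Spaces.linear (*s) (*s) (fd (transition c d) (snd c x))"
proof -
 have w: "snd c x \<in> snd c ` (fst c \<inter> fst d)" using assms by auto
 show l: "linear (fd (transition c d) (snd c x))"
  using holo_map_onD(1)[OF transition_holo[OF assms(1,2)] w] has_derivative_linear by blast
 show "fd (transition c d) (snd c x) (s *s v) = s *s fd (transition c d) (snd c x) v" for s v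
  by (rule holo_map_onD(2)[OF transition_holo[OF assms(1,2)] w])
 then show "Vector_Spaces.linear (*s) (*s) (fd (transition c d) (snd c x))"
  by (intro Vector_Spaces.linear_iff[THEN iffD2] conjI vec.vector_space_axioms) (use l in \<open>auto simp: linear_add\<close>)
qed

definition jdet :: "('a, 'k) chart => ('a, 'k) chart => 'a => complex" where
 "jdet c d x = det (matrix (fd (transition c d) (snd c x)))"

lemma jdet_cocycle:
 assumes "c \<in> X" "d \<in> X" "e \<in> X" "x \<in> fst c" "x \<in> fst d" "x \<in> fst e"
 shows "jdet c d x * jdet d e x = jdet c e x"
 unfolding jdet_def transition_compose[OF assms]
 using transition_linear(3) assms by (subst matrix_compose_gen) (auto simp: det_mul mult.commute)

lemma jdet_self: "c \<in> X ==> x \<in> fst c ==> jdet c c x = 1"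
 unfolding jdet_def by (simp add: transition_self matrix_id_mat_1)

lemma jdet_nz:
 assumes "c \<in> X" "d \<in> X" "x \<in> fst c" "x \<in> fst d"
 shows "jdet c d x \<noteq> 0"
 using jdet_cocycle[of c d c x] jdet_self[of c x] assms by auto

lemma jdet_holo:
 assumes "c \<in> X" "d \<in> X"
 shows "holo_fun X (fst c \<inter> fst d) (jdet c d)"
proof (rule holo_fun_chart[OF assms(1)])
 show op: "open (fst c \<inter> fst d)" by (intro open_Int chart(1) assms)
 let ?W = "snd c ` (fst c \<inter> fst d)"
 have opW: "open ?W" by (rule chart_image_open[OF assms(1) chart(1)[OF assms(2)]])
 have "holo_on ?W (\<lambda>w. det (matrix (fd (transition c d) w)))"
 proof (rule holo_on_det)
  fix i j
  have "holo_on ?W (\<lambda>w. fd (\<lambda>w. transition c d w $ i) w (axis j 1))"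
   by (rule holo_on_fd[OF _ opW]) (use transition_holo[OF assms] in \<open>auto simp: holo_map_on_def\<close>)
  then show "holo_on ?W (\<lambda>w. matrix (fd (transition c d) w) $ i $ j)"
   by (rule holo_on_cong[OF _ opW]) (simp add: matrix_def holo_map_onD(3)[OF transition_holo[OF assms]])
 qed
 then show "holo_on ?W (\<lambda>w. jdet c d (cinv c w))"
  by (rule holo_on_cong[OF _ opW]) (use chart(5)[OF assms(1)] in \<open>auto simp: jdet_def\<close>)
qed auto

lemma canonical_bundle_holomorphic: "holomorphic_line_bundle X (canonical_bundle X)"
 unfolding holomorphic_line_bundle_def
proof (intro conjI ballI)
 show "(\<Union>i\<in>lb_index (canonical_bundle X). lb_dom (canonical_bundle X) i) = UNIV"
  using chart_at by (auto simp: canonical_bundle_def)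
 fix c d assume "c \<in> lb_index (canonical_bundle X)" "d \<in> lb_index (canonical_bundle X)"
 then have cd: "c \<in> X" "d \<in> X" by (auto simp: canonical_bundle_def)
 show "holo_fun X (lb_dom (canonical_bundle X) c \<inter> lb_dom (canonical_bundle X) d) (lb_trans (canonical_bundle X) c d)"
  using jdet_holo[OF cd] unfolding jdet_def[abs_def] by (simp add: canonical_bundle_def)
qed (use chart(1) jdet_nz jdet_cocycle in \<open>auto simp: canonical_bundle_def jdet_def\<close>)

end

section \<open>Submersions and fibre volumes\<close>

locale submersion = X: cmanifold X + Y: cmanifold Y
 for X :: "('a::{t2_space,second_countable_topology}, 'k::finite) chart set"
  and Y :: "('b::{t2_space,second_countable_topology}, 'm::finite) chart set" +
 fixes p :: "'a => 'b"
 assumes sub: "holomorphic_submersion X Y p"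
begin

lemma p_cont: "continuous_on UNIV p" "open V ==> open (p -` V)"
 using sub unfolding holomorphic_submersion_def by (auto intro: open_vimage)

lemma p_holo:
 assumes "c \<in> X" "d \<in> Y"
 shows "holo_map_on (snd c ` (fst c \<inter> p -` fst d)) (\<lambda>w. snd d (p (cinv c w)))"
  "x \<in> fst c ==> p x \<in> fst d ==> surj (fd (\<lambda>w. snd d (p (cinv c w))) (snd c x))"
 using sub assms unfolding holomorphic_submersion_def o_def by (cases c; cases d; fastforce)+

lemma adapted_iff:
 "(c, d, io) \<in> adapted_charts X Y p \<longleftrightarrow> c \<in> X \<and> d \<in> Y \<and> inj io \<and> p ` fst c \<subseteq> fst d \<and>
  (\<forall>x\<in>fst c. \<forall>j. snd c x $ io j = snd d (p x) $ j)"
 by (cases c; cases d) (simp add: adapted_charts_def)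

text \<open>The normal form of a submersion: the coordinates selected by
  \<open>surjective_coordinates\<close> are replaced by those of \<open>p\<close>, the resulting map
  is invertible near the point, and \<open>atlas_compose\<close> makes it a chart.\<close>

lemma adapted_exists:
 assumes "open N" "x \<in> N"
 shows "\<exists>c d io. (c, d, io) \<in> adapted_charts X Y p \<and> x \<in> fst c \<and> fst c \<subseteq> N"
proof -
 obtain c where c: "c \<in> X" "x \<in> fst c" using X.chart_at by blast
 obtain d where d: "d \<in> Y" "p x \<in> fst d" using Y.chart_at by blast
 define W where "W = p -` fst d \<inter> N"
 have W: "open W" "x \<in> W" unfolding W_def using p_cont(2)[OF Y.chart(1)[OF d(1)]] assms d by auto
 define Om where "Om = snd c ` (fst c \<inter> W)"
 have op: "open Om" unfolding Om_def by (rule X.chart_image_open[OF c(1) W(1)])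
 define P where "P w = snd d (p (cinv c w))" for w
 have P: "holo_map_on Om P"
  unfolding Om_def P_def by (rule holo_map_on_subset[OF p_holo(1)[OF c(1) d(1)]]) (auto simp: W_def)
 have z0: "snd c x \<in> Om" unfolding Om_def using c W by auto
 let ?D = "fd P (snd c x)"
 have linD: "linear ?D" using holo_map_onD(1)[OF P z0] has_derivative_linear by blast
 have "surj ?D" unfolding P_def by (rule p_holo(2)[OF c(1) d(1) c(2) d(2)])
 then obtain io :: "'m => 'k" where io: "inj io"
  "inj (\<lambda>h. \<chi> k. if k \<in> range io then ?D h $ inv io k else h $ k)"
  using surjective_coordinates[OF linD holo_map_onD(2)[OF P z0]] by blast
 define G where "G w = (\<chi> k. if k \<in> range io then P w $ inv io k else w $ k)" for w
 have G: "holo_map_on Om G" unfolding holo_map_on_def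
 proof
  fix k show "holo_on Om (\<lambda>z. G z $ k)"
   using P unfolding G_def holo_map_on_def by (cases "k \<in> range io") auto
 qed
 have derG: "(G has_derivative (\<lambda>h. \<chi> k. if k \<in> range io then ?D h $ inv io k else h $ k)) (at (snd c x))"
 proof (rule has_derivative_vecI)
  fix k
  show "((\<lambda>z. G z $ k) has_derivative (\<lambda>v. (\<chi> k. if k \<in> range io then ?D v $ inv io k else v $ k) $ k)) (at (snd c x))"
   unfolding G_def using has_derivative_nth[OF holo_map_onD(1)[OF P z0], of "inv io k"] has_derivative_nth[OF has_derivative_ident, of k]
   by (cases "k \<in> range io") auto
 qed
 have "inj (fd G (snd c x))" unfolding fd_eq[OF derG] by (rule io(2))
 from holo_inverse_function[OF op G z0 this]
 obtain U1 V1 g where U1: "open U1" "U1 \<subseteq> Om" "snd c x \<in> U1" "open V1" "G ` U1 = V1" and g: "!!z. z \<in> U1 ==> g (G z) = z" "holo_map_on V1 g"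
  by blast
 define U' where "U' = snd c -` U1 \<inter> fst c"
 have U': "open U'" unfolding U'_def
  using continuous_on_open_vimage[OF X.chart(1)[OF c(1)], of "snd c"] X.chart(7)[OF c(1)] U1(1) by blast
 have im: "snd c ` U' = U1"
 proof -
  have "U1 \<subseteq> snd c ` fst c" using U1(2) unfolding Om_def by blast
  then show ?thesis unfolding U'_def by auto
 qed
 have U'W: "U' \<subseteq> W"
 proof
  fix x' assume x': "x' \<in> U'"
  then have "snd c x' \<in> snd c ` (fst c \<inter> W)" using U1(2) unfolding U'_def Om_def by blast
  then obtain x'' where "x'' \<in> fst c" "x'' \<in> W" "snd c x' = snd c x''" by auto
  then show "x' \<in> W" using inj_onD[OF X.chart(3)[OF c(1)]] x' unfolding U'_def by blast
 qed
 have "(U', G \<circ> snd c) \<in> X"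
  by (rule X.atlas_compose[OF c(1) U', of G g])
   (use U1 im g holo_map_on_subset[OF G] in \<open>auto simp: U'_def\<close>)
 moreover have "(G \<circ> snd c) x' $ io j = snd d (p x') $ j" if "x' \<in> U'" for x' j
  using that X.chart(4)[OF c(1), of x'] by (simp add: G_def P_def inv_f_f[OF io(1)] U'_def)
 ultimately have "((U', G \<circ> snd c), d, io) \<in> adapted_charts X Y p"
  unfolding adapted_iff using d io U'W by (auto simp: W_def)
 moreover have "x \<in> U'" using U1 c by (simp add: U'_def)
 ultimately show ?thesis
  using U'W by (intro exI[of _ "(U', G \<circ> snd c)"] exI[of _ d] exI[of _ io]) (auto simp: W_def)
qed

definition reltrans :: "('a, 'k) chart \<times> ('b, 'm) chart => ('a, 'k) chart \<times> ('b, 'm) chart => 'a => complex" where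
 "reltrans = lb_trans (relative_canonical_bundle X Y p)"

lemma reltrans_eq: "reltrans (c, d) (c', d') x = X.jdet c c' x * inverse (Y.jdet d d' (p x))"
 unfolding reltrans_def relative_canonical_bundle_def lb_tensor_def lb_dual_def lb_pullback_def canonical_bundle_def
  X.jdet_def Y.jdet_def by simp

lemma relcan_simps [simp]:
 "lb_index (relative_canonical_bundle X Y p) = X \<times> Y"
 "lb_dom (relative_canonical_bundle X Y p) (c, d) = fst c \<inter> p -` fst d"
 "lb_trans (relative_canonical_bundle X Y p) = reltrans"
 unfolding reltrans_def relative_canonical_bundle_def lb_tensor_def lb_dual_def lb_pullback_def canonical_bundle_def
 by auto

lemma holo_fun_pullback:
 assumes "holo_fun Y V f" "open V"
 shows "holo_fun X (p -` V) (\<lambda>x. f (p x))"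
proof (rule X.holo_funI)
 fix x assume x: "x \<in> p -` V"
 obtain c where c: "c \<in> X" "x \<in> fst c" using X.chart_at by blast
 obtain d where d: "d \<in> Y" "p x \<in> fst d" using Y.chart_at by blast
 let ?N = "fst c \<inter> p -` (fst d \<inter> V)"
 have op: "open ?N" using p_cont(2)[of "fst d \<inter> V"] X.chart(1)[OF c(1)] Y.chart(1)[OF d(1)] assms(2) by (auto intro: open_Int)
 have opN: "open (snd c ` ?N)" by (rule X.chart(9)[OF c(1) _ op]) auto
 have "holo_on (snd c ` ?N) (\<lambda>w. f (cinv d (snd d (p (cinv c w)))))"
  by (rule holo_on_compose[OF holo_map_on_subset[OF p_holo(1)[OF c(1) d(1)]] holo_funD[OF assms(1) d(1)] ])
   (auto simp: X.chart(4)[OF c(1)])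
 then have "holo_on (snd c ` ?N) (\<lambda>w. f (p (cinv c w)))"
  by (rule holo_on_cong[OF _ opN]) (auto simp: X.chart(4)[OF c(1)] Y.chart(4)[OF d(1)])
 then show "\<exists>c\<in>X. \<exists>N. open N \<and> x \<in> N \<and> N \<subseteq> fst c \<and> holo_on (snd c ` N) (\<lambda>w. f (p (cinv c w)))"
  using c d x op by (intro bexI[OF _ c(1)] exI[of _ ?N]) auto
qed

lemma relcan_holomorphic: "holomorphic_line_bundle X (relative_canonical_bundle X Y p)"
 unfolding relative_canonical_bundle_def
proof (intro X.line_bundle_tensor X.line_bundle_dual X.canonical_bundle_holomorphic)
 have K: "holomorphic_line_bundle Y (canonical_bundle Y)" by (rule Y.canonical_bundle_holomorphic)
 have "\<exists>i\<in>lb_index (canonical_bundle Y). y \<in> lb_dom (canonical_bundle Y) i" for y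
  using K unfolding holomorphic_line_bundle_def by blast
 then have cov: "(\<Union>i\<in>lb_index (lb_pullback p (canonical_bundle Y)). lb_dom (lb_pullback p (canonical_bundle Y)) i) = UNIV"
  by (auto simp: lb_pullback_def)
 show "holomorphic_line_bundle X (lb_pullback p (canonical_bundle Y))"
  unfolding holomorphic_line_bundle_def
 proof (intro conjI ballI cov)
  fix i j assume "i \<in> lb_index (lb_pullback p (canonical_bundle Y))" "j \<in> lb_index (lb_pullback p (canonical_bundle Y))"
  then have ij: "i \<in> lb_index (canonical_bundle Y)" "j \<in> lb_index (canonical_bundle Y)" by (auto simp: lb_pullback_def)
  then have "holo_fun Y (lb_dom (canonical_bundle Y) i \<inter> lb_dom (canonical_bundle Y) j) (lb_trans (canonical_bundle Y) i j)"
   "open (lb_dom (canonical_bundle Y) i \<inter> lb_dom (canonical_bundle Y) j)"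
   using K unfolding holomorphic_line_bundle_def by blast+
  from holo_fun_pullback[OF this]
  show "holo_fun X (lb_dom (lb_pullback p (canonical_bundle Y)) i \<inter> lb_dom (lb_pullback p (canonical_bundle Y)) j) (lb_trans (lb_pullback p (canonical_bundle Y)) i j)"
   by (simp add: lb_pullback_def)
 qed (use Y.canonical_bundle_holomorphic p_cont(2) in \<open>auto simp: holomorphic_line_bundle_def lb_pullback_def\<close>)
qed

lemma reltrans:
 assumes "c \<in> X" "d \<in> Y" "x \<in> fst c" "p x \<in> fst d" "c' \<in> X" "d' \<in> Y" "x \<in> fst c'" "p x \<in> fst d'"
 shows "reltrans (c, d) (c', d') x \<noteq> 0" "reltrans (c, d) (c, d) x = 1"
  "c'' \<in> X ==> d'' \<in> Y ==> x \<in> fst c'' ==> p x \<in> fst d'' ==>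
   reltrans (c, d) (c', d') x * reltrans (c', d') (c'', d'') x = reltrans (c, d) (c'', d'') x"
 using lb_trans_nz[OF relcan_holomorphic, of "(c, d)" x "(c', d')"] lb_trans_self[OF relcan_holomorphic, of "(c, d)" x]
  lb_trans_cocycle[OF relcan_holomorphic, of "(c, d)" x "(c', d')" "(c'', d'')"] assms by auto

end

section \<open>Existence and uniqueness of the volume measure on a fibre\<close>

context cmanifold
begin

lemma chart_image_borel:
 assumes "c \<in> X" "S \<in> sets borel" "S \<subseteq> fst c"
 shows "snd c ` S \<in> sets borel"
proof -
 have B: "snd c ` fst c \<in> sets borel" using chart(2)[OF assms(1)] by simp
 have "cinv c \<in> borel_measurable (restrict_space borel (snd c ` fst c))"
  by (rule borel_measurable_continuous_on_restrict[OF chart(8)[OF assms(1)]])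
 from measurable_sets[OF this assms(2)]
 have "cinv c -` S \<inter> snd c ` fst c \<in> sets (restrict_space borel (snd c ` fst c))"
  by (simp add: space_restrict_space)
 then have "cinv c -` S \<inter> snd c ` fst c \<in> sets borel"
  using B by (subst (asm) sets_restrict_space_iff) auto
 moreover have "cinv c -` S \<inter> snd c ` fst c = snd c ` S"
 proof (intro equalityI subsetI)
  fix w assume "w \<in> cinv c -` S \<inter> snd c ` fst c"
  then show "w \<in> snd c ` S" using chart(5)[OF assms(1), of w] by (metis IntD1 IntD2 image_eqI vimage_eq)
 next
  fix w assume "w \<in> snd c ` S"
  then show "w \<in> cinv c -` S \<inter> snd c ` fst c" using chart(4)[OF assms(1)] assms(3) by auto
 qed
 ultimately show ?thesis by simp
qed

end

locale fibre_section = submersion X Y p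
 for X :: "('a::{t2_space,second_countable_topology}, 'k::finite) chart set"
  and Y :: "('b::{t2_space,second_countable_topology}, 'm::finite) chart set"
  and p :: "'a => 'b" +
 fixes M :: "('i, 'a) line_bundle" and h :: "'i => 'a => real" and y :: 'b
  and u :: "'a => (('a, 'k) chart \<times> ('b, 'm) chart) \<times> 'i => complex"
 assumes M: "holomorphic_line_bundle X M" and h: "hermitian_metric X M h"
  and u: "u \<in> direct_image_fibre X Y p M y"
begin

definition dens :: "('a, 'k) chart => ('b, 'm) chart => 'a => real" where
 "dens c d x = lb_norm2 M h x (\<lambda>i. u x ((c, d), i))"

text \<open>The value that \<open>fibre_volume\<close> prescribes for \<open>S\<close> in one
  adapted chart, kept apart because that measure is available only after independence of the chart
  has been shown.\<close>

definition mass :: "('a, 'k) chart => ('b, 'm) chart => ('m => 'k) => 'a set => ennreal" where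
 "mass c d io S = (\<integral>\<^sup>+z. indicator (snd c ` (S \<inter> p -` {y})) (slice_point io (snd d y) z) *
   ennreal (dens c d (cinv c (slice_point io (snd d y) z))) \<partial>slice_lborel io)"

lemma u_trans:
 assumes "p x = y" "c \<in> X" "d \<in> Y" "i \<in> lb_index M" "x \<in> fst c" "p x \<in> fst d" "x \<in> lb_dom M i"
  "c' \<in> X" "d' \<in> Y" "j \<in> lb_index M" "x \<in> fst c'" "p x \<in> fst d'" "x \<in> lb_dom M j"
 shows "u x ((c, d), i) = reltrans (c, d) (c', d') x * lb_trans M i j x * u x ((c', d'), j)"
proof -
 have "u x \<in> lb_fibre (lb_tensor (relative_canonical_bundle X Y p) M) x"
  using u assms(1) unfolding direct_image_fibre_def lb_sections_def by auto
 then have "\<forall>a\<in>lb_index (lb_tensor (relative_canonical_bundle X Y p) M). \<forall>b\<in>lb_index (lb_tensor (relative_canonical_bundle X Y p) M).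
   x \<in> lb_dom (lb_tensor (relative_canonical_bundle X Y p) M) a \<inter> lb_dom (lb_tensor (relative_canonical_bundle X Y p) M) b -->
    u x a = lb_trans (lb_tensor (relative_canonical_bundle X Y p) M) a b x * u x b"
  unfolding lb_fibre_def by blast
 from this[rule_format, of "((c, d), i)" "((c', d'), j)"] assms show ?thesis
  by (simp add: lb_tensor_def)
qed

lemma dens_eq:
 assumes "p x = y" "c \<in> X" "d \<in> Y" "x \<in> fst c" "p x \<in> fst d" "i \<in> lb_index M" "x \<in> lb_dom M i"
 shows "dens c d x = (cmod (u x ((c, d), i)))\<^sup>2 * h i x"
 unfolding dens_def
proof (rule lb_norm2_eq[OF M h _ assms(6,7)])
 fix i j assume ij: "i \<in> lb_index M" "j \<in> lb_index M" "x \<in> lb_dom M i" "x \<in> lb_dom M j"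
 show "u x ((c, d), i) = lb_trans M i j x * u x ((c, d), j)"
  using u_trans[OF assms(1-3) ij(1) assms(4,5) ij(3) assms(2,3) ij(2) assms(4,5) ij(4)] reltrans(2)[of c d x] assms by simp
qed

lemma dom_at: "\<exists>i\<in>lb_index M. x \<in> lb_dom M i"
 using M unfolding holomorphic_line_bundle_def by blast

lemma h_pos: "i \<in> lb_index M ==> x \<in> lb_dom M i ==> h i x > 0"
 using h unfolding hermitian_metric_def by blast

lemma dens_nonneg:
 assumes "p x = y" "c \<in> X" "d \<in> Y" "x \<in> fst c" "p x \<in> fst d"
 shows "dens c d x \<ge> 0"
 using dom_at[of x] dens_eq[OF assms] h_pos[of _ x] by (metis less_imp_le mult_nonneg_nonneg zero_le_power2)

lemma dens_change:
 assumes "p x = y" "c \<in> X" "d \<in> Y" "x \<in> fst c" "p x \<in> fst d" "c' \<in> X" "d' \<in> Y" "x \<in> fst c'" "p x \<in> fst d'"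
 shows "dens c d x = (cmod (reltrans (c, d) (c', d') x))\<^sup>2 * dens c' d' x"
proof -
 obtain i where i: "i \<in> lb_index M" "x \<in> lb_dom M i" using dom_at by blast
 have "u x ((c, d), i) = reltrans (c, d) (c', d') x * u x ((c', d'), i)"
  using u_trans[OF assms(1-3) i(1) assms(4,5) i(2) assms(6,7) i(1) assms(8,9) i(2)] lb_trans_self[OF M i] by simp
 then show ?thesis
  unfolding dens_eq[OF assms(1-5) i] dens_eq[OF assms(1,6-9) i] by (simp add: norm_mult power_mult_distrib)
qed

text \<open>A section over a fibre is locally the restriction of an ambient holomorphic function,
  which gives continuity along the fibre.\<close>

lemma dens_continuous:
 assumes "c \<in> X" "d \<in> Y"
 shows "continuous_on (fst c \<inter> p -` fst d \<inter> p -` {y}) (dens c d)" (is "continuous_on ?T _")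
 unfolding continuous_on_eq_continuous_within
proof
 fix x assume x: "x \<in> ?T"
 obtain i where i: "i \<in> lb_index M" "x \<in> lb_dom M i" using dom_at by blast
 let ?a = "((c, d), i)"
 have dom: "lb_dom (lb_tensor (relative_canonical_bundle X Y p) M) ?a = fst c \<inter> p -` fst d \<inter> lb_dom M i"
  by (simp add: lb_tensor_def)
 have "?a \<in> lb_index (lb_tensor (relative_canonical_bundle X Y p) M)"
  using assms i by (simp add: lb_tensor_def)
 then have "holo_fun_sub X (p -` {y} \<inter> (fst c \<inter> p -` fst d \<inter> lb_dom M i)) (\<lambda>x. u x ?a)"
  using u unfolding direct_image_fibre_def lb_sections_def dom[symmetric] by blast
 moreover have "x \<in> p -` {y} \<inter> (fst c \<inter> p -` fst d \<inter> lb_dom M i)" using x i by auto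
 ultimately obtain W F where W: "open W" "x \<in> W" "holo_fun X W F"
  and F: "\<forall>x'\<in>W \<inter> (p -` {y} \<inter> (fst c \<inter> p -` fst d \<inter> lb_dom M i)). u x' ?a = F x'"
  unfolding holo_fun_sub_def by blast
 have di: "open (lb_dom M i)" using M i unfolding holomorphic_line_bundle_def by blast
 have hi: "smooth_fun X (lb_dom M i) (h i)" using h i unfolding hermitian_metric_def by blast
 let ?W = "W \<inter> lb_dom M i"
 have "continuous_on ?W (\<lambda>x. (cmod (F x))\<^sup>2 * h i x)"
  by (intro continuous_intros continuous_on_subset[OF X.holo_fun_continuous[OF W(3,1)]]
    continuous_on_subset[OF X.smooth_fun_continuous[OF hi di]]) auto
 then have "continuous_on (?T \<inter> ?W) (\<lambda>x. (cmod (F x))\<^sup>2 * h i x)"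
  by (rule continuous_on_subset) auto
 then have "continuous_on (?T \<inter> ?W) (dens c d)"
 proof (rule continuous_on_eq)
  fix x' assume x': "x' \<in> ?T \<inter> ?W"
  have "u x' ?a = F x'" using F x' by blast
  then show "(cmod (F x'))\<^sup>2 * h i x' = dens c d x'"
   using dens_eq[of x' c d i] x' assms i(1) by auto
 qed
 then have "continuous (at x within ?T \<inter> ?W) (dens c d)"
  unfolding continuous_on_eq_continuous_within by (rule bspec) (use x W(2) i(2) in auto)
 moreover have "at x within ?T \<inter> ?W = at x within ?T"
  by (rule at_within_nhd[of x ?W]) (use W di i in auto)
 ultimately show "continuous (at x within ?T) (dens c d)" by simp
qed

lemma adaptedD:
 assumes "(c, d, io) \<in> adapted_charts X Y p"
 shows "c \<in> X" "d \<in> Y" "inj io" "x \<in> fst c ==> p x \<in> fst d" "x \<in> fst c ==> snd c x $ io j = snd d (p x) $ j"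
 using assms unfolding adapted_iff by blast+

lemma fibre_borel: "p -` {y} \<in> sets borel"
 using p_cont(1) by (intro borel_closed closed_vimage) auto

lemma mass_integrand_measurable:
 assumes "(c, d, io) \<in> adapted_charts X Y p" "S \<in> sets borel" "S \<subseteq> fst c"
 shows "(\<lambda>w. indicator (snd c ` (S \<inter> p -` {y})) w * ennreal (dens c d (cinv c w))) \<in> borel_measurable borel"
proof -
 note ad = adaptedD[OF assms(1)]
 let ?B = "snd c ` (fst c \<inter> p -` {y})"
 have B: "?B \<in> sets borel"
  by (rule X.chart_image_borel[OF ad(1)]) (use X.chart(1)[OF ad(1)] fibre_borel in auto)
 have "continuous_on ?B (\<lambda>w. dens c d (cinv c w))"
  by (rule continuous_on_compose2[OF dens_continuous[OF ad(1,2)] continuous_on_subset[OF X.chart(8)[OF ad(1)]]])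
   (use ad(4) X.chart(4)[OF ad(1)] in auto)
 from borel_measurable_continuous_on_indicator[OF B this]
 have "(\<lambda>w. indicator ?B w *\<^sub>R dens c d (cinv c w)) \<in> borel_measurable borel" .
 moreover have "snd c ` (S \<inter> p -` {y}) \<in> sets borel"
  by (rule X.chart_image_borel[OF ad(1)]) (use assms fibre_borel in auto)
 ultimately have "(\<lambda>w. indicator (snd c ` (S \<inter> p -` {y})) w * ennreal (indicator ?B w *\<^sub>R dens c d (cinv c w))) \<in> borel_measurable borel"
  by measurable
 moreover have "(\<lambda>w. indicator (snd c ` (S \<inter> p -` {y})) w * ennreal (indicator ?B w *\<^sub>R dens c d (cinv c w)))
   = (\<lambda>w. indicator (snd c ` (S \<inter> p -` {y})) w * ennreal (dens c d (cinv c w)))"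
  using assms(3) by (auto simp: fun_eq_iff indicator_def)
 ultimately show ?thesis by simp
qed

lemma mass_suminf:
 assumes "(c, d, io) \<in> adapted_charts X Y p" "!!n::nat. S n \<in> sets borel" "!!n. S n \<subseteq> fst c" "disjoint_family S"
 shows "mass c d io (\<Union>n. S n) = (\<Sum>n. mass c d io (S n))"
proof -
 note ad = adaptedD[OF assms(1)]
 let ?s = "slice_point io (snd d y)"
 have "(\<Sum>n. mass c d io (S n)) = (\<integral>\<^sup>+z. (\<Sum>n. indicator (snd c ` (S n \<inter> p -` {y})) (?s z) *
   ennreal (dens c d (cinv c (?s z)))) \<partial>slice_lborel io)"
  unfolding mass_def
  by (rule nn_integral_suminf[symmetric])
   (rule measurable_compose[OF slice_point_measurable mass_integrand_measurable[OF assms(1-3)]])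
 also have "... = mass c d io (\<Union>n. S n)"
  unfolding mass_def
 proof (rule nn_integral_cong)
  fix z
  have "disjoint_family (\<lambda>n. snd c ` (S n \<inter> p -` {y}))"
   unfolding disjoint_family_on_def
  proof (intro ballI impI)
   fix m n :: nat assume "m \<noteq> n"
   then have "S m \<inter> S n = {}" using assms(4) by (simp add: disjoint_family_on_def)
   then show "snd c ` (S m \<inter> p -` {y}) \<inter> snd c ` (S n \<inter> p -` {y}) = {}"
    using inj_onD[OF X.chart(3)[OF ad(1)]] assms(3) by blast
  qed
  moreover have im: "(\<Union>n. snd c ` (S n \<inter> p -` {y})) = snd c ` ((\<Union>n. S n) \<inter> p -` {y})" by blast
  ultimately
  have "(\<Sum>n. indicator (snd c ` (S n \<inter> p -` {y})) (?s z) :: ennreal) = indicator (snd c ` ((\<Union>n. S n) \<inter> p -` {y})) (?s z)"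
   using suminf_indicator[of "\<lambda>n. snd c ` (S n \<inter> p -` {y})" "?s z"] by (simp only: im)
  then show "(\<Sum>n. indicator (snd c ` (S n \<inter> p -` {y})) (?s z) * ennreal (dens c d (cinv c (?s z))))
   = indicator (snd c ` ((\<Union>n. S n) \<inter> p -` {y})) (?s z) * ennreal (dens c d (cinv c (?s z)))"
   by simp
 qed
 finally show ?thesis by simp
qed

lemma mass_empty [simp]: "mass c d io {} = 0"
 unfolding mass_def by simp

lemma mass_no_fibre: "S \<inter> p -` {y} = {} ==> mass c d io S = 0"
 unfolding mass_def by simp

text \<open>On the fibre the modulus of \<open>reltrans\<close> is the quotient of the Jacobians of
  the transition maps upstairs and downstairs. Its square is precisely the factor in
  \<open>fibre_change_of_variables\<close>.\<close>

lemma mass_consistent: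
 assumes c: "(c, d, io) \<in> adapted_charts X Y p" and c': "(c', d', io') \<in> adapted_charts X Y p"
  and S: "S \<in> sets borel" "S \<subseteq> fst c \<inter> fst c'"
 shows "mass c d io S = mass c' d' io' S"
proof (cases "y \<in> fst d \<and> y \<in> fst d'")
 case False
 then have "S \<inter> p -` {y} = {}" using adaptedD(4)[OF c] adaptedD(4)[OF c'] S by blast
 then show ?thesis by (simp add: mass_no_fibre)
next
 case True
 note ad = adaptedD[OF c] and ad' = adaptedD[OF c']
 define Om where "Om = snd c ` (fst c \<inter> fst c')"
 define Ph where "Ph = transition c c'"
 have op: "open Om" unfolding Om_def by (rule X.chart_image_open[OF ad(1) X.chart(1)[OF ad'(1)]])
 have Ph: "holo_map_on Om Ph" unfolding Om_def Ph_def by (rule X.transition_holo[OF ad(1) ad'(1)])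
 have Phx: "Ph (snd c x) = snd c' x" if "x \<in> fst c" for x unfolding Ph_def by (rule X.transition_eq[OF ad(1) that])
 have im: "Ph ` Om = snd c' ` (fst c' \<inter> fst c)" unfolding Om_def image_image by (rule image_cong) (auto simp: Phx)
 define A where "A = fd (transition d d') (snd d y)"
 have A: "linear A" "!!s v. A (s *s v) = s *s A v" "det (matrix A) \<noteq> 0"
  unfolding A_def using Y.transition_linear(1,2)[of d d' y] Y.jdet_nz[of d d' y] ad ad' True by (auto simp: Y.jdet_def)
 have base_y: "p x = y" if "x \<in> fst c" "!!j. snd c x $ io j = snd d y $ j" for x
 proof -
  have "snd d (p x) = snd d y" using that ad(5)[OF that(1)] by (simp add: vec_eq_iff)
  then show ?thesis using inj_onD[OF Y.chart(3)[OF ad(2)]] ad(4)[OF that(1)] True by blast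
 qed
 have base_y': "p x = y" if "x \<in> fst c'" "!!j. snd c' x $ io' j = snd d' y $ j" for x
 proof -
  have "snd d' (p x) = snd d' y" using that ad'(5)[OF that(1)] by (simp add: vec_eq_iff)
  then show ?thesis using inj_onD[OF Y.chart(3)[OF ad'(2)]] ad'(4)[OF that(1)] True by blast
 qed
 let ?f = "\<lambda>w. indicator (snd c' ` (S \<inter> p -` {y})) w * ennreal (dens c' d' (cinv c' w))"
 let ?s = "slice_point io (snd d y)" and ?s' = "slice_point io' (snd d' y)"
 have "(\<integral>\<^sup>+z. ?f (?s' z) * indicator (Ph ` Om) (?s' z) \<partial>slice_lborel io')
  = (\<integral>\<^sup>+z. ?f (Ph (?s z)) * ennreal ((cmod (det (matrix (fd Ph (?s z)))))\<^sup>2 / (cmod (det (matrix A)))\<^sup>2) *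
    indicator Om (?s z) \<partial>slice_lborel io)"
 proof (rule fibre_change_of_variables[OF ad(3) ad'(3) op Ph, where Ps = "transition c' c"])
  show "open (Ph ` Om)" unfolding im by (rule X.chart_image_open[OF ad'(1) X.chart(1)[OF ad(1)]])
  show "continuous_on (Ph ` Om) (transition c' c)"
   unfolding im by (rule holo_map_on_continuous[OF X.transition_holo[OF ad'(1) ad(1)]])
  show "linear A" "!!c v. A (c *s v) = c *s A v" "det (matrix A) \<noteq> 0" by (rule A)+
  show "?f \<in> borel_measurable borel" by (rule mass_integrand_measurable[OF c' S(1)]) (use S in auto)
 next
  fix w assume "w \<in> Om"
  then obtain x where x: "x \<in> fst c" "x \<in> fst c'" "w = snd c x" unfolding Om_def by auto
  show "transition c' c (Ph w) = w" unfolding x(3) Phx[OF x(1)] by (rule X.transition_eq[OF ad'(1) x(2)])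
  show "det (matrix (fd Ph w)) \<noteq> 0"
   using X.jdet_nz[OF ad(1) ad'(1) x(1,2)] unfolding X.jdet_def Ph_def x(3) .
  show "Ph w $ io' j = snd d' y $ j" if "!!j. w $ io j = snd d y $ j" for j
   using base_y[OF x(1)] that ad'(5)[OF x(2)] unfolding x(3) Phx[OF x(1)] by simp
  show "w $ io j = snd d y $ j" if "!!j. Ph w $ io' j = snd d' y $ j" for j
   using base_y'[OF x(2)] that ad(5)[OF x(1)] unfolding x(3) Phx[OF x(1)] by simp
  show "fd Ph w v $ io' j = A (\<chi> j. v $ io j) $ j" if wb: "!!j. w $ io j = snd d y $ j" for v j
  proof -
   have px: "p x = y" using base_y[OF x(1)] wb unfolding x(3) by blast
   let ?b = "\<lambda>w::complex^'k. (\<chi> j. w $ io j) :: complex^'m"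
   define W where "W = snd c ` (fst c \<inter> (fst c' \<inter> p -` (fst d \<inter> fst d')))"
   have opW: "open W"
    unfolding W_def by (intro X.chart_image_open[OF ad(1)] open_Int p_cont(2) X.chart(1) Y.chart(1) ad(2) ad'(1,2))
   have wW: "w \<in> W" unfolding W_def using x px True by auto
   have bw: "?b w = snd d y" using wb by (simp add: vec_eq_iff)
   have hb: "(?b has_derivative ?b) (at w)"
    by (rule has_derivative_vecI) (simp add: has_derivative_nth[OF has_derivative_ident])
   have T: "(transition d d' has_derivative A) (at (?b w))"
    unfolding bw A_def by (rule holo_map_onD(1)[OF Y.transition_holo[OF ad(2) ad'(2)]]) (use True in auto)
   \<comment> \<open>In adapted charts the base components of \<open>Ph\<close> are the transition
     map of the base applied to the base coordinates, on a whole neighbourhood of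
     \<open>w\<close>.\<close>
   have "((\<lambda>w. transition d d' (?b w) $ j) has_derivative (\<lambda>v. A (?b v) $ j)) (at w)"
    by (rule has_derivative_nth[OF has_derivative_compose[OF hb T]])
   then have "((\<lambda>w. Ph w $ io' j) has_derivative (\<lambda>v. A (?b v) $ j)) (at w)"
   proof (rule has_derivative_transform_within_open[OF _ opW wW])
    fix w' assume "w' \<in> W"
    then obtain x' where x': "x' \<in> fst c" "x' \<in> fst c'" "p x' \<in> fst d" "p x' \<in> fst d'" "w' = snd c x'"
     unfolding W_def by auto
    have "?b w' = snd d (p x')" using ad(5)[OF x'(1)] unfolding x'(5) by (simp add: vec_eq_iff)
    then show "transition d d' (?b w') $ j = Ph w' $ io' j"
     using Y.transition_eq[OF ad(2) x'(3)] ad'(5)[OF x'(2)] unfolding x'(5) Phx[OF x'(1)] by simp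
   qed
   then have "fd (\<lambda>w. Ph w $ io' j) w v = A (?b v) $ j" by (simp add: fd_eq)
   then show ?thesis using holo_map_onD(3)[OF Ph, of w v "io' j"] \<open>w \<in> Om\<close> by simp
  qed
 qed
 moreover have "mass c' d' io' S = (\<integral>\<^sup>+z. ?f (?s' z) * indicator (Ph ` Om) (?s' z) \<partial>slice_lborel io')"
  unfolding mass_def im using S by (intro nn_integral_cong) (auto simp: indicator_def)
 moreover have "mass c d io S = (\<integral>\<^sup>+z. ?f (Ph (?s z)) * ennreal ((cmod (det (matrix (fd Ph (?s z)))))\<^sup>2 / (cmod (det (matrix A)))\<^sup>2) *
    indicator Om (?s z) \<partial>slice_lborel io)"
  unfolding mass_def
 proof (rule nn_integral_cong)
  fix z
  show "indicator (snd c ` (S \<inter> p -` {y})) (?s z) * ennreal (dens c d (cinv c (?s z))) =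
   ?f (Ph (?s z)) * ennreal ((cmod (det (matrix (fd Ph (?s z)))))\<^sup>2 / (cmod (det (matrix A)))\<^sup>2) * indicator Om (?s z)"
  proof (cases "?s z \<in> Om")
   case False
   then have "?s z \<notin> snd c ` (S \<inter> p -` {y})" using S unfolding Om_def by auto
   then show ?thesis using False by simp
  next
   case True2: True
   then obtain x where x: "x \<in> fst c" "x \<in> fst c'" "?s z = snd c x" unfolding Om_def by auto
   have px: "p x = y" using base_y[OF x(1)] slice_point_base[OF ad(3), of "snd d y" z] unfolding x(3) by simp
   have 1: "snd c x \<in> snd c ` (S \<inter> p -` {y}) \<longleftrightarrow> x \<in> S"
    using inj_onD[OF X.chart(3)[OF ad(1)]] x(1) S px by blast
   have 2: "snd c' x \<in> snd c' ` (S \<inter> p -` {y}) \<longleftrightarrow> x \<in> S"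
    using inj_onD[OF X.chart(3)[OF ad'(1)]] x(2) S px by blast
   have "cmod (reltrans (c, d) (c', d') x) = cmod (det (matrix (fd Ph (snd c x)))) / cmod (det (matrix A))"
    unfolding reltrans_eq X.jdet_def Y.jdet_def px Ph_def A_def by (simp add: norm_mult norm_inverse divide_inverse)
   then have dd: "dens c d x = (cmod (det (matrix (fd Ph (snd c x)))))\<^sup>2 / (cmod (det (matrix A)))\<^sup>2 * dens c' d' x"
    using dens_change[of x c d c' d'] px x ad(1,2) ad'(1,2) True by (simp add: power_divide)
   have "dens c' d' x \<ge> 0" using dens_nonneg[of x c' d'] px x ad'(1,2) ad'(4)[OF x(2)] by simp
   then have "ennreal (dens c d x) = ennreal ((cmod (det (matrix (fd Ph (snd c x)))))\<^sup>2 / (cmod (det (matrix A)))\<^sup>2) * ennreal (dens c' d' x)"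
    unfolding dd by (intro ennreal_mult) auto
   then show ?thesis
    using True2 unfolding x(3) Phx[OF x(1)] X.chart(4)[OF ad(1) x(1)] X.chart(4)[OF ad'(1) x(2)]
    by (simp add: indicator_def 1 2 mult_ac)
  qed
 qed
 ultimately show ?thesis by simp
qed

text \<open>Compactness gives finitely many adapted charts; their domains are made disjoint, and the
  measure is the sum of the chart integrals over the pieces. By \<open>mass_consistent\<close> it
  has the prescribed values in every chart, and these determine it.\<close>

lemma fibre_volume_unique_exists:
 assumes "compact (UNIV :: 'a set)"
 shows "\<exists>!mu. sets mu = sets borel \<and> emeasure mu (- (p -` {y})) = 0 \<and>
   (\<forall>c d io. (c, d, io) \<in> adapted_charts X Y p --> (\<forall>S\<in>sets borel. S \<subseteq> fst c --> emeasure mu S = mass c d io S))"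
  (is "\<exists>!mu. ?P mu")
proof -
 have "\<exists>a. a \<in> adapted_charts X Y p \<and> x \<in> fst (fst a)" for x
  using adapted_exists[OF open_UNIV UNIV_I[of x]] by (metis fst_conv)
 then obtain a where a: "!!x. a x \<in> adapted_charts X Y p" "!!x. x \<in> fst (fst (a x))" by metis
 define U where "U x = fst (fst (a x))" for x
 have opU: "open (U x)" for x
  unfolding U_def using a(1)[of x] by (cases "a x") (auto simp: adapted_iff intro: X.chart(1))
 obtain F where F: "finite F" "UNIV \<subseteq> (\<Union>x\<in>F. U x)"
 proof -
  have cov: "UNIV \<subseteq> (\<Union>x\<in>UNIV. U x)" using a(2) unfolding U_def by auto
  show ?thesis by (rule compactE_image[OF assms opU cov], rule that)
 qed
 obtain e where e: "bij_betw e {0..<card F} F" using ex_bij_betw_nat_finite[OF F(1)] by blast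
 define n where "n = card F"
 define D where "D = disjointed (\<lambda>i. U (e i))"
 have DU: "D i \<subseteq> U (e i)" for i unfolding D_def by (rule disjointed_subset)
 have Dm: "D i \<in> sets borel" for i
 proof -
  have "range (\<lambda>i. U (e i)) \<subseteq> sets borel" using opU by auto
  from sets.range_disjointed_sets[OF this] show ?thesis unfolding D_def by blast
 qed
 have Dd: "disjoint_family D" unfolding D_def by (rule disjoint_family_disjointed)
 have "(\<Union>i\<in>{0..<n}. D i) = (\<Union>i\<in>{0..<n}. U (e i))" unfolding D_def by (rule finite_UN_disjointed_eq)
 also have "... = (\<Union>x\<in>F. U x)" unfolding bij_betw_imp_surj_on[OF e[folded n_def], symmetric] by simp
 finally have Dc: "(\<Union>i\<in>{0..<n}. D i) = UNIV" using F by auto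
 define c where "c i = fst (a (e i))" for i
 define d where "d i = fst (snd (a (e i)))" for i
 define io where "io i = snd (snd (a (e i)))" for i
 have ad: "(c i, d i, io i) \<in> adapted_charts X Y p" for i using a(1)[of "e i"] by (simp add: c_def d_def io_def)
 have Dsub: "D i \<subseteq> fst (c i)" for i using DU[of i] by (simp add: U_def c_def)
 let ?m = "\<lambda>S. \<Sum>i<n. mass (c i) (d i) (io i) (S \<inter> D i)"
 define mu where "mu = measure_of UNIV (sets borel) ?m"
 have em: "emeasure mu S = ?m S" if "S \<in> sets borel" for S
  unfolding mu_def
 proof (rule emeasure_measure_of_sigma)
  show "sigma_algebra UNIV (sets (borel :: 'a measure))" using sets.sigma_algebra_axioms[of borel] by simp
  show "positive (sets borel) ?m" unfolding positive_def by simp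
  show "countably_additive (sets borel) ?m"
  proof (rule countably_additiveI)
   fix S :: "nat => 'a set" assume S: "range S \<subseteq> sets borel" "disjoint_family S" "(\<Union>i. S i) \<in> sets borel"
   have "(\<Sum>j. ?m (S j)) = (\<Sum>i<n. \<Sum>j. mass (c i) (d i) (io i) (S j \<inter> D i))"
    by (rule suminf_sum) simp
   also have "... = (\<Sum>i<n. mass (c i) (d i) (io i) (\<Union>j. S j \<inter> D i))"
   proof (rule sum.cong[OF refl], rule mass_suminf[OF ad, symmetric])
    fix i j
    show "S j \<inter> D i \<in> sets borel" using S Dm by auto
    show "S j \<inter> D i \<subseteq> fst (c i)" using Dsub by auto
    show "disjoint_family (\<lambda>j. S j \<inter> D i)" using S(2) unfolding disjoint_family_on_def by blast
   qed
   finally show "(\<Sum>j. ?m (S j)) = ?m (\<Union>j. S j)" by (simp add: Int_UN_distrib2)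
  qed
 qed (rule that)
 have sets: "sets mu = sets borel" 
  unfolding mu_def using sets.sigma_sets_eq[of "borel :: 'a measure"] by (subst sets_measure_of) auto
 have pieces: "emeasure nu S = (\<Sum>i<n. emeasure nu (S \<inter> D i))" if "sets nu = sets borel" "S \<in> sets borel" for nu S
 proof -
  have "(\<Sum>i\<in>{..<n}. emeasure nu (S \<inter> D i)) = emeasure nu (\<Union>i\<in>{..<n}. S \<inter> D i)"
  proof (rule sum_emeasure)
   show "(\<lambda>i. S \<inter> D i) ` {..<n} \<subseteq> sets nu" using that Dm by auto
   show "disjoint_family_on (\<lambda>i. S \<inter> D i) {..<n}" using Dd unfolding disjoint_family_on_def by blast
  qed simp
  also have "(\<Union>i\<in>{..<n}. S \<inter> D i) = S" using Dc by (auto simp: atLeast0LessThan)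
  finally show ?thesis by simp
 qed
 have Pmu: "?P mu"
 proof (intro conjI allI impI ballI sets)
  have "- (p -` {y}) \<in> sets borel" using fibre_borel by auto
  moreover have "mass (c i) (d i) (io i) (- (p -` {y}) \<inter> D i) = 0" for i
   by (rule mass_no_fibre) auto
  ultimately show "emeasure mu (- (p -` {y})) = 0" by (simp add: em)
 next
  fix c' d' io' S assume c': "(c', d', io') \<in> adapted_charts X Y p" and S: "S \<in> sets borel" "S \<subseteq> fst c'"
  \<comment> \<open>The finite partition is padded with empty sets, because
    \<open>mass_suminf\<close> is stated for sequences.\<close>
  define R where "R j = (if j < n then S \<inter> D j else {})" for j
  have "mass c' d' io' (\<Union>j. R j) = (\<Sum>j. mass c' d' io' (R j))"
  proof (rule mass_suminf[OF c'])
   show "disjoint_family R" using Dd unfolding disjoint_family_on_def R_def by auto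
  qed (use S Dm in \<open>auto simp: R_def\<close>)
  also have "... = (\<Sum>j<n. mass c' d' io' (R j))"
   by (rule suminf_finite) (auto simp: R_def)
  also have "(\<Union>j. R j) = S" using Dc by (force simp: R_def atLeast0LessThan)
  finally have "mass c' d' io' S = (\<Sum>j<n. mass c' d' io' (S \<inter> D j))" by (simp add: R_def)
  also have "... = ?m S"
   by (rule sum.cong[OF refl], rule mass_consistent[OF c' ad]) (use S Dm Dsub in auto)
  finally show "emeasure mu S = mass c' d' io' S" using em[OF S(1)] by simp
 qed
 moreover have "nu = mu" if "?P nu" for nu
 proof (rule measure_eqI)
  show "sets nu = sets mu" using that sets by simp
  fix S assume "S \<in> sets nu"
  then have S: "S \<in> sets borel" using that by simp
  have "emeasure nu (S \<inter> D i) = emeasure mu (S \<inter> D i)" for i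
  proof -
   have b: "S \<inter> D i \<in> sets borel" "S \<inter> D i \<subseteq> fst (c i)" using S Dm Dsub by auto
   have "emeasure nu (S \<inter> D i) = mass (c i) (d i) (io i) (S \<inter> D i)" using that ad b by blast
   moreover have "emeasure mu (S \<inter> D i) = mass (c i) (d i) (io i) (S \<inter> D i)" using Pmu ad b by blast
   ultimately show ?thesis by simp
  qed
  then show "emeasure nu S = emeasure mu S"
   using pieces[OF _ S, of nu] pieces[OF sets S] that by simp
 qed
 ultimately show ?thesis by (rule ex1I)
qed

lemma fibre_volume:
 assumes "compact (UNIV :: 'a set)"
 defines "mu \<equiv> fibre_volume X Y p M h y u"
 shows "sets mu = sets borel" "emeasure mu (- (p -` {y})) = 0"
  "(c, d, io) \<in> adapted_charts X Y p ==> S \<in> sets borel ==> S \<subseteq> fst c ==> emeasure mu S = mass c d io S"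
proof -
 have iff: "(\<forall>((U, ph), (V, \<psi>), io)\<in>adapted_charts X Y p. \<forall>S\<in>sets borel. S \<subseteq> U -->
    emeasure nu S =
     (\<integral>\<^sup>+z. (let w = slice_point io (\<psi> y) z; x = inv_into U ph w in
       indicator (ph ` (S \<inter> p -` {y})) w *
       ennreal (lb_norm2 M h x (\<lambda>i. u x (((U, ph), (V, \<psi>)), i))))
      \<partial>slice_lborel io))
  \<longleftrightarrow> (\<forall>c d io. (c, d, io) \<in> adapted_charts X Y p --> (\<forall>S\<in>sets borel. S \<subseteq> fst c --> emeasure nu S = mass c d io S))" for nu
  unfolding mass_def dens_def Let_def by fastforce
 have "mu = (THE mu. sets mu = sets borel \<and> emeasure mu (- (p -` {y})) = 0 \<and>
   (\<forall>c d io. (c, d, io) \<in> adapted_charts X Y p --> (\<forall>S\<in>sets borel. S \<subseteq> fst c --> emeasure mu S = mass c d io S)))"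
  unfolding mu_def fibre_volume_def iff ..
 with theI'[OF fibre_volume_unique_exists[OF assms(1)]]
 have P: "sets mu = sets borel \<and> emeasure mu (- (p -` {y})) = 0 \<and>
   (\<forall>c d io. (c, d, io) \<in> adapted_charts X Y p --> (\<forall>S\<in>sets borel. S \<subseteq> fst c --> emeasure mu S = mass c d io S))"
  by simp
 then show "sets mu = sets borel" "emeasure mu (- (p -` {y})) = 0" by blast+
 show "(c, d, io) \<in> adapted_charts X Y p ==> S \<in> sets borel ==> S \<subseteq> fst c ==> emeasure mu S = mass c d io S"
  using P by blast
qed

end

section \<open>Smooth cut-off functions\<close>

lemma smooth_on_ident: "smooth_on UNIV (\<lambda>x::real. x)"
 unfolding smooth_on_def
proof
 fix n show "Ck_on n UNIV (\<lambda>x::real. x)"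
 proof (cases n)
  case (Suc m)
  show ?thesis unfolding Suc
   by (rule Ck_on_SucI[where D = "\<lambda>_ v. v"]) (auto simp: Ck_on_const)
 qed (auto intro: continuous_intros)
qed

lemma smooth_real_of_smooth_on:
 fixes f :: "real => real"
 assumes "smooth_on UNIV f"
 shows "smooth_real UNIV f"
proof -
 define G where "G n = ((\<lambda>g x. fd g x (1::real)) ^^ n) f" for n
 have "smooth_on UNIV (G n)" for n
  by (induction n) (auto simp: G_def assms intro: smooth_onD(2))
 then have der: "(G n has_derivative fd (G n) x) (at x)" for n x using smooth_onD(1) by blast
 have GS: "G (Suc n) x = fd (G n) x 1" for n x by (simp add: G_def)
 have "(G n has_real_derivative G (Suc n) x) (at x)" for n x
  unfolding has_field_derivative_def
 proof (rule has_derivative_eq_rhs[OF der], rule ext)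
  fix h
  show "fd (G n) x h = G (Suc n) x * h"
   using linear_cmul[OF has_derivative_linear[OF der], of n x h 1] by (simp add: GS mult.commute)
 qed
 then show ?thesis unfolding smooth_real_def by (intro exI[of _ G]) (auto simp: G_def)
qed

lemma poly_div_exp_tendsto_0: "((\<lambda>t. poly q t / exp t) \<longlongrightarrow> (0::real)) at_top"
proof -
 have "((\<lambda>t. \<Sum>i\<le>degree q. coeff q i * (t ^ i / exp t)) \<longlongrightarrow> (\<Sum>i\<le>degree q. coeff q i * 0)) at_top"
  by (intro tendsto_sum tendsto_mult tendsto_const tendsto_power_div_exp_0)
 then show ?thesis by (simp add: poly_altdef sum_divide_distrib)
qed

text \<open>The functions \<open>poly q (1 / x) * exp (- 1 / x)\<close>, extended by 0. The family
  is closed under differentiation, \<open>q\<close> being replaced by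
  \<open>x\<^sup>2 * (q - q')\<close>, so all derivatives at 0 come from one limit.\<close>

definition flat_fun :: "real poly => real => real" where
 "flat_fun q x = (if x > 0 then poly q (inverse x) / exp (inverse x) else 0)"

lemma flat_fun_derivative:
 "(flat_fun q has_real_derivative flat_fun ([:0, 0, 1:] * (q - pderiv q)) x) (at x)"
proof -
 consider "x > 0" | "x < 0" | "x = 0" by linarith
 then show ?thesis
 proof cases
  case 1
  have "((\<lambda>x. poly q (inverse x) / exp (inverse x)) has_real_derivative
    flat_fun ([:0, 0, 1:] * (q - pderiv q)) x) (at x)"
   using 1 by (auto intro!: derivative_eq_intros DERIV_chain'[OF _ poly_DERIV]
     simp: flat_fun_def field_simps power2_eq_square)
  then show ?thesis
   by (rule has_field_derivative_transform_within_open[of _ _ _ "{0<..}"])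
    (use 1 in \<open>auto simp: flat_fun_def\<close>)
 next
  case 2
  have "((\<lambda>x. 0) has_real_derivative flat_fun ([:0, 0, 1:] * (q - pderiv q)) x) (at x)"
   using 2 by (simp add: flat_fun_def)
  then show ?thesis
   by (rule has_field_derivative_transform_within_open[of _ _ _ "{..<0}"])
    (use 2 in \<open>auto simp: flat_fun_def\<close>)
 next
  case 3
  have r: "((\<lambda>x. flat_fun q x / x) \<longlongrightarrow> 0) (at_right 0)"
  proof -
   have "((\<lambda>x. poly ([:0, 1:] * q) (inverse x) / exp (inverse x)) \<longlongrightarrow> 0) (at_right (0::real))"
    by (rule filterlim_compose[OF poly_div_exp_tendsto_0 filterlim_inverse_at_top_right])
   then show ?thesis
    by (rule tendsto_cong[THEN iffD1, rotated])
     (auto simp: flat_fun_def eventually_at_right_field divide_inverse intro!: exI[of _ 1])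
  qed
  have l: "((\<lambda>x. flat_fun q x / x) \<longlongrightarrow> 0) (at_left 0)"
   by (rule tendsto_eventually) (auto simp: flat_fun_def eventually_at_left_field intro!: exI[of _ "-1"])
  from l r have "((\<lambda>x. flat_fun q x / x) \<longlongrightarrow> 0) (at 0)" by (rule filterlim_split_at)
  then show ?thesis using 3 by (simp add: has_field_derivative_iff flat_fun_def)
 qed
qed

lemma smooth_flat_fun: "smooth_real UNIV (flat_fun 1)"
 unfolding smooth_real_def
 by (rule exI[of _ "\<lambda>n. flat_fun (((\<lambda>q. [:0, 0, 1:] * (q - pderiv q)) ^^ n) 1)"])
  (simp add: flat_fun_derivative del: mult_pCons_left)

text \<open>\<open>S\<close> is a smooth monotone step and \<open>th\<close> its primitive.
  \<open>th\<close> is a smooth convex substitute for the maximum of 0 and \<open>x - ka\<close>: it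
  equals one or the other off the unit interval and lies above both.\<close>

lemma smooth_step_exists:
 "\<exists>S th :: real => real. \<exists>ka. smooth_real UNIV S \<and> smooth_real UNIV th \<and>
   (\<forall>x. (th has_real_derivative S x) (at x)) \<and> (\<forall>x. \<exists>s\<ge>0. (S has_real_derivative s) (at x)) \<and>
   (\<forall>x\<le>0. S x = 0 \<and> th x = 0) \<and> (\<forall>x\<ge>1. S x = 1 \<and> th x = x - ka) \<and>
   (\<forall>x. 0 \<le> S x \<and> S x \<le> 1 \<and> th x \<ge> 0 \<and> th x \<ge> x - ka)"
proof -
 let ?g = "flat_fun 1"
 have g0: "?g x \<ge> 0" "x \<le> 0 ==> ?g x = 0" "x > 0 ==> ?g x > 0" for x by (auto simp: flat_fun_def)
 have gm: "?g x \<le> ?g y" if "x \<le> y" for x y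
  using that by (auto simp: flat_fun_def intro!: divide_left_mono)
 define S where "S x = ?g x / (?g x + ?g (1 - x))" for x
 have pos: "?g x + ?g (1 - x) > 0" for x
  using g0(1)[of x] g0(1)[of "1 - x"] g0(3)[of x] g0(3)[of "1 - x"] by (cases "x > 0") auto
 have "smooth_on UNIV (\<lambda>x. ?g x)" "smooth_on UNIV (\<lambda>x. ?g (1 - x))"
  by (rule smooth_on_compose_real[OF _ smooth_flat_fun]; auto intro: smooth_on_diff smooth_on_ident)+
 then have smS: "smooth_on UNIV S" unfolding S_def
  by (intro smooth_on_divide smooth_on_add) (auto simp: pos)
 have S01: "0 \<le> S x" "S x \<le> 1" for x
  using g0(1)[of x] g0(1)[of "1 - x"] pos[of x] by (auto simp: S_def)
 have S0: "S x = 0" if "x \<le> 0" for x using g0(2)[OF that] by (simp add: S_def)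
 have S1: "S x = 1" if "x \<ge> 1" for x using g0(2)[of "1 - x"] g0(3)[of x] that by (simp add: S_def)
 have mono: "S x \<le> S y" if "x \<le> y" for x y
 proof -
  have "?g x * ?g (1 - y) \<le> ?g y * ?g (1 - x)"
   using gm[OF that] gm[of "1 - y" "1 - x"] that g0 by (intro mult_mono) auto
  then show ?thesis using pos[of x] pos[of y] unfolding S_def by (simp add: divide_simps algebra_simps)
 qed
 have rS: "smooth_real UNIV S" by (rule smooth_real_of_smooth_on[OF smS])
 then obtain S' where S': "!!x. (S has_real_derivative S' x) (at x)"
  unfolding smooth_real_def by (metis UNIV_I)
 have S'0: "S' x \<ge> 0" for x
 proof (rule ccontr)
  assume "\<not> ?thesis"
  then obtain e where "e > 0" "!!h. h > 0 ==> h < e ==> S (x + h) < S x"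
   using DERIV_neg_dec_right[OF S', of x] by auto
  then have "S (x + e/2) < S x" by simp
  with mono[of x "x + e/2"] \<open>e > 0\<close> show False by simp
 qed
 have contS: "continuous_on A S" for A by (rule continuous_on_subset[OF smooth_onD(3)[OF smS]]) auto
 \<comment> \<open>Since \<open>S\<close> vanishes on the negative axis, the lower limit does not
   affect the values; a negative one makes 0 an interior point.\<close>
 define th where "th x = integral {-2..x} S" for x
 have th0: "th x = 0" if "x \<le> 0" for x
 proof -
  have "th x = integral {-2..x} (\<lambda>_. 0)" unfolding th_def
   by (rule integral_cong) (use that S0 in auto)
  then show ?thesis by simp
 qed
 have dth: "(th has_real_derivative S x) (at x)" for x
 proof (cases "x > -2")
  case True
  have "((\<lambda>x. integral {-2..x} S) has_real_derivative S x) (at x within {-2..x+1})"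
   by (rule integral_has_real_derivative[OF contS]) (use True in auto)
  moreover have "at x within {-2..x+1} = at x" using True by (simp add: at_within_Icc_at)
  ultimately show ?thesis unfolding th_def[abs_def] by (simp only:)
 next
  case False
  have "((\<lambda>x. 0) has_real_derivative S x) (at x)" using False by (simp add: S0)
  then show ?thesis
   by (rule has_field_derivative_transform_within_open[of _ _ _ "{..<0}"]) (use False th0 in auto)
 qed
 have rth: "smooth_real UNIV th" by (rule smooth_real_primitive[OF rS dth])
 define ka where "ka = 1 - th 1"
 have dthx: "((\<lambda>x. th x - x) has_real_derivative S x - 1) (at x)" for x
  by (rule DERIV_diff[OF dth DERIV_ident])
 have th1: "th x = x - ka" if "x \<ge> 1" for x
 proof (cases "x = 1")
  case False
  have "\<exists>z>1. z < x \<and> (th x - x) - (th 1 - 1) = (x - 1) * (S z - 1)"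
   by (rule MVT2[OF _ dthx]) (use that False in auto)
  then show ?thesis using S1 by (auto simp: ka_def)
 qed (simp add: ka_def)
 have "th x \<ge> 0" for x
 proof (cases "x \<le> 0")
  case False
  have "th 0 \<le> th x"
   by (rule DERIV_nonneg_imp_nondecreasing[where f = th]) (use False dth S01 in auto)
  then show ?thesis using th0[of 0] by simp
 qed (simp add: th0)
 moreover have "th x \<ge> x - ka" for x
 proof (cases "x \<ge> 1")
  case False
  have "th 1 - 1 \<le> th x - x"
  proof (rule DERIV_nonpos_imp_nonincreasing[where f = "\<lambda>x. th x - x"])
   show "x \<le> 1" using False by simp
   show "\<exists>z. ((\<lambda>x. th x - x) has_real_derivative z) (at y) \<and> z \<le> 0" for y
    using dthx[of y] S01(2)[of y] by (intro exI[of _ "S y - 1"]) auto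
  qed
  then show ?thesis by (simp add: ka_def)
 qed (simp add: th1)
 ultimately show ?thesis
  using rS rth dth S' S'0 S0 th0 S1 th1 S01
  by (intro exI[of _ S] exI[of _ th] exI[of _ ka]) blast
qed

text \<open>In the expansion by real and imaginary parts of \<open>c\<close>, the mixed second
  derivatives for \<open>v\<close> and \<open>\<i> *s v\<close> occur with opposite signs in the two
  summands.\<close>

lemma levi_scale_complex:
 assumes "open Om" "smooth_on Om f" "z \<in> Om"
 shows "levi f z (c *s v) = (cmod c)\<^sup>2 * levi f z v"
proof -
 have bl: "bounded_linear (d2 f z u)" for u
  by (rule fd_linear[OF smooth_onD(2)[OF assms(2)] assms(3)])
 have right: "d2 f z u (a *\<^sub>R v + b *\<^sub>R w) = a * d2 f z u v + b * d2 f z u w" for a b u v w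
  using bounded_linear.linear[OF bl[of u]] by (simp add: linear_add linear_cmul)
 have left: "d2 f z (a *\<^sub>R v + b *\<^sub>R w) u = a * d2 f z v u + b * d2 f z w u" for a b u v w
  unfolding d2_expand_left[OF assms, of "a *\<^sub>R v + b *\<^sub>R w" u] d2_expand_left[OF assms, of v u] d2_expand_left[OF assms, of w u]
  by (simp add: inner_add_left sum_distrib_left sum.distrib algebra_simps)
 have cv: "c *s v = Re c *\<^sub>R v + Im c *\<^sub>R (\<i> *s v)"
  by (simp add: vec_eq_iff complex_eq_iff)
 have icv: "\<i> *s (c *s v) = (- Im c) *\<^sub>R v + Re c *\<^sub>R (\<i> *s v)"
  by (simp add: vec_eq_iff complex_eq_iff)
 show ?thesis
  unfolding levi_def icv unfolding cv left right cmod_power2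
  by (simp add: power2_eq_square algebra_simps)
qed

section \<open>Gluing and a pointwise criterion for semi-positivity\<close>

context cmanifold
begin

lemma smooth_fun_glue:
 assumes "open U" "closed C" "C \<subseteq> U" "open W" "smooth_fun X (U \<inter> W) f"
  and "!!x. x \<in> U ==> x \<in> W ==> x \<notin> C ==> f x = 0"
 shows "smooth_fun X W (\<lambda>x. if x \<in> U then f x else 0)"
proof (rule smooth_fun_local)
 fix x assume x: "x \<in> W"
 show "\<exists>N. x \<in> N \<and> open N \<and> smooth_fun X N (\<lambda>x. if x \<in> U then f x else 0)"
 proof (cases "x \<in> U")
  case True
  have "smooth_fun X (U \<inter> W) (\<lambda>x. if x \<in> U then f x else 0)"
   by (rule smooth_fun_cong[OF assms(5)]) (use assms in auto)
  then show ?thesis using True x assms(1,4) by (intro exI[of _ "U \<inter> W"]) auto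
 next
  case False
  have "smooth_fun X (W - C) (\<lambda>x. if x \<in> U then f x else 0)"
   by (rule smooth_fun_cong[OF smooth_fun_const[of _ 0]]) (use assms in auto)
  then show ?thesis using False x assms by (intro exI[of _ "W - C"]) auto
 qed
qed

lemma holo_fun_sub_open:
 assumes "open S" "holo_fun_sub X S f"
 shows "holo_fun X S f"
proof (rule holo_fun_local)
 fix x assume "x \<in> S"
 then obtain W F where W: "open W" "x \<in> W" "holo_fun X W F" "\<forall>x'\<in>W \<inter> S. f x' = F x'"
  using assms(2) unfolding holo_fun_sub_def by blast
 have "holo_fun X (W \<inter> S) f"
  by (rule holo_fun_cong[OF holo_fun_subset[OF W(3)]]) (use W assms(1) in auto)
 then show "\<exists>N. x \<in> N \<and> open N \<and> holo_fun X N f"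
  using W assms(1) \<open>x \<in> S\<close> by (intro exI[of _ "W \<inter> S"]) auto
qed

lemma levi_chart_change:
 assumes "open W" "smooth_fun X W f" "x \<in> W" "c \<in> X" "c' \<in> X" "x \<in> fst c" "x \<in> fst c'"
 shows "levi (\<lambda>w. f (cinv c' w)) (snd c' x) v = levi (\<lambda>w. f (cinv c w)) (snd c x) (fd (transition c' c) (snd c' x) v)"
proof -
 let ?Om = "snd c' ` (fst c' \<inter> (fst c \<inter> W))"
 have op: "open ?Om" by (intro chart_image_open open_Int chart(1) assms)
 have "levi (\<lambda>w. f (cinv c' w)) (snd c' x) v = levi (\<lambda>w. f (cinv c (transition c' c w))) (snd c' x) v"
 proof (rule levi_cong[OF op])
  fix w assume "w \<in> ?Om"
  then obtain x' where x': "x' \<in> fst c'" "x' \<in> fst c" "w = snd c' x'" by auto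
  then show "f (cinv c' w) = f (cinv c (transition c' c w))"
   using transition_eq[OF assms(5) x'(1)] chart(4)[OF assms(5) x'(1)] chart(4)[OF assms(4) x'(2)] by simp
 qed (use assms in auto)
 also have "... = levi (\<lambda>w. f (cinv c w)) (transition c' c (snd c' x)) (fd (transition c' c) (snd c' x) v)"
 proof (rule levi_compose_holo[OF op chart_image_open[OF assms(4,1)] smooth_funD[OF assms(2,4)]])
  show "holo_map_on ?Om (transition c' c)"
   by (rule holo_map_on_subset[OF transition_holo[OF assms(5,4)]]) auto
  fix w assume "w \<in> ?Om"
  then obtain x' where x': "x' \<in> fst c'" "x' \<in> fst c" "x' \<in> W" "w = snd c' x'" by auto
  then show "transition c' c w \<in> snd c ` (fst c \<inter> W)"
   using transition_eq[OF assms(5) x'(1)] by auto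
 qed (use assms in auto)
 finally show ?thesis using transition_eq[OF assms(5,7)] by simp
qed

text \<open>One chart and one frame per point are enough: a change of frame adds a pluriharmonic
  function, a change of chart transforms \<open>v\<close> linearly, and a smooth function with
  nonnegative Levi form is plurisubharmonic.\<close>

lemma semipositiveI:
 assumes L: "holomorphic_line_bundle X L" "hermitian_metric X L h"
  and pt: "!!x. \<exists>i\<in>lb_index L. x \<in> lb_dom L i \<and> (\<exists>c\<in>X. x \<in> fst c \<and>
    (\<forall>v. levi (\<lambda>w. - ln (h i (cinv c w))) (snd c x) v \<ge> 0))"
 shows "semipositive X L h"
 unfolding semipositive_def psh_fun_def
proof clarify
 fix W f U' ph' assume fr: "lb_frame X L W f" and c'X: "(U', ph') \<in> X"
 let ?c' = "(U', ph')"
 have W: "open W" and fs: "f \<in> lb_sections X L W" and fnz: "!!x. x \<in> W ==> f x \<noteq> (\<lambda>_. 0)"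
  using fr unfolding lb_frame_def by auto
 define F where "F x = - ln (lb_norm2 L h x (f x))" for x
 have opW: "open (ph' ` (U' \<inter> W))" using chart_image_open[OF c'X W] by simp
 have fib: "f x i = lb_trans L i j x * f x j"
  if "x \<in> W" "i \<in> lb_index L" "j \<in> lb_index L" "x \<in> lb_dom L i" "x \<in> lb_dom L j" for x i j
  using fs that unfolding lb_sections_def lb_fibre_def by blast
 have loc: "\<exists>N. open N \<and> x \<in> N \<and> N \<subseteq> W \<and> smooth_fun X N F \<and>
   (\<forall>c'\<in>X. x \<in> fst c' --> (\<forall>v. levi (\<lambda>w. F (cinv c' w)) (snd c' x) v \<ge> 0))" if x: "x \<in> W" for x
 proof -
  obtain i c where i: "i \<in> lb_index L" "x \<in> lb_dom L i" and c: "c \<in> X" "x \<in> fst c"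
   and lev: "!!v. levi (\<lambda>w. - ln (h i (cinv c w))) (snd c x) v \<ge> 0" using pt[of x] by blast
  have di: "open (lb_dom L i)" using L(1) i unfolding holomorphic_line_bundle_def by blast
  let ?N = "W \<inter> lb_dom L i"
  have oN: "open ?N" using W di by auto
  have hs: "smooth_fun X (lb_dom L i) (h i)" and hp: "!!x. x \<in> lb_dom L i ==> h i x > 0"
   using L(2) i unfolding hermitian_metric_def by blast+
  have "holo_fun_sub X ?N (\<lambda>x. f x i)" using fs i unfolding lb_sections_def by blast
  then have fh: "holo_fun X ?N (\<lambda>x. f x i)" by (rule holo_fun_sub_open[OF oN])
  have fi: "f x' i \<noteq> 0" if x': "x' \<in> ?N" for x'
  proof
   assume z: "f x' i = 0"
   have "f x' j = 0" for j
   proof (cases "j \<in> lb_index L \<and> x' \<in> lb_dom L j")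
    case True
    then show ?thesis using fib[of x' j i] z i x' by simp
   next
    case False
    then show ?thesis using fs x' unfolding lb_sections_def lb_fibre_def by blast
   qed
   then show False using fnz[of x'] x' by auto
  qed
  have hsN: "smooth_fun X ?N (h i)" by (rule smooth_fun_subset[OF hs]) auto
  have s1: "smooth_fun X ?N (\<lambda>x. ln ((cmod (f x i))\<^sup>2))"
   by (intro smooth_fun_ln smooth_fun_cmod2 fh oN) (use fi in auto)
  have s2: "smooth_fun X ?N (\<lambda>x. ln (h i x))"
   by (intro smooth_fun_ln hsN oN) (use hp in auto)
  have Feq: "F x' = (0 - ln ((cmod (f x' i))\<^sup>2)) - ln (h i x')" if "x' \<in> ?N" for x'
  proof -
   have "lb_norm2 L h x' (f x') = (cmod (f x' i))\<^sup>2 * h i x'"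
   proof (rule lb_norm2_eq[OF L _ i(1)])
    show "x' \<in> lb_dom L i" using that by simp
    fix a b assume "a \<in> lb_index L" "b \<in> lb_index L" "x' \<in> lb_dom L a" "x' \<in> lb_dom L b"
    then show "f x' a = lb_trans L a b x' * f x' b" using that by (intro fib) simp_all
   qed
   then show ?thesis unfolding F_def using fi[OF that] hp[of x'] that by (simp add: ln_mult)
  qed
  have sF: "smooth_fun X ?N F"
  proof (rule smooth_fun_cong[OF _ oN])
   show "smooth_fun X ?N (\<lambda>x'. (0 - ln ((cmod (f x' i))\<^sup>2)) - ln (h i x'))"
    by (intro smooth_fun_diff smooth_fun_const oN s1 s2)
  qed (rule Feq[symmetric])
  have "levi (\<lambda>w. F (cinv c w)) (snd c x) v \<ge> 0" for v
  proof -
   let ?Om = "snd c ` (fst c \<inter> ?N)"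
   have op: "open ?Om" by (rule chart_image_open[OF c(1) oN])
   have z: "snd c x \<in> ?Om" using c x i by auto
   have "levi (\<lambda>w. F (cinv c w)) (snd c x) v =
    levi (\<lambda>w. (0 - ln ((cmod (f (cinv c w) i))\<^sup>2)) - ln (h i (cinv c w))) (snd c x) v"
    by (rule levi_cong[OF op z]) (rule Feq[OF chart_pt[OF c(1)]])
   also have "... = levi (\<lambda>w. 0 - ln ((cmod (f (cinv c w) i))\<^sup>2)) (snd c x) v - levi (\<lambda>w. ln (h i (cinv c w))) (snd c x) v"
    by (rule levi_diff[OF op z smooth_on_diff[OF op smooth_on_const smooth_funD[OF s1 c(1)]] smooth_funD[OF s2 c(1)]])
   also have "levi (\<lambda>w. 0 - ln ((cmod (f (cinv c w) i))\<^sup>2)) (snd c x) v = 0 - levi (\<lambda>w. ln ((cmod (f (cinv c w) i))\<^sup>2)) (snd c x) v"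
    by (subst levi_diff[OF op z smooth_on_const smooth_funD[OF s1 c(1)]]) simp
   also have "levi (\<lambda>w. ln ((cmod (f (cinv c w) i))\<^sup>2)) (snd c x) v = 0"
    by (rule levi_ln_cmod2[OF op z holo_funD[OF fh c(1)]]) (rule fi[OF chart_pt[OF c(1)]])
   also have "0 - 0 - levi (\<lambda>w. ln (h i (cinv c w))) (snd c x) v = levi (\<lambda>w. - ln (h i (cinv c w))) (snd c x) v"
    by (simp add: levi_minus[OF op z smooth_funD[OF s2 c(1)]])
   finally show ?thesis using lev by simp
  qed
  then have "\<forall>c'\<in>X. x \<in> fst c' --> (\<forall>v. levi (\<lambda>w. F (cinv c' w)) (snd c' x) v \<ge> 0)"
   using levi_chart_change[OF oN sF _ c(1) _ c(2)] x i by (smt (verit) Int_iff)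
  then show ?thesis using oN x i sF by (intro exI[of _ ?N]) auto
 qed
 have sF: "smooth_fun X W F"
  by (rule smooth_fun_local) (use loc in blast)
 have "psh_on (ph' ` (U' \<inter> W)) (\<lambda>w. ereal (F (inv_into U' ph' w)))"
 proof (rule levi_nonneg_imp_psh[OF opW])
  show "smooth_on (ph' ` (U' \<inter> W)) (\<lambda>w. F (inv_into U' ph' w))" using smooth_funD[OF sF c'X] by simp
  fix z v assume "z \<in> ph' ` (U' \<inter> W)"
  then obtain x where x: "x \<in> U'" "x \<in> W" "z = ph' x" by auto
  then show "levi (\<lambda>w. F (inv_into U' ph' w)) z v \<ge> 0" using loc[OF x(2)] c'X by fastforce
 qed
 then show "psh_on (ph' ` (U' \<inter> W)) ((\<lambda>x. ereal (- ln (lb_norm2 L h x (f x)))) \<circ> inv_into U' ph')"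
  by (simp add: F_def o_def)
qed

end

section \<open>Integrals over fibres\<close>

lemma slice_bounded_finite:
 assumes "inj io"
 shows "(\<integral>\<^sup>+z. indicator (cball w r) (slice_point io t z) \<partial>slice_lborel io) < \<infinity>"
proof -
 interpret product_sigma_finite "\<lambda>_::'b. lborel :: complex measure" by (rule PiM_lborel_product)
 let ?P = "slice_lborel io"
 let ?B = "Pi\<^sub>E (- range io) (\<lambda>k. cball (w $ k) r)"
 have "indicator (cball w r) (slice_point io t z) \<le> (indicator ?B z :: ennreal)" if "z \<in> space ?P" for z
 proof (cases "slice_point io t z \<in> cball w r")
  case True
  have "z \<in> ?B"
  proof (rule PiE_I)
   fix k assume k: "k \<in> - range io"
   have "dist (w $ k) (slice_point io t z $ k) \<le> dist w (slice_point io t z)" by (rule dist_vec_nth_le)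
   then show "z k \<in> cball (w $ k) r" using k True by (simp add: slice_point_def)
  qed (use that in \<open>auto simp: space_PiM PiE_def extensional_def\<close>)
  then show ?thesis by (simp add: indicator_def)
 qed simp
 then have "(\<integral>\<^sup>+z. indicator (cball w r) (slice_point io t z) \<partial>?P) \<le> (\<integral>\<^sup>+z. indicator ?B z \<partial>?P)"
  by (intro nn_integral_mono) auto
 also have "... = emeasure ?P ?B" by (rule nn_integral_indicator) (auto intro!: sets_PiM_I_finite)
 also have "... = (\<Prod>k\<in>- range io. emeasure lborel (cball (w $ k) r))" by (rule emeasure_PiM) auto
 also have "... < \<infinity>" using emeasure_lborel_cball_finite
  by (auto simp: less_top[symmetric] ennreal_prod_eq_top)
 finally show ?thesis .
qed

text \<open>The members of the cover may overlap; removing one at a time from \<open>T\<close> keeps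
  the pieces disjoint.\<close>

lemma emeasure_local_compare:
 assumes "finite \<V>" "T \<subseteq> \<Union>\<V>" "T \<in> sets borel"
  and sets: "sets mu = sets borel" "sets mu' = sets borel"
  and loc: "!!V. V \<in> \<V> ==> open V" "!!V S. V \<in> \<V> ==> S \<in> sets borel ==> S \<subseteq> V \<inter> T ==> emeasure mu' S \<le> C * emeasure mu S"
 shows "emeasure mu' T \<le> C * emeasure mu T"
 using assms(1-3) loc
proof (induction \<V> arbitrary: T)
 case (insert V \<V>)
 have V: "V \<in> sets borel" using insert.prems(3) by auto
 have T: "T \<in> sets borel" by fact
 have 1: "T \<inter> V \<in> sets borel" "T - V \<in> sets borel" using V T by auto
 have un: "T = (T \<inter> V) \<union> (T - V)" by blast
 have "emeasure mu' T = emeasure mu' (T \<inter> V) + emeasure mu' (T - V)"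
  by (subst un, rule plus_emeasure[symmetric]) (use 1 sets in auto)
 also have "... \<le> C * emeasure mu (T \<inter> V) + C * emeasure mu (T - V)"
 proof (rule add_mono)
  show "emeasure mu' (T \<inter> V) \<le> C * emeasure mu (T \<inter> V)" by (rule insert.prems(4)[OF insertI1 1(1)]) blast
  show "emeasure mu' (T - V) \<le> C * emeasure mu (T - V)"
  proof (rule insert.IH)
   show "T - V \<subseteq> \<Union> \<V>" using insert.prems(1) by blast
   show "emeasure mu' S \<le> C * emeasure mu S" if "V' \<in> \<V>" "S \<in> sets borel" "S \<subseteq> V' \<inter> (T - V)" for V' S
    by (rule insert.prems(4)[of V']) (use that in auto)
  qed (use 1 insert.prems(3) in auto)
 qed
 also have "... = C * (emeasure mu (T \<inter> V) + emeasure mu (T - V))" by (simp add: distrib_left)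
 also have "emeasure mu (T \<inter> V) + emeasure mu (T - V) = emeasure mu T"
  by (subst (3) un, rule plus_emeasure) (use 1 sets in auto)
 finally show ?case .
qed simp

context fibre_section
begin

text \<open>In each adapted chart both volumes are integrals of densities, so a pointwise bound on
  the densities passes to the measures. The two bundles may differ, which permits comparing the
  power \<open>k\<close> with the power 0.\<close>

lemma fibre_volume_compare:
 assumes K: "compact (UNIV :: 'a set)" and u': "fibre_section X Y p M' h' y u'" and T: "T \<in> sets borel"
  and le: "!!x c d. x \<in> T ==> p x = y ==> c \<in> X ==> d \<in> Y ==> x \<in> fst c ==> p x \<in> fst d ==>
   fibre_section.dens M' h' u' c d x \<le> C * dens c d x" and C: "C \<ge> 0"
 shows "emeasure (fibre_volume X Y p M' h' y u') T \<le> ennreal C * emeasure (fibre_volume X Y p M h y u) T"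
proof -
 interpret u': fibre_section X Y p M' h' y u' by fact
 define \<A> where "\<A> = {fst c |c d io. (c, d, io) \<in> adapted_charts X Y p}"
 have "\<forall>V\<in>\<A>. open V" using adaptedD(1) X.chart(1) unfolding \<A>_def by blast
 moreover have "UNIV \<subseteq> \<Union>\<A>"
 proof
  fix x show "x \<in> \<Union>\<A>" using adapted_exists[of UNIV x] unfolding \<A>_def by auto
 qed
 ultimately obtain \<V> where \<V>: "\<V> \<subseteq> \<A>" "finite \<V>" "UNIV \<subseteq> \<Union>\<V>"
  using compactE[OF K, of \<A>] by auto
 show ?thesis
 proof (rule emeasure_local_compare[OF \<V>(2) _ T fibre_volume(1)[OF K] u'.fibre_volume(1)[OF K]])
  show "open V" if "V \<in> \<V>" for V using that \<V>(1) \<open>\<forall>V\<in>\<A>. open V\<close> by auto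
  fix V S assume V: "V \<in> \<V>" and S: "S \<in> sets borel" "S \<subseteq> V \<inter> T"
  obtain c d io where c: "(c, d, io) \<in> adapted_charts X Y p" "V = fst c" using V \<V>(1) unfolding \<A>_def by auto
  have Sc: "S \<subseteq> fst c" using S c by auto
  have "u'.mass c d io S \<le> (\<integral>\<^sup>+z. ennreal C * (indicator (snd c ` (S \<inter> p -` {y})) (slice_point io (snd d y) z) *
   ennreal (dens c d (cinv c (slice_point io (snd d y) z)))) \<partial>slice_lborel io)"
   unfolding u'.mass_def
  proof (rule nn_integral_mono)
   fix z
   let ?w = "slice_point io (snd d y) z"
   show "indicator (snd c ` (S \<inter> p -` {y})) ?w * ennreal (u'.dens c d (cinv c ?w))
    \<le> ennreal C * (indicator (snd c ` (S \<inter> p -` {y})) ?w * ennreal (dens c d (cinv c ?w)))"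
   proof (cases "?w \<in> snd c ` (S \<inter> p -` {y})")
    case True
    then obtain x where x: "x \<in> S" "p x = y" "?w = snd c x" by auto
    have xc: "x \<in> fst c" using x Sc by auto
    have "u'.dens c d x \<le> C * dens c d x"
     by (rule le) (use x xc S adaptedD[OF c(1)] in auto)
    moreover have "cinv c ?w = x" unfolding x(3) using X.chart(4)[OF adaptedD(1)[OF c(1)] xc] .
    ultimately show ?thesis using True C by (simp add: ennreal_mult''[symmetric] ennreal_leI ennreal_mult'[symmetric])
   qed simp
  qed
  also have "... = ennreal C * mass c d io S"
   unfolding mass_def
   by (rule nn_integral_cmult)
    (rule measurable_compose[OF slice_point_measurable mass_integrand_measurable[OF c(1) S(1) Sc]])
  finally show "emeasure (fibre_volume X Y p M' h' y u') S \<le> ennreal C * emeasure (fibre_volume X Y p M h y u) S"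
   by (simp add: fibre_volume(3)[OF K c(1) S(1) Sc] u'.fibre_volume(3)[OF K c(1) S(1) Sc])
 qed (use \<V> in auto)
qed

lemma fibre_volume_finite:
 assumes cpt: "compact (UNIV :: 'a set)"
 shows "emeasure (fibre_volume X Y p M h y u) UNIV < \<infinity>"
proof -
 let ?mu = "fibre_volume X Y p M h y u"
 have loc: "\<exists>V. open V \<and> x \<in> V \<and> emeasure ?mu V < \<infinity>" for x
 proof -
  obtain c d io where c: "(c, d, io) \<in> adapted_charts X Y p" "x \<in> fst c" using adapted_exists[of UNIV x] by auto
  note cX = adaptedD(1)[OF c(1)]
  obtain r where r: "r > 0" "cball (snd c x) r \<subseteq> snd c ` fst c"
   using open_contains_cball[THEN iffD1, OF X.chart(2)[OF cX]] c(2) by blast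
  define V where "V = cinv c ` ball (snd c x) r"
  have bV: "ball (snd c x) r \<subseteq> snd c ` fst c" using r by auto
  have Veq: "V = fst c \<inter> snd c -` ball (snd c x) r"
  proof (intro set_eqI iffI)
   fix x' assume "x' \<in> V"
   then obtain w where w: "w \<in> ball (snd c x) r" "x' = cinv c w" unfolding V_def by blast
   then have "w \<in> snd c ` fst c" using bV by blast
   then show "x' \<in> fst c \<inter> snd c -` ball (snd c x) r"
    using w X.chart(5)[OF cX, of w] X.chart(6)[OF cX, of w] by (auto simp del: mem_ball)
  next
   fix x' assume "x' \<in> fst c \<inter> snd c -` ball (snd c x) r"
   then have "x' \<in> fst c" "snd c x' \<in> ball (snd c x) r" by auto
   then show "x' \<in> V" unfolding V_def using X.chart(4)[OF cX, of x'] by (metis image_eqI)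
  qed
  have oV: "open V" unfolding Veq
   by (rule continuous_open_preimage[OF X.chart(7)[OF cX] X.chart(1)[OF cX]]) simp
  have xV: "x \<in> V" using Veq c r by auto
  have Vc: "V \<subseteq> fst c" using Veq by auto
  have "mass c d io V < \<infinity>"
  proof (cases "y \<in> fst d")
   case True
   \<comment> \<open>The density is controlled only along the fibre, so the bound is taken on the
     part of the closed ball that lies in the fibre, a compact set.\<close>
   define K where "K = cball (snd c x) r \<inter> {w. \<forall>j. w $ io j = snd d y $ j}"
   have "compact K" unfolding K_def
    by (intro compact_Int_closed compact_cball closed_Collect_all closed_Collect_eq continuous_intros)
   have fib: "p (cinv c w) = y" "cinv c w \<in> fst c" if "w \<in> K" for w
   proof -
    have w: "w \<in> snd c ` fst c" using that r unfolding K_def by auto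
    note 1 = X.chart(5)[OF cX w] X.chart(6)[OF cX w]
    show "cinv c w \<in> fst c" by (rule 1)
    have "snd d (p (cinv c w)) = snd d y"
     using adaptedD(5)[OF c(1) 1(2)] that unfolding K_def by (auto simp: vec_eq_iff 1(1))
    then show "p (cinv c w) = y"
     using Y.chart(3)[OF adaptedD(2)[OF c(1)]] adaptedD(4)[OF c(1) 1(2)] True by (meson inj_onD)
   qed
   have "continuous_on K (\<lambda>w. dens c d (cinv c w))"
   proof (rule continuous_on_compose2[OF dens_continuous[OF cX adaptedD(2)[OF c(1)]]])
    show "continuous_on K (cinv c)" by (rule continuous_on_subset[OF X.chart(8)[OF cX]]) (use r K_def in blast)
    show "cinv c ` K \<subseteq> fst c \<inter> p -` fst d \<inter> p -` {y}"
    proof (rule image_subsetI)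
     fix w assume "w \<in> K"
     then show "cinv c w \<in> fst c \<inter> p -` fst d \<inter> p -` {y}" using fib[of w] True by simp
    qed
   qed
   then have "compact ((\<lambda>w. dens c d (cinv c w)) ` K)" by (rule compact_continuous_image) fact
   from compact_imp_bounded[OF this, unfolded bounded_pos] obtain C
    where C0: "C > 0" "\<forall>b\<in>(\<lambda>w. dens c d (cinv c w)) ` K. norm b \<le> C" by (elim exE conjE)
   note C = C0(1) C0(2)[rule_format, OF imageI]
   have "mass c d io V \<le> (\<integral>\<^sup>+z. ennreal C * indicator (cball (snd c x) r) (slice_point io (snd d y) z) \<partial>slice_lborel io)"
    unfolding mass_def
   proof (rule nn_integral_mono)
    fix z
    let ?w = "slice_point io (snd d y) z"
    show "indicator (snd c ` (V \<inter> p -` {y})) ?w * ennreal (dens c d (cinv c ?w)) \<le> ennreal C * indicator (cball (snd c x) r) ?w"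
    proof (cases "?w \<in> snd c ` (V \<inter> p -` {y})")
     case True
     then obtain x' where x': "x' \<in> V" "?w = snd c x'" by auto
     then have wb: "?w \<in> cball (snd c x) r" unfolding Veq by (auto simp: less_imp_le)
     have "?w \<in> K" unfolding K_def using wb slice_point_base[OF adaptedD(3)[OF c(1)]] by auto
     then show ?thesis using True wb C(2)[of ?w] C(1) by (auto intro!: ennreal_leI)
    qed simp
   qed
   also have "... = ennreal C * (\<integral>\<^sup>+z. indicator (cball (snd c x) r) (slice_point io (snd d y) z) \<partial>slice_lborel io)"
    by (rule nn_integral_cmult) (measurable, simp)
   also have "... < \<infinity>" using slice_bounded_finite[OF adaptedD(3)[OF c(1)], of "snd c x" r "snd d y"]
    by (simp add: ennreal_mult_less_top)
   finally show ?thesis .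
  next
   case False
   then have "V \<inter> p -` {y} = {}" using Vc adaptedD(4)[OF c(1)] by auto
   then show ?thesis by (simp add: mass_no_fibre)
  qed
  moreover have "emeasure ?mu V = mass c d io V" by (rule fibre_volume(3)[OF cpt c(1) _ Vc]) (use oV in auto)
  ultimately show ?thesis using oV xV by auto
 qed
 define \<A> where "\<A> = {V. open V \<and> emeasure ?mu V < \<infinity>}"
 have cov: "UNIV \<subseteq> \<Union>\<A>"
 proof
  fix x
  obtain V where "open V" "x \<in> V" "emeasure ?mu V < \<infinity>" using loc[of x] by (elim exE conjE)
  then have "V \<in> \<A>" unfolding \<A>_def by simp
  then show "x \<in> \<Union>\<A>" using \<open>x \<in> V\<close> by (rule UnionI)
 qed
 have op: "open V" if "V \<in> \<A>" for V using that by (simp add: \<A>_def)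
 obtain \<V> where \<V>: "\<V> \<subseteq> \<A>" "finite \<V>" "UNIV \<subseteq> \<Union>\<V>"
  using compactE[OF cpt cov op] .
 have "emeasure ?mu (\<Union>V\<in>\<V>. V) \<le> (\<Sum>V\<in>\<V>. emeasure ?mu V)"
  by (rule emeasure_subadditive_finite[OF \<V>(2)])
   (use \<V>(1) op in \<open>simp add: fibre_volume(1)[OF cpt] image_subset_iff subset_eq\<close>)
 also have "... < \<infinity>"
 proof -
  have "emeasure ?mu V < top" if "V \<in> \<V>" for V using subsetD[OF \<V>(1) that] by (simp add: \<A>_def)
  then show ?thesis using \<V>(2) by (simp add: ennreal_sum_less_top)
 qed
 finally show ?thesis using \<V>(3) by (simp add: top.extremum_unique)
qed

lemma fibre_L2_norm_square:
 assumes K: "compact (UNIV :: 'a set)"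
 shows "ennreal ((fibre_L2_norm X Y p M h y u)\<^sup>2) = emeasure (fibre_volume X Y p M h y u) UNIV"
  "fibre_L2_norm X Y p M h y u \<ge> 0"
proof -
 let ?mu = "fibre_volume X Y p M h y u"
 have b: "p -` {y} \<in> sets ?mu" "- (p -` {y}) \<in> sets ?mu" "UNIV \<in> sets ?mu"
  using fibre_borel fibre_volume(1)[OF K] by auto
 have "emeasure ?mu (p -` {y} \<union> - (p -` {y})) = emeasure ?mu (p -` {y}) + emeasure ?mu (- (p -` {y}))"
  by (rule plus_emeasure[symmetric]) (use b in auto)
 then have e: "emeasure ?mu UNIV = emeasure ?mu (p -` {y})" by (simp add: fibre_volume(2)[OF K])
 then have "emeasure ?mu (p -` {y}) \<noteq> \<infinity>" using fibre_volume_finite[OF K] by auto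
 then show "ennreal ((fibre_L2_norm X Y p M h y u)\<^sup>2) = emeasure ?mu UNIV"
  unfolding fibre_L2_norm_def e by (simp add: emeasure_eq_ennreal_measure)
qed (simp add: fibre_L2_norm_def)

end

section \<open>Rotations of slices and the Gaussian mean value inequality\<close>

lemma continuous_on_vecI: "(!!k. continuous_on S (\<lambda>x. f x $ k)) ==> continuous_on S f"
 using continuous_on_vec_lambda[of S "\<lambda>k x. f x $ k"] by simp

lemma det_matrix_scale: "cmod (det (matrix (\<lambda>v :: complex^'k::finite. c *s v))) = cmod c ^ CARD('k)"
proof -
 have "det (matrix (\<lambda>v :: complex^'k. c *s v)) = (\<Prod>i\<in>(UNIV :: 'k set). matrix (\<lambda>v :: complex^'k. c *s v) $ i $ i)"
  by (rule det_diagonal) (simp add: matrix_def axis_def)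
 then have "det (matrix (\<lambda>v :: complex^'k. c *s v)) = c ^ CARD('k)" by (simp add: matrix_def axis_def)
 then show ?thesis by (simp only: norm_power)
qed

lemma affine_scale_derivative: "((\<lambda>w. a' + c *s (w - a)) has_derivative (\<lambda>v :: complex^'k::finite. c *s v)) (at w)"
proof (rule has_derivative_vecI)
 fix k
 show "((\<lambda>x. (a' + c *s (x - a)) $ k) has_derivative (\<lambda>v. (c *s v) $ k)) (at w)"
  by (auto intro!: derivative_eq_intros has_derivative_nth)
qed

lemmas fd_affine_scale = fd_eq[OF affine_scale_derivative]

text \<open>Both Jacobian factors are powers of \<open>cmod c = 1\<close>. With \<open>c = 1\<close>
  the map is a translation between two slices, with \<open>c = cis th\<close> and equal centres it
  is a rotation within one.\<close>

lemma slice_integral_rotate: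
 fixes f :: "complex^'k::finite => ennreal" and io :: "'m::finite => 'k"
 assumes io: "inj io" and c: "cmod c = 1" and a: "!!j. a $ io j = t $ j" "!!j. a' $ io j = t' $ j"
  and f: "f \<in> borel_measurable borel"
 shows "(\<integral>\<^sup>+z. f (slice_point io t' z) \<partial>slice_lborel io) =
  (\<integral>\<^sup>+z. f (a' + c *s (slice_point io t z - a)) \<partial>slice_lborel io)"
proof -
 let ?Ph = "\<lambda>w. a' + c *s (w - a)"
 have c0: "c \<noteq> 0" using c by auto
 have surj: "range ?Ph = UNIV"
 proof (rule surjI)
  show "?Ph (a + inverse c *s (w - a')) = w" for w using c0 by (simp add: vec_eq_iff)
 qed
 have "(\<integral>\<^sup>+z. f (slice_point io t' z) * indicator (range ?Ph) (slice_point io t' z) \<partial>slice_lborel io)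
  = (\<integral>\<^sup>+z. f (?Ph (slice_point io t z)) *
    ennreal ((cmod (det (matrix (fd ?Ph (slice_point io t z)))))\<^sup>2 / (cmod (det (matrix (\<lambda>v :: complex^'m. c *s v))))\<^sup>2) *
    indicator UNIV (slice_point io t z) \<partial>slice_lborel io)"
 proof (rule fibre_change_of_variables[OF io io, where Ps = "\<lambda>w. a + inverse c *s (w - a')"])
  show "holo_map_on UNIV ?Ph"
   by (rule holo_map_onI[OF affine_scale_derivative]) (simp add: vec_eq_iff)
  show "continuous_on (range ?Ph) (\<lambda>w. a + inverse c *s (w - a'))"
   by (rule has_derivative_continuous_on[OF has_derivative_at_withinI[OF affine_scale_derivative]])
  show "det (matrix (fd ?Ph w)) \<noteq> 0" for w
   unfolding fd_affine_scale using det_matrix_scale[of c, where 'k='k] c by auto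
  show "fd ?Ph w h $ io j = (c *s (\<chi> j. h $ io j)) $ j" for w h j unfolding fd_affine_scale by simp
  show "det (matrix (\<lambda>v :: complex^'m. c *s v)) \<noteq> 0"
   using det_matrix_scale[of c, where 'k='m] c by auto
  show "linear (\<lambda>v :: complex^'m. c *s v)" by (rule linearI) (simp_all add: vec_eq_iff algebra_simps)
  show "c *s (c' *s v) = c' *s (c *s v)" for c' and v :: "complex^'m" by (simp add: vec_eq_iff)
 qed (use c0 a f surj in \<open>simp_all add: vec_eq_iff\<close>)
 then show ?thesis unfolding surj fd_affine_scale det_matrix_scale c by simp
qed

lemma submean_nn_integral:
 fixes v :: "complex^'k::finite => complex"
 assumes "open Om" "holo_on Om v" "!!ze. cmod ze \<le> 1 ==> a + ze *s b \<in> Om"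
 shows "ennreal ((cmod (v a))\<^sup>2) \<le> (\<integral>\<^sup>+th. ennreal ((cmod (v (a + cis th *s b)))\<^sup>2) \<partial>uniform_measure lborel {0..2*pi})"
proof -
 have "psh_on Om (\<lambda>z. ereal ((cmod (v z))\<^sup>2))"
  by (rule levi_nonneg_imp_psh[OF assms(1) smooth_on_cmod2[OF assms(1,2)]])
   (simp add: levi_cmod2[OF assms(1) _ assms(2)])
 then have "ereal ((cmod (v a))\<^sup>2) \<le> circle_mean (\<lambda>th. ereal ((cmod (v (a + cis th *s b)))\<^sup>2))"
  using assms(3) unfolding psh_on_def by blast
 also have "... = enn2ereal (\<integral>\<^sup>+th. ennreal ((cmod (v (a + cis th *s b)))\<^sup>2) \<partial>uniform_measure lborel {0..2*pi})"
  by (simp add: circle_mean_def ennreal_neg zero_ennreal.rep_eq)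
 finally have "e2ennreal (ereal ((cmod (v a))\<^sup>2)) \<le>
   e2ennreal (enn2ereal (\<integral>\<^sup>+th. ennreal ((cmod (v (a + cis th *s b)))\<^sup>2) \<partial>uniform_measure lborel {0..2*pi}))"
  by (rule e2ennreal_mono)
 then show ?thesis by simp
qed

lemma norm_vec_smult: "norm (c *s (v :: complex^'k::finite)) = cmod c * norm v"
 by (simp add: norm_vec_def norm_mult L2_set_right_distrib[symmetric])

text \<open>The rotations \<open>w \<mapsto> a + cis th (w - a)\<close> of the slice preserve Lebesgue measure, so a rotation invariant
 integral can be averaged over \<open>th\<close>, where the sub-mean value property applies.\<close>

lemma slice_mean_value:
 fixes v :: "complex^'k::finite => complex" and io :: "'m::finite => 'k" and g :: "real => ennreal"
 assumes io: "inj io" and a: "!!j. a $ io j = t $ j" and v: "open Om" "holo_on Om v" "ball a de \<subseteq> Om"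
  and g [measurable]: "g \<in> borel_measurable borel"
 defines "P \<equiv> slice_lborel io"
 shows "ennreal ((cmod (v a))\<^sup>2) * (\<integral>\<^sup>+z. indicator (ball a de) (slice_point io t z) * g (norm (slice_point io t z - a)) \<partial>P)
  \<le> (\<integral>\<^sup>+z. indicator (ball a de) (slice_point io t z) * (ennreal ((cmod (v (slice_point io t z)))\<^sup>2) * g (norm (slice_point io t z - a))) \<partial>P)"
proof -
 let ?U = "uniform_measure lborel {0..2*pi}"
 let ?W = "slice_point io t"
 define F where "F w = indicator (ball a de) w * (ennreal ((cmod (v w))\<^sup>2) * g (norm (w - a)))" for w
 interpret product_sigma_finite "\<lambda>_::'k. lborel :: complex measure" by (rule PiM_lborel_product)
 have U1: "emeasure ?U (space ?U) = 1" using emeasure_uniform_measure_1[of lborel "{0..2*pi}"] by simp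
 interpret U: finite_measure ?U by (rule finite_measureI) (simp only: U1, simp)
 interpret P: sigma_finite_measure P unfolding P_def by (rule sigma_finite) simp
 interpret pair_sigma_finite ?U P ..
 have W [measurable]: "?W \<in> borel_measurable P" unfolding P_def by measurable
 have vc: "continuous_on (ball a de) v" by (rule continuous_on_subset[OF holo_on_continuous[OF v(2)] v(3)])
 have vb: "(\<lambda>w. indicator (ball a de) w *\<^sub>R (cmod (v w))\<^sup>2) \<in> borel_measurable borel"
  by (rule borel_measurable_continuous_on_indicator) (use vc in \<open>auto intro!: continuous_intros\<close>)
 have Feq: "F w = ennreal (indicator (ball a de) w *\<^sub>R (cmod (v w))\<^sup>2) * g (norm (w - a))" for w
  unfolding F_def by (auto simp: indicator_def)
 have Fb [measurable]: "F \<in> borel_measurable borel"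
  unfolding Feq[abs_def] using vb by measurable
 have rot: "(\<integral>\<^sup>+z. F (?W z) \<partial>P) = (\<integral>\<^sup>+z. F (a + cis th *s (?W z - a)) \<partial>P)" for th
  unfolding P_def by (rule slice_integral_rotate[OF io _ a a Fb]) simp
 have cm: "continuous_on UNIV (\<lambda>x :: real \<times> (complex^'k). a + cis (fst x) *s (snd x - a))"
  by (rule continuous_on_vecI) (simp, intro continuous_intros)
 have [measurable]: "(\<lambda>x :: real \<times> (complex^'k). F (a + cis (fst x) *s (snd x - a))) \<in> borel_measurable (borel \<Otimes>\<^sub>M borel)"
  unfolding borel_prod by (rule measurable_compose[OF borel_measurable_continuous_onI[OF cm] Fb])
 have m: "(\<lambda>(th, z). F (a + cis th *s (?W z - a))) \<in> borel_measurable (?U \<Otimes>\<^sub>M P)"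
 proof -
  have "(\<lambda>x. (fst x, ?W (snd x))) \<in> measurable (?U \<Otimes>\<^sub>M P) (borel \<Otimes>\<^sub>M borel)" by measurable
  from measurable_compose[OF this \<open>(\<lambda>x. F (a + cis (fst x) *s (snd x - a))) \<in> _\<close>]
  show ?thesis by (simp add: case_prod_beta')
 qed
 have "ennreal ((cmod (v a))\<^sup>2) * (\<integral>\<^sup>+z. indicator (ball a de) (?W z) * g (norm (?W z - a)) \<partial>P)
  = (\<integral>\<^sup>+z. ennreal ((cmod (v a))\<^sup>2) * (indicator (ball a de) (?W z) * g (norm (?W z - a))) \<partial>P)"
 proof (rule nn_integral_cmult[symmetric])
  have "(\<lambda>w. norm (w - a)) \<in> borel_measurable borel"
   by (intro borel_measurable_continuous_onI continuous_intros)
  then have "(\<lambda>w. g (norm (w - a))) \<in> borel_measurable borel" by (rule measurable_compose[OF _ g])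
  then have "(\<lambda>w. indicator (ball a de) w * g (norm (w - a))) \<in> borel_measurable borel"
   by (intro borel_measurable_times_ennreal borel_measurable_indicator) auto
  then show "(\<lambda>z. indicator (ball a de) (?W z) * g (norm (?W z - a))) \<in> borel_measurable P"
   by (rule measurable_compose[OF W])
 qed
 \<comment> \<open>The disc through the slice point lies in the ball, and the indicator and
   \<open>g\<close> are constant on its boundary circle, so only \<open>v\<close> has to be
   averaged.\<close>
 also have "... \<le> (\<integral>\<^sup>+z. (\<integral>\<^sup>+th. F (a + cis th *s (?W z - a)) \<partial>?U) \<partial>P)"
 proof (rule nn_integral_mono)
  fix z
  let ?b = "?W z - a"
  have nb: "norm (cis th *s ?b) = norm ?b" for th by (simp only: norm_vec_smult norm_cis mult_1)
  show "ennreal ((cmod (v a))\<^sup>2) * (indicator (ball a de) (?W z) * g (norm (?W z - a)))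
   \<le> (\<integral>\<^sup>+th. F (a + cis th *s ?b) \<partial>?U)"
  proof (cases "?W z \<in> ball a de")
   case True
   then have nd: "norm ?b < de" by (simp add: dist_norm norm_minus_commute)
   have in_ball: "a + ze *s ?b \<in> ball a de" if "cmod ze \<le> 1" for ze
   proof -
    have "norm (ze *s ?b) \<le> 1 * norm ?b" unfolding norm_vec_smult by (rule mult_right_mono) (use that in auto)
    then show ?thesis using nd by (simp add: dist_norm del: vector_ssub_ldistrib)
   qed
   have "continuous_on UNIV (\<lambda>th. v (a + cis th *s ?b))"
   proof (rule continuous_on_compose2[OF vc])
    show "continuous_on UNIV (\<lambda>th. a + cis th *s ?b)"
     by (rule continuous_on_vecI) (simp, intro continuous_intros)
   qed (use in_ball in auto)
   then have [measurable]: "(\<lambda>th. v (a + cis th *s ?b)) \<in> borel_measurable borel"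
    by (rule borel_measurable_continuous_onI)
   have "ennreal ((cmod (v a))\<^sup>2) * g (norm ?b) \<le>
    (\<integral>\<^sup>+th. ennreal ((cmod (v (a + cis th *s ?b)))\<^sup>2) \<partial>?U) * g (norm ?b)"
    by (intro mult_right_mono submean_nn_integral[OF v(1,2)]) (use in_ball v(3) in auto)
   also have "... = (\<integral>\<^sup>+th. ennreal ((cmod (v (a + cis th *s ?b)))\<^sup>2) * g (norm ?b) \<partial>?U)"
    by (rule nn_integral_multc[symmetric]) measurable
   also have "... = (\<integral>\<^sup>+th. F (a + cis th *s ?b) \<partial>?U)"
    using in_ball[of "cis _"] by (intro nn_integral_cong) (simp add: F_def nb del: vector_ssub_ldistrib)
   finally show ?thesis using True by simp
  qed simp
 qed
 also have "... = (\<integral>\<^sup>+th. (\<integral>\<^sup>+z. F (a + cis th *s (?W z - a)) \<partial>P) \<partial>?U)"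
  by (rule Fubini') (use m in simp)
 also have "... = (\<integral>\<^sup>+th. (\<integral>\<^sup>+z. F (?W z) \<partial>P) \<partial>?U)" by (simp only: rot[symmetric])
 also have "... = (\<integral>\<^sup>+z. F (?W z) \<partial>P)" by (simp add: U1[simplified])
 finally show ?thesis unfolding F_def .
qed

definition slice_gauss :: "('m::finite => 'k::finite) => real => real => ennreal" where
 "slice_gauss io de B = (\<integral>\<^sup>+z. indicator (ball 0 de) (slice_point io 0 z) *
   ennreal (exp (- B * (norm (slice_point io 0 z))\<^sup>2)) \<partial>slice_lborel io)"

text \<open>A translation moves the centre to 0. Since the value depends neither on \<open>a\<close>
  nor on \<open>t\<close>, the Gaussian factors at the centre and on the circle are the same number
  and cancel.\<close>

lemma slice_gauss_eq:
 fixes io :: "'m::finite => 'k::finite"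
 assumes "inj io" "!!j. a $ io j = t $ j"
 shows "(\<integral>\<^sup>+z. indicator (ball a de) (slice_point io t z) *
   ennreal (exp (- B * (norm (slice_point io t z - a))\<^sup>2)) \<partial>slice_lborel io) = slice_gauss io de B"
 using slice_integral_rotate[OF assms(1), of 1 0 0 a t "\<lambda>w. indicator (ball a de) w * ennreal (exp (- B * (norm (w - a))\<^sup>2))"] assms(2)
 by (simp add: slice_gauss_def indicator_def dist_norm norm_minus_commute)

lemma slice_gauss_finite:
 assumes "inj io" "B \<ge> 0"
 shows "slice_gauss io de B < \<infinity>"
proof -
 have "slice_gauss io de B \<le> (\<integral>\<^sup>+z. indicator (cball 0 de) (slice_point io 0 z) \<partial>slice_lborel io)"
  unfolding slice_gauss_def by (rule nn_integral_mono) (use assms(2) in \<open>auto simp: indicator_def\<close>)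
 then show ?thesis using slice_bounded_finite[OF assms(1), of 0 de 0] by (rule le_less_trans)
qed

text \<open>On a ball of radius \<open>r\<close> with \<open>B * r\<^sup>2 \<le> et\<close> the
  integrand is at least \<open>exp (- k * et)\<close>, and the volume does not depend on
  \<open>k\<close>. So the Gaussian integral decays more slowly than any given exponential.\<close>

lemma slice_gauss_lower:
 fixes io :: "'m::finite => 'k::finite"
 assumes "inj io" "de > 0" "et > 0" "B > 0"
 shows "\<exists>V>0. \<forall>k::nat. slice_gauss io de (real k * B) \<ge> ennreal (V * exp (- real k * et))"
proof -
 interpret product_sigma_finite "\<lambda>_::'k. lborel :: complex measure" by (rule PiM_lborel_product)
 let ?P = "slice_lborel io"
 define r where "r = min (de / 2) (sqrt (et / B))"
 have r: "r > 0" "r < de" "B * r\<^sup>2 \<le> et"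
 proof -
  show "r > 0" "r < de" using assms unfolding r_def by auto
  have "r\<^sup>2 \<le> (sqrt (et / B))\<^sup>2" by (rule power_mono) (use \<open>r > 0\<close> r_def in auto)
  then show "B * r\<^sup>2 \<le> et" using assms by (simp add: field_simps)
 qed
 \<comment> \<open>A polydisc of this radius lies in the ball of radius \<open>r / 2\<close>, by the
   triangle inequality over all coordinates.\<close>
 define s where "s = r / (2 * real CARD('k))"
 have s: "s > 0" unfolding s_def using r by simp
 let ?Q = "Pi\<^sub>E (- range io) (\<lambda>_. cball 0 s) :: ('k => complex) set"
 define v where "v = measure lborel (cball (0::complex) s)"
 have v: "v > 0" "emeasure lborel (cball (0::complex) s) = ennreal v"
 proof -
  show e: "emeasure lborel (cball (0::complex) s) = ennreal v"
   unfolding v_def by (rule emeasure_eq_ennreal_measure) (use emeasure_lborel_cball_finite in \<open>auto simp: less_top[symmetric]\<close>)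
  show "v > 0" unfolding v_def using s by simp
 qed
 have Q: "emeasure ?P ?Q = ennreal (v ^ card (- range io))"
 proof -
  have "emeasure ?P ?Q = (\<Prod>k\<in>- range io. emeasure lborel (cball (0::complex) s))" by (rule emeasure_PiM) auto
  then show ?thesis using v by (simp add: ennreal_power)
 qed
 have "slice_gauss io de (real k * B) \<ge> ennreal (v ^ card (- range io) * exp (- real k * et))" for k :: nat
 proof -
  have "ennreal (v ^ card (- range io) * exp (- real k * et)) = (\<integral>\<^sup>+z. ennreal (exp (- real k * et)) * indicator ?Q z \<partial>?P)"
   by (subst nn_integral_cmult_indicator) (auto intro!: sets_PiM_I_finite simp: Q v(1) less_imp_le ennreal_mult mult.commute)
  also have "... \<le> slice_gauss io de (real k * B)"
   unfolding slice_gauss_def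
  proof (rule nn_integral_mono)
   fix z
   let ?w = "slice_point io 0 z"
   show "ennreal (exp (- real k * et)) * indicator ?Q z \<le>
    indicator (ball 0 de) ?w * ennreal (exp (- (real k * B) * (norm ?w)\<^sup>2))"
   proof (cases "z \<in> ?Q")
    case True
    have "norm ?w \<le> (\<Sum>i\<in>UNIV. norm (?w $ i))" unfolding norm_vec_def by (rule L2_set_le_sum) simp
    also have "... \<le> (\<Sum>i\<in>(UNIV :: 'k set). s)"
     using True s by (intro sum_mono) (auto simp: slice_point_def PiE_def Pi_def)
    also have "... = r / 2" by (simp add: s_def)
    finally have n: "norm ?w \<le> r" using r by simp
    have "B * (norm ?w)\<^sup>2 \<le> B * r\<^sup>2" using n assms by (intro mult_left_mono power_mono) auto
    then have "B * (norm ?w)\<^sup>2 \<le> et" using r by simp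
    then have "real k * (B * (norm ?w)\<^sup>2) \<le> real k * et" by (rule mult_left_mono) simp
    then show ?thesis using True n r by (simp add: ennreal_leI mult.assoc)
   qed simp
  qed
  finally show ?thesis .
 qed
 then show ?thesis using v by (intro exI[of _ "v ^ card (- range io)"]) auto
qed

section \<open>Projective embeddings\<close>

text \<open>The local data of the embedding become functions of the point, so that one may speak of
  the affine chart at \<open>x\<close>: \<open>ff x\<close> lifts \<open>F\<close> to homogeneous
  coordinates on \<open>WW x\<close> with the entry 1 in position \<open>ii x\<close>.\<close>

locale projective_submersion = submersion X Y p
 for X :: "('a::{t2_space,second_countable_topology}, 'k::finite) chart set"
  and Y :: "('b::{t2_space,second_countable_topology}, 'm::finite) chart set"
  and p :: "'a => 'b" +
 fixes N :: nat and F :: "'a => (nat => complex) set" and WW :: "'a => 'a set" and ii :: "'a => nat"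
  and ff :: "'a => 'a => nat => complex"
 assumes cpt: "compact (UNIV :: 'a set)" and F_inj: "inj F"
  and WW: "open (WW x)" "x \<in> WW x" and ii: "ii x \<le> N"
  and ff: "z \<in> WW x ==> F z = proj_point (ff x z)" "z \<in> WW x ==> ff x z (ii x) = 1"
   "z \<in> WW x ==> j > N ==> ff x z j = 0"
  and ff_holo: "holo_fun X (WW x) (\<lambda>z. ff x z j)"
  and immersion: "c \<in> X ==> x \<in> fst c ==> (!!j. fd (\<lambda>w. ff x (cinv c w) j) (snd c x) v = 0) ==> v = 0"
begin

text \<open>Both lifts represent the same line, and the normalisation of the second one identifies
  the factor. As functions of \<open>z\<close> these factors are the transition functions of the
  hyperplane bundle.\<close>

lemma ff_change:
 assumes "z \<in> WW x" "z \<in> WW x'"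
 shows "ff x z j = ff x z (ii x') * ff x' z j"
proof -
 have "ff x z \<in> proj_point (ff x z)" unfolding proj_point_def by (rule CollectI, rule exI[of _ 1]) simp
 then have "ff x z \<in> proj_point (ff x' z)" using ff(1)[OF assms(1)] ff(1)[OF assms(2)] by simp
 then obtain c where c: "ff x z = (\<lambda>j. c * ff x' z j)" unfolding proj_point_def by auto
 show ?thesis using ff(2)[OF assms(2)] by (simp add: c)
qed

lemma ff_nz: "z \<in> WW x ==> z \<in> WW x' ==> ff x z (ii x') \<noteq> 0"
 using ff_change[of z x x' "ii x"] ff(2)[of z x] by auto

text \<open>\<open>1 / nrm x\<close> is the Fubini-Study metric of the hyperplane bundle in the
  affine frame at \<open>x\<close>, and \<open>ln (nrm x)\<close> is its weight.\<close>

definition nrm :: "'a => 'a => real" where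
 "nrm x z = (\<Sum>j\<le>N. (cmod (ff x z j))\<^sup>2)"

lemma nrm_pos: "z \<in> WW x ==> nrm x z > 0"
 unfolding nrm_def by (rule sum_pos2[where i = "ii x"]) (auto simp: ii ff(2))

lemma nrm_change: "z \<in> WW x ==> z \<in> WW x' ==> nrm x z = (cmod (ff x z (ii x')))\<^sup>2 * nrm x' z"
 unfolding nrm_def sum_distrib_left
 by (rule sum.cong[OF refl], subst ff_change[of z x x']) (auto simp: norm_mult power_mult_distrib)

lemma nrm_smooth: "smooth_fun X (WW x) (nrm x)"
 unfolding nrm_def[abs_def] by (intro X.smooth_fun_sum X.smooth_fun_cmod2 ff_holo WW)

text \<open>In the affine chart at \<open>z\<close> itself a null vector makes the derivative of the
  lift a multiple \<open>s\<close> of the lift. The normalised coordinate is constant, so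
  \<open>s = 0\<close>, and the immersion property gives \<open>v = 0\<close>.\<close>

lemma levi_ln_nrm:
 assumes c: "c \<in> X" "z \<in> fst c" and z: "z \<in> WW x"
 shows "levi (\<lambda>w. ln (nrm x (cinv c w))) (snd c z) v \<ge> 0"
  and "levi (\<lambda>w. ln (nrm x (cinv c w))) (snd c z) v = 0 ==> v = 0"
proof -
 let ?Om = "snd c ` (fst c \<inter> (WW x \<inter> WW z))"
 have op: "open ?Om" by (intro X.chart_image_open c open_Int WW)
 have zO: "snd c z \<in> ?Om" using c z WW by blast
 have pt: "cinv c w \<in> WW x" "cinv c w \<in> WW z" if "w \<in> ?Om" for w using X.chart_pt[OF c(1) that] by auto
 have hol: "holo_on ?Om (\<lambda>w. ff y (cinv c w) j)" if "y = x \<or> y = z" for y j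
  by (rule holo_on_subset[OF holo_funD[OF ff_holo c(1)]]) (use that in auto)
 have sm: "smooth_on ?Om (\<lambda>w. ln (nrm z (cinv c w)))"
  unfolding nrm_def
  by (intro smooth_on_ln smooth_on_sum smooth_on_cmod2 op hol) (use nrm_pos[OF pt(2)] in \<open>auto simp: nrm_def\<close>)
 have sm': "smooth_on ?Om (\<lambda>w. ln ((cmod (ff x (cinv c w) (ii z)))\<^sup>2))"
  by (intro smooth_on_ln smooth_on_cmod2 op hol) (use ff_nz[OF pt] in auto)
 have "levi (\<lambda>w. ln (nrm x (cinv c w))) (snd c z) v =
  levi (\<lambda>w. ln ((cmod (ff x (cinv c w) (ii z)))\<^sup>2) + ln (nrm z (cinv c w))) (snd c z) v"
 proof (rule levi_cong[OF op zO])
  fix w assume w: "w \<in> ?Om"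
  show "ln (nrm x (cinv c w)) = ln ((cmod (ff x (cinv c w) (ii z)))\<^sup>2) + ln (nrm z (cinv c w))"
   using nrm_change[OF pt[OF w]] nrm_pos[OF pt(2)[OF w]] ff_nz[OF pt[OF w]] by (simp add: ln_mult)
 qed
 also have "... = levi (\<lambda>w. ln ((cmod (ff x (cinv c w) (ii z)))\<^sup>2)) (snd c z) v + levi (\<lambda>w. ln (nrm z (cinv c w))) (snd c z) v"
  by (rule levi_add[OF op zO sm' sm])
 also have "levi (\<lambda>w. ln ((cmod (ff x (cinv c w) (ii z)))\<^sup>2)) (snd c z) v = 0"
  by (rule levi_ln_cmod2[OF op zO hol]) (use ff_nz[OF pt] in auto)
 finally have eq: "levi (\<lambda>w. ln (nrm x (cinv c w))) (snd c z) v = levi (\<lambda>w. ln (nrm z (cinv c w))) (snd c z) v" by simp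
 have "\<exists>s. levi (\<lambda>w. ln (\<Sum>j\<le>N. (cmod (ff z (cinv c w) j))\<^sup>2)) (snd c z) v =
   4 * (\<Sum>j\<le>N. (cmod (fd (\<lambda>w. ff z (cinv c w) j) (snd c z) v - s * ff z (cinv c (snd c z)) j))\<^sup>2) /
   (\<Sum>j\<le>N. (cmod (ff z (cinv c (snd c z)) j))\<^sup>2)"
  by (rule levi_ln_sum_cmod2[OF op zO]) (use hol nrm_pos[OF pt(2)] in \<open>auto simp: nrm_def\<close>)
 then obtain s where s: "levi (\<lambda>w. ln (nrm x (cinv c w))) (snd c z) v =
   4 * (\<Sum>j\<le>N. (cmod (fd (\<lambda>w. ff z (cinv c w) j) (snd c z) v - s * ff z z j))\<^sup>2) / nrm z z"
  unfolding eq unfolding nrm_def X.chart(4)[OF c] by blast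
 show "levi (\<lambda>w. ln (nrm x (cinv c w))) (snd c z) v \<ge> 0"
  unfolding s using nrm_pos[OF WW(2)[of z]] by (intro divide_nonneg_pos mult_nonneg_nonneg sum_nonneg) auto
 assume "levi (\<lambda>w. ln (nrm x (cinv c w))) (snd c z) v = 0"
 then have "(\<Sum>j\<le>N. (cmod (fd (\<lambda>w. ff z (cinv c w) j) (snd c z) v - s * ff z z j))\<^sup>2) = 0"
  unfolding s using nrm_pos[OF WW(2)[of z]] by simp
 then have 0: "fd (\<lambda>w. ff z (cinv c w) j) (snd c z) v = s * ff z z j" if "j \<le> N" for j
  using that by (subst (asm) sum_nonneg_eq_0_iff) auto
 have const: "fd (\<lambda>w. ff z (cinv c w) j) (snd c z) = (\<lambda>v. 0)" if "!!z'. z' \<in> WW z ==> ff z z' j = q" for j q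
 proof -
  have "fd (\<lambda>w. ff z (cinv c w) j) (snd c z) = fd (\<lambda>w. q) (snd c z)"
   by (rule fd_cong_open[OF op zO]) (rule that[OF pt(2)])
  then show ?thesis by (simp add: fd_eq[OF has_derivative_const])
 qed
 have "s = 0" using 0[OF ii[of z]] const[of "ii z" 1] ff(2) WW(2) by simp
 show "v = 0"
 proof (rule immersion[OF c])
  fix j show "fd (\<lambda>w. ff z (cinv c w) j) (snd c z) v = 0"
   using 0[of j] \<open>s = 0\<close> const[of j 0] ff(3)[of _ z j] by (cases "j \<le> N") auto
 qed
qed

text \<open>The hyperplane section orthogonal to \<open>F x0\<close>; its squared norm \<open>ray\<close> is maximal at \<open>x0\<close> only.\<close>

definition ell :: "'a => 'a => 'a => complex" where
 "ell x0 x z = (\<Sum>j\<le>N. cnj (ff x0 x0 j) * ff x z j) / of_real (sqrt (nrm x0 x0))"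

definition ray :: "'a => 'a => 'a => real" where
 "ray x0 x z = (cmod (ell x0 x z))\<^sup>2 / nrm x z"

lemma ell_holo: "holo_fun X (WW x) (ell x0 x)"
 unfolding ell_def[abs_def] divide_inverse
 by (intro X.holo_fun_mult X.holo_fun_sum X.holo_fun_const ff_holo)

lemma ell_change: "z \<in> WW x ==> z \<in> WW x' ==> ell x0 x z = ff x z (ii x') * ell x0 x' z"
 unfolding ell_def times_divide_eq_right sum_distrib_left
 by (rule arg_cong2[where f = "(/)", OF sum.cong[OF refl]], subst ff_change[of z x x']) auto

lemma ray_change: "z \<in> WW x ==> z \<in> WW x' ==> ray x0 x z = ray x0 x' z"
 unfolding ray_def using ff_nz[of z x x'] by (simp add: ell_change[of z x x'] nrm_change[of z x x'] norm_mult power_mult_distrib)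

text \<open>Cauchy-Schwarz for the lifts at \<open>x0\<close> and at \<open>z\<close>. Equality
  makes the lifts proportional, so the points of projective space agree and injectivity of
  \<open>F\<close> applies.\<close>

lemma ray_props:
 assumes z: "z \<in> WW x"
 shows "0 \<le> ray x0 x z" "ray x0 x z \<le> 1" "ray x0 x z = 1 ==> z = x0"
proof -
 let ?a = "ff x0 x0" and ?b = "ff x z"
 have pos: "nrm x0 x0 > 0" "nrm x z > 0" using nrm_pos WW z by auto
 define s where "s = (\<Sum>j\<le>N. cnj (?a j) * ?b j) / of_real (nrm x0 x0)"
 have CS: "nrm x0 x0 * nrm x z - (cmod (\<Sum>j\<le>N. cnj (?a j) * ?b j))\<^sup>2 = nrm x0 x0 * (\<Sum>j\<le>N. (cmod (?b j - s * ?a j))\<^sup>2)"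
  using complex_Cauchy_Schwarz_sum[of "{..N}" ?a ?b] pos unfolding nrm_def s_def by simp
 have e: "(cmod (ell x0 x z))\<^sup>2 = (cmod (\<Sum>j\<le>N. cnj (?a j) * ?b j))\<^sup>2 / nrm x0 x0"
  using pos unfolding ell_def by (simp add: norm_divide power_divide)
 have rr: "1 - ray x0 x z = (\<Sum>j\<le>N. (cmod (?b j - s * ?a j))\<^sup>2) / nrm x z"
 proof -
  have "1 - ray x0 x z = (nrm x0 x0 * nrm x z - (cmod (\<Sum>j\<le>N. cnj (?a j) * ?b j))\<^sup>2) / (nrm x0 x0 * nrm x z)"
   using pos unfolding ray_def e by (simp add: diff_divide_distrib)
  then show ?thesis unfolding CS using pos by simp
 qed
 have nn: "(\<Sum>j\<le>N. (cmod (?b j - s * ?a j))\<^sup>2) \<ge> 0" by (intro sum_nonneg) auto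
 then have "0 \<le> (\<Sum>j\<le>N. (cmod (?b j - s * ?a j))\<^sup>2) / nrm x z" using pos by (intro divide_nonneg_pos) auto
 then show "ray x0 x z \<le> 1" using rr by linarith
 show "0 \<le> ray x0 x z" unfolding ray_def using pos by simp
 assume "ray x0 x z = 1"
 then have "(\<Sum>j\<le>N. (cmod (?b j - s * ?a j))\<^sup>2) = 0" using rr pos by simp
 then have 1: "?b j = s * ?a j" if "j \<le> N" for j using that by (subst (asm) sum_nonneg_eq_0_iff) auto
 have b: "?b j = s * ?a j" for j using 1[of j] ff(3)[OF z, of j] ff(3)[OF WW(2)[of x0], of j] by (cases "j \<le> N") auto
 have "s \<noteq> 0" using b[of "ii x"] ff(2)[OF z] by auto
 have "proj_point ?b = proj_point ?a"
 proof -
  have "(\<lambda>j. c * ?b j) = (\<lambda>j. (c * s) * ?a j)" "(\<lambda>j. c * ?a j) = (\<lambda>j. (c / s) * ?b j)" for c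
   using b \<open>s \<noteq> 0\<close> by (simp_all add: fun_eq_iff)
  then show ?thesis unfolding proj_point_def by blast
 qed
 then have "F z = F x0" using ff(1)[OF z] ff(1)[OF WW(2)[of x0]] by simp
 then show "z = x0" using F_inj by (simp add: inj_eq)
qed

lemma ray_center: "ray x0 x0 x0 = 1"
proof -
 have n: "nrm x0 x0 > 0" by (rule nrm_pos[OF WW(2)])
 have "(\<Sum>j\<le>N. cnj (ff x0 x0 j) * ff x0 x0 j) = of_real (nrm x0 x0)"
  unfolding nrm_def of_real_sum by (intro sum.cong refl) (metis complex_norm_square mult.commute of_real_power)
 then have "ell x0 x0 x0 = of_real (nrm x0 x0 / sqrt (nrm x0 x0))" unfolding ell_def by simp
 then show ?thesis unfolding ray_def using n by (simp add: real_div_sqrt)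
qed

text \<open>Evaluating at \<open>z\<close> in the affine chart at \<open>z\<close> gives one
  function on the whole manifold; by \<open>ray_change\<close> it agrees locally with a fixed
  chart.\<close>

lemma ray_continuous: "continuous_on UNIV (\<lambda>z. ray x0 z z)"
proof -
 have "continuous_on (WW x) (\<lambda>z. ray x0 z z)" for x
 proof -
  have "continuous_on (WW x) (ray x0 x)"
   unfolding ray_def[abs_def]
   by (intro continuous_intros X.holo_fun_continuous[OF ell_holo WW(1)] X.smooth_fun_continuous[OF nrm_smooth WW(1)])
    (use nrm_pos in \<open>auto simp: less_imp_neq[symmetric]\<close>)
  then show ?thesis
   by (rule continuous_on_cong[THEN iffD1, rotated -1, OF _ refl]) (rule ray_change[OF _ WW(2)])
 qed
 then have "continuous_on (\<Union>x. WW x) (\<lambda>z. ray x0 z z)" by (intro continuous_on_open_UN WW(1))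
 moreover have "(\<Union>x. WW x) = UNIV" using WW(2) by blast
 ultimately show ?thesis by simp
qed

lemma ray_bound:
 assumes "open B" "x0 \<in> B"
 shows "\<exists>rh<1. 0 < rh \<and> (\<forall>z x. z \<notin> B --> z \<in> WW x --> ray x0 x z \<le> rh)"
proof (cases "B = UNIV")
 case True
 then show ?thesis by (intro exI[of _ "1/2"]) auto
next
 case False
 have "compact (- B)" using cpt assms(1) by (simp add: Compl_eq_Diff_UNIV compact_diff)
 moreover have "- B \<noteq> {}" using False by auto
 ultimately have "\<exists>z0\<in>- B. \<forall>z\<in>- B. ray x0 z z \<le> ray x0 z0 z0"
  by (rule continuous_attains_sup) (rule continuous_on_subset[OF ray_continuous subset_UNIV])
 then obtain z0 where z0: "z0 \<in> - B" "!!z. z \<in> - B ==> ray x0 z z \<le> ray x0 z0 z0" by blast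
 have "ray x0 z0 z0 < 1" using ray_props(2,3)[OF WW(2)[of z0], of x0] z0 assms(2) by force
 moreover have "ray x0 x z \<le> ray x0 z0 z0" if "z \<notin> B" "z \<in> WW x" for z x
  using z0(2)[of z] that ray_change[OF that(2) WW(2)] by simp
 \<comment> \<open>The maximum with 1/2 keeps the bound positive, as its logarithm is taken
   later.\<close>
 ultimately show ?thesis by (intro exI[of _ "max (1/2) (ray x0 z0 z0)"]) (auto intro: max.coboundedI2)
qed

end

section \<open>Modifying the metric near a point of negative curvature\<close>

context cmanifold
begin

lemma chart_preimage:
 assumes c: "c \<in> X" and A: "A \<subseteq> snd c ` fst c"
 shows "z \<in> cinv c ` A \<longleftrightarrow> z \<in> fst c \<and> snd c z \<in> A"
  and "open A ==> open (cinv c ` A)" and "compact A ==> closed (cinv c ` A)"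
proof -
 show *: "z \<in> cinv c ` A \<longleftrightarrow> z \<in> fst c \<and> snd c z \<in> A" for z
 proof
  assume "z \<in> cinv c ` A"
  then obtain w where w: "w \<in> A" "z = cinv c w" by blast
  then have "w \<in> snd c ` fst c" using A by blast
  then show "z \<in> fst c \<and> snd c z \<in> A" using w chart(5)[OF c, of w] chart(6)[OF c, of w] by simp
 next
  assume "z \<in> fst c \<and> snd c z \<in> A"
  then show "z \<in> cinv c ` A" using chart(4)[OF c, of z] by (metis image_eqI)
 qed
 show "open (cinv c ` A)" if "open A"
 proof -
  have "cinv c ` A = fst c \<inter> snd c -` A" using * by blast
  then show ?thesis using continuous_open_preimage[OF chart(7)[OF c] chart(1)[OF c] that] by simp
 qed
 show "closed (cinv c ` A)" if "compact A"
  by (rule compact_imp_closed, rule compact_continuous_image[OF _ that])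
   (rule continuous_on_subset[OF chart(8)[OF c] A])
qed

lemma holo_fun_diff: "holo_fun X W f ==> holo_fun X W g ==> holo_fun X W (\<lambda>x. f x - g x)"
 using holo_fun_add[of W f "\<lambda>x. (-1) * g x"] holo_fun_mult[of W "\<lambda>x. -1" g] by simp

end

lemma norm_vec_square: "(norm (v :: complex^'k::finite))\<^sup>2 = (\<Sum>k\<in>UNIV. (cmod (v $ k))\<^sup>2)"
 by (simp add: norm_vec_def L2_set_def sum_nonneg)

text \<open>The exponents \<open>ep\<close>, \<open>4 ep\<close>, \<open>ep / 2\<close> and the convex function \<open>th\<close> are chosen so that the modified weight
 \<open>Th\<close> below vanishes away from \<open>x0\<close> and is affine in \<open>psi1 + ln ray\<close> close to it.\<close>

locale negative_point = projective_submersion X Y p N F WW ii ff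
 for X :: "('a::{t2_space,second_countable_topology}, 'k::finite) chart set"
  and Y :: "('b::{t2_space,second_countable_topology}, 'm::finite) chart set"
  and p :: "'a => 'b" and N F WW ii ff +
 fixes L :: "('i, 'a) line_bundle" and hL :: "'i => 'a => real" and x0 :: 'a and i0 :: 'i
  and c0 :: "('a, 'k) chart" and d0 :: "('b, 'm) chart" and io0 :: "'m => 'k" and w0 v0 :: "complex^'k" and k1 :: 'k
  and de0 R ep B ka :: real and S th :: "real => real"
 assumes L: "holomorphic_line_bundle X L" and hL: "hermitian_metric X L hL" and i0: "i0 \<in> lb_index L"
  and ad0: "(c0, d0, io0) \<in> adapted_charts X Y p" and x0: "x0 \<in> fst c0" "w0 = snd c0 x0"
  and k1: "k1 \<in> range io0" and v0: "v0 $ k1 = 1"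
  and R: "R > 0" "cball w0 (4 * R) \<subseteq> snd c0 ` (fst c0 \<inter> (WW x0 \<inter> lb_dom L i0))"
  and ell_nz: "w \<in> cball w0 (4 * R) ==> ell x0 x0 (cinv c0 w) \<noteq> 0"
  and neg: "de0 > 0" "w \<in> ball w0 R ==> levi (\<lambda>w. ln (hL i0 (cinv c0 w))) w v0 \<ge> de0"
  and eps: "ep > 0" "z \<notin> cinv c0 ` ball w0 (R / 2) ==> z \<in> WW x ==> ray x0 x z \<le> exp (- 4 * ep)"
  and B: "B > 0" "norm (w - w0) \<le> R ==> B * (norm (w - w0 - (w $ k1 - w0 $ k1) *s v0))\<^sup>2 \<le> ep"
  and S: "smooth_real UNIV S" "\<exists>s\<ge>0. (S has_real_derivative s) (at t)" "t \<le> 0 ==> S t = 0" "t \<ge> ep / 2 ==> S t = 1"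
   "0 \<le> S t" "S t \<le> 1"
  and th: "smooth_real UNIV th" "(th has_real_derivative S t) (at t)" "t \<le> 0 ==> th t = 0"
   "t \<ge> ep / 2 ==> th t = t - ka" "th t \<ge> 0" "th t \<ge> t - ka"
begin

lemmas c0X = adapted_iff[THEN iffD1, OF ad0, THEN conjunct1]

text \<open>\<open>w $ k1 - w0 $ k1\<close> is the parameter of the point of the line in the same
  \<open>k1\<close>-hyperplane as \<open>w\<close>, and the sum is the squared norm of the remaining
  displacement. Written in coordinates, it falls under the rules for squared moduli of holomorphic
  functions.\<close>

definition psi1 :: "complex^'k => real" where
 "psi1 w = B * (\<Sum>k\<in>UNIV. (cmod (w $ k - w0 $ k - (w $ k1 - w0 $ k1) * v0 $ k))\<^sup>2)"

lemma psi1_norm: "psi1 w = B * (norm (w - w0 - (w $ k1 - w0 $ k1) *s v0))\<^sup>2"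
 unfolding psi1_def norm_vec_square by (simp add: algebra_simps)

lemma psi1_smooth: "smooth_on UNIV psi1"
 unfolding psi1_def[abs_def]
 by (intro smooth_on_mult smooth_on_const smooth_on_sum smooth_on_cmod2 holo_on_diff holo_on_mult) auto

lemma psi1_levi: "levi psi1 w v = 4 * B * (norm (v - v $ k1 *s v0))\<^sup>2"
proof -
 let ?l = "\<lambda>k w. w $ k - w0 $ k - (w $ k1 - w0 $ k1) * v0 $ k"
 have h: "holo_on UNIV (?l k)" for k by (intro holo_on_diff holo_on_mult) auto
 have fdl: "fd (?l k) w v = v $ k - v $ k1 * v0 $ k" for k
  by (subst fd_eq[where D = "\<lambda>v. v $ k - v $ k1 * v0 $ k"])
   (auto intro!: derivative_eq_intros has_derivative_nth)
 have "levi psi1 w v = B * levi (\<lambda>w. \<Sum>k\<in>UNIV. (cmod (?l k w))\<^sup>2) w v"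
  unfolding psi1_def[abs_def] by (rule levi_cmult[of UNIV]) (auto intro!: smooth_on_sum smooth_on_cmod2 h)
 also have "levi (\<lambda>w. \<Sum>k\<in>UNIV. (cmod (?l k w))\<^sup>2) w v = (\<Sum>k\<in>UNIV. 4 * (cmod (fd (?l k) w v))\<^sup>2)"
 proof (subst levi_sum[of UNIV])
  show "(\<Sum>k\<in>UNIV. levi (\<lambda>w. (cmod (?l k w))\<^sup>2) w v) = (\<Sum>k\<in>UNIV. 4 * (cmod (fd (?l k) w v))\<^sup>2)"
   by (intro sum.cong refl levi_cmod2[of UNIV] h) auto
 qed (auto intro!: smooth_on_cmod2 h)
 finally show ?thesis unfolding fdl norm_vec_square by (simp add: sum_distrib_left mult_ac)
qed

lemma BR:
 assumes "r \<le> 4 * R"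
 shows "ball w0 r \<subseteq> snd c0 ` fst c0" "cball w0 r \<subseteq> snd c0 ` fst c0"
  "z \<in> cinv c0 ` ball w0 r \<longleftrightarrow> z \<in> fst c0 \<and> snd c0 z \<in> ball w0 r"
  "z \<in> cinv c0 ` cball w0 r \<longleftrightarrow> z \<in> fst c0 \<and> snd c0 z \<in> cball w0 r"
  "open (cinv c0 ` ball w0 r)" "closed (cinv c0 ` cball w0 r)"
  "cinv c0 ` ball w0 r \<subseteq> WW x0 \<inter> lb_dom L i0" "z \<in> cinv c0 ` ball w0 r ==> ell x0 x0 z \<noteq> 0"
proof -
 have b: "ball w0 r \<subseteq> cball w0 (4 * R)" "cball w0 r \<subseteq> cball w0 (4 * R)" using assms by auto
 show 1: "ball w0 r \<subseteq> snd c0 ` fst c0" and 2: "cball w0 r \<subseteq> snd c0 ` fst c0" using R(2) b by blast+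
 show "z \<in> cinv c0 ` ball w0 r \<longleftrightarrow> z \<in> fst c0 \<and> snd c0 z \<in> ball w0 r" by (rule X.chart_preimage[OF c0X 1])
 show "z \<in> cinv c0 ` cball w0 r \<longleftrightarrow> z \<in> fst c0 \<and> snd c0 z \<in> cball w0 r" by (rule X.chart_preimage[OF c0X 2])
 show "open (cinv c0 ` ball w0 r)" by (rule X.chart_preimage(2)[OF c0X 1]) simp
 show "closed (cinv c0 ` cball w0 r)" by (rule X.chart_preimage(3)[OF c0X 2]) simp
 show "cinv c0 ` ball w0 r \<subseteq> WW x0 \<inter> lb_dom L i0"
  by (rule image_subsetI, rule X.chart_pt[OF c0X]) (use R(2) b in blast)
 show "ell x0 x0 z \<noteq> 0" if "z \<in> cinv c0 ` ball w0 r" using that ell_nz b by blast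
qed

text \<open>Against the section \<open>ell x0\<close> the Fubini-Study weight is
  \<open>- ln ray\<close>, and \<open>ss\<close> is the excess of \<open>psi1 + ep\<close> over it.
  Adding \<open>th ss\<close> therefore replaces the old weight by \<open>psi1 + ep - ka\<close>
  where \<open>th\<close> is affine and leaves it alone where \<open>ss \<le> 0\<close>.\<close>

definition ss :: "'a => real" where
 "ss z = psi1 (snd c0 z) + ep + ln (ray x0 x0 z)"

definition Th :: "'a => real" where
 "Th z = (if z \<in> cinv c0 ` ball w0 R then th (ss z) else 0)"

lemma ray_pos: "z \<in> cinv c0 ` ball w0 R ==> ray x0 x0 z > 0"
 using BR(7,8)[of R] R(1) nrm_pos[of z x0] unfolding ray_def by auto

text \<open>\<open>psi1 \<le> ep\<close> on the ball of radius \<open>R\<close>, and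
  \<open>ln ray \<le> - 4 * ep\<close> outside the half ball, so \<open>ss\<close> is at most
  \<open>- 2 * ep\<close> there. Hence the modification can be extended by 0.\<close>

lemma ss_neg:
 assumes "z \<in> cinv c0 ` ball w0 R" "z \<notin> cinv c0 ` ball w0 (R / 2)"
 shows "ss z \<le> 0"
proof -
 have R4: "R \<le> 4 * R" using R(1) by simp
 have z: "z \<in> fst c0" "norm (snd c0 z - w0) \<le> R" "z \<in> WW x0"
  using assms(1) BR(3)[OF R4, of z] BR(7)[OF R4] by (auto simp: dist_norm norm_minus_commute)
 have "ln (ray x0 x0 z) \<le> ln (exp (- 4 * ep))"
  using eps(2)[OF assms(2) z(3)] ray_pos[OF assms(1)] by (subst ln_le_cancel_iff) auto
 then show ?thesis using B(2)[OF z(2)] eps(1) unfolding ss_def psi1_norm by simp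
qed

lemma ss_smooth: "smooth_fun X (cinv c0 ` ball w0 R) ss"
proof -
 let ?U = "cinv c0 ` ball w0 R"
 have R4: "R \<le> 4 * R" using R(1) by simp
 note o = BR(5)[OF R4]
 have sub: "?U \<subseteq> fst c0" "?U \<subseteq> WW x0" using BR(3)[OF R4] BR(7)[OF R4] by blast+
 have co: "holo_fun X ?U (\<lambda>z. snd c0 z $ k)" for k by (rule holo_fun_subset[OF X.holo_fun_coord[OF c0X] sub(1)])
 have "smooth_fun X ?U (\<lambda>z. psi1 (snd c0 z))"
  unfolding psi1_def by (intro X.smooth_fun_mult X.smooth_fun_sum X.smooth_fun_cmod2 X.holo_fun_diff
   X.holo_fun_mult X.smooth_fun_const X.holo_fun_const co o)
 moreover have "smooth_fun X ?U (\<lambda>z. ln (ray x0 x0 z))"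
 proof (intro X.smooth_fun_ln o ray_pos)
  show "smooth_fun X ?U (ray x0 x0)"
   unfolding ray_def[abs_def]
   by (intro X.smooth_fun_divide X.smooth_fun_cmod2 o holo_fun_subset[OF ell_holo sub(2)] smooth_fun_subset[OF nrm_smooth sub(2)])
    (use nrm_pos sub in blast)
 qed
 ultimately show ?thesis unfolding ss_def[abs_def] by (intro X.smooth_fun_add X.smooth_fun_const o)
qed

lemma Th_smooth: "smooth_fun X UNIV Th"
 unfolding Th_def[abs_def]
proof (rule X.smooth_fun_glue[where C = "cinv c0 ` cball w0 (R / 2)"])
 have R4: "R \<le> 4 * R" "R / 2 \<le> 4 * R" using R(1) by auto
 show "open (cinv c0 ` ball w0 R)" "closed (cinv c0 ` cball w0 (R / 2))" using BR(5,6) R4 by blast+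
 show "cinv c0 ` cball w0 (R / 2) \<subseteq> cinv c0 ` ball w0 R" using R(1) by (intro image_mono) auto
 show "smooth_fun X (cinv c0 ` ball w0 R \<inter> UNIV) (\<lambda>z. th (ss z))"
  using X.smooth_fun_compose_real[OF BR(5)[OF R4(1)] th(1) ss_smooth] by simp
 show "th (ss z) = 0" if "z \<in> cinv c0 ` ball w0 R" "z \<notin> cinv c0 ` cball w0 (R / 2)" for z
 proof (rule th(3), rule ss_neg[OF that(1)])
  show "z \<notin> cinv c0 ` ball w0 (R / 2)" using that(2) ball_subset_cball by blast
 qed
qed simp

lemma Th_outside: "z \<notin> cinv c0 ` cball w0 (R / 2) ==> Th z = 0"
 unfolding Th_def using ss_neg[of z] th(3) ball_subset_cball[of w0 "R/2"] by fastforce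

definition psiw :: "'a => 'a => real" where
 "psiw x z = ln (nrm x z) + Th z"

lemma psiw_smooth: "smooth_fun X (WW x) (psiw x)"
 unfolding psiw_def[abs_def]
 by (intro X.smooth_fun_add X.smooth_fun_ln nrm_smooth nrm_pos smooth_fun_subset[OF Th_smooth] WW) simp_all

lemma levi_psiw_outside:
 assumes z: "z \<notin> cinv c0 ` cball w0 (R / 2)" "z \<in> WW x" and c: "c \<in> X" "z \<in> fst c"
 shows "levi (\<lambda>w. psiw x (cinv c w)) (snd c z) v \<ge> 0"
  and "levi (\<lambda>w. psiw x (cinv c w)) (snd c z) v = 0 ==> v = 0"
proof -
 let ?W = "- (cinv c0 ` cball w0 (R / 2))"
 have "R / 2 \<le> 4 * R" using R(1) by simp
 from BR(6)[OF this] have "open (snd c ` (fst c \<inter> ?W))" by (intro X.chart_image_open c open_Compl)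
 moreover have "snd c z \<in> snd c ` (fst c \<inter> ?W)" using z c by blast
 ultimately have "levi (\<lambda>w. psiw x (cinv c w)) (snd c z) v = levi (\<lambda>w. ln (nrm x (cinv c w))) (snd c z) v"
  by (rule levi_cong) (simp add: psiw_def Th_outside[OF ComplD[OF X.chart_pt[OF c(1)]]])
 then show "levi (\<lambda>w. psiw x (cinv c w)) (snd c z) v \<ge> 0"
  "levi (\<lambda>w. psiw x (cinv c w)) (snd c z) v = 0 ==> v = 0"
  using levi_ln_nrm[OF c z(2)] by auto
qed

text \<open>The chain rule gives \<open>S\<close> times the form of \<open>ss\<close> plus a term
  that is nonnegative because \<open>th\<close> is convex. The form of \<open>ss\<close> is that of
  \<open>psi1\<close> minus the Fubini-Study form, so a convex combination of the two
  remains.\<close>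

lemma levi_psiw_inside:
 assumes z: "z \<in> cinv c0 ` ball w0 R"
 shows "levi (\<lambda>w. psiw x0 (cinv c0 w)) (snd c0 z) v \<ge>
  (1 - S (ss z)) * levi (\<lambda>w. ln (nrm x0 (cinv c0 w))) (snd c0 z) v + S (ss z) * (4 * B * (norm (v - v $ k1 *s v0))\<^sup>2)"
proof -
 have R4: "R \<le> 4 * R" using R(1) by simp
 let ?U = "cinv c0 ` ball w0 R" and ?Om = "snd c0 ` (fst c0 \<inter> cinv c0 ` ball w0 R)"
 have op: "open ?Om" by (rule X.chart_image_open[OF c0X BR(5)[OF R4]])
 have zc: "z \<in> fst c0" "z \<in> WW x0" using z BR(3)[OF R4, of z] BR(7)[OF R4] by auto
 have zO: "snd c0 z \<in> ?Om" using z zc by blast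
 have pt: "cinv c0 w \<in> ?U" if "w \<in> ?Om" for w by (rule X.chart_pt[OF c0X that])
 have ptW: "cinv c0 w \<in> WW x0" if "w \<in> ?Om" for w using pt[OF that] BR(7)[OF R4] by blast
 have wc: "snd c0 (cinv c0 w) = w" if "w \<in> ?Om" for w by (rule X.chart(5)[OF c0X]) (use that in blast)
 have hell: "holo_on ?Om (\<lambda>w. ell x0 x0 (cinv c0 w))"
  by (rule holo_on_subset[OF holo_funD[OF ell_holo c0X]]) (use BR(7)[OF R4] in blast)
 have s1: "smooth_on ?Om psi1" by (rule smooth_on_subset[OF psi1_smooth]) simp
 have s2: "smooth_on ?Om (\<lambda>w. ln ((cmod (ell x0 x0 (cinv c0 w)))\<^sup>2))"
  by (intro smooth_on_ln smooth_on_cmod2 op hell) (use BR(8)[OF R4 pt] in auto)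
 have "smooth_on ?Om (\<lambda>w. nrm x0 (cinv c0 w))"
  by (rule smooth_on_subset[OF smooth_funD[OF nrm_smooth c0X]]) (use BR(7)[OF R4] in blast)
 then have s3: "smooth_on ?Om (\<lambda>w. ln (nrm x0 (cinv c0 w)))"
  by (intro smooth_on_ln op nrm_pos[OF ptW])
 have sss: "smooth_on ?Om (\<lambda>w. ss (cinv c0 w))" by (rule smooth_funD[OF ss_smooth c0X])
 have sTh: "smooth_on ?Om (\<lambda>w. th (ss (cinv c0 w)))"
  by (rule smooth_on_compose_real[OF op th(1) _ sss]) simp
 have "levi (\<lambda>w. ss (cinv c0 w)) (snd c0 z) v =
  levi (\<lambda>w. (psi1 w + ep) + (ln ((cmod (ell x0 x0 (cinv c0 w)))\<^sup>2) - ln (nrm x0 (cinv c0 w)))) (snd c0 z) v"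
 proof (rule levi_cong[OF op zO])
  fix w assume w: "w \<in> ?Om"
  show "ss (cinv c0 w) = (psi1 w + ep) + (ln ((cmod (ell x0 x0 (cinv c0 w)))\<^sup>2) - ln (nrm x0 (cinv c0 w)))"
   using BR(8)[OF R4 pt[OF w]] nrm_pos[OF ptW[OF w]] by (simp add: ss_def ray_def ln_div wc[OF w])
 qed
 also have "... = levi (\<lambda>w. psi1 w + ep) (snd c0 z) v +
   levi (\<lambda>w. ln ((cmod (ell x0 x0 (cinv c0 w)))\<^sup>2) - ln (nrm x0 (cinv c0 w))) (snd c0 z) v"
  by (rule levi_add[OF op zO smooth_on_add[OF op s1 smooth_on_const] smooth_on_diff[OF op s2 s3]])
 also have "levi (\<lambda>w. psi1 w + ep) (snd c0 z) v = levi psi1 (snd c0 z) v"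
  by (subst levi_add[OF op zO s1 smooth_on_const]) simp
 also have "levi (\<lambda>w. ln ((cmod (ell x0 x0 (cinv c0 w)))\<^sup>2) - ln (nrm x0 (cinv c0 w))) (snd c0 z) v =
   levi (\<lambda>w. ln ((cmod (ell x0 x0 (cinv c0 w)))\<^sup>2)) (snd c0 z) v - levi (\<lambda>w. ln (nrm x0 (cinv c0 w))) (snd c0 z) v"
  by (rule levi_diff[OF op zO s2 s3])
 also have "levi (\<lambda>w. ln ((cmod (ell x0 x0 (cinv c0 w)))\<^sup>2)) (snd c0 z) v = 0"
  by (rule levi_ln_cmod2[OF op zO hell]) (use BR(8)[OF R4 pt] in auto)
 finally have lss: "levi (\<lambda>w. ss (cinv c0 w)) (snd c0 z) v =
   4 * B * (norm (v - v $ k1 *s v0))\<^sup>2 - levi (\<lambda>w. ln (nrm x0 (cinv c0 w))) (snd c0 z) v"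
  by (simp add: psi1_levi)
 obtain s' where s': "s' \<ge> 0" "(S has_real_derivative s') (at (ss (cinv c0 (snd c0 z))))" using S(2) by blast
 have zz: "cinv c0 (snd c0 z) = z" by (rule X.chart(4)[OF c0X zc(1)])
 have "levi (\<lambda>w. psiw x0 (cinv c0 w)) (snd c0 z) v =
  levi (\<lambda>w. ln (nrm x0 (cinv c0 w)) + th (ss (cinv c0 w))) (snd c0 z) v"
  by (rule levi_cong[OF op zO]) (simp add: psiw_def Th_def pt)
 also have "... = levi (\<lambda>w. ln (nrm x0 (cinv c0 w))) (snd c0 z) v + levi (\<lambda>w. th (ss (cinv c0 w))) (snd c0 z) v"
  by (rule levi_add[OF op zO s3 sTh])
 also have "levi (\<lambda>w. th (ss (cinv c0 w))) (snd c0 z) v = S (ss (cinv c0 (snd c0 z))) * levi (\<lambda>w. ss (cinv c0 w)) (snd c0 z) v +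
   s' * ((fd (\<lambda>w. ss (cinv c0 w)) (snd c0 z) v)\<^sup>2 + (fd (\<lambda>w. ss (cinv c0 w)) (snd c0 z) (\<i> *s v))\<^sup>2)"
  by (rule levi_compose_real[OF op zO sss th(2) s'(2)])
 finally have eq: "levi (\<lambda>w. psiw x0 (cinv c0 w)) (snd c0 z) v = levi (\<lambda>w. ln (nrm x0 (cinv c0 w))) (snd c0 z) v +
   (S (ss z) * levi (\<lambda>w. ss (cinv c0 w)) (snd c0 z) v +
    s' * ((fd (\<lambda>w. ss (cinv c0 w)) (snd c0 z) v)\<^sup>2 + (fd (\<lambda>w. ss (cinv c0 w)) (snd c0 z) (\<i> *s v))\<^sup>2))"
  unfolding zz .
 have "s' * ((fd (\<lambda>w. ss (cinv c0 w)) (snd c0 z) v)\<^sup>2 + (fd (\<lambda>w. ss (cinv c0 w)) (snd c0 z) (\<i> *s v))\<^sup>2) \<ge> 0"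
  by (rule mult_nonneg_nonneg[OF s'(1)]) (rule sum_power2_ge_zero)
 then show ?thesis unfolding eq lss left_diff_distrib right_diff_distrib by linarith
qed

text \<open>If the factor \<open>S\<close> is 0, the Fubini-Study form is strictly positive;
  otherwise the form of \<open>psi1\<close> enters with a positive factor, and its null space is
  spanned by \<open>v0\<close>.\<close>

lemma levi_psiw_inside_nonneg:
 assumes z: "z \<in> cinv c0 ` ball w0 R"
 shows "levi (\<lambda>w. psiw x0 (cinv c0 w)) (snd c0 z) v \<ge> 0"
  and "levi (\<lambda>w. psiw x0 (cinv c0 w)) (snd c0 z) v = 0 ==> v = v $ k1 *s v0"
proof -
 have R4: "R \<le> 4 * R" using R(1) by simp
 have zc: "z \<in> fst c0" "z \<in> WW x0" using z BR(3)[OF R4, of z] BR(7)[OF R4] by auto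
 let ?A = "levi (\<lambda>w. ln (nrm x0 (cinv c0 w))) (snd c0 z) v" and ?Q = "4 * B * (norm (v - v $ k1 *s v0))\<^sup>2"
 have A: "?A \<ge> 0" by (rule levi_ln_nrm[OF c0X zc])
 have Q: "?Q \<ge> 0" using B(1) by simp
 have nn: "(1 - S (ss z)) * ?A \<ge> 0" "S (ss z) * ?Q \<ge> 0" using A Q S(5,6)[of "ss z"] by (simp_all add: B(1) less_imp_le)
 show "levi (\<lambda>w. psiw x0 (cinv c0 w)) (snd c0 z) v \<ge> 0" using levi_psiw_inside[OF z, of v] nn by linarith
 assume "levi (\<lambda>w. psiw x0 (cinv c0 w)) (snd c0 z) v = 0"
 then have 0: "(1 - S (ss z)) * ?A = 0" "S (ss z) * ?Q = 0" using levi_psiw_inside[OF z, of v] nn by linarith+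
 show "v = v $ k1 *s v0"
 proof (cases "S (ss z) = 0")
  case True
  then have "v = 0" using 0 levi_ln_nrm(2)[OF c0X zc] by simp
  then show ?thesis by simp
 next
  case False
  then have "norm (v - v $ k1 *s v0) = 0" using 0 B(1) by simp
  then show ?thesis by simp
 qed
qed

end

section \<open>The semi-positive line bundle\<close>

text \<open>The functions \<open>rh a\<close> weight the metrics of the dual of the relative canonical bundle in which the frame of
 \<open>(ch a, dh a)\<close> is a unit vector; the bundle \<open>EE\<close> has the finite index set \<open>{..n}\<close>. Near \<open>x0\<close> only the index 0
 contributes, with an extra weight that uses up part of the negative curvature of \<open>L\<close>.\<close>

locale negative_cover = negative_point X Y p N F WW ii ff L hL x0 i0 c0 d0 io0 w0 v0 k1 de0 R ep B ka S th
 for X :: "('a::{t2_space,second_countable_topology}, 'k::finite) chart set"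
  and Y :: "('b::{t2_space,second_countable_topology}, 'm::finite) chart set"
  and p :: "'a => 'b" and N F WW ii ff and L :: "('i, 'a) line_bundle" and hL x0 i0 c0 d0 io0 w0 v0 k1 de0 R ep B ka S th +
 fixes n :: nat and ch :: "nat => ('a, 'k) chart" and dh :: "nat => ('b, 'm) chart" and il :: "nat => 'i"
  and pt :: "nat => 'a" and DD CC :: "nat => 'a set" and rh :: "nat => 'a => real"
 assumes ch: "ch a \<in> X" "dh a \<in> Y" "p ` fst (ch a) \<subseteq> fst (dh a)" and il: "il a \<in> lb_index L"
  and DD: "open (DD a)" "DD a \<subseteq> fst (ch a) \<inter> (WW (pt a) \<inter> lb_dom L (il a))"
  and rh: "rh a z \<ge> 0" "smooth_fun X UNIV (rh a)" "closed (CC a)" "CC a \<subseteq> DD a" "z \<notin> CC a ==> rh a z = 0"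
  and cover: "\<exists>a\<le>n. rh a z > 0"
  and zero: "ch 0 = c0" "dh 0 = d0" "il 0 = i0" "pt 0 = x0"
   "z \<in> cinv c0 ` ball w0 R ==> z \<in> DD 0 \<and> rh 0 z = exp (de0 / 8 * (cmod (snd c0 z $ k1 - w0 $ k1))\<^sup>2)"
   "a > 0 ==> z \<in> cinv c0 ` ball w0 R ==> z \<notin> DD a"
begin

lemma DD_D: "z \<in> DD a ==> z \<in> fst (ch a)" "z \<in> DD a ==> p z \<in> fst (dh a)" "z \<in> DD a ==> z \<in> WW (pt a)" "z \<in> DD a ==> z \<in> lb_dom L (il a)"
 using DD(2)[of a] ch(3)[of a] by auto

definition kap :: "nat => ('a, 'k) chart \<times> ('b, 'm) chart" where "kap a = (ch a, dh a)"

lemma kap_trans: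
 assumes "z \<in> DD a" "z \<in> DD b"
 shows "reltrans (kap a) (kap b) z \<noteq> 0" "reltrans (kap a) (kap a) z = 1"
  "z \<in> DD e ==> reltrans (kap a) (kap b) z * reltrans (kap b) (kap e) z = reltrans (kap a) (kap e) z"
proof -
 note 1 = ch(1,2)[of a] DD_D(1,2)[OF assms(1)] and 2 = ch(1,2)[of b] DD_D(1,2)[OF assms(2)]
 show "reltrans (kap a) (kap b) z \<noteq> 0" "reltrans (kap a) (kap a) z = 1"
  unfolding kap_def by (rule reltrans(1,2)[OF 1 2])+
 show "reltrans (kap a) (kap b) z * reltrans (kap b) (kap e) z = reltrans (kap a) (kap e) z" if "z \<in> DD e"
  unfolding kap_def by (rule reltrans(3)[OF 1 2 ch(1,2) DD_D(1,2)[OF that]])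
qed

lemma reltrans_holo:
 assumes "c \<in> X" "d \<in> Y" "c' \<in> X" "d' \<in> Y"
 shows "holo_fun X ((fst c \<inter> p -` fst d) \<inter> (fst c' \<inter> p -` fst d')) (reltrans (c, d) (c', d'))"
 using relcan_holomorphic[unfolded holomorphic_line_bundle_def, THEN conjunct2, THEN conjunct2, THEN conjunct1,
   rule_format, of "(c, d)" "(c', d')", THEN conjunct1] assms by simp

text \<open>A sum of metrics of the dual relative canonical bundle, evaluated on the dual of the
  frame \<open>ga\<close>. Outside \<open>DD a\<close> the factor \<open>rh a\<close> vanishes, so
  undefined values of \<open>reltrans\<close> do not enter.\<close>

definition qq :: "('a, 'k) chart \<times> ('b, 'm) chart => 'a => real" where
 "qq ga z = (\<Sum>a\<le>n. rh a z * (cmod (reltrans ga (kap a) z))\<^sup>2)"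

lemma rh_dom: "rh a z > 0 ==> z \<in> DD a" using rh(4)[of a] rh(5)[of z a] by auto

lemma qq_change:
 assumes "c \<in> X" "d \<in> Y" "z \<in> fst c" "p z \<in> fst d" "c' \<in> X" "d' \<in> Y" "z \<in> fst c'" "p z \<in> fst d'"
 shows "qq (c, d) z = (cmod (reltrans (c, d) (c', d') z))\<^sup>2 * qq (c', d') z"
 unfolding qq_def sum_distrib_left
proof (rule sum.cong[OF refl])
 fix a
 show "rh a z * (cmod (reltrans (c, d) (kap a) z))\<^sup>2 =
  (cmod (reltrans (c, d) (c', d') z))\<^sup>2 * (rh a z * (cmod (reltrans (c', d') (kap a) z))\<^sup>2)"
 proof (cases "rh a z = 0")
  case False
  then have z: "z \<in> DD a" using rh(1)[of a z] by (intro rh_dom) linarith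
  have "reltrans (c, d) (kap a) z = reltrans (c, d) (c', d') z * reltrans (c', d') (kap a) z"
   unfolding kap_def by (rule reltrans(3)[symmetric, OF assms ch(1,2) DD_D(1,2)[OF z]])
  then show ?thesis by (simp add: norm_mult power_mult_distrib)
 qed simp
qed

lemma qq_pos:
 assumes "c \<in> X" "d \<in> Y" "z \<in> fst c" "p z \<in> fst d"
 shows "qq (c, d) z > 0"
proof -
 obtain a where a: "a \<le> n" "rh a z > 0" using cover by blast
 have "reltrans (c, d) (kap a) z \<noteq> 0"
  unfolding kap_def by (rule reltrans(1)[OF assms ch(1,2) DD_D(1,2)[OF rh_dom[OF a(2)]]])
 then show ?thesis unfolding qq_def using a rh(1) by (intro sum_pos2[where i = a]) auto
qed

lemma qq_smooth:
 assumes "c \<in> X" "d \<in> Y"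
 shows "smooth_fun X (fst c \<inter> p -` fst d) (qq (c, d))"
proof -
 let ?W = "fst c \<inter> p -` fst d"
 have oW: "open ?W" by (intro open_Int X.chart assms p_cont Y.chart)
 have "smooth_fun X ?W (\<lambda>z. rh a z * (cmod (reltrans (c, d) (kap a) z))\<^sup>2)" for a
 proof (rule X.smooth_fun_cong[OF _ oW])
  show "smooth_fun X ?W (\<lambda>z. if z \<in> DD a then rh a z * (cmod (reltrans (c, d) (kap a) z))\<^sup>2 else 0)"
  proof (rule X.smooth_fun_glue[OF DD(1) rh(3,4) oW])
   have "holo_fun X (DD a \<inter> ?W) (reltrans (c, d) (kap a))"
    unfolding kap_def by (rule holo_fun_subset[OF reltrans_holo[OF assms ch(1,2)]]) (use DD_D[of _ a] in blast)
   then show "smooth_fun X (DD a \<inter> ?W) (\<lambda>z. rh a z * (cmod (reltrans (c, d) (kap a) z))\<^sup>2)"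
    by (intro X.smooth_fun_mult X.smooth_fun_cmod2 smooth_fun_subset[OF rh(2)] open_Int DD(1) oW) auto
  qed (simp add: rh(5))
  fix z show "(if z \<in> DD a then rh a z * (cmod (reltrans (c, d) (kap a) z))\<^sup>2 else 0) = rh a z * (cmod (reltrans (c, d) (kap a) z))\<^sup>2"
   using rh(4)[of a] rh(5)[of z a] by auto
 qed
 then show ?thesis unfolding qq_def[abs_def] by (intro X.smooth_fun_sum oW)
qed

lemma qq_near:
 assumes "z \<in> cinv c0 ` ball w0 R"
 shows "qq (c0, d0) z = exp (de0 / 8 * (cmod (snd c0 z $ k1 - w0 $ k1))\<^sup>2)"
proof -
 have k0: "kap 0 = (c0, d0)" by (simp add: kap_def zero)
 have "rh a z = 0" if "a \<noteq> 0" for a using zero(6)[OF _ assms, of a] rh(4)[of a] rh(5)[of z a] that by auto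
 then have "qq (c0, d0) z = (\<Sum>a\<le>n. if a = 0 then rh 0 z * (cmod (reltrans (kap 0) (kap 0) z))\<^sup>2 else 0)"
  unfolding qq_def by (intro sum.cong refl) (simp add: k0)
 also have "... = rh 0 z" using kap_trans(2)[of z 0 0] zero(5)[OF assms] by simp
 finally show ?thesis using zero(5)[OF assms] by simp
qed

text \<open>The cover is numbered because the positivity hypothesis quantifies over bundles with
  index type \<open>nat\<close>, whereas charts and frames of \<open>L\<close> have index types of
  their own.\<close>

definition EE :: "nat => (nat, 'a) line_bundle" where
 "EE k = \<lparr>lb_index = {..n}, lb_dom = DD, lb_trans = (\<lambda>a b z. ff (pt a) z (ii (pt b)) ^ k *
   inverse (reltrans (kap a) (kap b) z * lb_trans L (il a) (il b) z))\<rparr>"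

definition hE :: "nat => nat => 'a => real" where
 "hE k a z = (exp (- Th z) / nrm (pt a) z) ^ k * qq (kap a) z / hL (il a) z"

lemma hL_facts: "i \<in> lb_index L ==> smooth_fun X (lb_dom L i) (hL i)" "i \<in> lb_index L ==> x \<in> lb_dom L i ==> hL i x > 0"
 "i \<in> lb_index L ==> j \<in> lb_index L ==> x \<in> lb_dom L i ==> x \<in> lb_dom L j ==> hL j x = (cmod (lb_trans L i j x))\<^sup>2 * hL i x"
 using hL unfolding hermitian_metric_def by blast+

lemma EE_bundle: "holomorphic_line_bundle X (EE k)"
 unfolding holomorphic_line_bundle_def
proof (intro conjI ballI)
 show "open (lb_dom (EE k) a)" for a by (simp add: EE_def DD)
 show "(\<Union>a\<in>lb_index (EE k). lb_dom (EE k) a) = UNIV"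
  using cover rh_dom unfolding EE_def by (auto simp: set_eq_iff) (metis atMost_iff)
 fix a b
 show "holo_fun X (lb_dom (EE k) a \<inter> lb_dom (EE k) b) (lb_trans (EE k) a b)"
 proof -
  have 1: "holo_fun X (DD a \<inter> DD b) (reltrans (kap a) (kap b))"
   unfolding kap_def by (rule holo_fun_subset[OF reltrans_holo[OF ch(1,2) ch(1,2)]]) (use DD_D in blast)
  have "holo_fun X (lb_dom L (il a) \<inter> lb_dom L (il b)) (lb_trans L (il a) (il b))"
   using L il unfolding holomorphic_line_bundle_def by auto
  then have 2: "holo_fun X (DD a \<inter> DD b) (lb_trans L (il a) (il b))"
   by (rule holo_fun_subset) (use DD_D in auto)
  have 3: "holo_fun X (DD a \<inter> DD b) (\<lambda>z. ff (pt a) z (ii (pt b)))"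
   by (rule holo_fun_subset[OF ff_holo]) (use DD_D in auto)
  have nz: "reltrans (kap a) (kap b) z * lb_trans L (il a) (il b) z \<noteq> 0" if "z \<in> DD a \<inter> DD b" for z
   using that kap_trans(1)[of z a b] lb_trans_nz[OF L il DD_D(4) il DD_D(4), of z a b] by auto
  show ?thesis unfolding EE_def by (simp only: line_bundle.simps)
   (intro X.holo_fun_mult X.holo_fun_power X.holo_fun_inverse 1 2 3 nz)
 qed
 show "lb_trans (EE k) a b z \<noteq> 0" if "z \<in> lb_dom (EE k) a \<inter> lb_dom (EE k) b" for z
 proof -
  have z: "z \<in> DD a" "z \<in> DD b" using that by (auto simp: EE_def)
  show ?thesis using kap_trans(1)[OF z] lb_trans_nz[OF L il DD_D(4)[OF z(1)] il DD_D(4)[OF z(2)]]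
    ff_nz[OF DD_D(3)[OF z(1)] DD_D(3)[OF z(2)]] by (simp add: EE_def)
 qed
 show "lb_trans (EE k) a b z * lb_trans (EE k) b e z = lb_trans (EE k) a e z"
  if "z \<in> lb_dom (EE k) a \<inter> lb_dom (EE k) b \<inter> lb_dom (EE k) e" for e z
 proof -
  have z: "z \<in> DD a" "z \<in> DD b" "z \<in> DD e" using that by (auto simp: EE_def)
  have "ff (pt a) z (ii (pt e)) = ff (pt a) z (ii (pt b)) * ff (pt b) z (ii (pt e))"
   by (rule ff_change[OF DD_D(3)[OF z(1)] DD_D(3)[OF z(2)]])
  moreover have "reltrans (kap a) (kap e) z = reltrans (kap a) (kap b) z * reltrans (kap b) (kap e) z"
   by (rule kap_trans(3)[OF z, symmetric])
  moreover have "lb_trans L (il a) (il e) z = lb_trans L (il a) (il b) z * lb_trans L (il b) (il e) z"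
   by (rule lb_trans_cocycle[OF L il DD_D(4)[OF z(1)] il DD_D(4)[OF z(2)] il DD_D(4)[OF z(3)], symmetric])
  ultimately show ?thesis by (simp add: EE_def power_mult_distrib mult_ac)
 qed
qed

lemma hE_metric: "hermitian_metric X (EE k) (hE k)"
 unfolding hermitian_metric_def
proof (intro conjI ballI)
 fix a b
 show "smooth_fun X (lb_dom (EE k) a) (hE k a)"
 proof -
  have 1: "smooth_fun X (DD a) (nrm (pt a))" by (rule smooth_fun_subset[OF nrm_smooth]) (use DD_D in auto)
  have 2: "smooth_fun X (DD a) (qq (kap a))" unfolding kap_def
   by (rule smooth_fun_subset[OF qq_smooth[OF ch(1,2)]]) (use DD_D in auto)
  have 3: "smooth_fun X (DD a) (hL (il a))" by (rule smooth_fun_subset[OF hL_facts(1)[OF il]]) (use DD_D in auto)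
  have 4: "smooth_fun X (DD a) (\<lambda>z. - Th z)"
   using X.smooth_fun_diff[OF DD(1) X.smooth_fun_const smooth_fun_subset[OF Th_smooth subset_UNIV], of a 0] by simp
  show ?thesis unfolding EE_def hE_def[abs_def]
   by (simp only: line_bundle.simps)
    (intro X.smooth_fun_mult X.smooth_fun_divide X.smooth_fun_power X.smooth_fun_exp 1 2 3 4 DD(1) hL_facts(2)[OF il] nrm_pos DD_D)
 qed
 show "hE k a z > 0" if "z \<in> lb_dom (EE k) a" for z
 proof -
  have z: "z \<in> DD a" using that by (simp add: EE_def)
  have "qq (kap a) z > 0" unfolding kap_def by (rule qq_pos[OF ch(1,2) DD_D(1,2)[OF z]])
  then show ?thesis unfolding hE_def using nrm_pos[OF DD_D(3)[OF z]] hL_facts(2)[OF il DD_D(4)[OF z]] by simp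
 qed
 show "hE k b z = (cmod (lb_trans (EE k) a b z))\<^sup>2 * hE k a z" if "z \<in> lb_dom (EE k) a \<inter> lb_dom (EE k) b" for z
 proof -
  have z: "z \<in> DD a" "z \<in> DD b" using that by (auto simp: EE_def)
  let ?f = "cmod (ff (pt a) z (ii (pt b)))" and ?r = "cmod (reltrans (kap a) (kap b) z)" and ?t = "cmod (lb_trans L (il a) (il b) z)"
  have nz: "?f \<noteq> 0" "?r \<noteq> 0" "?t \<noteq> 0"
   using kap_trans(1)[OF z] lb_trans_nz[OF L il DD_D(4)[OF z(1)] il DD_D(4)[OF z(2)]]
    ff_nz[OF DD_D(3)[OF z(1)] DD_D(3)[OF z(2)]] by auto
  have q: "qq (kap a) z = ?r\<^sup>2 * qq (kap b) z" unfolding kap_def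
   by (rule qq_change[OF ch(1,2) DD_D(1,2)[OF z(1)] ch(1,2) DD_D(1,2)[OF z(2)]])
  have n: "nrm (pt a) z = ?f\<^sup>2 * nrm (pt b) z" by (rule nrm_change[OF DD_D(3)[OF z(1)] DD_D(3)[OF z(2)]])
  have h: "hL (il b) z = ?t\<^sup>2 * hL (il a) z" by (rule hL_facts(3)[OF il il DD_D(4)[OF z(1)] DD_D(4)[OF z(2)]])
  have pos: "nrm (pt b) z > 0" "hL (il a) z > 0" by (intro nrm_pos hL_facts DD_D z il)+
  have "(exp (- Th z) / nrm (pt b) z) ^ k = (?f ^ k)\<^sup>2 * (exp (- Th z) / nrm (pt a) z) ^ k"
  proof -
   have "exp (- Th z) / nrm (pt b) z = ?f\<^sup>2 * (exp (- Th z) / nrm (pt a) z)" unfolding n using nz(1) by simp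
   then show ?thesis by (simp only: power_mult_distrib) (simp add: power_mult[symmetric] mult.commute)
  qed
  note e1 = this
  have e2: "qq (kap b) z / hL (il b) z = (inverse (?r * ?t))\<^sup>2 * (qq (kap a) z / hL (il a) z)"
   unfolding q h using nz pos by (simp add: field_simps)
  have "hE k b z = (?f ^ k * inverse (?r * ?t))\<^sup>2 * hE k a z"
   unfolding hE_def times_divide_eq_right[symmetric] e1 e2 by (simp add: power_mult_distrib mult_ac)
  then show ?thesis by (simp add: EE_def norm_mult norm_power norm_inverse)
 qed
qed

end

section \<open>Semi-positivity for large powers\<close>

context negative_cover
begin

text \<open>The weight of the dual of the relative canonical bundle tensored with \<open>L\<close>.
  It does not depend on \<open>k\<close>, so \<open>ln_hE\<close> has the shape that
  \<open>levi_absorb\<close> treats.\<close>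

definition gg :: "nat => 'a => real" where
 "gg a z = ln (hL (il a) z) - ln (qq (kap a) z)"

lemma qq_kap_pos: "z \<in> DD a ==> qq (kap a) z > 0"
 unfolding kap_def by (intro qq_pos ch DD_D)

lemma gg_smooth: "smooth_fun X (DD a) (gg a)"
proof -
 have 2: "smooth_fun X (DD a) (qq (kap a))" unfolding kap_def
  by (rule smooth_fun_subset[OF qq_smooth[OF ch(1,2)]]) (use DD_D in auto)
 have 3: "smooth_fun X (DD a) (hL (il a))" by (rule smooth_fun_subset[OF hL_facts(1)[OF il]]) (use DD_D in auto)
 show ?thesis unfolding gg_def[abs_def]
  by (intro X.smooth_fun_diff X.smooth_fun_ln DD(1) 2 3 qq_kap_pos hL_facts(2)[OF il] DD_D)
qed

lemma ln_hE:
 assumes z: "z \<in> DD a"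
 shows "- ln (hE k a z) = real k * psiw (pt a) z + gg a z"
proof -
 have pos: "nrm (pt a) z > 0" "hL (il a) z > 0" "qq (kap a) z > 0"
  using nrm_pos[OF DD_D(3)[OF z]] hL_facts(2)[OF il DD_D(4)[OF z]] qq_kap_pos[OF z] by auto
 have "ln (hE k a z) = real k * ln (exp (- Th z) / nrm (pt a) z) + ln (qq (kap a) z) - ln (hL (il a) z)"
  unfolding hE_def using pos by (simp add: ln_div ln_mult ln_realpow)
 also have "ln (exp (- Th z) / nrm (pt a) z) = - psiw (pt a) z"
  unfolding psiw_def using pos by (simp add: ln_div)
 finally show ?thesis by (simp add: gg_def)
qed

lemma absorb_at:
 assumes c: "c \<in> X" "z \<in> fst c" and V: "open V" "z \<in> V" "V \<subseteq> DD a"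
  and nn: "!!z' v. z' \<in> V ==> z' \<in> fst c ==> levi (\<lambda>w. psiw (pt a) (cinv c w)) (snd c z') v \<ge> 0"
  and pos: "!!v. v \<noteq> 0 ==> levi (\<lambda>w. psiw (pt a) (cinv c w)) (snd c z) v = 0 ==>
   levi (\<lambda>w. gg a (cinv c w)) (snd c z) v > 0"
 shows "\<exists>k0 W. open W \<and> z \<in> W \<and> (\<forall>k\<ge>k0. \<forall>z'\<in>W. z' \<in> DD a \<and> z' \<in> fst c \<and>
  (\<forall>v. levi (\<lambda>w. - ln (hE k a (cinv c w))) (snd c z') v \<ge> 0))"
proof -
 let ?Om = "snd c ` (fst c \<inter> V)"
 have op: "open ?Om" by (rule X.chart_image_open[OF c(1) V(1)])
 have zO: "snd c z \<in> ?Om" using c V by blast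
 have pt: "cinv c w \<in> DD a" if "w \<in> ?Om" for w using X.chart_pt[OF c(1) that] V(3) by blast
 have "V \<subseteq> WW (pt a)" using V(3) DD_D(3) by blast
 then have sp: "smooth_on ?Om (\<lambda>w. psiw (pt a) (cinv c w))"
  by (rule smooth_funD[OF smooth_fun_subset[OF psiw_smooth] c(1)])
 have sg: "smooth_on ?Om (\<lambda>w. gg a (cinv c w))" by (rule smooth_funD[OF smooth_fun_subset[OF gg_smooth V(3)] c(1)])
 obtain k0 :: nat and W where W: "open W" "snd c z \<in> W" "W \<subseteq> ?Om"
  "!!k w v. k \<ge> k0 ==> w \<in> W ==> real k * levi (\<lambda>w. psiw (pt a) (cinv c w)) w v + levi (\<lambda>w. gg a (cinv c w)) w v \<ge> 0"
 proof -
  have "\<exists>k0::nat. \<exists>W. open W \<and> snd c z \<in> W \<and> W \<subseteq> ?Om \<and> (\<forall>k\<ge>k0. \<forall>w\<in>W. \<forall>v.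
   real k * levi (\<lambda>w. psiw (pt a) (cinv c w)) w v + levi (\<lambda>w. gg a (cinv c w)) w v \<ge> 0)"
  proof (rule levi_absorb[OF op zO sp sg _ pos])
   fix w v assume "w \<in> ?Om"
   then obtain z' where "z' \<in> fst c" "z' \<in> V" "w = snd c z'" by blast
   then show "levi (\<lambda>w. psiw (pt a) (cinv c w)) w v \<ge> 0" using nn[of z' v] by simp
  qed
  then show ?thesis using that by blast
 qed
 have Wc: "W \<subseteq> snd c ` fst c" using W(3) by blast
 have "levi (\<lambda>w. - ln (hE k a (cinv c w))) (snd c z') v \<ge> 0" if "k \<ge> k0" "snd c z' \<in> W" for k z' v
 proof -
  have w: "snd c z' \<in> ?Om" using that(2) W(3) by blast
  have "levi (\<lambda>w. - ln (hE k a (cinv c w))) (snd c z') v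
   = levi (\<lambda>w. real k * psiw (pt a) (cinv c w) + gg a (cinv c w)) (snd c z') v"
   by (rule levi_cong[OF op w]) (rule ln_hE[OF pt])
  also have "... = levi (\<lambda>w. real k * psiw (pt a) (cinv c w)) (snd c z') v + levi (\<lambda>w. gg a (cinv c w)) (snd c z') v"
   by (rule levi_add[OF op w smooth_on_mult[OF op smooth_on_const sp] sg])
  also have "levi (\<lambda>w. real k * psiw (pt a) (cinv c w)) (snd c z') v = real k * levi (\<lambda>w. psiw (pt a) (cinv c w)) (snd c z') v"
   by (rule levi_cmult[OF op w sp])
  finally show ?thesis using W(4)[OF that(1), of "snd c z'" v] that(2) by simp
 qed
 moreover have "z' \<in> DD a \<and> z' \<in> fst c \<and> snd c z' \<in> W" if "z' \<in> cinv c ` W" for z'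
 proof -
  have 1: "z' \<in> fst c" "snd c z' \<in> W" using that X.chart_preimage(1)[OF c(1) Wc] by auto
  have "cinv c (snd c z') \<in> DD a" by (rule pt) (use 1 W(3) in blast)
  then show ?thesis using 1 X.chart(4)[OF c(1) 1(1)] by simp
 qed
 moreover have "z \<in> cinv c ` W" using X.chart_preimage(1)[OF c(1) Wc] c W(2) by auto
 ultimately show ?thesis using X.chart_preimage(2)[OF c(1) Wc W(1)]
  by (intro exI[of _ k0] exI[of _ "cinv c ` W"]) blast
qed

text \<open>\<open>ln hL\<close> contributes at least \<open>de0\<close>. The weight
  \<open>de0 / 8 * (cmod t)\<^sup>2\<close> has Levi form \<open>de0 / 2\<close> at
  \<open>v0\<close>, because \<open>v0 $ k1 = 1\<close> and \<open>levi\<close> carries the factor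
  4. At least \<open>de0 / 2\<close> is left.\<close>

lemma gg_near:
 assumes z: "z \<in> cinv c0 ` ball w0 R"
 shows "levi (\<lambda>w. gg 0 (cinv c0 w)) (snd c0 z) v0 > 0"
proof -
 have R4: "R \<le> 4 * R" using R(1) by simp
 let ?U = "cinv c0 ` ball w0 R" and ?Om = "snd c0 ` (fst c0 \<inter> cinv c0 ` ball w0 R)"
 have op: "open ?Om" by (rule X.chart_image_open[OF c0X BR(5)[OF R4]])
 have zO: "snd c0 z \<in> ?Om" and zb: "snd c0 z \<in> ball w0 R" using z BR(3)[OF R4, of z] by auto
 have wc: "snd c0 (cinv c0 w) = w" if "w \<in> ?Om" for w by (rule X.chart(5)[OF c0X]) (use that in blast)
 have k0: "kap 0 = (c0, d0)" by (simp add: kap_def zero)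
 let ?h = "\<lambda>w :: complex^'k. w $ k1 - w0 $ k1"
 have hol: "holo_on ?Om ?h" by (intro holo_on_diff) auto
 have s1: "smooth_on ?Om (\<lambda>w. ln (hL i0 (cinv c0 w)))"
  by (rule smooth_funD[OF X.smooth_fun_ln[OF BR(5)[OF R4]] c0X])
   (use BR(7)[OF R4] i0 in \<open>auto intro!: smooth_fun_subset[OF hL_facts(1)] hL_facts(2)\<close>)
 have "levi (\<lambda>w. gg 0 (cinv c0 w)) (snd c0 z) v0 =
  levi (\<lambda>w. ln (hL i0 (cinv c0 w)) - de0 / 8 * (cmod (?h w))\<^sup>2) (snd c0 z) v0"
 proof (rule levi_cong[OF op zO])
  fix w assume w: "w \<in> ?Om"
  show "gg 0 (cinv c0 w) = ln (hL i0 (cinv c0 w)) - de0 / 8 * (cmod (?h w))\<^sup>2"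
   using qq_near[OF X.chart_pt[OF c0X w]] unfolding gg_def k0 zero wc[OF w] by simp
 qed
 also have "... = levi (\<lambda>w. ln (hL i0 (cinv c0 w))) (snd c0 z) v0 - levi (\<lambda>w. de0 / 8 * (cmod (?h w))\<^sup>2) (snd c0 z) v0"
  by (intro levi_diff[OF op zO s1] smooth_on_mult op smooth_on_const smooth_on_cmod2 hol)
 also have "levi (\<lambda>w. de0 / 8 * (cmod (?h w))\<^sup>2) (snd c0 z) v0 = de0 / 8 * levi (\<lambda>w. (cmod (?h w))\<^sup>2) (snd c0 z) v0"
  by (rule levi_cmult[OF op zO smooth_on_cmod2[OF op hol]])
 also have "levi (\<lambda>w. (cmod (?h w))\<^sup>2) (snd c0 z) v0 = 4 * (cmod (fd ?h (snd c0 z) v0))\<^sup>2"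
  by (rule levi_cmod2[OF op zO hol])
 also have "fd ?h (snd c0 z) = (\<lambda>v. v $ k1)"
  by (rule fd_eq) (auto intro!: derivative_eq_intros has_derivative_nth)
 finally show ?thesis using neg(1) neg(2)[OF zb] by (simp add: v0)
qed

text \<open>Off the closed half ball the Fubini-Study form alone is strictly positive and the
  condition on \<open>gg\<close> is void; on it the null directions are multiples of
  \<open>v0\<close>, where \<open>gg_near\<close> applies.\<close>

lemma semipositive_local:
 "\<exists>k0 W. open W \<and> z \<in> W \<and> (\<forall>k\<ge>k0. \<forall>z'\<in>W. \<exists>a\<le>n. z' \<in> DD a \<and> (\<exists>c\<in>X. z' \<in> fst c \<and>
  (\<forall>v. levi (\<lambda>w. - ln (hE k a (cinv c w))) (snd c z') v \<ge> 0)))"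
proof (cases "z \<in> cinv c0 ` cball w0 (R / 2)")
 case False
 obtain a where a: "a \<le> n" "rh a z > 0" using cover by blast
 note z = rh_dom[OF a(2)]
 let ?V = "DD a \<inter> - (cinv c0 ` cball w0 (R / 2))"
 have "R / 2 \<le> 4 * R" using R(1) by simp
 then have oV: "open ?V" using BR(6) DD(1) by (intro open_Int open_Compl) auto
 have "\<exists>k0 W. open W \<and> z \<in> W \<and> (\<forall>k\<ge>k0. \<forall>z'\<in>W. z' \<in> DD a \<and> z' \<in> fst (ch a) \<and>
  (\<forall>v. levi (\<lambda>w. - ln (hE k a (cinv (ch a) w))) (snd (ch a) z') v \<ge> 0))"
 proof (rule absorb_at[OF ch(1) DD_D(1)[OF z] oV])
  show "z \<in> ?V" using z False by simp
  show "levi (\<lambda>w. psiw (pt a) (cinv (ch a) w)) (snd (ch a) z') v \<ge> 0" if "z' \<in> ?V" "z' \<in> fst (ch a)" for z' v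
   by (rule levi_psiw_outside(1)[OF _ _ ch(1) that(2)]) (use that DD_D(3) in auto)
  show "levi (\<lambda>w. gg a (cinv (ch a) w)) (snd (ch a) z) v > 0"
   if "v \<noteq> 0" "levi (\<lambda>w. psiw (pt a) (cinv (ch a) w)) (snd (ch a) z) v = 0" for v
   using levi_psiw_outside(2)[OF False DD_D(3)[OF z] ch(1) DD_D(1)[OF z] that(2)] that(1) by simp
 qed simp
 then show ?thesis using a(1) ch(1) by meson
next
 case True
 let ?U = "cinv c0 ` ball w0 R"
 have R4: "R \<le> 4 * R" using R(1) by simp
 have "cball w0 (R / 2) \<subseteq> ball w0 R" using R(1) by auto
 then have z: "z \<in> ?U" using True by blast
 have zc: "z \<in> fst c0" using z BR(3)[OF R4] by blast
 have UD: "?U \<subseteq> DD 0" using zero(5) by blast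
 have "\<exists>k0 W. open W \<and> z \<in> W \<and> (\<forall>k\<ge>k0. \<forall>z'\<in>W. z' \<in> DD 0 \<and> z' \<in> fst c0 \<and>
  (\<forall>v. levi (\<lambda>w. - ln (hE k 0 (cinv c0 w))) (snd c0 z') v \<ge> 0))"
 proof (rule absorb_at[OF c0X zc BR(5)[OF R4] z UD])
  show "levi (\<lambda>w. psiw (pt 0) (cinv c0 w)) (snd c0 z') v \<ge> 0" if "z' \<in> ?U" for z' v
   unfolding zero by (rule levi_psiw_inside_nonneg(1)[OF that])
  fix v assume v: "v \<noteq> 0" "levi (\<lambda>w. psiw (pt 0) (cinv c0 w)) (snd c0 z) v = 0"
  have ve: "v = v $ k1 *s v0" by (rule levi_psiw_inside_nonneg(2)[OF z v(2)[unfolded zero]])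
  then have nz: "v $ k1 \<noteq> 0" using v(1) by auto
  have "snd c0 z \<in> snd c0 ` (fst c0 \<inter> ?U)" using z zc by blast
  then have "levi (\<lambda>w. gg 0 (cinv c0 w)) (snd c0 z) (v $ k1 *s v0) = (cmod (v $ k1))\<^sup>2 * levi (\<lambda>w. gg 0 (cinv c0 w)) (snd c0 z) v0"
   by (intro levi_scale_complex[OF X.chart_image_open[OF c0X BR(5)[OF R4]] smooth_funD[OF smooth_fun_subset[OF gg_smooth UD] c0X]])
  then show "levi (\<lambda>w. gg 0 (cinv c0 w)) (snd c0 z) v > 0"
   using gg_near[OF z] nz ve by simp
 qed
 then show ?thesis using c0X by (meson le0)
qed

lemma EE_semipositive: "\<exists>k0. \<forall>k\<ge>k0. semipositive X (EE k) (hE k)"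
proof -
 define P where "P k z' \<longleftrightarrow> (\<exists>a\<le>n. z' \<in> DD a \<and> (\<exists>c\<in>X. z' \<in> fst c \<and>
  (\<forall>v. levi (\<lambda>w. - ln (hE k a (cinv c w))) (snd c z') v \<ge> 0)))" for k z'
 have "\<exists>q. open (snd q) \<and> z \<in> snd q \<and> (\<forall>k\<ge>fst q. \<forall>z'\<in>snd q. P k z')" for z
 proof -
  obtain k0 W where "open W" "z \<in> W" "\<forall>k\<ge>k0. \<forall>z'\<in>W. P k z'"
   unfolding P_def using semipositive_local[of z] by (elim exE conjE)
  then show ?thesis by (intro exI[of _ "(k0, W)"]) simp
 qed
 then have "\<forall>z. \<exists>q. open (snd q) \<and> z \<in> snd q \<and> (\<forall>k\<ge>fst q. \<forall>z'\<in>snd q. P k z')" ..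
 from choice[OF this] obtain q where
  q: "\<forall>z. open (snd (q z)) \<and> z \<in> snd (q z) \<and> (\<forall>k\<ge>fst (q z). \<forall>z'\<in>snd (q z). P k z')" ..
 define kf where "kf z = fst (q z)" for z
 define Wf where "Wf z = snd (q z)" for z
 have W: "open (Wf z)" "z \<in> Wf z" "k \<ge> kf z ==> z' \<in> Wf z ==> P k z'" for z k z'
 proof -
  note qz = spec[OF q, of z, folded kf_def Wf_def]
  show "open (Wf z)" "z \<in> Wf z" by (rule conjunct1[OF qz], rule conjunct1[OF conjunct2[OF qz]])
  show "P k z'" if "k \<ge> kf z" "z' \<in> Wf z"
   by (rule bspec[OF mp[OF spec[OF conjunct2[OF conjunct2[OF qz]]] that(1)] that(2)])
 qed
 have "UNIV \<subseteq> (\<Union>z\<in>UNIV. Wf z)" 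
 proof (rule subsetI)
  fix z show "z \<in> (\<Union>z\<in>UNIV. Wf z)" by (rule UN_I[of z]) (rule UNIV_I, rule W(2))
 qed
 then obtain T where T: "finite T" "UNIV \<subseteq> (\<Union>z\<in>T. Wf z)"
  by (rule compactE_image[OF cpt, of UNIV Wf, OF W(1)])
 \<comment> \<open>The inserted 0 makes the set under \<open>Max\<close> visibly nonempty.\<close>
 have "semipositive X (EE k) (hE k)" if k: "k \<ge> Max (insert 0 (kf ` T))" for k
 proof (rule X.semipositiveI[OF EE_bundle hE_metric])
  fix z
  obtain t where t: "t \<in> T" "z \<in> Wf t" using subsetD[OF T(2) UNIV_I[of z]] by (rule UN_E)
  have "kf t \<le> Max (insert 0 (kf ` T))" using T(1) t(1) by (intro Max_ge) auto
  then have "P k z" using W(3)[of t k z] t(2) k by simp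
  then obtain a c where "a \<le> n" "z \<in> DD a" "c \<in> X" "z \<in> fst c"
   "\<forall>v. levi (\<lambda>w. - ln (hE k a (cinv c w))) (snd c z) v \<ge> 0" unfolding P_def by (elim exE conjE bexE)
  then show "\<exists>i\<in>lb_index (EE k). z \<in> lb_dom (EE k) i \<and> (\<exists>c\<in>X. z \<in> fst c \<and>
    (\<forall>v. levi (\<lambda>w. - ln (hE k i (cinv c w))) (snd c z) v \<ge> 0))"
   by (intro bexI[of _ a] conjI bexI[of _ c]) (simp_all add: EE_def)
 qed
 then show ?thesis by (intro exI[of _ "Max (insert 0 (kf ` T))"]) simp
qed

end

lemma hermitian_metricD:
 assumes "hermitian_metric A L h" "i \<in> lb_index L"
 shows "smooth_fun A (lb_dom L i) (h i)" "x \<in> lb_dom L i ==> h i x > 0"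
  "j \<in> lb_index L ==> x \<in> lb_dom L i ==> x \<in> lb_dom L j ==> h j x = (cmod (lb_trans L i j x))\<^sup>2 * h i x"
 using assms unfolding hermitian_metric_def by blast+

lemma holomorphic_line_bundleD:
 assumes "holomorphic_line_bundle A L" "i \<in> lb_index L"
 shows "open (lb_dom L i)" "j \<in> lb_index L ==> holo_fun A (lb_dom L i \<inter> lb_dom L j) (lb_trans L i j)"
 using assms unfolding holomorphic_line_bundle_def by blast+

context cmanifold
begin

lemma hermitian_metric_tensor:
 assumes L: "holomorphic_line_bundle X L" "hermitian_metric X L h" and M: "holomorphic_line_bundle X M" "hermitian_metric X M g"
 shows "hermitian_metric X (lb_tensor L M) (tensor_metric h g)"
 unfolding hermitian_metric_def
proof (intro conjI ballI)
 fix al assume "al \<in> lb_index (lb_tensor L M)"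
 then obtain i a where ia: "al = (i, a)" "i \<in> lb_index L" "a \<in> lb_index M" by (auto simp: lb_tensor_def)
 note o = holomorphic_line_bundleD(1)[OF L(1) ia(2)] holomorphic_line_bundleD(1)[OF M(1) ia(3)]
 note s = hermitian_metricD(1)[OF L(2) ia(2)] hermitian_metricD(1)[OF M(2) ia(3)]
 note pos = hermitian_metricD(2)[OF L(2) ia(2)] hermitian_metricD(2)[OF M(2) ia(3)]
 show "smooth_fun X (lb_dom (lb_tensor L M) al) (tensor_metric h g al)"
  unfolding ia lb_tensor_def tensor_metric_def
  by simp (intro smooth_fun_mult open_Int o smooth_fun_subset[OF s(1)] smooth_fun_subset[OF s(2)]; simp)
 show "tensor_metric h g al x > 0" if "x \<in> lb_dom (lb_tensor L M) al" for x
  using that pos unfolding ia lb_tensor_def tensor_metric_def by simp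
 fix \<beta> x assume "\<beta> \<in> lb_index (lb_tensor L M)" and x: "x \<in> lb_dom (lb_tensor L M) al \<inter> lb_dom (lb_tensor L M) \<beta>"
 then obtain j b where jb: "\<beta> = (j, b)" "j \<in> lb_index L" "b \<in> lb_index M" by (auto simp: lb_tensor_def)
 have "h j x = (cmod (lb_trans L i j x))\<^sup>2 * h i x" "g b x = (cmod (lb_trans M a b x))\<^sup>2 * g a x"
  using hermitian_metricD(3)[OF L(2) ia(2) jb(2), of x] hermitian_metricD(3)[OF M(2) ia(3) jb(3), of x] x
  unfolding ia jb lb_tensor_def by simp_all
 then show "tensor_metric h g \<beta> x = (cmod (lb_trans (lb_tensor L M) al \<beta> x))\<^sup>2 * tensor_metric h g al x"
  unfolding ia jb lb_tensor_def tensor_metric_def by (simp add: norm_mult power_mult_distrib)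
qed

end

section \<open>The norm estimates\<close>

text \<open>On the ball of radius \<open>2 * de\<close> the bound on \<open>ray\<close> forces
  \<open>ss \<ge> ep / 2\<close>, where \<open>th\<close> is affine and the weight explicit. Twice
  the radius leaves room for balls of radius \<open>de\<close> around all points of the line at
  distance less than \<open>de\<close> from \<open>w0\<close>.\<close>

locale estimates = negative_cover X Y p N F WW ii ff L hL x0 i0 c0 d0 io0 w0 v0 k1 de0 R ep B ka S th n ch dh il pt DD CC rh
 for X :: "('a::{t2_space,second_countable_topology}, 'k::finite) chart set"
  and Y :: "('b::{t2_space,second_countable_topology}, 'm::finite) chart set"
  and p :: "'a => 'b" and N F WW ii ff and L :: "('i, 'a) line_bundle" and hL x0 i0 c0 d0 io0 w0 v0 k1 de0 R ep B ka S th
  and n ch dh il pt DD CC rh +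
 fixes de :: real and j1 :: 'm
 assumes de: "de > 0" "2 * de \<le> R / 2" "w \<in> ball w0 (2 * de) ==> ray x0 x0 (cinv c0 w) \<ge> exp (- ep / 2)"
  and j1: "io0 j1 = k1"
begin

abbreviation "MM k \<equiv> lb_tensor L (EE k)"
abbreviation "hM k \<equiv> tensor_metric hL (hE k)"

lemma MM: "holomorphic_line_bundle X (MM k)" "hermitian_metric X (MM k) (hM k)"
 by (intro X.line_bundle_tensor X.hermitian_metric_tensor L hL EE_bundle hE_metric)+

lemma fibre_sectionI: "u \<in> direct_image_fibre X Y p (MM k) y ==> fibre_section X Y p (MM k) (hM k) y u"
 by (intro fibre_section.intro fibre_section_axioms.intro submersion_axioms MM)

lemma MM_simps: "lb_index (MM k) = lb_index L \<times> {..n}" "lb_dom (MM k) (i, a) = lb_dom L i \<inter> DD a"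
 by (simp_all add: lb_tensor_def EE_def)

text \<open>The squared norm of \<open>ell x0\<close> in the modified Fubini-Study metric, as a
  function on the whole manifold.\<close>

definition rt :: "'a => real" where
 "rt x = ray x0 x x * exp (- Th x)"

lemma rt_eq: "x \<in> WW a ==> rt x = ray x0 a x * exp (- Th x)"
 unfolding rt_def using ray_change[of x a x x0] WW(2)[of x] by simp

lemma hM_eq:
 assumes "x \<in> DD a"
 shows "(cmod (ell x0 (pt a) x ^ k * q))\<^sup>2 * hM k (il a, a) x = rt x ^ k * ((cmod q)\<^sup>2 * qq (kap a) x)"
proof -
 let ?r = "cmod (ell x0 (pt a) x)" and ?h = "hL (il a) x" and ?m = "nrm (pt a) x" and ?e = "exp (- Th x)"
 have h: "?h \<noteq> 0" using hL_facts(2)[OF il DD_D(4)[OF assms]] by simp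
 have 1: "(cmod (ell x0 (pt a) x ^ k * q))\<^sup>2 = (?r\<^sup>2) ^ k * (cmod q)\<^sup>2"
  by (simp only: norm_mult norm_power power_mult_distrib power_mult[symmetric] mult.commute)
 have 2: "hM k (il a, a) x = (?e / ?m) ^ k * qq (kap a) x"
  unfolding tensor_metric_def hE_def using h by simp
 have "(?r\<^sup>2 * (?e / ?m)) ^ k = rt x ^ k"
  unfolding rt_eq[OF DD_D(3)[OF assms]] ray_def by (simp only: times_divide_eq_right times_divide_eq_left)
 then show ?thesis unfolding 1 2 power_mult_distrib by (simp only: mult_ac)
qed

text \<open>The section \<open>ell x0 ^ k\<close> read in the frames of the tensor product. The
  factors \<open>reltrans\<close> and \<open>lb_trans\<close> move the frames of the relative
  canonical bundle and of \<open>L\<close> to those of index \<open>a\<close>, which cancel against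
  the dual factors of \<open>EE k\<close>.\<close>

definition uk :: "nat => 'a => (('a, 'k) chart \<times> ('b, 'm) chart) \<times> 'i \<times> nat => complex" where
 "uk k x = (\<lambda>(ga, i, a). if ga \<in> X \<times> Y \<and> x \<in> fst (fst ga) \<and> p x \<in> fst (snd ga) \<and> i \<in> lb_index L \<and> x \<in> lb_dom L i \<and> a \<le> n \<and> x \<in> DD a
  then ell x0 (pt a) x ^ k * (reltrans ga (kap a) x * lb_trans L i (il a) x) else 0)"

lemma uk_section: "restrict_section p (uk k) y \<in> direct_image_fibre X Y p (MM k) y"
proof -
 let ?B = "lb_tensor (relative_canonical_bundle X Y p) (MM k)"
 have idx: "al \<in> lb_index ?B \<longleftrightarrow> fst al \<in> X \<times> Y \<and> fst (snd al) \<in> lb_index L \<and> snd (snd al) \<le> n" for al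
  by (cases al) (auto simp: lb_tensor_def EE_def)
 have dom: "x \<in> lb_dom ?B al \<longleftrightarrow> x \<in> fst (fst (fst al)) \<and> p x \<in> fst (snd (fst al)) \<and> x \<in> lb_dom L (fst (snd al)) \<and> x \<in> DD (snd (snd al))" for al x
  by (cases al) (auto simp: lb_tensor_def EE_def)
 have uke: "uk k x al = ell x0 (pt (snd (snd al))) x ^ k * (reltrans (fst al) (kap (snd (snd al))) x * lb_trans L (fst (snd al)) (il (snd (snd al))) x)"
  if "al \<in> lb_index ?B" "x \<in> lb_dom ?B al" for al x
  using that unfolding idx dom by (cases al) (auto simp: uk_def)
 have fib: "uk k x \<in> lb_fibre ?B x" for x
  unfolding lb_fibre_def
 proof (intro CollectI conjI allI ballI impI)
  show "uk k x al = 0" if "\<not> (al \<in> lb_index ?B \<and> x \<in> lb_dom ?B al)" for al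
   using that unfolding idx dom by (cases al) (auto simp: uk_def)
  fix al \<beta> assume al: "al \<in> lb_index ?B" and \<beta>: "\<beta> \<in> lb_index ?B" and x: "x \<in> lb_dom ?B al \<inter> lb_dom ?B \<beta>"
  obtain c d i a where ale: "al = ((c, d), i, a)" by (cases al) auto
  obtain c' d' j b where \<beta>e: "\<beta> = ((c', d'), j, b)" by (cases \<beta>) auto
  have 1: "c \<in> X" "d \<in> Y" "x \<in> fst c" "p x \<in> fst d" "c' \<in> X" "d' \<in> Y" "x \<in> fst c'" "p x \<in> fst d'"
   "i \<in> lb_index L" "x \<in> lb_dom L i" "j \<in> lb_index L" "x \<in> lb_dom L j" "x \<in> DD a" "x \<in> DD b"
   using al \<beta> x unfolding idx dom Int_iff ale \<beta>e by auto
  note cd = 1(1-4) and cd' = 1(5-8)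
  have r: "reltrans (c, d) (kap b) x = reltrans (c, d) (kap a) x * reltrans (kap a) (kap b) x"
   "reltrans (c, d) (kap b) x = reltrans (c, d) (c', d') x * reltrans (c', d') (kap b) x"
   unfolding kap_def
   by (rule reltrans(3)[OF cd ch(1,2) DD_D(1,2)[OF 1(13)] ch(1,2) DD_D(1,2)[OF 1(14)], symmetric])
    (rule reltrans(3)[OF cd cd' ch(1,2) DD_D(1,2)[OF 1(14)], symmetric])
  have l: "lb_trans L i (il b) x = lb_trans L i (il a) x * lb_trans L (il a) (il b) x"
   "lb_trans L i (il b) x = lb_trans L i j x * lb_trans L j (il b) x"
   by (rule lb_trans_cocycle[OF L 1(9,10) il DD_D(4)[OF 1(13)] il DD_D(4)[OF 1(14)], symmetric])
    (rule lb_trans_cocycle[OF L 1(9-12) il DD_D(4)[OF 1(14)], symmetric])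
  have nz: "reltrans (kap a) (kap b) x * lb_trans L (il a) (il b) x \<noteq> 0"
   using kap_trans(1)[OF 1(13,14)] lb_trans_nz[OF L il DD_D(4)[OF 1(13)] il DD_D(4)[OF 1(14)]] by simp
  have e: "ell x0 (pt a) x = ff (pt a) x (ii (pt b)) * ell x0 (pt b) x"
   by (rule ell_change[OF DD_D(3)[OF 1(13)] DD_D(3)[OF 1(14)]])
  have "lb_trans ?B al \<beta> x * uk k x \<beta> = (reltrans (c, d) (c', d') x * (lb_trans L i j x *
    (ff (pt a) x (ii (pt b)) ^ k * inverse (reltrans (kap a) (kap b) x * lb_trans L (il a) (il b) x)))) *
    (ell x0 (pt b) x ^ k * (reltrans (c', d') (kap b) x * lb_trans L j (il b) x))"
   using uke[OF \<beta>, of x] x by (simp add: ale \<beta>e lb_tensor_def EE_def)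
  also have "... = ell x0 (pt a) x ^ k * ((reltrans (c, d) (c', d') x * reltrans (c', d') (kap b) x) *
    (lb_trans L i j x * lb_trans L j (il b) x) * inverse (reltrans (kap a) (kap b) x * lb_trans L (il a) (il b) x))"
   by (simp only: e power_mult_distrib mult_ac)
  also have "... = ell x0 (pt a) x ^ k * ((reltrans (c, d) (kap a) x * lb_trans L i (il a) x) *
    ((reltrans (kap a) (kap b) x * lb_trans L (il a) (il b) x) * inverse (reltrans (kap a) (kap b) x * lb_trans L (il a) (il b) x)))"
   unfolding r(2)[symmetric] l(2)[symmetric] unfolding r(1) l(1) by (simp only: mult_ac)
  also have "... = uk k x al"
   unfolding right_inverse[OF nz] using uke[OF al, of x] x by (simp add: ale)
  finally show "uk k x al = lb_trans ?B al \<beta> x * uk k x \<beta>" by simp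
 qed
 have hol: "holo_fun_sub X (p -` {y} \<inter> lb_dom ?B al) (\<lambda>x. restrict_section p (uk k) y x al)" if al: "al \<in> lb_index ?B" for al
  unfolding holo_fun_sub_def
 proof
  fix x assume x: "x \<in> p -` {y} \<inter> lb_dom ?B al"
  obtain c d i a where ale: "al = ((c, d), i, a)" by (cases al) auto
  have 1: "c \<in> X" "d \<in> Y" "i \<in> lb_index L" using al unfolding idx ale by auto
  let ?D = "lb_dom ?B al"
  have De: "?D = (fst c \<inter> p -` fst d) \<inter> (lb_dom L i \<inter> DD a)" using dom[of _ al] unfolding ale by auto
  have "open (lb_dom L i)" by (rule holomorphic_line_bundleD(1)[OF L 1(3)])
  then have oD: "open ?D" unfolding De by (intro open_Int X.chart(1) p_cont(2) Y.chart(1) 1 DD)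
  have h1: "holo_fun X ?D (ell x0 (pt a))" by (rule holo_fun_subset[OF ell_holo]) (use De DD_D(3)[of _ a] in blast)
  have h2: "holo_fun X ?D (reltrans (c, d) (kap a))" unfolding kap_def
   by (rule holo_fun_subset[OF reltrans_holo[OF 1(1,2) ch(1,2)]]) (use De DD_D(1,2)[of _ a] in blast)
  have h3: "holo_fun X ?D (lb_trans L i (il a))"
   by (rule holo_fun_subset[OF holomorphic_line_bundleD(2)[OF L 1(3) il]]) (use De DD_D(4)[of _ a] in blast)
  have "holo_fun X ?D (\<lambda>x. uk k x al)"
  proof (rule X.holo_fun_cong[OF _ oD])
   show "holo_fun X ?D (\<lambda>x. ell x0 (pt a) x ^ k * (reltrans (c, d) (kap a) x * lb_trans L i (il a) x))"
    by (intro X.holo_fun_mult X.holo_fun_power h1 h2 h3)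
  qed (use uke[OF al, unfolded ale fst_conv snd_conv] ale in simp)
  then show "\<exists>W F. open W \<and> x \<in> W \<and> holo_fun X W F \<and> (\<forall>x'\<in>W \<inter> (p -` {y} \<inter> ?D). restrict_section p (uk k) y x' al = F x')"
   using oD x by (intro exI[of _ ?D] exI[of _ "\<lambda>x. uk k x al"]) (auto simp: restrict_section_def)
 qed
 show ?thesis
  unfolding direct_image_fibre_def lb_sections_def
  using fib hol by (auto simp: restrict_section_def)
qed

text \<open>The index with \<open>rh a x > 0\<close> is only a choice of frame; \<open>qq\<close>
  absorbs the change to the frame of \<open>(c, d)\<close>.\<close>

lemma uk_dens:
 assumes "p x = y" "c \<in> X" "d \<in> Y" "x \<in> fst c" "p x \<in> fst d"
 shows "fibre_section.dens (MM k) (hM k) (restrict_section p (uk k) y) c d x = rt x ^ k * qq (c, d) x"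
proof -
 interpret fibre_section X Y p "MM k" "hM k" y "restrict_section p (uk k) y"
  by (rule fibre_sectionI[OF uk_section])
 obtain a where a: "a \<le> n" "rh a x > 0" using cover by blast
 have x: "x \<in> DD a" by (rule rh_dom[OF a(2)])
 have "dens c d x = (cmod (restrict_section p (uk k) y x ((c, d), (il a, a))))\<^sup>2 * hM k (il a, a) x"
  by (rule dens_eq[OF assms]) (use x a il DD_D(4)[OF x] in \<open>auto simp: MM_simps\<close>)
 also have "restrict_section p (uk k) y x ((c, d), (il a, a)) = ell x0 (pt a) x ^ k * reltrans (c, d) (kap a) x"
  using assms x a il DD_D(4)[OF x] lb_trans_self[OF L il DD_D(4)[OF x]] by (simp add: restrict_section_def uk_def)
 also have "(cmod (ell x0 (pt a) x ^ k * reltrans (c, d) (kap a) x))\<^sup>2 * hM k (il a, a) x =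
   rt x ^ k * ((cmod (reltrans (c, d) (kap a) x))\<^sup>2 * qq (kap a) x)" by (rule hM_eq[OF x])
 also have "(cmod (reltrans (c, d) (kap a) x))\<^sup>2 * qq (kap a) x = qq (c, d) x"
  unfolding kap_def by (rule qq_change[OF assms(2-5) ch(1,2) DD_D(1,2)[OF x], symmetric])
 finally show ?thesis .
qed

end

section \<open>Norm of the peak section and bounds for evaluations\<close>

context estimates
begin

abbreviation "G k \<equiv> slice_gauss io0 de (real k * B)"

text \<open>The constant by which the modified weight, taken against \<open>ell x0\<close>, exceeds
  \<open>psi1\<close> where \<open>th\<close> is affine.\<close>

definition al :: real where "al = ep - ka"
text \<open>The loss of \<open>rt\<close> against \<open>exp (- al)\<close> on the central fibre: at
  least \<open>B * de\<^sup>2\<close> between the radii \<open>de\<close> and \<open>R / 2\<close>,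
  and at least \<open>3 * ep\<close> beyond, since there \<open>rt \<le> exp (- 4 * ep)\<close> and
  \<open>al \<le> ep\<close>.\<close>

definition et :: real where "et = min (B * de\<^sup>2) (3 * ep)"

lemma al: "al \<le> ep" and et: "et > 0"
 using th(3)[of 0] th(6)[of 0] B(1) de(1) eps(1) by (auto simp: al_def et_def)

lemma Th_nonneg: "Th x \<ge> 0"
 unfolding Th_def using th(5) by simp

lemma rt_nonneg: "rt x \<ge> 0"
 unfolding rt_def using ray_props(1)[OF WW(2)[of x]] by simp

lemma rt_outside: "x \<notin> cinv c0 ` ball w0 (R / 2) ==> rt x \<le> exp (- 4 * ep)"
 unfolding rt_def using eps(2)[OF _ WW(2)[of x]] Th_nonneg[of x] ray_props(1)[OF WW(2)[of x]]
 by (intro order_trans[OF mult_right_le_one_le]) auto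

lemma rt_exp:
 assumes "x \<in> cinv c0 ` ball w0 R"
 shows "rt x = exp (ln (ray x0 x0 x) - th (ss x))"
proof -
 have "R \<le> 4 * R" using R(1) by simp
 then have "x \<in> WW x0" using BR(7) assms by blast
 then show ?thesis using ray_pos[OF assms] assms by (simp add: rt_eq Th_def exp_diff exp_minus field_simps)
qed

text \<open>\<open>th t \<ge> t - ka\<close> holds everywhere, so the Gaussian is an upper bound on
  the whole ball of radius \<open>R\<close>. Equality, in \<open>rt_saturated\<close>, serves the
  lower bounds for norms of arbitrary sections.\<close>

lemma rt_inside: "x \<in> cinv c0 ` ball w0 R ==> rt x \<le> exp (- psi1 (snd c0 x) - al)"
 using th(6)[of "ss x"] unfolding rt_exp ss_def al_def by simp

lemma rt_saturated:
 assumes w: "w \<in> ball w0 (2 * de)"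
 shows "rt (cinv c0 w) = exp (- psi1 w - al)" "cinv c0 w \<in> cinv c0 ` ball w0 R" "snd c0 (cinv c0 w) = w" "cinv c0 w \<in> fst c0"
proof -
 have "2 * de \<le> R" "R \<le> 4 * R" using de(2) R(1) by auto
 then have wR: "w \<in> ball w0 R" using w by auto
 then have w': "w \<in> snd c0 ` fst c0" using BR(1)[OF \<open>R \<le> 4 * R\<close>] by blast
 show wc: "snd c0 (cinv c0 w) = w" and "cinv c0 w \<in> fst c0"
  using X.chart(5)[OF c0X w'] X.chart(6)[OF c0X w'] by auto
 show in_R: "cinv c0 w \<in> cinv c0 ` ball w0 R" using wR by blast
 have "ln (exp (- ep / 2)) \<le> ln (ray x0 x0 (cinv c0 w))"
  using de(3)[OF w] ray_pos[OF in_R] by (subst ln_le_cancel_iff) auto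
 moreover have "psi1 w \<ge> 0" unfolding psi1_norm using B(1) by simp
 ultimately have "ss (cinv c0 w) \<ge> ep / 2" unfolding ss_def wc by simp
 then show "rt (cinv c0 w) = exp (- psi1 w - al)"
  unfolding rt_exp[OF in_R] by (simp add: th(4) ss_def wc al_def)
qed

lemma base_eq: "x \<in> fst c0 ==> snd c0 x $ io0 j = snd d0 (p x) $ j"
 and inj0: "inj io0" and d0Y: "d0 \<in> Y" and p_d0: "x \<in> fst c0 ==> p x \<in> fst d0"
 using adapted_iff[THEN iffD1, OF ad0] by auto

lemma t0: "snd d0 (p x0) $ j = w0 $ io0 j"
 using base_eq[OF x0(1), of j] x0(2) by simp

lemma p_slice:
 assumes "w \<in> snd c0 ` fst c0" "y \<in> fst d0" "!!j. w $ io0 j = snd d0 y $ j"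
 shows "p (cinv c0 w) = y"
proof -
 note 1 = X.chart(5)[OF c0X assms(1)] X.chart(6)[OF c0X assms(1)]
 have "snd d0 (p (cinv c0 w)) = snd d0 y" using base_eq[OF 1(2)] assms(3) 1(1) by (simp add: vec_eq_iff)
 then show ?thesis using Y.chart(3)[OF d0Y] p_d0[OF 1(2)] assms(2) by (meson inj_onD)
qed

lemma fibre_k1: "x \<in> fst c0 ==> p x = p x0 ==> snd c0 x $ k1 = w0 $ k1"
 using base_eq[of x j1] t0[of j1] j1 by simp

lemma psi1_fibre: "w $ k1 = w0 $ k1 ==> psi1 w = B * (norm (w - w0))\<^sup>2"
 unfolding psi1_norm by simp

lemma rt_far:
 assumes "p x = p x0" "x \<notin> cinv c0 ` ball w0 de"
 shows "rt x \<le> exp (- al - et)"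
proof (cases "x \<in> cinv c0 ` ball w0 (R / 2)")
 case True
 have R4: "R / 2 \<le> 4 * R" "R \<le> 4 * R" "de \<le> 4 * R" using R(1) de by auto
 have xc: "x \<in> fst c0" using True BR(3)[OF R4(1)] by blast
 have "ball w0 (R / 2) \<subseteq> ball w0 R" using R(1) by auto
 then have xR: "x \<in> cinv c0 ` ball w0 R" using True by blast
 have "norm (snd c0 x - w0) \<ge> de"
  using assms(2) BR(3)[OF R4(3), of x] xc by (auto simp: dist_norm norm_minus_commute)
 then have "B * de\<^sup>2 \<le> psi1 (snd c0 x)"
  unfolding psi1_fibre[OF fibre_k1[OF xc assms(1)]] using B(1) de(1) by (intro mult_left_mono power_mono) auto
 then have "et \<le> psi1 (snd c0 x)" unfolding et_def by linarith
 then show ?thesis using rt_inside[OF xR] by (elim order_trans) simp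
next
 case False
 have "et \<le> 3 * ep" unfolding et_def by simp
 then have "exp (- 4 * ep) \<le> exp (- al - et)" using al by simp
 then show ?thesis using rt_outside[OF False] by linarith
qed

abbreviation "vol k y u \<equiv> fibre_volume X Y p (MM k) (hM k) y u"
abbreviation "us k \<equiv> restrict_section p (uk k) (p x0)"

text \<open>Near \<open>x0\<close> the density is at most a Gaussian, with \<open>qq = 1\<close>
  because the base coordinate along the line vanishes on the central fibre. Elsewhere it is compared
  with the density for the power 0, whose total mass \<open>C\<close> does not depend on
  \<open>k\<close>.\<close>

lemma uk_upper:
 "\<exists>C\<ge>0. \<forall>k. emeasure (vol k (p x0) (us k)) UNIV \<le> ennreal (exp (- al) ^ k) * (G k + ennreal (C * exp (- et) ^ k))"
proof -
 let ?V = "cinv c0 ` ball w0 de" and ?t = "snd d0 (p x0)"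
 have fs: "fibre_section X Y p (MM k) (hM k) (p x0) (us k)" for k by (rule fibre_sectionI[OF uk_section])
 define C where "C = enn2real (emeasure (vol 0 (p x0) (us 0)) UNIV)"
 have C: "emeasure (vol 0 (p x0) (us 0)) UNIV = ennreal C" "C \<ge> 0"
  using fibre_section.fibre_volume_finite[OF fs cpt, of 0] unfolding C_def by (auto simp: less_top)
 have R4: "de \<le> 4 * R" using R(1) de by auto
 have oV: "open ?V" by (rule BR(5)[OF R4])
 have Vc: "?V \<subseteq> fst c0" using BR(3)[OF R4] by blast
 have "emeasure (vol k (p x0) (us k)) UNIV \<le> ennreal (exp (- al) ^ k) * (G k + ennreal (C * exp (- et) ^ k))" for k
 proof -
  let ?mu = "vol k (p x0) (us k)"
  interpret fs: fibre_section X Y p "MM k" "hM k" "p x0" "us k" by (rule fs)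
  interpret f0: fibre_section X Y p "MM 0" "hM 0" "p x0" "us 0" by (rule fs)
  have sets: "sets ?mu = sets borel" by (rule fs.fibre_volume(1)[OF cpt])
  have "emeasure ?mu (?V \<union> - ?V) = emeasure ?mu ?V + emeasure ?mu (- ?V)"
   by (rule plus_emeasure[symmetric]) (use oV sets in auto)
  then have split: "emeasure ?mu UNIV = emeasure ?mu ?V + emeasure ?mu (- ?V)" by simp
  have far: "emeasure ?mu (- ?V) \<le> ennreal (exp (- al - et) ^ k) * ennreal C"
  proof -
   have "emeasure ?mu (- ?V) \<le> ennreal (exp (- al - et) ^ k) * emeasure (vol 0 (p x0) (us 0)) (- ?V)"
   proof (rule f0.fibre_volume_compare[OF cpt fs])
    show "- ?V \<in> sets borel" using oV by auto
    show "fs.dens c d x \<le> exp (- al - et) ^ k * f0.dens c d x"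
     if x: "x \<in> - ?V" "p x = p x0" and cd: "c \<in> X" "d \<in> Y" "x \<in> fst c" "p x \<in> fst d" for x c d
    proof -
     have "rt x ^ k * qq (c, d) x \<le> exp (- al - et) ^ k * qq (c, d) x"
      using qq_pos[OF cd] rt_far[OF x(2)] x(1) rt_nonneg by (intro mult_right_mono power_mono) auto
     then show ?thesis unfolding uk_dens[OF x(2) cd] by simp
    qed
   qed simp
   also have "... \<le> ennreal (exp (- al - et) ^ k) * ennreal C"
    unfolding C(1)[symmetric] by (intro mult_left_mono emeasure_mono) (auto simp: f0.fibre_volume(1)[OF cpt])
   finally show ?thesis .
  qed
  have near: "emeasure ?mu ?V \<le> ennreal (exp (- al) ^ k) * G k"
  proof -
   let ?P = "slice_lborel io0" and ?W = "slice_point io0 ?t"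
   have "emeasure ?mu ?V = fs.mass c0 d0 io0 ?V"
    by (rule fs.fibre_volume(3)[OF cpt ad0 _ Vc]) (use oV in auto)
   also have "... \<le> (\<integral>\<^sup>+z. ennreal (exp (- al) ^ k) *
     (indicator (ball w0 de) (?W z) * ennreal (exp (- (real k * B) * (norm (?W z - w0))\<^sup>2))) \<partial>?P)"
    unfolding fs.mass_def
   proof (rule nn_integral_mono)
    fix z
    show "indicator (snd c0 ` (?V \<inter> p -` {p x0})) (?W z) * ennreal (fs.dens c0 d0 (cinv c0 (?W z)))
     \<le> ennreal (exp (- al) ^ k) * (indicator (ball w0 de) (?W z) * ennreal (exp (- (real k * B) * (norm (?W z - w0))\<^sup>2)))"
    proof (cases "?W z \<in> snd c0 ` (?V \<inter> p -` {p x0})")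
     case True
     then obtain x where x: "x \<in> ?V" "p x = p x0" "?W z = snd c0 x" by blast
     have xc: "x \<in> fst c0" "?W z \<in> ball w0 de" using x BR(3)[OF R4, of x] by auto
     have "ball w0 de \<subseteq> ball w0 R" using de by auto
     then have xR: "x \<in> cinv c0 ` ball w0 R" using x(1) by blast
     have cx: "cinv c0 (?W z) = x" unfolding x(3) by (rule X.chart(4)[OF c0X xc(1)])
     have k1: "?W z $ k1 = w0 $ k1" unfolding x(3) by (rule fibre_k1[OF xc(1) x(2)])
     have "fs.dens c0 d0 x = rt x ^ k * qq (c0, d0) x"
      by (rule uk_dens[OF x(2) c0X d0Y xc(1) p_d0[OF xc(1)]])
     also have "qq (c0, d0) x = 1" unfolding qq_near[OF xR] using k1 x(3) by simp
     also have "rt x ^ k * 1 \<le> exp (- psi1 (snd c0 x) - al) ^ k"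
      using rt_inside[OF xR] rt_nonneg by (simp add: power_mono)
     also have "... = exp (- al) ^ k * exp (- (real k * B) * (norm (?W z - w0))\<^sup>2)"
      unfolding psi1_fibre[OF k1, unfolded x(3)] x(3) exp_of_nat_mult[symmetric] exp_add[symmetric] by (simp add: algebra_simps)
     finally have "ennreal (fs.dens c0 d0 x) \<le> ennreal (exp (- al) ^ k * exp (- (real k * B) * (norm (?W z - w0))\<^sup>2))"
      by (rule ennreal_leI)
     then show ?thesis using True xc(2) cx by (simp add: ennreal_mult)
    qed simp
   qed
   also have "... = ennreal (exp (- al) ^ k) * (\<integral>\<^sup>+z. indicator (ball w0 de) (?W z) * ennreal (exp (- (real k * B) * (norm (?W z - w0))\<^sup>2)) \<partial>?P)"
   proof (rule nn_integral_cmult)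
    have "(\<lambda>w. indicator (ball w0 de) w * ennreal (exp (- (real k * B) * (norm (w - w0))\<^sup>2))) \<in> borel_measurable borel"
     by (intro borel_measurable_times_ennreal borel_measurable_indicator measurable_compose[OF _ measurable_ennreal]
       borel_measurable_continuous_onI continuous_intros) auto
    then show "(\<lambda>z. indicator (ball w0 de) (?W z) * ennreal (exp (- (real k * B) * (norm (?W z - w0))\<^sup>2))) \<in> borel_measurable ?P"
     by (rule measurable_compose[OF slice_point_measurable])
   qed
   also have "(\<integral>\<^sup>+z. indicator (ball w0 de) (?W z) * ennreal (exp (- (real k * B) * (norm (?W z - w0))\<^sup>2)) \<partial>?P) = G k"
    by (rule slice_gauss_eq[OF inj0]) (simp add: t0)
   finally show ?thesis .
  qed
  have "emeasure ?mu UNIV \<le> ennreal (exp (- al) ^ k) * G k + ennreal (exp (- al - et) ^ k) * ennreal C"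
   unfolding split by (rule add_mono[OF near far])
  also have "ennreal (exp (- al - et) ^ k) * ennreal C = ennreal (exp (- al) ^ k) * ennreal (C * exp (- et) ^ k)"
  proof -
   have "exp (- al - et) ^ k * C = exp (- al) ^ k * (C * exp (- et) ^ k)"
   proof -
    have "exp (- al - et) = exp (- al) * exp (- et)" by (simp add: mult_exp_exp)
    then show ?thesis by (simp only: power_mult_distrib mult_ac)
   qed
   then show ?thesis using C(2) by (simp add: ennreal_mult[symmetric])
  qed
  finally show ?thesis by (simp add: distrib_left)
 qed
 then show ?thesis using C(2) by blast
qed

text \<open>The coefficient of \<open>u\<close> against the peak section, in the frame of index 0.
  Dividing by the power of \<open>ell\<close> turns the density of \<open>u\<close> into the squared
  modulus of this coefficient times an explicit weight.\<close>

definition evl :: "nat => complex^'k => ('a => (('a, 'k) chart \<times> ('b, 'm) chart) \<times> 'i \<times> nat => complex) => complex" where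
 "evl k w u = u (cinv c0 w) ((c0, d0), i0, 0) / ell x0 x0 (cinv c0 w) ^ k"

text \<open>A section over the fibre is extended to a neighbourhood in the coordinate space by the projection onto the slice.\<close>

lemma evl_slice_holo:
 assumes u: "u \<in> direct_image_fibre X Y p (MM k) y" and y: "y \<in> fst d0"
  and a: "!!j. a $ io0 j = snd d0 y $ j" "ball a de \<subseteq> ball w0 (2 * de)"
 shows "holo_on (ball a de) (\<lambda>w. evl k (slice_point io0 (snd d0 y) (($) w)) u)"
proof -
 let ?B = "lb_tensor (relative_canonical_bundle X Y p) (MM k)" and ?i = "((c0, d0), i0, 0::nat)"
 let ?pr = "\<lambda>w :: complex^'k. slice_point io0 (snd d0 y) (($) w)"
 have prb: "?pr w \<in> ball a de" if "w \<in> ball a de" for w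
 proof -
  have "cmod ((?pr w - a) $ k) \<le> cmod ((w - a) $ k)" for k
   using a(1) by (cases "k \<in> range io0") (auto simp: slice_point_def inj0)
  then have "norm (?pr w - a) \<le> norm (w - a)" by (rule norm_le_componentwise_cart)
  then show ?thesis using that by (simp add: dist_norm norm_minus_commute)
 qed
 have prh: "holo_map_on S ?pr" for S
  unfolding holo_map_on_def slice_point_def
 proof
  fix k show "holo_on S (\<lambda>w. (\<chi> k. if k \<in> range io0 then snd d0 y $ inv io0 k else w $ k) $ k)"
   by (cases "k \<in> range io0") simp_all
 qed
 have "2 * de \<le> R" "R \<le> 4 * R" using de R(1) by auto
 then have sub: "ball w0 (2 * de) \<subseteq> ball w0 R" by auto
 have ptR: "cinv c0 (?pr w) \<in> cinv c0 ` ball w0 R" and prc: "?pr w \<in> snd c0 ` fst c0" if "w \<in> ball a de" for w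
  using prb[OF that] a(2) sub BR(1)[OF \<open>R \<le> 4 * R\<close>] by blast+
 have pty: "p (cinv c0 (?pr w)) = y" if "w \<in> ball a de" for w
  by (rule p_slice[OF prc[OF that] y]) (rule slice_point_base[OF inj0])
 have dom: "cinv c0 (?pr w) \<in> p -` {y} \<inter> lb_dom ?B ?i" if "w \<in> ball a de" for w
  using pty[OF that] ptR[OF that] zero(5) BR(7)[OF \<open>R \<le> 4 * R\<close>] X.chart(6)[OF c0X prc[OF that]] y
  by (auto simp: lb_tensor_def EE_def)
 have "?i \<in> lb_index ?B" using c0X d0Y i0 by (simp add: lb_tensor_def EE_def)
 then have hs: "holo_fun_sub X (p -` {y} \<inter> lb_dom ?B ?i) (\<lambda>x. u x ?i)"
  using u unfolding direct_image_fibre_def lb_sections_def by blast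
 have 1: "holo_on (ball a de) (\<lambda>w. u (cinv c0 (?pr w)) ?i)"
 proof (rule holo_on_local)
  fix w1 assume w1: "w1 \<in> ball a de"
  obtain W H where W: "open W" "cinv c0 (?pr w1) \<in> W" "holo_fun X W H"
   "\<forall>x\<in>W \<inter> (p -` {y} \<inter> lb_dom ?B ?i). u x ?i = H x"
   using hs dom[OF w1] unfolding holo_fun_sub_def by blast
  define T where "T = ball a de \<inter> ?pr -` (snd c0 ` (fst c0 \<inter> W))"
  have oT: "open T" unfolding T_def
   by (rule continuous_open_preimage[OF slice_point_continuous open_ball X.chart_image_open[OF c0X W(1)]])
  have T: "cinv c0 (?pr w) \<in> W" if "w \<in> T" for w
   by (rule X.chart_pt[OF c0X]) (use that T_def in blast)
  have "w1 \<in> T" unfolding T_def using w1 X.chart_image_inter[OF c0X, of "?pr w1" W] prc[OF w1] W(2) by simp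
  moreover have "holo_on T (\<lambda>w. u (cinv c0 (?pr w)) ?i)"
  proof (rule holo_on_cong[OF _ oT])
   show "holo_on T (\<lambda>w. H (cinv c0 (?pr w)))"
    by (rule holo_on_compose[OF prh holo_funD[OF W(3) c0X]]) (auto simp: T_def)
   show "H (cinv c0 (?pr w)) = u (cinv c0 (?pr w)) ?i" if "w \<in> T" for w
    using W(4) T[OF that] dom[of w] that unfolding T_def by simp
  qed
  ultimately show "\<exists>W. w1 \<in> W \<and> holo_on W (\<lambda>w. u (cinv c0 (?pr w)) ?i)" by blast
 qed
 have 2: "holo_on (ball a de) (\<lambda>w. ell x0 x0 (cinv c0 (?pr w)))"
 proof (rule holo_on_compose[OF prh holo_funD[OF ell_holo c0X]])
  show "?pr w \<in> snd c0 ` (fst c0 \<inter> WW x0)" if "w \<in> ball a de" for w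
   using X.chart_image_inter[OF c0X, of "?pr w" "WW x0"] prc[OF that] ptR[OF that] BR(7)[OF \<open>R \<le> 4 * R\<close>] by blast
 qed
 show ?thesis unfolding evl_def
  by (intro holo_on_divide holo_on_power 1 2) (use BR(8)[OF \<open>R \<le> 4 * R\<close> ptR] in auto)
qed

text \<open>In the slice through the point \<open>a\<close> of the line, the weight is exactly
  \<open>al + B * (norm (w - a))\<^sup>2\<close> per power, and \<open>qq\<close> is constant. The
  mean value inequality with this Gaussian bounds the value at \<open>a\<close> by the mass of the
  ball of radius \<open>de\<close>.\<close>

lemma evl_bound:
 assumes u: "u \<in> direct_image_fibre X Y p (MM k) y" and y: "y \<in> fst d0"
  and z: "!!j. snd d0 y $ j = w0 $ io0 j + ze * v0 $ io0 j" "norm (ze *s v0) < de"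
 shows "ennreal ((cmod (evl k (w0 + ze *s v0) u))\<^sup>2) * (ennreal (exp (- al) ^ k * exp (de0 / 8 * (cmod ze)\<^sup>2)) * G k)
  \<le> emeasure (vol k y u) UNIV"
proof -
 let ?P = "slice_lborel io0" and ?W = "slice_point io0 (snd d0 y)"
 define a where "a = w0 + ze *s v0"
 define q where "q = exp (- al) ^ k * exp (de0 / 8 * (cmod ze)\<^sup>2)"
 have q: "q > 0" unfolding q_def by simp
 interpret fs: fibre_section X Y p "MM k" "hM k" y u by (rule fibre_sectionI[OF u])
 have a: "a $ io0 j = snd d0 y $ j" for j unfolding a_def z(1) by simp
 have sub: "ball a de \<subseteq> ball w0 (2 * de)"
 proof
  fix w assume "w \<in> ball a de"
  then have "dist a w < de" "dist w0 a < de" using z(2) by (auto simp: a_def dist_norm)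
  then show "w \<in> ball w0 (2 * de)" using dist_triangle[of w0 w a] by simp
 qed
 have R4: "2 * de \<le> 4 * R" "R \<le> 4 * R" using de R(1) by auto
 have bc: "ball a de \<subseteq> snd c0 ` fst c0" using sub BR(1)[OF R4(1)] by blast
 let ?V = "cinv c0 ` ball a de"
 have oV: "open ?V" by (rule X.chart_preimage(2)[OF c0X bc]) simp
 have Vc: "?V \<subseteq> fst c0" using X.chart_preimage(1)[OF c0X bc] by blast
 define v where "v w = evl k (slice_point io0 (snd d0 y) (($) w)) u" for w
 have hv: "holo_on (ball a de) v" unfolding v_def by (rule evl_slice_holo[OF u y a sub])
 define g where "g r = ennreal (exp (- (real k * B) * r\<^sup>2))" for r :: real
 have [measurable]: "g \<in> borel_measurable borel" unfolding g_def by measurable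
 have va: "v a = evl k a u" unfolding v_def by (simp add: slice_point_self[OF inj0 a])
 have dens: "indicator (ball a de) (?W z) * (ennreal ((cmod (v (?W z)))\<^sup>2) * g (norm (?W z - a))) * ennreal q
   = indicator (snd c0 ` (?V \<inter> p -` {y})) (?W z) * ennreal (fs.dens c0 d0 (cinv c0 (?W z)))" for z
 proof (cases "?W z \<in> ball a de")
  case True
  let ?w = "?W z"
  let ?x = "cinv c0 ?w"
  have wb: "?w \<in> ball w0 (2 * de)" using True sub by blast
  note rs = rt_saturated[OF wb]
  have py: "p ?x = y" by (rule p_slice[OF _ y slice_point_base[OF inj0]]) (use True bc in blast)
  have "snd c0 ?x \<in> snd c0 ` (?V \<inter> p -` {y})" using True py by (intro imageI) auto
  then have ind: "?w \<in> snd c0 ` (?V \<inter> p -` {y})" unfolding rs(3) .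
  have xD: "?x \<in> DD 0" using zero(5)[OF rs(2)] by blast
  have kk: "kap 0 = (c0, d0)" by (simp add: kap_def zero)
  have "fs.dens c0 d0 ?x = (cmod (u ?x ((c0, d0), i0, 0)))\<^sup>2 * hM k (i0, 0) ?x"
   by (rule fs.dens_eq[OF py c0X d0Y rs(4) p_d0[OF rs(4)]])
    (use xD i0 DD_D(4)[OF xD] zero in \<open>auto simp: MM_simps\<close>)
  also have "u ?x ((c0, d0), i0, 0) = ell x0 (pt 0) ?x ^ k * v ?w"
   using BR(8)[OF R4(2) rs(2)] unfolding v_def evl_def zero by simp
  also have "(cmod ...)\<^sup>2 * hM k (i0, 0) ?x = rt ?x ^ k * ((cmod (v ?w))\<^sup>2 * qq (c0, d0) ?x)"
   using hM_eq[OF xD, of k "v ?w"] unfolding zero kk .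
  also have "qq (c0, d0) ?x = exp (de0 / 8 * (cmod ze)\<^sup>2)"
  proof -
   have "?w $ k1 = a $ k1" using a[of j1] slice_point_base[OF inj0, of "snd d0 y" z j1] j1 by simp
   then have "?w $ k1 - w0 $ k1 = ze" by (simp add: a_def v0)
   then show ?thesis using qq_near[OF rs(2)] unfolding rs(3) by simp
  qed
  also have "rt ?x = exp (- al) * exp (- B * (norm (?w - a))\<^sup>2)"
  proof -
   have "?w $ k1 = a $ k1" using a[of j1] slice_point_base[OF inj0, of "snd d0 y" z j1] j1 by simp
   \<comment> \<open>The coordinate \<open>k1\<close> belongs to the base and is constant on the
     slice, so all its points are measured from the same point \<open>a\<close> of the line.\<close>
   then have e: "?w - w0 - (?w $ k1 - w0 $ k1) *s v0 = ?w - a" by (simp add: a_def v0)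
   show ?thesis unfolding rs(1) psi1_norm e by (simp add: mult_exp_exp)
  qed
  also have "(exp (- al) * exp (- B * (norm (?w - a))\<^sup>2)) ^ k * ((cmod (v ?w))\<^sup>2 * exp (de0 / 8 * (cmod ze)\<^sup>2))
   = (cmod (v ?w))\<^sup>2 * exp (- (real k * B) * (norm (?w - a))\<^sup>2) * q"
  proof -
   have "exp (- B * (norm (?w - a))\<^sup>2) ^ k = exp (- (real k * B) * (norm (?w - a))\<^sup>2)"
    by (simp add: exp_of_nat_mult[symmetric])
   then show ?thesis unfolding q_def power_mult_distrib by (simp only: mult_ac)
  qed
  finally have "ennreal (fs.dens c0 d0 ?x) = ennreal ((cmod (v ?w))\<^sup>2) * g (norm (?w - a)) * ennreal q"
   unfolding g_def using q by (simp add: ennreal_mult)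
  then show ?thesis using True ind by simp
 next
  case False
  have "?W z \<notin> snd c0 ` (?V \<inter> p -` {y})"
  proof
   assume "?W z \<in> snd c0 ` (?V \<inter> p -` {y})"
   then obtain x where "x \<in> ?V" "?W z = snd c0 x" by blast
   then show False using False X.chart_preimage(1)[OF c0X bc, of x] by simp
  qed
  then show ?thesis using False by simp
 qed
 have meas: "(\<lambda>z. indicator (ball a de) (?W z) * (ennreal ((cmod (v (?W z)))\<^sup>2) * g (norm (?W z - a)))) \<in> borel_measurable ?P"
 proof -
  have e: "indicator (ball a de) w * (ennreal ((cmod (v w))\<^sup>2) * g (norm (w - a)))
   = ennreal (indicator (ball a de) w *\<^sub>R (cmod (v w))\<^sup>2) * ennreal (exp (- (real k * B) * (norm (w - a))\<^sup>2))" for w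
   unfolding g_def by (auto simp: indicator_def)
  have 1: "(\<lambda>w. indicator (ball a de) w *\<^sub>R (cmod (v w))\<^sup>2) \<in> borel_measurable borel"
   by (rule borel_measurable_continuous_on_indicator) (auto intro!: continuous_intros holo_on_continuous hv)
  have 2: "(\<lambda>w. exp (- (real k * B) * (norm (w - a))\<^sup>2)) \<in> borel_measurable borel"
   by (intro borel_measurable_continuous_onI continuous_intros)
  have "(\<lambda>w. indicator (ball a de) w * (ennreal ((cmod (v w))\<^sup>2) * g (norm (w - a)))) \<in> borel_measurable borel"
   unfolding e by (rule borel_measurable_times_ennreal[OF measurable_compose[OF 1 measurable_ennreal] measurable_compose[OF 2 measurable_ennreal]])
  then show ?thesis by (rule measurable_compose[OF slice_point_measurable])
 qed
 have "ennreal ((cmod (v a))\<^sup>2) * (\<integral>\<^sup>+z. indicator (ball a de) (?W z) * g (norm (?W z - a)) \<partial>?P)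
  \<le> (\<integral>\<^sup>+z. indicator (ball a de) (?W z) * (ennreal ((cmod (v (?W z)))\<^sup>2) * g (norm (?W z - a))) \<partial>?P)"
  by (rule slice_mean_value[OF inj0 a open_ball hv order_refl]) measurable
 also have "(\<integral>\<^sup>+z. indicator (ball a de) (?W z) * g (norm (?W z - a)) \<partial>?P) = G k"
  unfolding g_def by (rule slice_gauss_eq[OF inj0 a])
 finally have "ennreal ((cmod (v a))\<^sup>2) * G k * ennreal q \<le>
   (\<integral>\<^sup>+z. indicator (ball a de) (?W z) * (ennreal ((cmod (v (?W z)))\<^sup>2) * g (norm (?W z - a))) \<partial>?P) * ennreal q"
  by (rule mult_right_mono) simp
 also have "... = fs.mass c0 d0 io0 ?V"
  unfolding fs.mass_def nn_integral_multc[OF meas, symmetric] dens ..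
 also have "... = emeasure (vol k y u) ?V"
  by (rule fs.fibre_volume(3)[OF cpt ad0 _ Vc, symmetric]) (use oV in auto)
 also have "... \<le> emeasure (vol k y u) UNIV"
  by (rule emeasure_mono) (simp_all add: fs.fibre_volume(1)[OF cpt])
 finally show ?thesis unfolding va a_def[symmetric] q_def[symmetric] by (simp only: mult_ac)
qed

end

lemma ereal_log_le: "0 \<le> d ==> d\<^sup>2 \<le> q ==> 0 < q ==> ereal_log d \<le> ereal (ln q / 2)"
proof (cases "d = 0")
 case False
 assume d: "0 \<le> d" "d\<^sup>2 \<le> q" "0 < q"
 then have "ln (d\<^sup>2) \<le> ln q" using False by (subst ln_le_cancel_iff) auto
 then show ?thesis using False d by (simp add: ereal_log_def ln_realpow)
qed (simp add: ereal_log_def)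

lemma lb_fibre_scale:
 assumes v: "v \<in> lb_fibre M x"
 shows "(\<lambda>j. c * v j) \<in> lb_fibre M x"
 unfolding lb_fibre_def
proof (intro CollectI conjI allI impI ballI)
 show "c * v i = 0" if "\<not> (i \<in> lb_index M \<and> x \<in> lb_dom M i)" for i
 proof -
  have "v i = 0" using v that unfolding lb_fibre_def by blast
  then show ?thesis by simp
 qed
 show "c * v i = lb_trans M i j x * (c * v j)" if "i \<in> lb_index M" "j \<in> lb_index M" "x \<in> lb_dom M i \<inter> lb_dom M j" for i j
 proof -
  have "v i = lb_trans M i j x * v j" using v that unfolding lb_fibre_def by blast
  from this[symmetric] show ?thesis by (metis mult.left_commute)
 qed
qed

context estimates
begin

section \<open>The dual section and the contradiction\<close>

lemma scale_section:
 assumes u: "u \<in> direct_image_fibre X Y p (MM k) y"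
 shows "(\<lambda>x j. c * u x j) \<in> direct_image_fibre X Y p (MM k) y"
proof -
 let ?B = "lb_tensor (relative_canonical_bundle X Y p) (MM k)"
 have u': "!!x. x \<in> p -` {y} ==> u x \<in> lb_fibre ?B x" "!!x. x \<notin> p -` {y} ==> u x = (\<lambda>_. 0)"
  "!!i. i \<in> lb_index ?B ==> holo_fun_sub X (p -` {y} \<inter> lb_dom ?B i) (\<lambda>x. u x i)"
  using u unfolding direct_image_fibre_def lb_sections_def by blast+
 have 1: "(\<lambda>j. c * u x j) \<in> lb_fibre ?B x" if "x \<in> p -` {y}" for x
  by (rule lb_fibre_scale[OF u'(1)[OF that]])
 have 2: "holo_fun_sub X (p -` {y} \<inter> lb_dom ?B i) (\<lambda>x. c * u x i)" if i: "i \<in> lb_index ?B" for i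
  unfolding holo_fun_sub_def
 proof
  fix x assume "x \<in> p -` {y} \<inter> lb_dom ?B i"
  then obtain W H where "open W" "x \<in> W" "holo_fun X W H" "\<forall>x'\<in>W \<inter> (p -` {y} \<inter> lb_dom ?B i). u x' i = H x'"
   using u'(3)[OF i] unfolding holo_fun_sub_def by blast
  then show "\<exists>W F. open W \<and> x \<in> W \<and> holo_fun X W F \<and> (\<forall>x'\<in>W \<inter> (p -` {y} \<inter> lb_dom ?B i). c * u x' i = F x')"
   by (intro exI[of _ W] exI[of _ "\<lambda>x. c * H x"] conjI X.holo_fun_mult X.holo_fun_const) auto
 qed
 show ?thesis
  unfolding direct_image_fibre_def lb_sections_def using 1 2 u'(2) by auto
qed

lemma scale_vol:
 assumes u: "u \<in> direct_image_fibre X Y p (MM k) y"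
 shows "emeasure (vol k y (\<lambda>x j. c * u x j)) UNIV \<le> ennreal ((cmod c)\<^sup>2) * emeasure (vol k y u) UNIV"
proof -
 interpret fs: fibre_section X Y p "MM k" "hM k" y u by (rule fibre_sectionI[OF u])
 note fc = fibre_sectionI[OF scale_section[OF u, of c]]
 show ?thesis
  by (rule fs.fibre_volume_compare[OF cpt fc])
   (auto simp: fibre_section.dens_def[OF fc] fs.dens_def lb_norm2_def Let_def norm_mult power_mult_distrib)
qed

abbreviation "L2 k y u \<equiv> fibre_L2_norm X Y p (MM k) (hM k) y u"

lemma L2_square:
 assumes "u \<in> direct_image_fibre X Y p (MM k) y"
 shows "ennreal ((L2 k y u)\<^sup>2) = emeasure (vol k y u) UNIV" "L2 k y u \<ge> 0"
 by (rule fibre_section.fibre_L2_norm_square[OF fibre_sectionI[OF assms] cpt])+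

text \<open>A holomorphic dual section lives on an open set of the base, not on a disc. So the line
  is extended to a section of \<open>p\<close>: the base coordinates are \<open>t\<close>, and the
  fibre coordinates follow the line with parameter \<open>t $ j1 - w0 $ k1\<close>.\<close>

definition sg :: "complex^'m => complex^'k" where
 "sg t = slice_point io0 t (\<lambda>k. w0 $ k + (t $ j1 - w0 $ k1) * v0 $ k)"

definition UU :: "'b set" where
 "UU = {y \<in> fst d0. sg (snd d0 y) \<in> ball w0 (2 * de)}"

definition \<xi> :: "nat => 'b => ('a => (('a, 'k) chart \<times> ('b, 'm) chart) \<times> 'i \<times> nat => complex) => complex" where
 "\<xi> k y = evl k (sg (snd d0 y))"

lemma sg_disc: "(!!j. t $ j = w0 $ io0 j + ze * v0 $ io0 j) ==> sg t = w0 + ze *s v0"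
 using v0 j1[symmetric] unfolding sg_def slice_point_def by (auto simp: vec_eq_iff inj0)

lemma sg_holo: "holo_map_on T sg"
 unfolding holo_map_on_def
proof
 fix k show "holo_on T (\<lambda>t. sg t $ k)"
  unfolding sg_def slice_point_def
  by (cases "k \<in> range io0") (auto intro!: holo_on_add holo_on_mult holo_on_diff)
qed

lemma UU_open: "open UU"
proof -
 have "UU = fst d0 \<inter> (\<lambda>y. sg (snd d0 y)) -` ball w0 (2 * de)" unfolding UU_def by auto
 moreover have "continuous_on (fst d0) (\<lambda>y. sg (snd d0 y))"
  by (rule continuous_on_compose2[OF holo_map_on_continuous[OF sg_holo, of UNIV] Y.chart(7)[OF d0Y]]) simp
 ultimately show ?thesis using continuous_open_preimage[OF _ Y.chart(1)[OF d0Y] open_ball] by metis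
qed

lemma sg_point:
 assumes "y \<in> UU"
 shows "sg (snd d0 y) \<in> snd c0 ` fst c0" "p (cinv c0 (sg (snd d0 y))) = y"
  "cinv c0 (sg (snd d0 y)) \<in> cinv c0 ` ball w0 R" "cinv c0 (sg (snd d0 y)) \<in> fst c0"
proof -
 have b: "sg (snd d0 y) \<in> ball w0 (2 * de)" "y \<in> fst d0" using assms unfolding UU_def by auto
 note rs = rt_saturated[OF b(1)]
 show c: "sg (snd d0 y) \<in> snd c0 ` fst c0" using rs(3,4) by (metis image_eqI)
 show "cinv c0 (sg (snd d0 y)) \<in> cinv c0 ` ball w0 R" "cinv c0 (sg (snd d0 y)) \<in> fst c0" by (rule rs)+
 show "p (cinv c0 (sg (snd d0 y))) = y"
  by (rule p_slice[OF c b(2)]) (simp add: sg_def slice_point_base[OF inj0])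
qed

lemma \<xi>_holo: "holo_dual_section X Y p (MM k) UU (\<xi> k)"
 unfolding holo_dual_section_def
proof (intro conjI ballI allI impI)
 show "linear_functional_on (direct_image_fibre X Y p (MM k) y) (\<xi> k y)" for y
  unfolding linear_functional_on_def \<xi>_def evl_def by (simp add: add_divide_distrib)
 fix V u
 let ?B = "lb_tensor (relative_canonical_bundle X Y p) (MM k)" and ?i = "((c0, d0), i0, 0::nat)"
 assume a: "open V \<and> V \<subseteq> UU \<and> u \<in> lb_sections X ?B (p -` V)"
 then have oV: "open V" and VU: "V \<subseteq> UU" and u: "u \<in> lb_sections X ?B (p -` V)" by auto
 have Vd: "V \<subseteq> fst d0" using VU unfolding UU_def by auto
 have R4: "R \<le> 4 * R" using R(1) by simp
 have idx: "?i \<in> lb_index ?B" using c0X d0Y i0 by (simp add: lb_tensor_def EE_def)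
 let ?D = "p -` V \<inter> lb_dom ?B ?i"
 have De: "lb_dom ?B ?i = (fst c0 \<inter> p -` fst d0) \<inter> (lb_dom L i0 \<inter> DD 0)" by (simp add: lb_tensor_def EE_def)
 have oD: "open ?D" unfolding De
  by (intro open_Int X.chart(1) p_cont(2) Y.chart(1) c0X d0Y DD oV holomorphic_line_bundleD(1)[OF L i0])
 have "holo_fun_sub X ?D (\<lambda>x. u x ?i)" using u idx unfolding lb_sections_def by blast
 then have hu: "holo_fun X ?D (\<lambda>x. u x ?i)" by (rule X.holo_fun_sub_open[OF oD])
 have pt: "sg t \<in> snd c0 ` (fst c0 \<inter> ?D)" "sg t \<in> snd c0 ` (fst c0 \<inter> WW x0)" "ell x0 x0 (cinv c0 (sg t)) \<noteq> 0"
  and py: "p (cinv c0 (sg t)) = cinv d0 t" and tc: "snd d0 (cinv d0 t) = t" if t: "t \<in> snd d0 ` V" for t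
 proof -
  obtain y where y: "y \<in> V" "t = snd d0 y" using t by blast
  have yd: "y \<in> fst d0" using y Vd by blast
  have ct: "cinv d0 t = y" unfolding y(2) by (rule Y.chart(4)[OF d0Y yd])
  note sp = sg_point[OF subsetD[OF VU y(1)], folded y(2)]
  show "p (cinv c0 (sg t)) = cinv d0 t" unfolding ct by (rule sp)
  show "snd d0 (cinv d0 t) = t" using ct y(2) by simp
  show "ell x0 x0 (cinv c0 (sg t)) \<noteq> 0" by (rule BR(8)[OF R4 sp(3)])
  have x: "cinv c0 (sg t) \<in> DD 0" "cinv c0 (sg t) \<in> WW x0" "cinv c0 (sg t) \<in> lb_dom L i0"
   using zero(5)[OF sp(3)] BR(7)[OF R4] sp(3) by blast+
  show "sg t \<in> snd c0 ` (fst c0 \<inter> WW x0)" using X.chart_image_inter[OF c0X] sp(1) x by blast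
  have "cinv c0 (sg t) \<in> ?D" unfolding De using x sp(2,4) y(1) yd by auto
  then show "sg t \<in> snd c0 ` (fst c0 \<inter> ?D)" using X.chart_image_inter[OF c0X] sp(1) by blast
 qed
 have "holo_on (snd d0 ` V) (\<lambda>t. u (cinv c0 (sg t)) ?i / ell x0 x0 (cinv c0 (sg t)) ^ k)"
  by (intro holo_on_divide holo_on_power holo_on_compose[OF sg_holo holo_funD[OF hu c0X]]
    holo_on_compose[OF sg_holo holo_funD[OF ell_holo c0X]]) (use pt in auto)
 then have "holo_on (snd d0 ` V) (\<lambda>t. \<xi> k (cinv d0 t) (restrict_section p u (cinv d0 t)))"
  by (rule holo_on_cong[OF _ Y.chart(9)[OF d0Y Vd oV]]) (simp add: \<xi>_def evl_def tc py restrict_section_def)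
 then show "holo_fun Y V (\<lambda>y. \<xi> k y (restrict_section p u y))"
  by (rule Y.holo_fun_chart[OF d0Y oV Vd])
qed

abbreviation "dn k y \<equiv> dual_norm X Y p (MM k) (hM k) y (\<xi> k y)"

definition gk :: "nat => real" where "gk k = enn2real (G k)"

lemma gk: "G k = ennreal (gk k)" "gk k > 0"
proof -
 have "G k < \<infinity>" by (rule slice_gauss_finite[OF inj0]) (use B(1) in simp)
 then show 1: "G k = ennreal (gk k)" unfolding gk_def by (simp add: less_top)
 obtain V where "V > 0" "\<forall>k::nat. G k \<ge> ennreal (V * exp (- real k * et))"
  using slice_gauss_lower[OF inj0 de(1) et B(1)] by blast
 then have "0 < ennreal (V * exp (- real k * et))" "ennreal (V * exp (- real k * et)) \<le> G k" by simp_all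
 then have "0 < ennreal (gk k)" unfolding 1 by (rule less_le_trans)
 then show "gk k > 0" by simp
qed

lemma \<xi>_bound:
 assumes u: "u \<in> direct_image_fibre X Y p (MM k) y" and y: "y \<in> fst d0"
  and z: "!!j. snd d0 y $ j = w0 $ io0 j + ze * v0 $ io0 j" "norm (ze *s v0) < de"
 shows "(cmod (\<xi> k y u))\<^sup>2 * (exp (- al) ^ k * exp (de0 / 8 * (cmod ze)\<^sup>2) * gk k) \<le> (L2 k y u)\<^sup>2"
proof -
 have "ennreal ((cmod (\<xi> k y u))\<^sup>2) * (ennreal (exp (- al) ^ k * exp (de0 / 8 * (cmod ze)\<^sup>2)) * G k) \<le> ennreal ((L2 k y u)\<^sup>2)"
  unfolding L2_square(1)[OF u] \<xi>_def sg_disc[OF z(1)] by (rule evl_bound[OF u y z])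
 then show ?thesis unfolding gk(1) using gk(2)[of k] by (simp add: ennreal_mult[symmetric])
qed

text \<open>The estimate for all sections also shows that the set in \<open>dual_norm\<close> is
  bounded, so that its \<open>SUP\<close> is a genuine supremum.\<close>

lemma dn_upper:
 fixes k :: nat
 assumes y: "y \<in> fst d0" and z: "!!j. snd d0 y $ j = w0 $ io0 j + ze * v0 $ io0 j" "norm (ze *s v0) < de"
 defines "Q \<equiv> 1 / (exp (- al) ^ k * exp (de0 / 8 * (cmod ze)\<^sup>2) * gk k)"
 shows "0 \<le> dn k y" "(dn k y)\<^sup>2 \<le> Q" "0 < Q"
  "u \<in> direct_image_fibre X Y p (MM k) y ==> L2 k y u \<le> 1 ==> cmod (\<xi> k y u) \<le> dn k y"
proof -
 let ?A = "{u \<in> direct_image_fibre X Y p (MM k) y. L2 k y u \<le> 1}"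
 show Q: "0 < Q" unfolding Q_def using gk(2)[of k] by simp
 have le: "cmod (\<xi> k y u) \<le> sqrt Q" if "u \<in> ?A" for u
 proof -
  have u: "u \<in> direct_image_fibre X Y p (MM k) y" "L2 k y u \<le> 1" using that by auto
  have "(L2 k y u)\<^sup>2 \<le> 1" using u(2) L2_square(2)[OF u(1)] by (simp add: power_le_one)
  then have "(cmod (\<xi> k y u))\<^sup>2 \<le> Q"
   using \<xi>_bound[OF u(1) y z] gk(2)[of k] unfolding Q_def by (simp add: pos_le_divide_eq)
  then show ?thesis by (rule real_le_rsqrt)
 qed
 then have bdd: "bdd_above ((\<lambda>u. cmod (\<xi> k y u)) ` ?A)" by (intro bdd_aboveI2)
 show up: "cmod (\<xi> k y u) \<le> dn k y" if "u \<in> direct_image_fibre X Y p (MM k) y" "L2 k y u \<le> 1" for u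
  unfolding dual_norm_def by (rule cSUP_upper[OF _ bdd]) (use that in simp)
 have u0: "restrict_section p (uk k) y \<in> direct_image_fibre X Y p (MM k) y" by (rule uk_section)
 \<comment> \<open>The zero section, obtained by scaling, shows that the set under the supremum is
   nonempty.\<close>
 let ?z = "\<lambda>x j. 0 * restrict_section p (uk k) y x j"
 have z0: "?z \<in> direct_image_fibre X Y p (MM k) y" by (rule scale_section[OF u0])
 have "ennreal ((L2 k y ?z)\<^sup>2) \<le> 0" unfolding L2_square(1)[OF z0] using scale_vol[OF u0, of 0] by simp
 then have zA: "?z \<in> ?A" using z0 L2_square(2)[OF z0] by simp
 have "L2 k y ?z \<le> 1" using zA by simp
 from order_trans[OF norm_ge_zero up[OF z0 this]] show "0 \<le> dn k y" .
 moreover have "dn k y \<le> sqrt Q"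
  unfolding dual_norm_def by (rule cSUP_least) (use zA le in blast)+
 ultimately have "(dn k y)\<^sup>2 \<le> (sqrt Q)\<^sup>2" by (intro power_mono)
 then show "(dn k y)\<^sup>2 \<le> Q" using Q by simp
qed

text \<open>At the centre the normalised peak section bounds the dual norm from below; on the circle
  it is bounded from above with the extra factor \<open>e > 1\<close>. The sub-mean value inequality
  leaves \<open>(e - 1) * gk k\<close> below an error of order \<open>exp (- et) ^ k\<close>, but
  \<open>gk k\<close> decays more slowly.\<close>

lemma not_griffiths:
 assumes "!!k. k \<ge> k0 ==> griffiths_semipositive X Y p (MM k) (hM k)"
 shows False
proof -
 \<comment> \<open>Chosen with \<open>r * norm v0 < de\<close>, so that \<open>dn_upper\<close>
   applies on the whole closed disc.\<close>
 define r where "r = de / (2 * (norm v0 + 1))"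
 have r: "r > 0" "r * norm v0 < de"
 proof -
  have n1: "norm v0 + 1 > 0" by (simp add: add_nonneg_pos)
  show "r > 0" unfolding r_def using de(1) n1 by simp
  have "r * norm v0 = de * (norm v0 / (2 * (norm v0 + 1)))" unfolding r_def by simp
  also have "... < de * 1" using n1 de(1) by (intro mult_strict_left_mono) (simp_all add: field_simps)
  finally show "r * norm v0 < de" by simp
 qed
 let ?y0 = "p x0"
 have y0: "?y0 \<in> fst d0" by (rule p_d0[OF x0(1)])
 define e where "e = exp (de0 / 8 * r\<^sup>2)"
 have e: "e > 1" unfolding e_def using neg(1) r(1) by simp
 have key: "(e - 1) * gk k \<le> C * exp (- et) ^ k"
  if k: "k \<ge> k0" and C: "C \<ge> 0" "emeasure (vol k (p x0) (us k)) UNIV \<le> ennreal (exp (- al) ^ k) * (G k + ennreal (C * exp (- et) ^ k))" for k C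
 proof -
  let ?E = "exp (- al) ^ k"
  have u: "us k \<in> direct_image_fibre X Y p (MM k) ?y0" by (rule uk_section)
  define nu where "nu = L2 k ?y0 (us k)"
  have nu_le: "nu\<^sup>2 \<le> ?E * (gk k + C * exp (- et) ^ k)"
  proof -
   have "ennreal (nu\<^sup>2) \<le> ennreal ?E * (ennreal (gk k) + ennreal (C * exp (- et) ^ k))"
    using C(2) unfolding nu_def L2_square(1)[OF u] gk(1) .
   also have "... = ennreal (?E * (gk k + C * exp (- et) ^ k))"
    using C(1) gk(2)[of k] by (simp add: ennreal_mult[symmetric] ennreal_plus[symmetric] del: ennreal_plus)
   finally show ?thesis using C(1) gk(2)[of k] by (subst (asm) ennreal_le_iff) (auto simp: less_imp_le)
  qed
  have z0: "snd d0 ?y0 $ j = w0 $ io0 j + 0 * v0 $ io0 j" "norm (0 *s v0) < de" for j using t0 de(1) by auto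
  have xi1: "\<xi> k ?y0 (us k) = 1"
  proof -
   have x: "cinv c0 w0 = x0" unfolding x0(2) by (rule X.chart(4)[OF c0X x0(1)])
   have R4: "R \<le> 4 * R" using R(1) by simp
   have xR: "x0 \<in> cinv c0 ` ball w0 R" using x R(1) by (metis centre_in_ball image_eqI)
   have xD: "x0 \<in> DD 0" using zero(5)[OF xR] by blast
   have "reltrans (c0, d0) (kap 0) x0 = 1" using kap_trans(2)[OF xD xD] by (simp add: kap_def zero)
   moreover have "lb_trans L i0 (il 0) x0 = 1" unfolding zero by (rule lb_trans_self[OF L i0]) (use BR(7)[OF R4] xR in blast)
   moreover have "x0 \<in> lb_dom L i0" using BR(7)[OF R4] xR by blast
   ultimately have "uk k x0 ((c0, d0), i0, 0) = ell x0 x0 x0 ^ k"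
    using c0X d0Y x0(1) y0 i0 xD zero(4) by (simp add: uk_def)
   then show ?thesis using sg_disc[OF z0(1)] BR(8)[OF R4 xR] by (simp add: \<xi>_def evl_def x restrict_section_def)
  qed
  have nu_pos: "nu > 0"
  proof -
   have "0 < ?E * gk k" using gk(2)[of k] by simp
   also have "... \<le> nu\<^sup>2" using \<xi>_bound[OF u y0 z0] unfolding xi1 nu_def by simp
   finally show ?thesis using L2_square(2)[OF u] unfolding nu_def by (simp add: zero_less_power2 order_less_le)
  qed
  have low: "1 / nu \<le> dn k ?y0"
  proof -
   let ?u = "\<lambda>x j. of_real (1 / nu) * us k x j"
   have u': "?u \<in> direct_image_fibre X Y p (MM k) ?y0" by (rule scale_section[OF u])
   have "ennreal ((L2 k ?y0 ?u)\<^sup>2) \<le> ennreal ((cmod (of_real (1 / nu)))\<^sup>2) * ennreal (nu\<^sup>2)"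
   proof -
    have n: "ennreal (nu\<^sup>2) = emeasure (vol k ?y0 (us k)) UNIV" unfolding nu_def by (rule L2_square(1)[OF u])
    show ?thesis unfolding L2_square(1)[OF u'] n by (rule scale_vol[OF u])
   qed
   also have "... = ennreal 1" using nu_pos by (simp add: ennreal_mult[symmetric] norm_divide power_divide)
   finally have "(L2 k ?y0 ?u)\<^sup>2 \<le> 1" by (subst (asm) ennreal_le_iff) auto
   then have "L2 k ?y0 ?u \<le> 1" unfolding abs_square_le_1 by (rule order_trans[OF abs_ge_self])
   then have "cmod (\<xi> k ?y0 ?u) \<le> dn k ?y0" by (rule dn_upper(4)[OF y0 z0 u'])
   moreover have "\<xi> k ?y0 ?u = of_real (1 / nu) * \<xi> k ?y0 (us k)" unfolding \<xi>_def evl_def by simp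
   ultimately show ?thesis using nu_pos xi1 by (simp add: norm_divide)
  qed
  \<comment> \<open>The direction of the line in base coordinates: the unit disc in
    \<open>ze\<close> is the projection of the disc of radius \<open>r\<close> on the line.\<close>
  define b where "b = (\<chi> j. of_real r * v0 $ io0 j)"
  have disc: "snd d0 ?y0 + ze *s b \<in> snd d0 ` (fst d0 \<inter> UU) \<and> cinv d0 (snd d0 ?y0 + ze *s b) \<in> fst d0 \<and>
    (\<forall>j. snd d0 (cinv d0 (snd d0 ?y0 + ze *s b)) $ j = w0 $ io0 j + (ze * of_real r) * v0 $ io0 j) \<and>
    norm ((ze * of_real r) *s v0) < de" if "cmod ze \<le> 1" for ze
  proof -
   let ?t = "snd d0 ?y0 + ze *s b" and ?w = "w0 + (ze * of_real r) *s v0"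
   have tj: "?t $ j = w0 $ io0 j + (ze * of_real r) * v0 $ io0 j" for j by (simp add: t0 b_def)
   have "norm ((ze * of_real r) *s v0) \<le> r * norm v0"
    unfolding norm_vec_smult using that r(1) by (simp add: norm_mult mult_left_le_one_le mult_right_mono)
   then have nd: "norm ((ze * of_real r) *s v0) < de" using r(2) by simp
   then have wb: "?w \<in> ball w0 (2 * de)" using de(1) by (simp add: dist_norm)
   note rs = rt_saturated[OF wb]
   let ?y = "p (cinv c0 ?w)"
   have yd: "?y \<in> fst d0" by (rule p_d0[OF rs(4)])
   have "snd d0 ?y = ?t" unfolding vec_eq_iff using base_eq[OF rs(4)] tj unfolding rs(3) by simp
   moreover have "?y \<in> UU" unfolding UU_def using yd wb sg_disc[OF tj] \<open>snd d0 ?y = ?t\<close> by simp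
   moreover have "cinv d0 ?t = ?y" using Y.chart(4)[OF d0Y yd] \<open>snd d0 ?y = ?t\<close> by simp
   ultimately show ?thesis using yd tj nd by (metis IntI image_eqI)
  qed
  have "psh_fun Y UU (\<lambda>y. ereal_log (dn k y))"
   using assms[OF k] UU_open \<xi>_holo unfolding griffiths_semipositive_def by blast
  then have "psh_on (snd d0 ` (fst d0 \<inter> UU)) (\<lambda>t. ereal_log (dn k (cinv d0 t)))"
   using d0Y unfolding psh_fun_def by (cases d0) (auto simp: o_def)
  then have mean: "ereal_log (dn k (cinv d0 (snd d0 ?y0))) \<le>
    circle_mean (\<lambda>th. ereal_log (dn k (cinv d0 (snd d0 ?y0 + cis th *s b))))"
   using disc unfolding psh_on_def by blast
  define Q where "Q = 1 / (?E * e * gk k)"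
  have Q: "Q > 0" unfolding Q_def using e gk(2)[of k] by simp
  have "circle_mean (\<lambda>th. ereal_log (dn k (cinv d0 (snd d0 ?y0 + cis th *s b)))) \<le> ereal (ln Q / 2)"
  proof (rule circle_mean_le)
   fix th
   have d: "cinv d0 (snd d0 ?y0 + cis th *s b) \<in> fst d0"
    "!!j. snd d0 (cinv d0 (snd d0 ?y0 + cis th *s b)) $ j = w0 $ io0 j + (cis th * of_real r) * v0 $ io0 j"
    "norm ((cis th * of_real r) *s v0) < de" using disc[of "cis th"] by simp_all
   have "(cmod (cis th * of_real r))\<^sup>2 = r\<^sup>2" by (simp add: norm_mult)
   then have "Q = 1 / (?E * exp (de0 / 8 * (cmod (cis th * of_real r))\<^sup>2) * gk k)" unfolding Q_def e_def by simp
   then show "ereal_log (dn k (cinv d0 (snd d0 ?y0 + cis th *s b))) \<le> ereal (ln Q / 2)"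
    using dn_upper(1-3)[OF d, of k] by (intro ereal_log_le) simp_all
  qed
  moreover have "ereal (ln (1 / nu)) \<le> ereal_log (dn k ?y0)"
  proof -
   have d: "0 < 1 / nu" "0 < dn k ?y0" using low nu_pos by (simp, smt (verit) zero_less_divide_1_iff)
   have "ln (1 / nu) \<le> ln (dn k ?y0)" using low d by (subst ln_le_cancel_iff)
   then show ?thesis using d(2) by (simp add: ereal_log_def)
  qed
  ultimately have "ereal (ln (1 / nu)) \<le> ereal (ln Q / 2)"
   using mean unfolding Y.chart(4)[OF d0Y y0] by (meson order_trans)
  then have "- ln (nu\<^sup>2) \<le> - ln (?E * e * gk k)"
   using nu_pos e gk(2)[of k] unfolding Q_def by (simp add: ln_div ln_realpow)
  then have "ln (?E * e * gk k) \<le> ln (nu\<^sup>2)" by simp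
  then have "?E * e * gk k \<le> nu\<^sup>2" using nu_pos e gk(2)[of k] by (subst (asm) ln_le_cancel_iff) auto
  also note nu_le
  finally have "?E * (e * gk k) \<le> ?E * (gk k + C * exp (- et) ^ k)" by (simp only: mult.assoc)
  then have "e * gk k \<le> gk k + C * exp (- et) ^ k" by (rule mult_left_le_imp_le) simp
  then show ?thesis by (simp add: algebra_simps)
 qed
 obtain C where C: "C \<ge> 0" "!!k. emeasure (vol k (p x0) (us k)) UNIV \<le> ennreal (exp (- al) ^ k) * (G k + ennreal (C * exp (- et) ^ k))"
  using uk_upper by blast
 \<comment> \<open>Half of \<open>et\<close>: the Gaussian integral then dominates a multiple of
   \<open>q ^ k\<close>, whereas the error is of order \<open>q ^ k * q ^ k\<close>.\<close>
 obtain V where V: "V > 0" "!!k::nat. G k \<ge> ennreal (V * exp (- real k * (et / 2)))"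
  using slice_gauss_lower[OF inj0 de(1) half_gt_zero[OF et] B(1)] by blast
 define q where "q = exp (- (et / 2))"
 have q: "0 < q" "q < 1" unfolding q_def using et by auto
 have Vg: "V * q ^ k \<le> gk k" for k
 proof -
  have "exp (- real k * (et / 2)) = q ^ k" unfolding q_def by (simp add: exp_of_nat_mult[symmetric])
  then show ?thesis using V(2)[of k] V(1) gk(2)[of k] unfolding gk(1) by (simp add: ennreal_le_iff less_imp_le)
 qed
 have qq2: "exp (- et) ^ k = q ^ k * q ^ k" for k
  unfolding q_def power_mult_distrib[symmetric] by (simp add: mult_exp_exp)
 have main: "(e - 1) * V \<le> C * q ^ k" if "k \<ge> k0" for k
 proof -
  have "(e - 1) * (V * q ^ k) \<le> (e - 1) * gk k" using Vg e by (intro mult_left_mono) auto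
  also have "... \<le> C * exp (- et) ^ k" by (rule key[OF that C])
  finally have "((e - 1) * V) * q ^ k \<le> (C * q ^ k) * q ^ k" unfolding qq2 by (simp only: mult_ac)
  then show ?thesis using q by (simp add: mult_le_cancel_right)
 qed
 \<comment> \<open>The summand 1 keeps the denominator positive when \<open>C = 0\<close>.\<close>
 define s where "s = (e - 1) * V / (C + 1)"
 have s: "s > 0" unfolding s_def using e V(1) C(1) by simp
 obtain m where m: "q ^ m < s" using real_arch_pow_inv[OF s q(2)] by blast
 have "q ^ (k0 + m) \<le> q ^ m" using q by (intro power_decreasing) auto
 then have "q ^ (k0 + m) < s" using m by simp
 then have "(C + 1) * q ^ (k0 + m) < (e - 1) * V" unfolding s_def using C(1) by (simp add: pos_less_divide_eq mult.commute)
 moreover have "C * q ^ (k0 + m) \<le> (C + 1) * q ^ (k0 + m)" using q by (intro mult_right_mono) auto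
 ultimately show False using main[of "k0 + m"] by simp
qed

end

section \<open>Construction of the cover\<close>

context negative_point
begin

text \<open>The step \<open>S\<close> serves again as a cut-off: its argument is at most 0 outside
  the ball of radius \<open>r\<close> and at least \<open>3 / 4 * ep\<close> on the half ball, where
  \<open>S = 1\<close>.\<close>

lemma bump:
 assumes c: "c \<in> X" and D: "open D" "D \<subseteq> fst c" and r: "r > 0" "cball wz r \<subseteq> snd c ` D"
  and f: "smooth_fun X D f" "!!z. z \<in> D ==> f z > 0"
 defines "rh \<equiv> \<lambda>z. if z \<in> D then S (ep * (1 - (norm (snd c z - wz))\<^sup>2 / r\<^sup>2)) * f z else 0"
 shows "rh z \<ge> 0" "smooth_fun X UNIV rh" "closed (cinv c ` cball wz r)" "cinv c ` cball wz r \<subseteq> D"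
  "z \<notin> cinv c ` cball wz r ==> rh z = 0" "z \<in> cinv c ` ball wz (r / 2) ==> z \<in> D \<and> rh z = f z"
  "open (cinv c ` ball wz (r / 2))"
proof -
 have sub: "cball wz r \<subseteq> snd c ` fst c" using r(2) D(2) by blast
 have "ball wz (r / 2) \<subseteq> cball wz r" using r(1) by auto
 with sub have sub2: "ball wz (r / 2) \<subseteq> snd c ` fst c" by blast
 note cp = X.chart_preimage[OF c sub] and bp = X.chart_preimage[OF c sub2]
 show nn: "rh z \<ge> 0" for z unfolding rh_def using S(5) f(2)[of z] by (auto intro: mult_nonneg_nonneg less_imp_le)
 show cl: "closed (cinv c ` cball wz r)" by (rule cp(3)) simp
 show CD: "cinv c ` cball wz r \<subseteq> D"
 proof (rule image_subsetI)
  fix w assume "w \<in> cball wz r"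
  then obtain z where "z \<in> D" "w = snd c z" using r(2) by blast
  then show "cinv c w \<in> D" using X.chart(4)[OF c] D(2) by auto
 qed
 have out: "S (ep * (1 - (norm (snd c z - wz))\<^sup>2 / r\<^sup>2)) * f z = 0" if "z \<in> D" "z \<notin> cinv c ` cball wz r" for z
 proof -
  have "norm (snd c z - wz) > r" using that cp(1)[of z] D(2) by (auto simp: dist_norm norm_minus_commute)
  then have "(norm (snd c z - wz))\<^sup>2 \<ge> r\<^sup>2" using r(1) by (intro power_mono) auto
  then have "1 - (norm (snd c z - wz))\<^sup>2 / r\<^sup>2 \<le> 0" using r(1) by simp
  then have "ep * (1 - (norm (snd c z - wz))\<^sup>2 / r\<^sup>2) \<le> 0" using eps(1) by (intro mult_nonneg_nonpos) auto
  then show ?thesis using S(3) by simp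
 qed
 show "rh z = 0" if "z \<notin> cinv c ` cball wz r" for z using out[OF _ that] unfolding rh_def by simp
 show "open (cinv c ` ball wz (r / 2))" by (rule bp(2)) simp
 show "z \<in> D \<and> rh z = f z" if z: "z \<in> cinv c ` ball wz (r / 2)" for z
 proof -
  have "ball wz (r / 2) \<subseteq> cball wz r" using r(1) by auto
  then have zD: "z \<in> D" using z CD by blast
  have "norm (snd c z - wz) \<le> r / 2" using bp(1)[of z] z by (auto simp: dist_norm norm_minus_commute)
  then have "(norm (snd c z - wz))\<^sup>2 \<le> (r / 2)\<^sup>2" by (intro power_mono) auto
  then have "(norm (snd c z - wz))\<^sup>2 / r\<^sup>2 \<le> 1 / 4" using r(1) by (simp add: field_simps power2_eq_square)
  then have "1 / 2 \<le> 1 - (norm (snd c z - wz))\<^sup>2 / r\<^sup>2" by linarith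
  then have "ep * (1 / 2) \<le> ep * (1 - (norm (snd c z - wz))\<^sup>2 / r\<^sup>2)" using eps(1) by (intro mult_left_mono) auto
  then show ?thesis using zD S(4) unfolding rh_def by simp
 qed
 have co: "holo_fun X D (\<lambda>z. snd c z $ k)" for k by (rule holo_fun_subset[OF X.holo_fun_coord[OF c] D(2)])
 have sn: "smooth_fun X D (\<lambda>z. ep * (1 - (\<Sum>k\<in>UNIV. (cmod (snd c z $ k - wz $ k))\<^sup>2) * (1 / r\<^sup>2)))"
  by (intro X.smooth_fun_mult X.smooth_fun_diff X.smooth_fun_const X.smooth_fun_sum X.smooth_fun_cmod2
    X.holo_fun_diff X.holo_fun_const co D(1))
 have e: "(\<Sum>k\<in>UNIV. (cmod (snd c z $ k - wz $ k))\<^sup>2) * (1 / r\<^sup>2) = (norm (snd c z - wz))\<^sup>2 / r\<^sup>2" for z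
  unfolding norm_vec_square by simp
 have "smooth_fun X D (\<lambda>z. S (ep * (1 - (norm (snd c z - wz))\<^sup>2 / r\<^sup>2)) * f z)"
  by (intro X.smooth_fun_mult[OF D(1) _ f(1)] X.smooth_fun_compose_real[OF D(1) S(1) sn[unfolded e]]) simp
 then show "smooth_fun X UNIV rh" unfolding rh_def
  by (intro X.smooth_fun_glue[OF D(1) cl CD open_UNIV]) (use out in simp_all)
qed

definition patch :: "('a, 'k) chart \<times> ('b, 'm) chart \<times> 'i \<times> 'a \<times> 'a set \<times> 'a set \<times> ('a => real) => bool" where
 "patch = (\<lambda>(c, d, i, x, D, C, rh). c \<in> X \<and> d \<in> Y \<and> p ` fst c \<subseteq> fst d \<and> i \<in> lb_index L \<and> open D \<and>
   D \<subseteq> fst c \<inter> (WW x \<inter> lb_dom L i) \<and> (\<forall>z. rh z \<ge> 0) \<and> smooth_fun X UNIV rh \<and> closed C \<and> C \<subseteq> D \<and> (\<forall>z. z \<notin> C --> rh z = 0))"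

text \<open>The chart is taken inside the complement of the closed ball of radius \<open>R\<close>,
  so none of these patches reaches the region where index 0 has to act alone.\<close>

lemma patch_at:
 assumes "z \<notin> cinv c0 ` cball w0 R"
 shows "\<exists>c d i D C rh V. patch (c, d, i, z, D, C, rh) \<and> D \<inter> cinv c0 ` ball w0 R = {} \<and> open V \<and> z \<in> V \<and> (\<forall>z'\<in>V. rh z' > 0)"
proof -
 have "R \<le> 4 * R" using R(1) by simp
 from BR(6)[OF this] have "open (- (cinv c0 ` cball w0 R))" by (rule open_Compl)
 then obtain c d io where c: "(c, d, io) \<in> adapted_charts X Y p" "z \<in> fst c" "fst c \<subseteq> - (cinv c0 ` cball w0 R)"
  using adapted_exists assms by (metis ComplI)
 note cc = adapted_iff[THEN iffD1, OF c(1)]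
 obtain i where i: "i \<in> lb_index L" "z \<in> lb_dom L i"
  using L unfolding holomorphic_line_bundle_def by blast
 define D where "D = fst c \<inter> (WW z \<inter> lb_dom L i)"
 have D: "open D" "D \<subseteq> fst c" "z \<in> D"
  unfolding D_def by (intro open_Int X.chart(1) conjunct1[OF cc] WW holomorphic_line_bundleD(1)[OF L i(1)])
   (use i c(2) WW in blast)+
 have "open (snd c ` D)" by (rule X.chart(9)[OF _ D(2,1)]) (use cc in blast)
 then obtain r where r: "r > 0" "cball (snd c z) r \<subseteq> snd c ` D" using D(3) open_contains_cball by blast
 note b = bump[OF conjunct1[OF cc] D(1,2) r X.smooth_fun_const[of D 1] zero_less_one]
 let ?rh = "\<lambda>z'. if z' \<in> D then S (ep * (1 - (norm (snd c z' - snd c z))\<^sup>2 / r\<^sup>2)) * 1 else 0"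
 have "patch (c, d, i, z, D, cinv c ` cball (snd c z) r, ?rh)"
 proof -
  have "D \<subseteq> fst c \<inter> (WW z \<inter> lb_dom L i)" unfolding D_def by (rule order_refl)
  then show ?thesis unfolding patch_def case_prod_conv using cc i(1) D(1) b(1-5) by blast
 qed
 moreover have "D \<inter> cinv c0 ` ball w0 R = {}" using D(2) c(3) ball_subset_cball[of w0 R] by blast
 moreover have "z \<in> cinv c ` ball (snd c z) (r / 2)"
  using X.chart(4)[OF conjunct1[OF cc] c(2)] r(1) by (metis centre_in_ball half_gt_zero image_eqI)
 moreover have "\<forall>z'\<in>cinv c ` ball (snd c z) (r / 2). ?rh z' > 0" using b(6) by fastforce
 ultimately show ?thesis using b(7) by blast
qed

text \<open>The radii nest: index 0 has the exact weight on the ball of radius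
  \<open>3 * R / 2\<close> and support in that of radius \<open>3 * R\<close>. The complement
  \<open>K\<close> of the former is compact and avoids the closed ball of radius \<open>R\<close>,
  so finitely many patches away from that ball cover it.\<close>

lemma negative_cover_exists:
 "\<exists>n ch dh il pt DD CC rh. negative_cover X Y p N F WW ii ff L hL x0 i0 c0 d0 io0 w0 v0 k1 de0 R ep B ka S th n ch dh il pt DD CC rh"
proof -
 have R4: "R \<le> 4 * R" "3 * R \<le> 4 * R" "4 * R \<le> 4 * R" "3 / 2 * R \<le> 4 * R" using R(1) by auto
 let ?BR = "cinv c0 ` ball w0 R"
 define D0 where "D0 = cinv c0 ` ball w0 (4 * R)"
 have D0: "open D0" "D0 \<subseteq> fst c0" "D0 \<subseteq> WW x0 \<inter> lb_dom L i0"
  unfolding D0_def using BR(5,7)[OF R4(3)] BR(3)[OF R4(3)] by blast+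
 have "cball w0 (3 * R) \<subseteq> ball w0 (4 * R)" using R(1) by auto
 moreover have "ball w0 (4 * R) \<subseteq> snd c0 ` D0"
 proof
  fix w assume w: "w \<in> ball w0 (4 * R)"
  then have "snd c0 (cinv c0 w) = w" using X.chart(5)[OF c0X] BR(1)[OF R4(3)] by blast
  then show "w \<in> snd c0 ` D0" unfolding D0_def using w by (metis image_eqI)
 qed
 ultimately have r0: "cball w0 (3 * R) \<subseteq> snd c0 ` D0" by blast
 define f0 where "f0 z = exp (de0 / 8 * (cmod (snd c0 z $ k1 - w0 $ k1))\<^sup>2)" for z
 have f0: "smooth_fun X D0 f0" "!!z. f0 z > 0"
 proof -
  show "smooth_fun X D0 f0" unfolding f0_def[abs_def]
   by (intro X.smooth_fun_exp X.smooth_fun_mult X.smooth_fun_const X.smooth_fun_cmod2 X.holo_fun_diff X.holo_fun_const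
     holo_fun_subset[OF X.holo_fun_coord[OF c0X] D0(2)] D0(1))
 qed (simp add: f0_def)
 have R3: "3 * R > 0" using R(1) by simp
 note b0 = bump[OF c0X D0(1,2) R3 r0 f0]
 define rh0 where "rh0 z = (if z \<in> D0 then S (ep * (1 - (norm (snd c0 z - w0))\<^sup>2 / (3 * R)\<^sup>2)) * f0 z else 0)" for z
 note b0 = b0[folded rh0_def]
 have ad: "c0 \<in> X" "d0 \<in> Y" "p ` fst c0 \<subseteq> fst d0" using adapted_iff[THEN iffD1, OF ad0] by auto
 define T0 where "T0 = (c0, d0, i0, x0, D0, cinv c0 ` cball w0 (3 * R), rh0)"
 \<comment> \<open>The families run over all naturals; indices beyond the last patch get an empty
   domain and the weight 0.\<close>
 define Tn where "Tn = (c0, d0, i0, x0, {} :: 'a set, {} :: 'a set, (\<lambda>_. 0) :: 'a => real)"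
 have P0: "patch T0" unfolding patch_def T0_def using ad i0 D0 b0(1-5) by simp
 have Pn: "patch Tn" unfolding patch_def Tn_def using ad i0 by simp
 define K where "K = - (cinv c0 ` ball w0 (3 * R / 2))"
 have K: "compact K" "!!z. z \<in> K ==> z \<notin> cinv c0 ` cball w0 R"
 proof -
  have "closed K" unfolding K_def using b0(7) by (simp add: closed_Compl)
  then show "compact K" using cpt closed_Int_compact[of K UNIV] by simp
  have "cball w0 R \<subseteq> ball w0 (3 * R / 2)" using R(1) by auto
  then show "z \<notin> cinv c0 ` cball w0 R" if "z \<in> K" for z using that unfolding K_def by blast
 qed
 define good where "good z = (\<lambda>(T, V). patch T \<and> fst (snd (snd (snd (snd T)))) \<inter> ?BR = {} \<and> open V \<and> z \<in> V \<and>
  (\<forall>z'\<in>V. snd (snd (snd (snd (snd (snd T))))) z' > 0))" for z :: 'a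
 have "\<forall>z\<in>K. \<exists>q. good z q"
 proof
  fix z assume "z \<in> K"
  from patch_at[OF K(2)[OF this]] obtain c d i D C rh V where
   "patch (c, d, i, z, D, C, rh)" "D \<inter> ?BR = {}" "open V" "z \<in> V" "\<forall>z'\<in>V. rh z' > 0" by (elim exE conjE)
  then have "good z ((c, d, i, z, D, C, rh), V)" unfolding good_def by simp
  then show "\<exists>q. good z q" ..
 qed
 from bchoice[OF this] obtain q where q: "\<forall>z\<in>K. good z (q z)" ..
 have qV: "open (snd (q z))" "z \<in> snd (q z)" if "z \<in> K" for z
  using q[rule_format, OF that] unfolding good_def case_prod_beta by blast+
 obtain T where T: "T \<subseteq> K" "finite T" "K \<subseteq> (\<Union>z\<in>T. snd (q z))"
 proof (rule compactE_image[OF K(1), of K "\<lambda>z. snd (q z)"])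
  show "K \<subseteq> (\<Union>z\<in>K. snd (q z))" using qV(2) by blast
 qed (use qV(1) in blast)+
 obtain xs where xs: "set xs = T" using finite_list[OF T(2)] by blast
 define Q where "Q a = (if a = 0 then T0 else if a \<le> length xs then fst (q (xs ! (a - 1))) else Tn)" for a :: nat
 have in_K: "xs ! (a - 1) \<in> K" if "a \<noteq> 0" "a \<le> length xs" for a
  using that T(1) xs nth_mem[of "a - 1" xs] by (metis One_nat_def Suc_pred neq0_conv subsetD less_eq_Suc_le)
 have PQ: "patch (Q a)" for a
  using P0 Pn q[rule_format, OF in_K, of a] unfolding Q_def good_def case_prod_beta by (cases "a = 0"; cases "a \<le> length xs") auto
 have far: "fst (snd (snd (snd (snd (Q a))))) \<inter> ?BR = {}" if "a > 0" for a
  using that q[rule_format, OF in_K, of a] unfolding Q_def good_def case_prod_beta by (cases "a \<le> length xs") (auto simp: Tn_def)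
 have cov: "\<exists>a\<le>length xs. snd (snd (snd (snd (snd (snd (Q a)))))) z > 0" for z
 proof (cases "z \<in> K")
  case True
  then obtain x where x: "x \<in> T" "z \<in> snd (q x)" using T(3) by blast
  then obtain a where a: "a < length xs" "xs ! a = x" using xs by (metis in_set_conv_nth)
  have "snd (snd (snd (snd (snd (snd (fst (q x))))))) z > 0"
   using q[rule_format, of x] x T(1) unfolding good_def case_prod_beta by blast
  then show ?thesis using a by (intro exI[of _ "Suc a"]) (simp add: Q_def)
 next
  case False
  then have "z \<in> cinv c0 ` ball w0 (3 * R / 2)" unfolding K_def by simp
  from b0(6)[OF this] show ?thesis using f0(2)[of z] by (intro exI[of _ 0]) (simp add: Q_def T0_def)
 qed
 let ?ch = "\<lambda>a. fst (Q a)" and ?dh = "\<lambda>a. fst (snd (Q a))" and ?il = "\<lambda>a. fst (snd (snd (Q a)))"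
  and ?pt = "\<lambda>a. fst (snd (snd (snd (Q a))))" and ?DD = "\<lambda>a. fst (snd (snd (snd (snd (Q a)))))"
  and ?CC = "\<lambda>a. fst (snd (snd (snd (snd (snd (Q a))))))" and ?rh = "\<lambda>a. snd (snd (snd (snd (snd (snd (Q a))))))"
 have "negative_cover X Y p N F WW ii ff L hL x0 i0 c0 d0 io0 w0 v0 k1 de0 R ep B ka S th (length xs) ?ch ?dh ?il ?pt ?DD ?CC ?rh"
 proof (intro negative_cover.intro negative_cover_axioms.intro negative_point_axioms)
  note PQ' = PQ[unfolded patch_def case_prod_beta]
  show "?ch a \<in> X" "?dh a \<in> Y" "p ` fst (?ch a) \<subseteq> fst (?dh a)" "?il a \<in> lb_index L" "open (?DD a)"
   "?DD a \<subseteq> fst (?ch a) \<inter> (WW (?pt a) \<inter> lb_dom L (?il a))" "?rh a z \<ge> 0" "smooth_fun X UNIV (?rh a)"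
   "closed (?CC a)" "?CC a \<subseteq> ?DD a" "z \<notin> ?CC a ==> ?rh a z = 0" for a z
   using PQ'[of a] by blast+
  show "\<exists>a\<le>length xs. ?rh a z > 0" for z by (rule cov)
  show "?ch 0 = c0" "?dh 0 = d0" "?il 0 = i0" "?pt 0 = x0" by (simp_all add: Q_def T0_def)
  show "z \<in> ?DD 0 \<and> ?rh 0 z = exp (de0 / 8 * (cmod (snd c0 z $ k1 - w0 $ k1))\<^sup>2)" if "z \<in> ?BR" for z
  proof -
   have "ball w0 R \<subseteq> ball w0 (3 * R / 2)" using R(1) by auto
   then have "z \<in> cinv c0 ` ball w0 (3 * R / 2)" using that by blast
   from b0(6)[OF this] show ?thesis by (simp add: Q_def T0_def f0_def)
  qed
  show "z \<notin> ?DD a" if "a > 0" "z \<in> ?BR" for a z using far[OF that(1)] that(2) by blast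
 qed
 then show ?thesis by blast
qed

end

lemma smooth_real_scale:
 assumes "smooth_real UNIV g"
 shows "smooth_real UNIV (\<lambda>x. g (a * x))"
proof -
 obtain H where H: "H 0 = g" "!!j x. (H j has_real_derivative H (Suc j) x) (at x)"
  using assms unfolding smooth_real_def by auto
 have "((\<lambda>x. a ^ j * H j (a * x)) has_real_derivative a ^ Suc j * H (Suc j) (a * x)) (at x)" for j x
 proof -
  have "((\<lambda>x. H j (a * x)) has_real_derivative H (Suc j) (a * x) * a) (at x)"
   by (rule DERIV_chain2[OF H(2)]) (rule DERIV_cmult_Id)
  from DERIV_cmult[OF this, of "a ^ j"] show ?thesis by (simp add: mult_ac)
 qed
 then show ?thesis unfolding smooth_real_def
  by (intro exI[of _ "\<lambda>j x. a ^ j * H j (a * x)"]) (simp add: H(1))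
qed

lemma scaled_step_exists:
 fixes ep :: real
 assumes "ep > 0"
 shows "\<exists>S th ka. smooth_real UNIV S \<and> smooth_real UNIV th \<and> (\<forall>t. \<exists>s\<ge>0. (S has_real_derivative s) (at t)) \<and>
  (\<forall>t. (th has_real_derivative S t) (at t)) \<and> (\<forall>t\<le>0. S t = 0 \<and> th t = 0) \<and>
  (\<forall>t\<ge>ep / 2. S t = 1 \<and> th t = t - ka) \<and> (\<forall>t. 0 \<le> S t \<and> S t \<le> 1 \<and> th t \<ge> 0 \<and> th t \<ge> t - ka)"
proof -
 obtain S th :: "real => real" and ka where 1: "smooth_real UNIV S" "!!x. (th has_real_derivative S x) (at x)"
  "!!x. \<exists>s\<ge>0. (S has_real_derivative s) (at x)" "!!x. x \<le> 0 ==> S x = 0 \<and> th x = 0"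
  "!!x. x \<ge> 1 ==> S x = 1 \<and> th x = x - ka" "!!x. 0 \<le> S x \<and> S x \<le> 1 \<and> th x \<ge> 0 \<and> th x \<ge> x - ka"
  using smooth_step_exists by blast
 \<comment> \<open>Moves the end of the step from 1 to \<open>ep / 2\<close>; dividing
   \<open>th\<close> by \<open>a\<close> keeps \<open>S\<close> its derivative.\<close>
 define a where "a = 2 / ep"
 have a: "a > 0" "1 / a = ep / 2" unfolding a_def using assms by auto
 let ?S = "\<lambda>t. S (a * t)" and ?th = "\<lambda>t. th (a * t) / a"
 have S: "smooth_real UNIV ?S" by (rule smooth_real_scale[OF 1(1)])
 have d: "(?th has_real_derivative ?S t) (at t)" for t
 proof -
  have "((\<lambda>t. th (a * t)) has_real_derivative S (a * t) * a) (at t)"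
   by (rule DERIV_chain2[OF 1(2)]) (rule DERIV_cmult_Id)
  from DERIV_cdivide[OF this, of a] show ?thesis using a by simp
 qed
 have sd: "\<exists>s\<ge>0. (?S has_real_derivative s) (at t)" for t
 proof -
  obtain s where s: "s \<ge> 0" "(S has_real_derivative s) (at (a * t))" using 1(3) by blast
  have "(?S has_real_derivative s * a) (at t)" by (rule DERIV_chain2[where f = S and g = "\<lambda>t. a * t", OF s(2)]) (rule DERIV_cmult_Id)
  then show ?thesis using s(1) a(1) by (intro exI[of _ "s * a"]) simp
 qed
 have neg: "?S t = 0 \<and> ?th t = 0" if "t \<le> 0" for t
  using 1(4)[of "a * t"] that a(1) by (simp add: mult_nonneg_nonpos)
 have sat: "?S t = 1 \<and> ?th t = t - ka / a" if "t \<ge> ep / 2" for t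
 proof -
  have "a * t \<ge> 1" using that assms unfolding a_def by (simp add: field_simps)
  then show ?thesis using 1(5)[of "a * t"] a(1) by (simp add: diff_divide_distrib)
 qed
 have bd: "0 \<le> ?S t \<and> ?S t \<le> 1 \<and> ?th t \<ge> 0 \<and> ?th t \<ge> t - ka / a" for t
 proof -
  have "(a * t - ka) / a \<le> ?th t" using 1(6)[of "a * t"] a(1) by (intro divide_right_mono) auto
  then show ?thesis using 1(6)[of "a * t"] a(1) by (simp add: diff_divide_distrib)
 qed
 show ?thesis
  by (intro exI[of _ ?S] exI[of _ ?th] exI[of _ "ka / a"] conjI allI impI S
    smooth_real_primitive[OF S d] d sd neg[THEN conjunct1] neg[THEN conjunct2] sat[THEN conjunct1] sat[THEN conjunct2]
    bd[THEN conjunct1] bd[THEN conjunct2, THEN conjunct1] bd[THEN conjunct2, THEN conjunct2, THEN conjunct1]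
    bd[THEN conjunct2, THEN conjunct2, THEN conjunct2]) assumption+
qed

section \<open>Choice of the constants and conclusion\<close>

context projective_submersion
begin

text \<open>A negative value persists for nearby points and directions, which leaves room to choose
  the constants of the preceding locales one after the other; then \<open>not_griffiths\<close>
  contradicts the hypothesis.\<close>

lemma levi_nonneg:
 fixes L :: "('i, 'a) line_bundle"
 assumes L: "holomorphic_line_bundle X L" and hL: "hermitian_metric X L hL"
  and griff: "!!(E :: (nat, 'a) line_bundle) hE.
   holomorphic_line_bundle X E ==> hermitian_metric X E hE ==> semipositive X E hE ==>
   griffiths_semipositive X Y p (lb_tensor L E) (tensor_metric hL hE)"
  and i0: "i0 \<in> lb_index L" "x0 \<in> lb_dom L i0"
  and ad: "(c0, d0, io0) \<in> adapted_charts X Y p" "x0 \<in> fst c0"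
 shows "levi (\<lambda>w. - ln (hL i0 (cinv c0 w))) (snd c0 x0) v \<ge> 0"
proof (rule ccontr)
 assume "\<not> ?thesis"
 then have neg: "levi (\<lambda>w. - ln (hL i0 (cinv c0 w))) (snd c0 x0) v < 0" by simp
 have c0X: "c0 \<in> X" using adapted_iff[THEN iffD1, OF ad(1)] by blast
 define w0 where "w0 = snd c0 x0"
 let ?h = "\<lambda>w. ln (hL i0 (cinv c0 w))"
 define W1 where "W1 = {z \<in> WW x0. ell x0 x0 z \<noteq> 0} \<inter> lb_dom L i0"
 have oi: "open (lb_dom L i0)" by (rule holomorphic_line_bundleD(1)[OF L i0(1)])
 have "open (WW x0 \<inter> ell x0 x0 -` (- {0}))"
  by (rule continuous_open_preimage[OF X.holo_fun_continuous[OF ell_holo WW(1)] WW(1)]) auto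
 moreover have "WW x0 \<inter> ell x0 x0 -` (- {0}) = {z \<in> WW x0. ell x0 x0 z \<noteq> 0}" by auto
 ultimately have oW1: "open W1" unfolding W1_def using oi by (simp add: open_Int)
 have "ell x0 x0 x0 \<noteq> 0" using ray_center[of x0] unfolding ray_def by auto
 then have xW1: "x0 \<in> W1" unfolding W1_def using WW(2) i0(2) by simp
 define Om where "Om = snd c0 ` (fst c0 \<inter> W1)"
 have op: "open Om" unfolding Om_def by (rule X.chart_image_open[OF c0X oW1])
 have wO: "w0 \<in> Om" unfolding Om_def w0_def using xW1 ad(2) by blast
 have pt: "cinv c0 w \<in> W1" if "w \<in> Om" for w by (rule X.chart_pt[OF c0X]) (use that Om_def in blast)
 have "smooth_fun X (lb_dom L i0) (\<lambda>z. ln (hL i0 z))"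
  by (rule X.smooth_fun_ln[OF oi hermitian_metricD(1,2)[OF hL i0(1)]])
 then have sh: "smooth_on Om ?h" unfolding Om_def
  by (rule smooth_funD[OF smooth_fun_subset c0X]) (auto simp: W1_def)
 have pos: "levi ?h w0 v > 0" using neg levi_minus[OF op wO sh] unfolding w0_def by simp
 \<comment> \<open>Any base coordinate will do; one exists because types are nonempty.\<close>
 define j1 :: 'm where "j1 = undefined"
 define k1 where "k1 = io0 j1"
 \<comment> \<open>If \<open>v\<close> has no component in the chosen base coordinate, a small
   multiple of that coordinate vector is added; by continuity the Levi form stays positive.\<close>
 have "\<exists>v'. v' $ k1 \<noteq> 0 \<and> levi ?h w0 v' > 0"
 proof (cases "v $ k1 = 0")
  case True
  have cont: "continuous_on UNIV (\<lambda>s::real. levi ?h w0 (v + of_real s *s axis k1 1))"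
  proof (rule levi_continuous[OF op sh continuous_on_const])
   show "continuous_on UNIV (\<lambda>s::real. v + of_real s *s axis k1 1 :: complex^'k)"
    by (rule continuous_on_vecI) (simp, intro continuous_intros)
  qed (rule wO)
  then have "isCont (\<lambda>s::real. levi ?h w0 (v + of_real s *s axis k1 1)) 0"
   by (simp add: continuous_on_eq_continuous_at)
  then have "\<forall>\<^sub>F s in at 0. levi ?h w0 (v + of_real s *s axis k1 1) > 0"
   unfolding isCont_def by (rule order_tendstoD(1)) (use pos in simp)
  then have "\<forall>\<^sub>F s in at (0::real). levi ?h w0 (v + of_real s *s axis k1 1) > 0 \<and> s \<noteq> 0"
   by (rule eventually_conj) (simp add: eventually_at_filter)
  then obtain s :: real where s: "levi ?h w0 (v + of_real s *s axis k1 1) > 0" "s \<noteq> 0"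
   using eventually_happens'[OF at_neq_bot] by blast
  then show ?thesis using True by (intro exI[of _ "v + of_real s *s axis k1 1"]) (simp add: axis_def)
 next
  case False
  then show ?thesis using pos by blast
 qed
 then obtain v' where v': "v' $ k1 \<noteq> 0" "levi ?h w0 v' > 0" by blast
 define v0 where "v0 = inverse (v' $ k1) *s v'"
 have v0: "v0 $ k1 = 1" unfolding v0_def using v'(1) by simp
 have pos0: "levi ?h w0 v0 > 0"
  unfolding v0_def levi_scale_complex[OF op sh wO] using v' by simp
 \<comment> \<open>Half of the value at \<open>w0\<close>, so that it remains a lower bound in a
   neighbourhood.\<close>
 define de0 where "de0 = levi ?h w0 v0 / 2"
 have de0: "de0 > 0" unfolding de0_def using pos0 by simp
 have "continuous_on Om (\<lambda>w. levi ?h w v0)"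
  by (rule levi_continuous[OF op sh]) (auto intro: continuous_intros)
 then have "open (Om \<inter> (\<lambda>w. levi ?h w v0) -` {de0<..})" by (rule continuous_open_preimage[OF _ op open_greaterThan])
 moreover have "w0 \<in> Om \<inter> (\<lambda>w. levi ?h w v0) -` {de0<..}" using wO pos0 by (simp add: de0_def)
 ultimately obtain T where T: "open T" "w0 \<in> T" "!!w. w \<in> T ==> levi ?h w v0 > de0" by blast
 have "open (Om \<inter> T)" "w0 \<in> Om \<inter> T" using op T wO by auto
 then obtain r where r: "r > 0" "cball w0 r \<subseteq> Om \<inter> T" using open_contains_cball by blast
 define R where "R = r / 4"
 have R: "R > 0" "cball w0 (4 * R) \<subseteq> Om" "cball w0 (4 * R) \<subseteq> T" unfolding R_def using r by auto
 have sub: "cball w0 (4 * R) \<subseteq> snd c0 ` fst c0" using R(2) unfolding Om_def by blast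
 have "ball w0 (R / 2) \<subseteq> cball w0 (4 * R)" "ball w0 R \<subseteq> cball w0 (4 * R)" using R(1) by auto
 then have sub2: "ball w0 (R / 2) \<subseteq> snd c0 ` fst c0" and sub3: "ball w0 R \<subseteq> cball w0 (4 * R)" using sub by blast+
 have "open (cinv c0 ` ball w0 (R / 2))" by (rule X.chart_preimage(2)[OF c0X sub2]) simp
 moreover have "x0 \<in> cinv c0 ` ball w0 (R / 2)"
  using X.chart_preimage(1)[OF c0X sub2] ad(2) R(1) by (simp add: w0_def)
 ultimately obtain si where si: "si < 1" "0 < si" "!!z x. z \<notin> cinv c0 ` ball w0 (R / 2) ==> z \<in> WW x ==> ray x0 x z \<le> si"
  using ray_bound[of _ x0] by blast
 \<comment> \<open>Solves \<open>exp (- 4 * ep) = si\<close>, where \<open>si\<close> bounds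
   \<open>ray\<close> outside the half ball.\<close>
 define ep where "ep = - ln si / 4"
 have ep: "ep > 0" "exp (- 4 * ep) = si" unfolding ep_def using si by simp_all
 \<comment> \<open>\<open>R * (1 + norm v0)\<close> bounds the displacement from the line on the
   ball of radius \<open>R\<close>, so the squared displacement times \<open>B\<close> is at most
   \<open>ep\<close>.\<close>
 define B where "B = ep / (R * (1 + norm v0))\<^sup>2"
 have n1: "1 + norm v0 > 0" by (simp add: add_pos_nonneg)
 have B: "B > 0" "norm (w - w0) \<le> R ==> B * (norm (w - w0 - (w $ k1 - w0 $ k1) *s v0))\<^sup>2 \<le> ep" for w
 proof -
  show "B > 0" unfolding B_def using ep(1) R(1) n1 by simp
  assume w: "norm (w - w0) \<le> R"
  have "cmod (w $ k1 - w0 $ k1) \<le> norm (w - w0)" using Finite_Cartesian_Product.norm_nth_le[of "w - w0" k1] by simp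
  then have "cmod (w $ k1 - w0 $ k1) * norm v0 \<le> R * norm v0" using w by (intro mult_right_mono) auto
  moreover have "norm (w - w0 - (w $ k1 - w0 $ k1) *s v0) \<le> norm (w - w0) + cmod (w $ k1 - w0 $ k1) * norm v0"
   using norm_triangle_ineq4[of "w - w0" "(w $ k1 - w0 $ k1) *s v0"] unfolding norm_vec_smult .
  ultimately have "norm (w - w0 - (w $ k1 - w0 $ k1) *s v0) \<le> R * (1 + norm v0)" using w unfolding distrib_left mult_1_right by linarith
  then have "(norm (w - w0 - (w $ k1 - w0 $ k1) *s v0))\<^sup>2 \<le> (R * (1 + norm v0))\<^sup>2" by (intro power_mono) auto
  then have "B * (norm (w - w0 - (w $ k1 - w0 $ k1) *s v0))\<^sup>2 \<le> B * (R * (1 + norm v0))\<^sup>2"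
   using \<open>B > 0\<close> by (intro mult_left_mono) auto
  also have "... = ep" unfolding B_def using R(1) n1 by simp
  finally show "B * (norm (w - w0 - (w $ k1 - w0 $ k1) *s v0))\<^sup>2 \<le> ep" .
 qed
 obtain S th ka where st: "smooth_real UNIV S" "smooth_real UNIV th" "!!t. \<exists>s\<ge>0. (S has_real_derivative s) (at t)"
  "!!t. (th has_real_derivative S t) (at t)" "!!t. t \<le> 0 ==> S t = 0" "!!t. t \<le> 0 ==> th t = 0"
  "!!t. t \<ge> ep / 2 ==> S t = 1" "!!t. t \<ge> ep / 2 ==> th t = t - ka" "!!t. 0 \<le> S t" "!!t. S t \<le> 1"
  "!!t. th t \<ge> 0" "!!t. th t \<ge> t - ka"
  using scaled_step_exists[OF ep(1)] by blast
 interpret negative_point X Y p N F WW ii ff L hL x0 i0 c0 d0 io0 w0 v0 k1 de0 R ep B ka S th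
 proof (intro negative_point.intro negative_point_axioms.intro projective_submersion_axioms)
  show "cball w0 (4 * R) \<subseteq> snd c0 ` (fst c0 \<inter> (WW x0 \<inter> lb_dom L i0))"
   using R(2) unfolding Om_def W1_def by blast
  show "ell x0 x0 (cinv c0 w) \<noteq> 0" if "w \<in> cball w0 (4 * R)" for w
   using pt[OF subsetD[OF R(2) that]] unfolding W1_def by blast
  show "levi ?h w v0 \<ge> de0" if "w \<in> ball w0 R" for w
   using T(3)[OF subsetD[OF R(3) subsetD[OF sub3 that]]] by simp
  show "ray x0 x z \<le> exp (- 4 * ep)" if "z \<notin> cinv c0 ` ball w0 (R / 2)" "z \<in> WW x" for x z
   unfolding ep(2) by (rule si(3)[OF that])
 qed (fact L hL i0(1) ad w0_def v0 R(1) de0 ep(1) B st | simp add: k1_def)+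
 obtain n ch dh il pt' DD CC rh where nc: "negative_cover X Y p N F WW ii ff L hL x0 i0 c0 d0 io0 w0 v0 k1 de0 R ep B ka S th n ch dh il pt' DD CC rh"
  using negative_cover_exists by blast
 have "open {z. exp (- ep / 2) < ray x0 z z}"
  by (rule open_Collect_less[OF continuous_on_const ray_continuous])
 then have oT: "open (snd c0 ` (fst c0 \<inter> ({z. exp (- ep / 2) < ray x0 z z} \<inter> WW x0)))"
  by (intro X.chart_image_open[OF c0X] open_Int WW)
 have "x0 \<in> {z. exp (- ep / 2) < ray x0 z z} \<inter> WW x0" using ep(1) by (simp add: ray_center WW)
 then have "w0 \<in> snd c0 ` (fst c0 \<inter> ({z. exp (- ep / 2) < ray x0 z z} \<inter> WW x0))" using ad(2) unfolding w0_def by blast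
 then obtain s where s: "s > 0" "ball w0 s \<subseteq> snd c0 ` (fst c0 \<inter> ({z. exp (- ep / 2) < ray x0 z z} \<inter> WW x0))"
  using oT open_contains_ball by blast
 \<comment> \<open>The first bound keeps the ball of radius \<open>2 * de\<close> inside the region
   where \<open>ray > exp (- ep / 2)\<close>; the second one gives
   \<open>2 * de \<le> R / 2\<close>.\<close>
 define de where "de = min (s / 2) (R / 4)"
 interpret estimates X Y p N F WW ii ff L hL x0 i0 c0 d0 io0 w0 v0 k1 de0 R ep B ka S th n ch dh il pt' DD CC rh de j1
 proof (intro estimates.intro estimates_axioms.intro nc)
  show "de > 0" "2 * de \<le> R / 2" unfolding de_def using s(1) R(1) by auto
  show "exp (- ep / 2) \<le> ray x0 x0 (cinv c0 w)" if "w \<in> ball w0 (2 * de)" for w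
  proof -
   have "w \<in> ball w0 s" using that unfolding de_def by auto
   from X.chart_pt[OF c0X subsetD[OF s(2) this]]
   have "exp (- ep / 2) < ray x0 (cinv c0 w) (cinv c0 w)" "cinv c0 w \<in> WW x0" by simp_all
   then show ?thesis using ray_change[OF _ WW(2), of "cinv c0 w" x0 x0] by simp
  qed
 qed (simp add: k1_def)
 obtain k0 where k0: "\<forall>k\<ge>k0. semipositive X (EE k) (hE k)" using EE_semipositive by blast
 show False
  by (rule not_griffiths[of k0]) (rule griff[OF EE_bundle hE_metric], use k0 in blast)
qed

lemma semipositive_if_griffiths:
 fixes L :: "('i, 'a) line_bundle"
 assumes L: "holomorphic_line_bundle X L" and hL: "hermitian_metric X L hL"
  and griff: "!!(E :: (nat, 'a) line_bundle) hE.
   holomorphic_line_bundle X E ==> hermitian_metric X E hE ==> semipositive X E hE ==>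
   griffiths_semipositive X Y p (lb_tensor L E) (tensor_metric hL hE)"
 shows "semipositive X L hL"
proof (rule X.semipositiveI[OF L hL])
 fix x
 obtain i where i: "i \<in> lb_index L" "x \<in> lb_dom L i" using L unfolding holomorphic_line_bundle_def by blast
 obtain c d io where c: "(c, d, io) \<in> adapted_charts X Y p" "x \<in> fst c" using adapted_exists[of UNIV x] by auto
 have "c \<in> X" using adapted_iff[THEN iffD1, OF c(1)] by blast
 then show "\<exists>i\<in>lb_index L. x \<in> lb_dom L i \<and> (\<exists>c\<in>X. x \<in> fst c \<and> (\<forall>v. levi (\<lambda>w. - ln (hL i (cinv c w))) (snd c x) v \<ge> 0))"
  using levi_nonneg[OF L hL griff i c] i c(2) by blast
qed

end

theorem theorem1p4:
  fixes X :: "('a::{t2_space,second_countable_topology}, 'k::finite) chart set"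
    and Y :: "('b::{t2_space,second_countable_topology}, 'm::finite) chart set"
    and p :: "'a \<Rightarrow> 'b"
    and L :: "('i, 'a) line_bundle"
    and hL :: "'i \<Rightarrow> 'a \<Rightarrow> real"
  assumes "projective_manifold X"
    and "complex_manifold Y" and "connected (UNIV :: 'b set)"
    and "holomorphic_submersion X Y p"
    and "holomorphic_line_bundle X L" and "hermitian_metric X L hL"
    and "\<exists>y. direct_image_fibre X Y p L y \<noteq> {\<lambda>_ _. 0}"
    and "\<And>(E :: (nat, 'a) line_bundle) hE.
           holomorphic_line_bundle X E \<Longrightarrow> hermitian_metric X E hE \<Longrightarrow> semipositive X E hE \<Longrightarrow>
           griffiths_semipositive X Y p (lb_tensor L E) (tensor_metric hL hE)"
  shows "semipositive X L hL"
proof -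
 let ?I = "\<lambda>N F x (W, i, f). open W \<and> x \<in> W \<and> i \<le> N \<and>
  (\<forall>x'\<in>W. F x' = proj_point (f x') \<and> f x' i = 1 \<and> (\<forall>j>N. f x' j = 0)) \<and>
  (\<forall>j. holo_fun X W (\<lambda>x'. f x' j)) \<and>
  (\<forall>(U, ph)\<in>X. x \<in> U -->
   (\<forall>v. (\<forall>j. frechet_derivative (\<lambda>z. f (inv_into U ph z) j) (at (ph x)) v = 0) --> v = 0))"
 have "complex_manifold X \<and> compact (UNIV :: 'a set) \<and> (\<exists>N F. inj F \<and> range F \<subseteq> proj_space N \<and> (\<forall>x. \<exists>W i f. ?I N F x (W, i, f)))"
  using assms(1) unfolding projective_manifold_def case_prod_conv .
 then obtain N F where X: "complex_manifold X" "compact (UNIV :: 'a set)" "inj F"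
  and ex: "\<forall>x. \<exists>W i f. ?I N F x (W, i, f)" by (elim conjE exE)
 have "\<forall>x. \<exists>q. ?I N F x q"
 proof
  fix x
  obtain W i f where "?I N F x (W, i, f)" using ex[rule_format, of x] by (elim exE)
  then show "\<exists>q. ?I N F x q" by (rule exI)
 qed
 \<comment> \<open>One choice function supplies neighbourhood, index and lift at every point, as the
   locale expects.\<close>
 from choice[OF this] obtain q where q: "\<forall>x. ?I N F x (q x)" ..
 have q': "open (fst (q x))" "x \<in> fst (q x)" "fst (snd (q x)) \<le> N"
  "\<forall>x'\<in>fst (q x). F x' = proj_point (snd (snd (q x)) x') \<and> snd (snd (q x)) x' (fst (snd (q x))) = 1 \<and> (\<forall>j>N. snd (snd (q x)) x' j = 0)"
  "\<forall>j. holo_fun X (fst (q x)) (\<lambda>x'. snd (snd (q x)) x' j)"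
  "\<forall>c\<in>X. x \<in> fst c --> (\<forall>v. (\<forall>j. fd (\<lambda>w. snd (snd (q x)) (cinv c w) j) (snd c x) v = 0) --> v = 0)" for x
 proof -
  note qx = spec[OF q, of x, unfolded case_prod_beta]
  show "open (fst (q x))" by (rule conjunct1[OF qx])
  note qx = conjunct2[OF qx]
  show "x \<in> fst (q x)" by (rule conjunct1[OF qx])
  note qx = conjunct2[OF qx]
  show "fst (snd (q x)) \<le> N" by (rule conjunct1[OF qx])
  note qx = conjunct2[OF qx]
  show "\<forall>x'\<in>fst (q x). F x' = proj_point (snd (snd (q x)) x') \<and> snd (snd (q x)) x' (fst (snd (q x))) = 1 \<and> (\<forall>j>N. snd (snd (q x)) x' j = 0)"
   by (rule conjunct1[OF qx])
  note qx = conjunct2[OF qx]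
  show "\<forall>j. holo_fun X (fst (q x)) (\<lambda>x'. snd (snd (q x)) x' j)" by (rule conjunct1[OF qx])
  show "\<forall>c\<in>X. x \<in> fst c --> (\<forall>v. (\<forall>j. fd (\<lambda>w. snd (snd (q x)) (cinv c w) j) (snd c x) v = 0) --> v = 0)"
   by (rule conjunct2[OF qx])
 qed
 interpret projective_submersion X Y p N F "\<lambda>x. fst (q x)" "\<lambda>x. fst (snd (q x))" "\<lambda>x. snd (snd (q x))"
 proof unfold_locales
  show "v = 0" if "c \<in> X" "x \<in> fst c" "!!j. fd (\<lambda>w. snd (snd (q x)) (cinv c w) j) (snd c x) v = 0" for c x v
   using q'(6)[of x] that by blast
 qed (use X assms(2,4) in \<open>simp_all add: q' bspec[OF q'(4)]\<close>)
 show ?thesis by (rule semipositive_if_griffiths[OF assms(5,6,8)])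
qed

end
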